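(* For each $\varepsilon\in(0,1]$ let $\lambda_\varepsilon:\mathbb R\to(0,\infty)$ be a continuously differentiable function with bounded derivative, such that $\lambda_\varepsilon$ is bounded and separated from zero uniformly in $\varepsilon\in(0,1]$, and such that $\lim_{\varepsilon\downarrow0}\lambda_\varepsilon(q)=\lambda_1$ for $q<0$ and $\lim_{\varepsilon\downarrow0}\lambda_\varepsilon(q)=\lambda_2$ for $q>0$, where $\lambda_1,\lambda_2$ are constants. Let $q_t^{\mu,\delta,\varepsilon}$ be the solution of $$\mu\ddot q_t^{\mu,\delta,\varepsilon}=b(q_t^{\mu,\delta,\varepsilon})-\lambda_\varepsilon(q_t^{\mu,\delta,\varepsilon})\dot q_t^{\mu,\delta,\varepsilon}+\dot W_t^\delta,\qquad q_0^{\mu,\delta,\varepsilon}=q,\ \dot q_0^{\mu,\delta,\varepsilon}=p.$$ Let $\widehat\lambda(q)=\lambda_1$ for $q\le0$ and $\widehat\lambda(q)=\lambda_2$ for $q>0$, and $$\widehat u(q)=\int_0^q\widehat\lambda(x)\exp\Big(-2\int_0^xb(y)\widehat\lambda(y)\,dy\Big)dx,\qquad \widehat v(q)=2\int_0^q\widehat\lambda(x)\exp\Big(2\int_0^xb(y)\widehat\lambda(y)\,dy\Big)dx.$$ Then $q_t^{\mu,\delta,\varepsilon}$ converges weakly to the diffusion process $\widehat q_t$ in $\mathbb R$ (started at $q$) governed by $A=D_{\widehat v}D_{\widehat u}$, as first $\mu\downarrow0$, then $\delta\downarrow0$, and then $\varepsilon\downarrow0$.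
   Context: The function $b:\mathbb R\to\mathbb R$ is continuously differentiable and bounded together with its first derivative. $W_t$ is a standard one-dimensional Wiener process and $W_t^\delta=\frac1\delta\int_0^\infty W_s\,\rho\big(\frac{s-t}{\delta}\big)ds$, where $\rho$ is a $C^\infty$ function with support in $[0,1]$ and $\int_0^1\rho(s)ds=1$; $\dot W_t^\delta$ is its time derivative. For a continuous strictly increasing function $u$, $D_u$ denotes differentiation with respect to $u$: $D_uf(q)=\lim_{h\to0}\frac{f(q+h)-f(q)}{u(q+h)-u(q)}$; $D_v$ is defined similarly. The domain $\mathfrak D_A$ of the generator $A=D_{\widehat v}D_{\widehat u}$ is described as follows: a continuous bounded function $f$ on $\mathbb R$, twice continuously differentiable on $\mathbb R\setminus\{0\}$, belongs to $\mathfrak D_A$ if and only if its left and right derivatives at $0$ satisfy the gluing condition $\frac1{\lambda_1}f'_-(0)=\frac1{\lambda_2}f'_+(0)$ and $Af$ is continuous. Weak convergence of processes means weak convergence of their laws (on finite time intervals); the limits in $\mu$, $\delta$, $\varepsilon$ are taken successively (iterated limits). *)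

theory Defs
  imports "HOL-Probability.Probability"
begin

section \<open>The noise\<close>

definition wiener_process :: "'a measure \<Rightarrow> (real \<Rightarrow> 'a \<Rightarrow> real) \<Rightarrow> bool" where
  "wiener_process M W \<longleftrightarrow>
     prob_space M \<and>
     (\<forall>t\<ge>0. W t \<in> borel_measurable M) \<and>
     (AE \<omega> in M. W 0 \<omega> = 0) \<and>
     (\<forall>\<omega>\<in>space M. continuous_on {0..} (\<lambda>t. W t \<omega>)) \<and>
     (\<forall>s t. 0 \<le> s \<longrightarrow> s < t \<longrightarrow>
        distributed M lborel (\<lambda>\<omega>. W t \<omega> - W s \<omega>)
          (\<lambda>x. ennreal (normal_density 0 (sqrt (t - s)) x))) \<and>
     (\<forall>(\<tau> :: nat \<Rightarrow> real) n. 0 \<le> \<tau> 0 \<longrightarrow> (\<forall>i<n. \<tau> i < \<tau> (Suc i)) \<longrightarrow>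
        prob_space.indep_vars M (\<lambda>_. borel) (\<lambda>i \<omega>. W (\<tau> (Suc i)) \<omega> - W (\<tau> i) \<omega>) {..<n})"

definition mollifier :: "(real \<Rightarrow> real) \<Rightarrow> bool" where
  "mollifier \<rho> \<longleftrightarrow>
     (\<forall>k x. (deriv ^^ k) \<rho> field_differentiable (at x)) \<and>
     (\<forall>x. x \<notin> {0..1} \<longrightarrow> \<rho> x = 0) \<and>
     (LBINT x=0..1. \<rho> x) = 1"

definition smoothed :: "(real \<Rightarrow> real) \<Rightarrow> (real \<Rightarrow> 'a \<Rightarrow> real) \<Rightarrow> real \<Rightarrow> real \<Rightarrow> 'a \<Rightarrow> real" where
  "smoothed \<rho> W \<delta> t \<omega> = 1 / \<delta> * (LBINT s:{0..}. W s \<omega> * \<rho> ((s - t) / \<delta>))"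

section \<open>The equation of motion\<close>

definition C1_bounded_deriv :: "(real \<Rightarrow> real) \<Rightarrow> bool" where
  "C1_bounded_deriv f \<longleftrightarrow>
     (\<exists>f'. (\<forall>x. (f has_real_derivative f' x) (at x)) \<and> continuous_on UNIV f' \<and> bounded (range f'))"

text \<open>\<open>x\<close> solves \<open>\<mu> x'' = b(x) - l(x) x' + \<xi>\<close> on \<open>[0,\<infinity>)\<close> with \<open>x(0) = q\<close> and
  \<open>x'(0) = p\<close>; derivatives at time \<open>0\<close> are one-sided.\<close>

definition solves_motion ::
  "real \<Rightarrow> (real \<Rightarrow> real) \<Rightarrow> (real \<Rightarrow> real) \<Rightarrow> (real \<Rightarrow> real) \<Rightarrow> real \<Rightarrow> real \<Rightarrow> (real \<Rightarrow> real) \<Rightarrow> bool"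
where
  "solves_motion \<mu> b l \<xi> q p x \<longleftrightarrow>
     (\<exists>v a. x 0 = q \<and> v 0 = p \<and>
        (\<forall>t\<ge>0. (x has_real_derivative v t) (at t within {0..}) \<and>
               (v has_real_derivative a t) (at t within {0..}) \<and>
               \<mu> * a t = b (x t) - l (x t) * v t + \<xi> t))"

section \<open>The operator \<open>D\<^sub>v D\<^sub>u\<close> and its domain\<close>

definition has_deriv_wrt :: "(real \<Rightarrow> real) \<Rightarrow> (real \<Rightarrow> real) \<Rightarrow> real \<Rightarrow> real \<Rightarrow> bool" where
  "has_deriv_wrt u f d q \<longleftrightarrow> ((\<lambda>h. (f (q + h) - f q) / (u (q + h) - u q)) \<longlongrightarrow> d) (at 0)"

definition deriv_wrt :: "(real \<Rightarrow> real) \<Rightarrow> (real \<Rightarrow> real) \<Rightarrow> real \<Rightarrow> real" where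
  "deriv_wrt u f q = Lim (at 0) (\<lambda>h. (f (q + h) - f q) / (u (q + h) - u q))"

definition lam_hat :: "real \<Rightarrow> real \<Rightarrow> real \<Rightarrow> real" where
  "lam_hat l1 l2 q = (if q \<le> 0 then l1 else l2)"

definition u_hat :: "(real \<Rightarrow> real) \<Rightarrow> real \<Rightarrow> real \<Rightarrow> real \<Rightarrow> real" where
  "u_hat b l1 l2 q =
     (LBINT x=0..q. lam_hat l1 l2 x * exp (- 2 * (LBINT y=0..x. b y * lam_hat l1 l2 y)))"

definition v_hat :: "(real \<Rightarrow> real) \<Rightarrow> real \<Rightarrow> real \<Rightarrow> real \<Rightarrow> real" where
  "v_hat b l1 l2 q =
     2 * (LBINT x=0..q. lam_hat l1 l2 x * exp (2 * (LBINT y=0..x. b y * lam_hat l1 l2 y)))"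

definition A_op :: "(real \<Rightarrow> real) \<Rightarrow> real \<Rightarrow> real \<Rightarrow> (real \<Rightarrow> real) \<Rightarrow> real \<Rightarrow> real" where
  "A_op b l1 l2 f = deriv_wrt (v_hat b l1 l2) (deriv_wrt (u_hat b l1 l2) f)"

text \<open>The last three conjuncts say that \<open>A f\<close> is continuous; since \<^const>\<open>Lim\<close> is unspecified
  where the limit fails to exist, existence of the limits is stated explicitly.\<close>

definition A_dom :: "(real \<Rightarrow> real) \<Rightarrow> real \<Rightarrow> real \<Rightarrow> (real \<Rightarrow> real) set" where
  "A_dom b l1 l2 = {f.
     continuous_on UNIV f \<and> bounded (range f) \<and>
     (\<exists>f' f''. (\<forall>q\<in>-{0}. (f has_real_derivative f' q) (at q) \<and>
                          (f' has_real_derivative f'' q) (at q)) \<and>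
               continuous_on (-{0}) f'') \<and>
     (\<exists>dl dr. (f has_real_derivative dl) (at_left 0) \<and>
              (f has_real_derivative dr) (at_right 0) \<and>
              1 / l1 * dl = 1 / l2 * dr) \<and>
     (\<forall>q. \<exists>d. has_deriv_wrt (u_hat b l1 l2) f d q) \<and>
     (\<forall>q. \<exists>d. has_deriv_wrt (v_hat b l1 l2) (deriv_wrt (u_hat b l1 l2) f) d q) \<and>
     continuous_on UNIV (A_op b l1 l2 f)}"

section \<open>Diffusion processes governed by an operator\<close>

text \<open>Conservative transition functions on the line with the Feller property.\<close>

definition feller_transition :: "(real \<Rightarrow> real \<Rightarrow> real measure) \<Rightarrow> bool" where
  "feller_transition P \<longleftrightarrow>
     (\<forall>t\<ge>0. P t \<in> borel \<rightarrow>\<^sub>M prob_algebra borel) \<and>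
     (\<forall>x. P 0 x = return borel x) \<and>
     (\<forall>s\<ge>0. \<forall>t\<ge>0. \<forall>x. P (s + t) x = (P s x \<bind> P t)) \<and>
     (\<forall>t\<ge>0. \<forall>f. continuous_on UNIV f \<longrightarrow> bounded (range f) \<longrightarrow>
        continuous_on UNIV (\<lambda>x. \<integral>y. (f y :: real) \<partial>P t x))"

text \<open>The generator acts on bounded continuous functions, and its domain consists of those for
  which \<open>(P\<^sub>t f - f) / t\<close> converges to a continuous function. The convergence is pointwise;
  it cannot be uniform for \<open>A = D\<^sub>v D\<^sub>u\<close> on the domain above, which contains bounded
  \<open>f\<close> with \<open>A f\<close> unbounded.\<close>

definition generator_is ::
  "(real \<Rightarrow> real \<Rightarrow> real measure) \<Rightarrow> ((real \<Rightarrow> real) \<Rightarrow> real \<Rightarrow> real) \<Rightarrow> (real \<Rightarrow> real) set \<Rightarrow> bool"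
where
  "generator_is P A D \<longleftrightarrow>
     D = {f. continuous_on UNIV f \<and> bounded (range f) \<and>
             (\<exists>g. continuous_on UNIV g \<and>
                (\<forall>x. ((\<lambda>t. ((\<integral>y. f y \<partial>P t x) - f x) / t) \<longlongrightarrow> g x) (at_right 0)))} \<and>
     (\<forall>f\<in>D. \<forall>x. ((\<lambda>t. ((\<integral>y. f y \<partial>P t x) - f x) / t) \<longlongrightarrow> A f x) (at_right 0))"

definition past :: "'a measure \<Rightarrow> (real \<Rightarrow> 'a \<Rightarrow> real) \<Rightarrow> real \<Rightarrow> 'a measure" where
  "past N X s = sigma (space N) {X r -` B \<inter> space N | r B. 0 \<le> r \<and> r \<le> s \<and> B \<in> sets borel}"

definition markov_process ::
  "'a measure \<Rightarrow> (real \<Rightarrow> 'a \<Rightarrow> real) \<Rightarrow> (real \<Rightarrow> real \<Rightarrow> real measure) \<Rightarrow> bool"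
where
  "markov_process N X P \<longleftrightarrow>
     prob_space N \<and>
     (\<forall>t\<ge>0. X t \<in> borel_measurable N) \<and>
     (\<forall>s\<ge>0. \<forall>t\<ge>0. \<forall>B\<in>sets borel. AE \<omega> in N.
        real_cond_exp N (past N X s) (\<lambda>\<omega>. indicator B (X (s + t) \<omega>)) \<omega> =
        measure (P t (X s \<omega>)) B)"

definition diffusion_governed_by ::
  "((real \<Rightarrow> real) \<Rightarrow> real \<Rightarrow> real) \<Rightarrow> (real \<Rightarrow> real) set \<Rightarrow> real \<Rightarrow>
   'a measure \<Rightarrow> (real \<Rightarrow> 'a \<Rightarrow> real) \<Rightarrow> bool"
where
  "diffusion_governed_by A D q N X \<longleftrightarrow>
     (\<exists>P. feller_transition P \<and> generator_is P A D \<and> markov_process N X P) \<and>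
     (\<forall>\<omega>\<in>space N. continuous_on {0..} (\<lambda>t. X t \<omega>)) \<and>
     (AE \<omega> in N. X 0 \<omega> = q)"

section \<open>Weak convergence\<close>

text \<open>The law of a continuous process on \<open>C[0,T]\<close>. That space is identified, isometrically, with
  the closed subspace of \<^typ>\<open>real \<Rightarrow>\<^sub>C real\<close> of functions constant on \<open>(-\<infinity>,0]\<close> and on
  \<open>[T,\<infinity>)\<close>.\<close>

definition path_law :: "'a measure \<Rightarrow> real \<Rightarrow> (real \<Rightarrow> 'a \<Rightarrow> real) \<Rightarrow> (real \<Rightarrow>\<^sub>C real) measure" where
  "path_law M T X = distr M borel (\<lambda>\<omega>. Bcontfun (ext_cont (\<lambda>t. X t \<omega>) 0 T))"

definition converges_weakly ::
  "('i \<Rightarrow> 'b::topological_space measure) \<Rightarrow> 'b measure \<Rightarrow> 'i filter \<Rightarrow> bool"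
where
  "converges_weakly L L0 F \<longleftrightarrow>
     prob_space L0 \<and> sets L0 = sets borel \<and>
     (\<forall>\<phi> :: 'b \<Rightarrow> real. continuous_on UNIV \<phi> \<longrightarrow> bounded (range \<phi>) \<longrightarrow>
        ((\<lambda>i. \<integral>x. \<phi> x \<partial>L i) \<longlongrightarrow> (\<integral>x. \<phi> x \<partial>L0)) F)"

text \<open>Iterated weak limit of the laws \<open>L \<mu> \<delta> \<epsilon>\<close>: first \<open>\<mu> \<down> 0\<close>, then \<open>\<delta> \<down> 0\<close>, then \<open>\<epsilon> \<down> 0\<close>.\<close>

definition iterated_weak_limit ::
  "(real \<Rightarrow> real \<Rightarrow> real \<Rightarrow> 'b::topological_space measure) \<Rightarrow> 'b measure \<Rightarrow> bool"
where
  "iterated_weak_limit L L0 \<longleftrightarrow>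
     (\<exists>L1 L2.
        (\<forall>\<epsilon>\<in>{0<..1}. \<forall>\<delta>>0. converges_weakly (\<lambda>\<mu>. L \<mu> \<delta> \<epsilon>) (L1 \<delta> \<epsilon>) (at_right 0)) \<and>
        (\<forall>\<epsilon>\<in>{0<..1}. converges_weakly (\<lambda>\<delta>. L1 \<delta> \<epsilon>) (L2 \<epsilon>) (at_right 0)) \<and>
        converges_weakly L2 L0 (at_right 0))"

end

(* In the coordinate z given by z' = lam_hat, both the limit and the prelimit equations have additive
   noise.  Integrating mu q'' = b(q) - lam_eps(q) q' + dW^delta/dt with Lam_eps' = lam_eps gives
     mu q'_t + Lam_eps(q_t) = mu p + Lam_eps(q) + int_0^t b(q_s) ds + W^delta_t - W^delta_0,
   and q' is bounded uniformly in mu.  Gronwall's inequality therefore yields uniform convergence on [0,T]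
   for every single path in each of the three limits; the last one is the solution of
     y(X_t) = y(q) + int_0^t b(X_s) ds + W_t,   y(x) = int_0^x lam_hat,
   so that weak convergence needs no compactness argument.

   In the coordinate z the operator A is F''/2 + b F' and the gluing condition says that F is twice continuously
   differentiable across 0.  A short time expansion of E F(Z_t), resp. Schwarz' argument (maximum principle
   against a solution of A H = g), shows that A with the given domain is exactly the pointwise generator of X.
   Conversely a Feller semigroup with this generator has its resolvent determined by the bounded solutions
   of l f - A f = l h, which are unique because z^2 + k is a Lyapunov function; the Laplace transform and
   the Markov property then determine the law. *)
theory Submission
  imports Defs
begin

section \<open>Measures on metric spaces\<close>

text \<open>Three obstacles shape the route. The diffusion is given only by its generator, a
  pointwise limit on a domain that contains functions with unbounded derivatives and unbounded
  \<open>A f\<close>, so uniform semigroup theory does not apply. Every expansion is therefore made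
  for a bounded function with an error \<open>\<kappa> * h^2 + C * h^4\<close> valid for all
  \<open>h\<close>: the fourth moment of the displacement makes the second term negligible, and the
  same term lets a local maximum serve as a global one. An arbitrary process governed by
  \<open>A\<close> comes without continuity of its semigroup at time 0, which has to be drawn from a
  function of the domain. Finally, C[0,T] sits inside the bounded continuous functions on the line,
  a nonseparable space: its Borel sets are not generated by coordinates, and Borel sets of products
  need not be generated by rectangles. Path-valued maps are shown measurable as limits of
  interpolations or by Lipschitz dependence on a measurable path, and joint measurability pairs a
  path with a real argument.\<close>

definition bump :: "'a::metric_space set \<Rightarrow> nat \<Rightarrow> 'a \<Rightarrow> real" where
  "bump F n x = (if F = {} then 0 else max 0 (1 - n * infdist x F))"

lemma bump_range: "0 \<le> bump F n x" "bump F n x \<le> 1"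
  by (auto simp: bump_def infdist_nonneg)

lemma bump_abs: "\<bar>bump F n x\<bar> \<le> 1"
  using bump_range[of F n x] by auto

lemma continuous_bump: "continuous_on UNIV (bump F n)"
  unfolding bump_def[abs_def] by (cases "F = {}") (auto intro!: continuous_intros)

lemma bounded_bump: "bounded (range (bump F n))"
  using bump_abs[of F n] by (auto simp: bounded_iff)

text \<open>A point outside the closed set has positive distance to it, so the bumps vanish there
  eventually. The empty set is treated apart because \<open>infdist\<close> to it is 0 by
  convention, which would make the bump 1 everywhere.\<close>

lemma bump_tendsto_indicator:
  assumes "closed F" shows "(\<lambda>n. bump F n x) \<longlonglongrightarrow> indicator F x"
proof (cases "F = {}")
  case False
  show ?thesis
  proof (cases "x \<in> F")
    case True
    then show ?thesis using False by (simp add: bump_def)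
  next
    case xF: False
    then have pos: "infdist x F > 0"
      using in_closed_iff_infdist_zero[OF assms False] infdist_nonneg[of x F] by (metis less_eq_real_def)
    obtain N :: nat where N: "N * infdist x F > 1"
      using reals_Archimedean3[OF pos] by blast
    have "bump F n x = 0" if "n \<ge> N" for n
    proof -
      have "N * infdist x F \<le> n * infdist x F"
        using that pos by (intro mult_right_mono) auto
      then show ?thesis using N False by (auto simp: bump_def)
    qed
    then have "eventually (\<lambda>n. bump F n x = indicator F x) sequentially"
      using xF by (auto simp: eventually_sequentially)
    then show ?thesis by (rule tendsto_eventually)
  qed
qed (simp add: bump_def)

lemma borel_measurable_bump [measurable]: "bump F n \<in> borel_measurable borel"
  by (rule borel_measurable_continuous_onI[OF continuous_bump])

lemma (in finite_measure) integral_bump_tendsto: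
  fixes U :: "'a \<Rightarrow> 'b::metric_space"
  assumes [measurable]: "U \<in> M \<rightarrow>\<^sub>M borel" and F: "closed F"
  shows "(\<lambda>n. \<integral>\<omega>. bump F n (U \<omega>) \<partial>M) \<longlonglongrightarrow> measure M (U -` F \<inter> space M)"
proof -
  have [measurable]: "F \<in> sets borel" using F by (rule borel_closed)
  have "(\<lambda>n. \<integral>\<omega>. bump F n (U \<omega>) \<partial>M) \<longlonglongrightarrow> (\<integral>\<omega>. indicator F (U \<omega>) \<partial>M)"
    by (rule integral_dominated_convergence[where w = "\<lambda>_. 1"])
       (auto intro!: AE_I2 bump_tendsto_indicator[OF F] simp: bump_abs)
  also have "(\<integral>\<omega>. indicator F (U \<omega>) \<partial>M) = (\<integral>\<omega>. indicator (U -` F \<inter> space M) \<omega> \<partial>M)"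
    by (rule Bochner_Integration.integral_cong) (auto simp: indicator_def)
  also have "\<dots> = measure M (U -` F \<inter> space M)" by simp
  finally show ?thesis .
qed

text \<open>The mass of a closed set is the limit of the integrals of its bumps, and the closed sets
  are an intersection-stable generator of the Borel sets.\<close>

lemma measure_eqI_continuous:
  fixes \<mu> \<nu> :: "'a::metric_space measure"
  assumes "finite_measure \<mu>" "finite_measure \<nu>" and s: "sets \<mu> = sets borel" "sets \<nu> = sets borel"
    and eq: "\<And>f::'a \<Rightarrow> real. continuous_on UNIV f \<Longrightarrow> bounded (range f) \<Longrightarrow> (\<integral>x. f x \<partial>\<mu>) = (\<integral>x. f x \<partial>\<nu>)"
  shows "\<mu> = \<nu>"
proof -
  interpret A: finite_measure \<mu> by fact
  interpret B: finite_measure \<nu> by fact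
  have sp: "space \<mu> = UNIV" "space \<nu> = UNIV" using s by (auto dest: sets_eq_imp_space_eq)
  have cl: "emeasure \<mu> F = emeasure \<nu> F" if F: "closed F" for F
  proof -
    have "(\<lambda>n. \<integral>\<omega>. bump F n \<omega> \<partial>\<mu>) \<longlonglongrightarrow> measure \<mu> ((\<lambda>x. x) -` F \<inter> space \<mu>)"
      by (rule A.integral_bump_tendsto) (use s F in \<open>auto simp: measurable_def sp\<close>)
    moreover have "(\<lambda>n. \<integral>\<omega>. bump F n \<omega> \<partial>\<nu>) \<longlonglongrightarrow> measure \<nu> ((\<lambda>x. x) -` F \<inter> space \<nu>)"
      by (rule B.integral_bump_tendsto) (use s F in \<open>auto simp: measurable_def sp\<close>)
    moreover have "(\<integral>\<omega>. bump F n \<omega> \<partial>\<mu>) = (\<integral>\<omega>. bump F n \<omega> \<partial>\<nu>)" for n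
      by (rule eq) (auto simp: continuous_bump bounded_bump)
    ultimately have "measure \<mu> F = measure \<nu> F"
      using LIMSEQ_unique sp by auto
    then show ?thesis by (simp add: A.emeasure_eq_measure B.emeasure_eq_measure)
  qed
  show ?thesis
  proof (rule measure_eqI_generator_eq[where E="{F. closed F}" and \<Omega>=UNIV and A="\<lambda>_. UNIV"])
    show "Int_stable {F :: 'a set. closed F}" by (auto simp: Int_stable_def)
    show "sets \<mu> = sigma_sets UNIV {F. closed F}" "sets \<nu> = sigma_sets UNIV {F. closed F}"
      using s by (simp_all add: borel_eq_closed)
    show "emeasure \<mu> X = emeasure \<nu> X" if "X \<in> {F. closed F}" for X using cl that by auto
  qed auto
qed

text \<open>The factorisation passes from bumps to pairs of closed sets by dominated convergence,
  and from this pi-system to the generated sigma-algebras. Independence of path-valued variables can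
  thus be checked through limits of interpolations, where only expectations of continuous functions
  are known to converge.\<close>

lemma (in prob_space) indep_varI_continuous:
  fixes U V :: "'a \<Rightarrow> 'b::metric_space"
  assumes U[measurable]: "U \<in> M \<rightarrow>\<^sub>M borel" and V[measurable]: "V \<in> M \<rightarrow>\<^sub>M borel"
    and eq: "\<And>(f::'b \<Rightarrow> real) (g::'b \<Rightarrow> real). continuous_on UNIV f \<Longrightarrow> bounded (range f) \<Longrightarrow>
      continuous_on UNIV g \<Longrightarrow> bounded (range g) \<Longrightarrow>
      expectation (\<lambda>\<omega>. f (U \<omega>) * g (V \<omega>)) = expectation (\<lambda>\<omega>. f (U \<omega>)) * expectation (\<lambda>\<omega>. g (V \<omega>))"
  shows "indep_var borel U borel V"
proof -
  let ?GU = "{U -` F \<inter> space M | F. F \<in> {F. closed F}}"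
  let ?GV = "{V -` F \<inter> space M | F. F \<in> {F. closed F}}"
  have prod: "prob ((U -` F \<inter> space M) \<inter> (V -` G \<inter> space M)) = prob (U -` F \<inter> space M) * prob (V -` G \<inter> space M)"
    if F: "closed F" and G: "closed G" for F G
  proof -
    have [measurable]: "F \<in> sets borel" "G \<in> sets borel" using F G by (auto intro: borel_closed)
    have "(\<lambda>n. expectation (\<lambda>\<omega>. bump F n (U \<omega>) * bump G n (V \<omega>)))
        \<longlonglongrightarrow> expectation (\<lambda>\<omega>. indicator F (U \<omega>) * indicator G (V \<omega>) :: real)"
    proof (rule integral_dominated_convergence[where w = "\<lambda>_. 1"])
      show "AE x in M. (\<lambda>i. bump F i (U x) * bump G i (V x)) \<longlonglongrightarrow> indicator F (U x) * (indicator G (V x) :: real)"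
        by (intro AE_I2 tendsto_mult bump_tendsto_indicator F G)
      show "AE x in M. norm (bump F i (U x) * bump G i (V x)) \<le> 1" for i
        using bump_abs[of F i] bump_abs[of G i] by (auto simp: abs_mult intro!: mult_le_one)
    qed auto
    moreover have "expectation (\<lambda>\<omega>. bump F n (U \<omega>) * bump G n (V \<omega>))
        = expectation (\<lambda>\<omega>. bump F n (U \<omega>)) * expectation (\<lambda>\<omega>. bump G n (V \<omega>))" for n
      by (rule eq) (rule continuous_bump bounded_bump)+
    moreover have "(\<lambda>n. expectation (\<lambda>\<omega>. bump F n (U \<omega>)) * expectation (\<lambda>\<omega>. bump G n (V \<omega>)))
        \<longlonglongrightarrow> prob (U -` F \<inter> space M) * prob (V -` G \<inter> space M)"
      by (intro tendsto_mult integral_bump_tendsto F G U V)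
    ultimately have "expectation (\<lambda>\<omega>. indicator F (U \<omega>) * indicator G (V \<omega>) :: real)
        = prob (U -` F \<inter> space M) * prob (V -` G \<inter> space M)"
      using LIMSEQ_unique by auto
    also have "expectation (\<lambda>\<omega>. indicator F (U \<omega>) * indicator G (V \<omega>) :: real)
      = expectation (\<lambda>\<omega>. indicator ((U -` F \<inter> space M) \<inter> (V -` G \<inter> space M)) \<omega>)"
      by (rule Bochner_Integration.integral_cong) (auto simp: indicator_def)
    also have "\<dots> = prob ((U -` F \<inter> space M) \<inter> (V -` G \<inter> space M))"
      by simp
    finally show ?thesis by simp
  qed
  have ind: "indep_set ?GU ?GV"
    by (rule indep_setI) (auto intro!: prod measurable_sets[OF U] measurable_sets[OF V] borel_closed)
  have "indep_set (sigma_sets (space M) ?GU) (sigma_sets (space M) ?GV)"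
  proof (rule indep_set_sigma_sets[OF ind])
    have st: "Int_stable {Z -` F \<inter> space M | F. F \<in> {F. closed F}}" for Z :: "'a \<Rightarrow> 'b"
    proof (rule Int_stableI)
      fix a b assume "a \<in> {Z -` F \<inter> space M | F. F \<in> {F. closed F}}" "b \<in> {Z -` F \<inter> space M | F. F \<in> {F. closed F}}"
      then obtain F G where "closed F" "closed G" "a = Z -` F \<inter> space M" "b = Z -` G \<inter> space M" by auto
      then show "a \<inter> b \<in> {Z -` F \<inter> space M | F. F \<in> {F. closed F}}"
        by (intro CollectI exI[of _ "F \<inter> G"]) auto
    qed
    show "Int_stable ?GU" "Int_stable ?GV" by (rule st)+
  qed
  moreover have "{U -` A \<inter> space M |A. A \<in> sets borel} = sigma_sets (space M) ?GU"
    by (subst sigma_sets_vimage_commute[symmetric, where \<Omega>'=UNIV]) (auto simp: borel_eq_closed)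
  moreover have "{V -` A \<inter> space M |A. A \<in> sets borel} = sigma_sets (space M) ?GV"
    by (subst sigma_sets_vimage_commute[symmetric, where \<Omega>'=UNIV]) (auto simp: borel_eq_closed)
  ultimately show ?thesis
    unfolding indep_var_eq by (simp add: U V sigma_sets_sigma_sets_eq image_subset_iff subset_eq) (subst (1 2) sigma_sets_sigma_sets_eq; auto)
qed

lemma pair_measure_eqI_rectangles:
  fixes \<mu> \<nu> :: "('a \<times> 'b) measure"
  assumes "finite_measure \<mu>" and s: "sets \<mu> = sets (A \<Otimes>\<^sub>M B)" "sets \<nu> = sets (A \<Otimes>\<^sub>M B)"
    and eq: "\<And>C D. C \<in> sets A \<Longrightarrow> D \<in> sets B \<Longrightarrow> emeasure \<mu> (C \<times> D) = emeasure \<nu> (C \<times> D)"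
  shows "\<mu> = \<nu>"
proof -
  interpret finite_measure \<mu> by fact
  show ?thesis
  proof (rule measure_eqI_generator_eq[where E="{a \<times> b | a b. a \<in> sets A \<and> b \<in> sets B}"
        and \<Omega>="space A \<times> space B" and A="\<lambda>_. space A \<times> space B"])
    show "sets \<mu> = sigma_sets (space A \<times> space B) {a \<times> b | a b. a \<in> sets A \<and> b \<in> sets B}"
      "sets \<nu> = sigma_sets (space A \<times> space B) {a \<times> b | a b. a \<in> sets A \<and> b \<in> sets B}"
      using s by (simp_all add: sets_pair_measure)
    show "emeasure \<mu> X = emeasure \<nu> X" if "X \<in> {a \<times> b | a b. a \<in> sets A \<and> b \<in> sets B}" for X
      using that eq by auto
    show "emeasure \<mu> (space A \<times> space B) \<noteq> \<infinity>" for i :: nat by simp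
    show "{a \<times> b |a b. a \<in> sets A \<and> b \<in> sets B} \<subseteq> Pow (space A \<times> space B)"
      by (auto dest: sets.sets_into_space)
  qed (auto intro!: Int_stable_pair_measure_generator)
qed

text \<open>Rounding the real argument to multiples of \<open>1 / Suc n\<close> leaves countably
  many measurable sections, and continuity in that argument gives the limit. Joint continuity would
  yield measurability only for the Borel sets of a product, which can exceed the product
  sigma-algebra when a factor is a path space.\<close>

lemma measurable_caratheodory:
  fixes f :: "real \<Rightarrow> 'a \<Rightarrow> 'b::metric_space"
  assumes meas: "\<And>x. f x \<in> M \<rightarrow>\<^sub>M borel"
    and cont: "\<And>\<omega>. \<omega> \<in> space M \<Longrightarrow> continuous_on UNIV (\<lambda>x. f x \<omega>)"
  shows "(\<lambda>(x, \<omega>). f x \<omega>) \<in> borel \<Otimes>\<^sub>M M \<rightarrow>\<^sub>M borel"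
proof (rule borel_measurable_LIMSEQ_metric)
  define d where "d n x = real_of_int \<lfloor>Suc n * x\<rfloor> / Suc n" for n :: nat and x :: real
  have dl: "\<bar>d n x - x\<bar> \<le> 1 / Suc n" for n x
  proof -
    have "d n x - x = (real_of_int \<lfloor>Suc n * x\<rfloor> - Suc n * x) / Suc n"
      by (simp add: d_def field_simps del: of_nat_Suc)
    moreover have "\<bar>real_of_int \<lfloor>Suc n * x\<rfloor> - Suc n * x\<bar> \<le> 1" by linarith
    ultimately show ?thesis by (simp add: divide_right_mono del: of_nat_Suc)
  qed
  show "(\<lambda>(x, \<omega>). f (d n x) \<omega>) \<in> borel \<Otimes>\<^sub>M M \<rightarrow>\<^sub>M borel" for n
  proof -
    have "(\<lambda>p. (\<lambda>i p. f (real_of_int i / Suc n) (snd p)) \<lfloor>real (Suc n) * fst p\<rfloor> p) \<in> borel \<Otimes>\<^sub>M M \<rightarrow>\<^sub>M borel"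
    proof (rule measurable_compose_countable[where f = "\<lambda>i p. f (real_of_int i / Suc n) (snd p)"
          and g = "\<lambda>p. \<lfloor>real (Suc n) * fst p\<rfloor>"])
      show "(\<lambda>p. f (real_of_int i / Suc n) (snd p)) \<in> borel \<Otimes>\<^sub>M M \<rightarrow>\<^sub>M borel" for i
        using measurable_compose[OF measurable_snd meas] .
      have "(\<lambda>p. real (Suc n) * fst p) \<in> borel_measurable (borel \<Otimes>\<^sub>M M)" by measurable
      from measurable_compose[OF this measurable_real_floor]
      show "(\<lambda>p. \<lfloor>real (Suc n) * fst p\<rfloor>) \<in> borel \<Otimes>\<^sub>M M \<rightarrow>\<^sub>M count_space UNIV" .
    qed
    then show ?thesis by (simp add: d_def case_prod_beta)
  qed
  fix p :: "real \<times> 'a" assume p: "p \<in> space (borel \<Otimes>\<^sub>M M)"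
  have lim: "(\<lambda>n. d n (fst p)) \<longlonglongrightarrow> fst p"
  proof (rule LIMSEQ_I)
    fix r :: real assume "r > 0"
    then obtain N where "1 / Suc N < r" using nat_approx_posE by blast
    moreover have "1 / Suc n \<le> 1 / Suc N" if "n \<ge> N" for n using that by (simp add: frac_le)
    ultimately show "\<exists>no. \<forall>n\<ge>no. norm (d n (fst p) - fst p) < r"
      using dl[of _ "fst p"] by (smt (verit) real_norm_def)
  qed
  have "isCont (\<lambda>x. f x (snd p)) (fst p)"
    using cont[of "snd p"] p by (auto simp: continuous_on_eq_continuous_at space_pair_measure)
  from isCont_tendsto_compose[OF this lim]
  show "(\<lambda>n. case p of (x, \<omega>) \<Rightarrow> f (d n x) \<omega>) \<longlonglongrightarrow> (case p of (x, \<omega>) \<Rightarrow> f x \<omega>)"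
    by (simp add: case_prod_beta)
qed

text \<open>The estimate makes \<open>X\<close> a function of \<open>Y\<close>: the preimage of an
  open \<open>S\<close> under \<open>X\<close> is the preimage under \<open>Y\<close> of a union of
  balls. Stability estimates for an equation become measurability of its solutions, however these
  were selected.\<close>

lemma measurable_lipschitz_factor:
  fixes X :: "'a \<Rightarrow> 'b::metric_space" and Y :: "'a \<Rightarrow> 'c::metric_space"
  assumes Y: "Y \<in> M \<rightarrow>\<^sub>M borel"
    and lip: "\<And>\<omega> \<omega>'. \<omega> \<in> space M \<Longrightarrow> \<omega>' \<in> space M \<Longrightarrow> dist (X \<omega>) (X \<omega>') \<le> C * dist (Y \<omega>) (Y \<omega>')"
  shows "X \<in> M \<rightarrow>\<^sub>M borel"
proof (rule borel_measurableI)
  fix S :: "'b set" assume S: "open S"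
  \<comment> \<open>The maximum with 1 keeps the radii \<open>r / D\<close> positive whatever the
    sign of \<open>C\<close>.\<close>
  define D where "D = max C 1"
  have D: "D > 0" "C \<le> D" by (auto simp: D_def)
  define V where "V = (\<Union>{ball (Y \<omega>) (r / D) | \<omega> r. \<omega> \<in> space M \<and> r > 0 \<and> ball (X \<omega>) r \<subseteq> S})"
  have "open V" unfolding V_def by blast
  have "X -` S \<inter> space M = Y -` V \<inter> space M"
  proof (intro subset_antisym subsetI)
    fix \<omega> assume w: "\<omega> \<in> X -` S \<inter> space M"
    then obtain r where r: "r > 0" "ball (X \<omega>) r \<subseteq> S" using S open_contains_ball by blast
    have "Y \<omega> \<in> ball (Y \<omega>) (r / D)" using r D by simp
    then have "Y \<omega> \<in> V" unfolding V_def using r w by blast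
    then show "\<omega> \<in> Y -` V \<inter> space M" using w by auto
  next
    fix \<omega> assume w: "\<omega> \<in> Y -` V \<inter> space M"
    then obtain \<omega>' r where r: "\<omega>' \<in> space M" "r > 0" "ball (X \<omega>') r \<subseteq> S" "Y \<omega> \<in> ball (Y \<omega>') (r / D)"
      unfolding V_def by blast
    have "dist (X \<omega>') (X \<omega>) \<le> C * dist (Y \<omega>') (Y \<omega>)" using lip r w by auto
    also have "\<dots> \<le> D * dist (Y \<omega>') (Y \<omega>)" using D by (intro mult_right_mono) auto
    also have "\<dots> < r" using r(4) D by (simp add: field_simps)
    finally show "\<omega> \<in> X -` S \<inter> space M" using r w by auto
  qed
  then show "X -` S \<inter> space M \<in> sets M"
    using measurable_sets[OF Y borel_open[OF \<open>open V\<close>]] by simp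
qed

text \<open>Convergence at every sample point and dominated convergence. Measurability is asked only
  up to \<open>c\<close> because the interface parameter lives in (0,1]; the filter
  \<open>at 0 within {0..c}\<close> equals \<open>at_right 0\<close> and reduces the claim to
  sequences inside that range.\<close>

lemma converges_weakly_pathwise:
  fixes Y :: "real \<Rightarrow> 'a \<Rightarrow> 'b::metric_space" and c :: real
  assumes "prob_space M" and Y0: "Y0 \<in> M \<rightarrow>\<^sub>M borel"
    and c: "c > 0" and Y: "\<And>h. 0 < h \<Longrightarrow> h \<le> c \<Longrightarrow> Y h \<in> M \<rightarrow>\<^sub>M borel"
    and lim: "\<And>\<omega>. \<omega> \<in> space M \<Longrightarrow> ((\<lambda>h. Y h \<omega>) \<longlongrightarrow> Y0 \<omega>) (at_right 0)"
  shows "converges_weakly (\<lambda>h. distr M borel (Y h)) (distr M borel Y0) (at_right 0)"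
  unfolding converges_weakly_def
proof (intro conjI allI impI)
  interpret prob_space M by fact
  show "prob_space (distr M borel Y0)" by (rule prob_space_distr[OF Y0])
  fix \<phi> :: "'b \<Rightarrow> real" assume \<phi>: "continuous_on UNIV \<phi>" "bounded (range \<phi>)"
  have [measurable]: "\<phi> \<in> borel_measurable borel" by (rule borel_measurable_continuous_onI[OF \<phi>(1)])
  obtain B where B: "\<And>x. \<bar>\<phi> x\<bar> \<le> B" using \<phi>(2) by (auto simp: bounded_iff)
  have "((\<lambda>h. expectation (\<lambda>\<omega>. \<phi> (Y h \<omega>))) \<longlongrightarrow> expectation (\<lambda>\<omega>. \<phi> (Y0 \<omega>))) (at 0 within {0..c})"
    unfolding tendsto_at_iff_sequentially comp_def
  proof (intro allI impI)
    fix X :: "nat \<Rightarrow> real" assume X: "\<forall>i. X i \<in> {0..c} - {0}" "X \<longlonglongrightarrow> 0"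
    have m: "Y (X i) \<in> M \<rightarrow>\<^sub>M borel" for i using X(1) by (intro Y) (auto simp: less_le)
    show "(\<lambda>i. expectation (\<lambda>\<omega>. \<phi> (Y (X i) \<omega>))) \<longlonglongrightarrow> expectation (\<lambda>\<omega>. \<phi> (Y0 \<omega>))"
    proof (rule integral_dominated_convergence[where w = "\<lambda>_. B"])
      show "AE x in M. (\<lambda>i. \<phi> (Y (X i) x)) \<longlonglongrightarrow> \<phi> (Y0 x)"
      proof (rule AE_I2)
        fix \<omega> assume "\<omega> \<in> space M"
        then have "(\<lambda>i. Y (X i) \<omega>) \<longlonglongrightarrow> Y0 \<omega>"
          using lim[of \<omega>] X unfolding at_within_Icc_at_right[OF c, symmetric] tendsto_at_iff_sequentially comp_def
          by blast
        then show "(\<lambda>i. \<phi> (Y (X i) \<omega>)) \<longlonglongrightarrow> \<phi> (Y0 \<omega>)"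
          by (rule continuous_on_tendsto_compose[OF \<phi>(1)]) auto
      qed
    qed (use B m Y0 in auto)
  qed
  then have "((\<lambda>h. expectation (\<lambda>\<omega>. \<phi> (Y h \<omega>))) \<longlongrightarrow> expectation (\<lambda>\<omega>. \<phi> (Y0 \<omega>))) (at_right 0)"
    by (simp add: at_within_Icc_at_right[OF c])
  moreover have "eventually (\<lambda>h. expectation (\<lambda>\<omega>. \<phi> (Y h \<omega>)) = (\<integral>x. \<phi> x \<partial>distr M borel (Y h))) (at_right 0)"
    using eventually_at_right[of 0 c] c unfolding eventually_at_right_field
    by (intro exI[of _ c]) (auto intro!: integral_distr[symmetric] Y)
  ultimately have "((\<lambda>h. \<integral>x. \<phi> x \<partial>distr M borel (Y h)) \<longlongrightarrow> expectation (\<lambda>\<omega>. \<phi> (Y0 \<omega>))) (at_right 0)"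
    by (rule Lim_transform_eventually)
  then show "((\<lambda>h. \<integral>x. \<phi> x \<partial>distr M borel (Y h)) \<longlongrightarrow> (\<integral>x. \<phi> x \<partial>distr M borel Y0)) (at_right 0)"
    by (subst integral_distr[OF Y0]) auto
qed simp

section \<open>Paths and their piecewise linear interpolation\<close>

definition path :: "real \<Rightarrow> (real \<Rightarrow> real) \<Rightarrow> (real \<Rightarrow>\<^sub>C real)" where
  "path T x = Bcontfun (ext_cont x 0 T)"

lemma clamp_real: "0 \<le> T \<Longrightarrow> clamp 0 T r = max 0 (min r (T::real))"
    by (simp add: clamp_def max_def min_def)

lemma path_apply:
  assumes "continuous_on {0..T} x" "0 \<le> T"
  shows "apply_bcontfun (path T x) r = x (max 0 (min r T))"
proof -
  have "ext_cont x 0 T \<in> bcontfun"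
    unfolding bcontfun_def
    using assms continuous_on_ext_cont[of 0 T x UNIV] clamp_bounded[of x 0 T] compact_imp_bounded[OF compact_continuous_image[OF assms(1)]]
    by (auto simp: ext_cont_def)
  then show ?thesis
    unfolding path_def using assms(2) by (simp add: Bcontfun_inverse ext_cont_def clamp_real)
qed

lemma dist_path_le:
  assumes "continuous_on {0..T} x" "continuous_on {0..T} x'" "0 \<le> T"
    and "\<And>t. t \<in> {0..T} \<Longrightarrow> \<bar>x t - x' t\<bar> \<le> e"
  shows "dist (path T x) (path T x') \<le> e"
  by (rule dist_bound) (use assms in \<open>auto simp: path_apply dist_real_def\<close>)

lemma path_dist_ge:
  assumes "continuous_on {0..T} x" "continuous_on {0..T} x'" "t \<in> {0..T}"
  shows "\<bar>x t - x' t\<bar> \<le> dist (path T x) (path T x')"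
  using dist_bounded[of "path T x" t "path T x'"] assms by (simp add: path_apply dist_real_def)

text \<open>Rises linearly from 0 to 1 across the \<open>i\<close>-th of \<open>n\<close> equal
  pieces of [0,T] and is constant elsewhere.\<close>

definition ramp :: "real \<Rightarrow> nat \<Rightarrow> nat \<Rightarrow> (real \<Rightarrow>\<^sub>C real)" where
  "ramp T n i = Bcontfun (\<lambda>r. max 0 (min 1 (n * r / T - i)))"

lemma ramp_apply: "apply_bcontfun (ramp T n i) r = max 0 (min 1 (n * r / T - i))"
proof -
  have "continuous_on UNIV (\<lambda>r::real. max 0 (min 1 (n * r / T - i)))"
    by (auto simp: divide_inverse intro!: continuous_intros)
  moreover have "bounded (range (\<lambda>r::real. max 0 (min 1 (n * r / T - i))))"
    by (auto simp: bounded_iff intro!: exI[of _ 1])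
  ultimately show ?thesis
    by (simp add: ramp_def Bcontfun_inverse bcontfun_def)
qed

definition ramp_sum :: "real \<Rightarrow> nat \<Rightarrow> real \<Rightarrow> (nat \<Rightarrow> real) \<Rightarrow> (real \<Rightarrow>\<^sub>C real)" where
  "ramp_sum T n c d = c *\<^sub>R const_bcontfun 1 + (\<Sum>i<n. d i *\<^sub>R ramp T n i)"

text \<open>Written through increments instead of node values, because the Wiener process makes the
  increments independent with known laws.\<close>

definition interp :: "real \<Rightarrow> nat \<Rightarrow> (real \<Rightarrow> real) \<Rightarrow> (real \<Rightarrow>\<^sub>C real)" where
  "interp T n x = ramp_sum T n (x 0) (\<lambda>i. x (T * Suc i / n) - x (T * i / n))"

lemma apply_bcontfun_sum: "apply_bcontfun (\<Sum>i\<in>I. f i) x = (\<Sum>i\<in>I. apply_bcontfun (f i) (x::real) :: real)"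
  by (induction I rule: infinite_finite_induct) auto

text \<open>On the \<open>j\<close>-th piece the ramps further left equal 1 and their increments
  telescope to \<open>x (T * j / n) - x 0\<close>, while those further right are still 0.\<close>

lemma interp_apply:
  fixes T r :: real
  assumes T: "0 < T" and n: "0 < n" and j: "j < n" and r: "T * j / n \<le> r" "r \<le> T * Suc j / n"
  shows "apply_bcontfun (interp T n x) r = x (T * j / n) + (x (T * Suc j / n) - x (T * j / n)) * (n * r / T - j)"
proof -
  let ?d = "\<lambda>i. x (T * Suc i / n) - x (T * i / n)"
  have a: "j \<le> n * r / T" "n * r / T \<le> Suc j"
    using r T n by (auto simp: field_simps)
  have "(\<Sum>i<n. ?d i * max 0 (min 1 (n * r / T - i)))
    = (\<Sum>i<n. (if i < j then ?d i else 0) + (if i = j then ?d j * (n * r / T - j) else 0))"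
  proof (rule sum.cong[OF refl])
    fix i assume "i \<in> {..<n}"
    consider "i < j" | "i = j" | "i > j" by linarith
    then show "?d i * max 0 (min 1 (n * r / T - i)) = (if i < j then ?d i else 0) + (if i = j then ?d j * (n * r / T - j) else 0)"
    proof cases
      case 1
      then have "real i + 1 \<le> j" by linarith
      then have "min 1 (n * r / T - i) = 1" using a by linarith
      then show ?thesis using 1 by simp
    next
      case 2
      then have "max 0 (min 1 (n * r / T - i)) = n * r / T - j" using a by auto
      then show ?thesis using 2 by simp
    next
      case 3
      then have "real i \<ge> Suc j" by linarith
      then have "max 0 (min 1 (n * r / T - i)) = 0" using a by linarith
      then show ?thesis using 3 by simp
    qed
  qed
  also have "\<dots> = (\<Sum>i<n. if i < j then ?d i else 0) + ?d j * (n * r / T - j)"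
    using j by (simp add: sum.distrib)
  also have "(\<Sum>i<n. if i < j then ?d i else 0) = (\<Sum>i<j. ?d i)"
    using j by (intro sum.mono_neutral_cong_right) auto
  also have "\<dots> = x (T * j / n) - x 0"
    using sum_lessThan_telescope[of "\<lambda>i. x (T * i / n)" j] by simp
  finally show ?thesis
    by (simp add: interp_def ramp_sum_def apply_bcontfun_sum ramp_apply algebra_simps del: of_nat_Suc)
qed

lemma interp_outside:
  fixes T r :: real
  assumes T: "0 < T" and n: "0 < n"
  shows "apply_bcontfun (interp T n x) r = apply_bcontfun (interp T n x) (max 0 (min r T))"
proof -
  have "max 0 (min 1 (n * r / T - i)) = max 0 (min 1 (n * max 0 (min r T) / T - i))" if "i < n" for i
  proof -
    consider "r < 0" | "0 \<le> r" "r \<le> T" | "T < r" by linarith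
    then show ?thesis
    proof cases
      case 1
      then have "n * r / T \<le> 0" using T n by (simp add: divide_nonpos_pos mult_nonneg_nonpos)
      then show ?thesis using 1 T by simp
    next
      case 3
      then have "n * r / T \<ge> n" using T by (simp add: field_simps mult_right_mono)
      moreover have "real i + 1 \<le> n" using that by linarith
      ultimately show ?thesis using 3 T by simp
    qed simp
  qed
  then show ?thesis
    by (simp add: interp_def ramp_sum_def apply_bcontfun_sum ramp_apply)
qed

lemma interp_tendsto_path:
  fixes T :: real
  assumes T: "0 < T" and x: "continuous_on {0..T} x"
  shows "(\<lambda>n. interp T (Suc n) x) \<longlonglongrightarrow> path T x"
proof (rule LIMSEQ_I)
  fix e :: real assume e: "e > 0"
  have "uniformly_continuous_on {0..T} x" using x by (simp add: compact_uniformly_continuous)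
  then obtain d where d: "d > 0" "\<And>s t. s \<in> {0..T} \<Longrightarrow> t \<in> {0..T} \<Longrightarrow> dist s t < d \<Longrightarrow> dist (x s) (x t) < e / 3"
    unfolding uniformly_continuous_on_def using e by (metis zero_less_divide_iff zero_less_numeral)
  obtain N :: nat where N: "T / d < N" using reals_Archimedean2 by blast
  show "\<exists>no. \<forall>n\<ge>no. norm (interp T (Suc n) x - path T x) < e"
  proof (intro exI[of _ N] allI impI)
    fix n assume "n \<ge> N"
    define m where "m = Suc n"
    have m: "m > 0" "T / m < d" using \<open>n \<ge> N\<close> N T d(1)
      by (auto simp: m_def field_simps intro: less_le_trans) 
        (smt (verit, best) mult_left_mono of_nat_le_iff of_nat_Suc)
    have "dist (interp T m x) (path T x) \<le> 2 * (e / 3)"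
    proof (rule dist_bound)
      fix r
      define s where "s = max 0 (min r T)"
      have s: "0 \<le> s" "s \<le> T" using T by (auto simp: s_def)
      have "\<exists>j<m. T * j / m \<le> s \<and> s \<le> T * Suc j / m"
      \<comment> \<open>At the right end rounding down \<open>m * s / T\<close> would give
        \<open>m\<close>, one past the last piece, so the last index \<open>n = m - 1\<close> is
        named directly.\<close>
      proof (cases "s = T")
        case True
        then show ?thesis using m T by (intro exI[of _ n]) (auto simp: m_def field_simps)
      next
        case False
        define j where "j = nat \<lfloor>m * s / T\<rfloor>"
        have nn: "0 \<le> m * s / T" using s T by simp
        have lt: "m * s / T < m" using s T False m by (simp add: field_simps)
        have j: "real j \<le> m * s / T" "m * s / T \<le> Suc j"
          unfolding j_def using nn by linarith+
        then have "j < m" using lt by linarith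
        moreover have "T * j / m \<le> s" "s \<le> T * Suc j / m" using j T m by (auto simp: field_simps)
        ultimately show ?thesis by blast
      qed
      then obtain j where j: "j < m" "T * j / m \<le> s" "s \<le> T * Suc j / m" by blast
      define a where "a = T * j / m"
      define b where "b = T * Suc j / m"
      have ab: "b - a = T / m" by (simp add: a_def b_def add_divide_distrib algebra_simps)
      have a0: "0 \<le> a" "0 \<le> b" using T by (simp_all add: a_def b_def)
      have "real (Suc j) \<le> m" using j(1) by linarith
      then have bT: "b \<le> T" using T m by (simp add: b_def divide_le_eq mult_left_mono del: of_nat_Suc)
      have th: "0 \<le> m * s / T - j" "m * s / T - j \<le> 1"
        using j T m by (auto simp: field_simps)
      have 1: "dist (x a) (x s) < e / 3"
        by (rule d(2)) (use a0 bT j ab m s in \<open>auto simp: a_def b_def dist_real_def\<close>)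
      have 2: "dist (x b) (x a) < e / 3"
        by (rule d(2)) (use a0 bT j ab m s in \<open>auto simp: a_def[symmetric] b_def[symmetric] dist_real_def\<close>)
      have key: "\<bar>x a + c - x s\<bar> \<le> 2 * (e / 3)" if "\<bar>c\<bar> \<le> \<bar>x b - x a\<bar>" for c
        using 1 2 that unfolding dist_real_def by linarith
      have "\<bar>(x b - x a) * (m * s / T - j)\<bar> \<le> \<bar>x b - x a\<bar>"
        using th by (auto simp: abs_mult mult_left_le)
      moreover have "apply_bcontfun (interp T m x) s = x a + (x b - x a) * (m * s / T - j)"
        unfolding a_def b_def by (rule interp_apply) (use T m j in auto)
      moreover have "apply_bcontfun (interp T m x) r = apply_bcontfun (interp T m x) s"
        unfolding s_def by (rule interp_outside) (use T m in auto)
      ultimately show "dist (apply_bcontfun (interp T m x) r) (apply_bcontfun (path T x) r) \<le> 2 * (e / 3)"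
        using T x key by (simp add: path_apply s_def[symmetric] dist_real_def)
    qed
    then show "norm (interp T (Suc n) x - path T x) < e"
      using e by (simp add: m_def dist_norm)
  qed
qed

lemma continuous_ramp_sum:
  "continuous_on UNIV (\<lambda>c. ramp_sum T n (c 0) (\<lambda>i. c (Suc i)))"
  unfolding ramp_sum_def
  by (intro continuous_intros continuous_on_scaleR)
     (auto intro!: continuous_on_product_coordinates)

text \<open>The start value and the coefficients are packed into one random sequence, shifted by one
  place and padded with 0. On sequences the Borel sets do come from coordinates, and the sum of
  ramps is a continuous function of the sequence.\<close>

lemma borel_measurable_ramp_sum:
  assumes "a \<in> borel_measurable M" "\<And>i. i < n \<Longrightarrow> c i \<in> borel_measurable M"
  shows "(\<lambda>\<omega>. ramp_sum T n (a \<omega>) (\<lambda>i. c i \<omega>)) \<in> M \<rightarrow>\<^sub>M borel"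
proof -
  let ?c = "\<lambda>\<omega> k. case k of 0 \<Rightarrow> a \<omega> | Suc i \<Rightarrow> if i < n then c i \<omega> else 0"
  have 1: "?c \<in> M \<rightarrow>\<^sub>M borel"
  proof (rule measurable_coordinatewise_then_product)
    fix k show "(\<lambda>\<omega>. ?c \<omega> k) \<in> borel_measurable M"
    proof (cases k)
      case (Suc i)
      then show ?thesis using assms by (cases "i < n") auto
    qed (use assms in auto)
  qed
  have "(\<lambda>\<omega>. ramp_sum T n (?c \<omega> 0) (\<lambda>i. ?c \<omega> (Suc i))) \<in> M \<rightarrow>\<^sub>M borel"
    by (rule measurable_compose[OF 1 borel_measurable_continuous_onI[OF continuous_ramp_sum]])
  moreover have "ramp_sum T n (?c \<omega> 0) (\<lambda>i. ?c \<omega> (Suc i)) = ramp_sum T n (a \<omega>) (\<lambda>i. c i \<omega>)" for \<omega>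
    by (simp add: ramp_sum_def)
  ultimately show ?thesis by simp
qed

lemma borel_measurable_interp:
  assumes "0 \<le> T" and "\<And>t. 0 \<le> t \<Longrightarrow> X t \<in> borel_measurable M"
  shows "(\<lambda>\<omega>. interp T n (\<lambda>t. X t \<omega>)) \<in> M \<rightarrow>\<^sub>M borel"
  unfolding interp_def
  by (rule borel_measurable_ramp_sum) (use assms in \<open>auto intro!: borel_measurable_diff\<close>)

text \<open>The interpolations are continuous functions of finitely many values and converge
  uniformly. The case \<open>T = 0\<close> is separate since the ramps divide by
  \<open>T\<close>.\<close>

lemma borel_measurable_path:
  assumes "0 \<le> T" "\<And>t. 0 \<le> t \<Longrightarrow> X t \<in> borel_measurable M"
    and cont: "\<And>\<omega>. \<omega> \<in> space M \<Longrightarrow> continuous_on {0..T} (\<lambda>t. X t \<omega>)"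
  shows "(\<lambda>\<omega>. path T (\<lambda>t. X t \<omega>)) \<in> M \<rightarrow>\<^sub>M borel"
proof (cases "T = 0")
  case True
  have "path T x = ramp_sum 0 0 (x 0) (\<lambda>_. 0)" for x
    unfolding True by (rule bcontfun_eqI) (auto simp: path_apply ramp_sum_def)
  then show ?thesis by (simp add: borel_measurable_ramp_sum assms)
next
  case False
  show ?thesis
    by (rule borel_measurable_LIMSEQ_metric[where f = "\<lambda>n \<omega>. interp T (Suc n) (\<lambda>t. X t \<omega>)"])
      (use False assms cont in \<open>auto intro!: borel_measurable_interp interp_tendsto_path\<close>)
qed

section \<open>First order equations driven by a continuous path\<close>

lemma abs_integral_le:
  fixes f g :: "real \<Rightarrow> real"
  assumes "f integrable_on S" "g integrable_on S" "\<And>x. x \<in> S \<Longrightarrow> \<bar>f x\<bar> \<le> g x"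
  shows "\<bar>integral S f\<bar> \<le> integral S g"
  using Henstock_Kurzweil_Integration.integral_norm_bound_integral[of f S g] assms by simp

text \<open>\<open>\<psi>\<close> is the right-hand side discounted by \<open>exp (- L * s)\<close>.
  Its derivative carries the factor \<open>\<phi> s\<close> minus that right-hand side, so it
  decreases and stays below its initial value \<open>C\<close>.\<close>

lemma gronwall:
  fixes \<phi> :: "real \<Rightarrow> real"
  assumes cont: "continuous_on {0..T} \<phi>" and L: "0 \<le> L"
    and le: "\<And>t. t \<in> {0..T} \<Longrightarrow> \<phi> t \<le> C + L * integral {0..t} \<phi>"
    and t: "t \<in> {0..T}"
  shows "\<phi> t \<le> C * exp (L * t)"
proof -
  define \<psi> where "\<psi> s = exp (- L * s) * (C + L * integral {0..s} \<phi>)" for s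
  have d: "(\<psi> has_real_derivative exp (- L * s) * L * (\<phi> s - (C + L * integral {0..s} \<phi>))) (at s within {0..t})"
    if s: "s \<in> {0..t}" for s
  proof -
    have "((\<lambda>u. integral {0..u} \<phi>) has_real_derivative \<phi> s) (at s within {0..t})"
      using integral_has_real_derivative[of 0 T \<phi> s] cont s t by (auto intro: DERIV_subset)
    then show ?thesis
      unfolding \<psi>_def by (auto intro!: derivative_eq_intros simp: algebra_simps)
  qed
  have "\<psi> t \<le> \<psi> 0"
  proof (rule DERIV_nonpos_imp_decreasing_open[where f = \<psi> and a = 0 and b = t])
    show "0 \<le> t" using t by simp
    show "continuous_on {0..t} \<psi>" using d by (rule DERIV_continuous_on)
    fix s assume s: "0 < s" "s < t"
    have "(\<psi> has_real_derivative exp (- L * s) * L * (\<phi> s - (C + L * integral {0..s} \<phi>))) (at s)"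
      using d[of s] s by (simp add: at_within_interior[of s "{0..t}"])
    moreover have "exp (- L * s) * L * (\<phi> s - (C + L * integral {0..s} \<phi>)) \<le> 0"
      using le[of s] s t L by (intro mult_nonneg_nonpos) auto
    ultimately show "\<exists>y. (\<psi> has_real_derivative y) (at s) \<and> y \<le> 0" by blast
  qed
  then have "exp (- L * t) * (C + L * integral {0..t} \<phi>) \<le> C" by (simp add: \<psi>_def)
  then have "C + L * integral {0..t} \<phi> \<le> C * exp (L * t)"
    by (simp add: exp_minus field_simps)
  then show ?thesis using le[OF t] by simp
qed

text \<open>The inverse is defined on the whole line and is Lipschitz with constant
  \<open>1 / m\<close>. The condition is phrased by increments because the limit coordinate
  \<open>scale\<close> has a kink at 0.\<close>

definition coercive :: "real \<Rightarrow> (real \<Rightarrow> real) \<Rightarrow> bool" where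
  "coercive m \<Lambda> \<longleftrightarrow> 0 < m \<and> (\<forall>x y. m * \<bar>x - y\<bar> \<le> \<bar>\<Lambda> x - \<Lambda> y\<bar>) \<and> continuous_on UNIV \<Lambda> \<and> surj \<Lambda>"

text \<open>For smooth data this is the integral of \<open>\<Lambda>'(X) X' = b(X) + w'\<close>; it
  remains meaningful for merely continuous \<open>w\<close>, hence for each single Wiener
  path.\<close>

definition solves :: "(real \<Rightarrow> real) \<Rightarrow> (real \<Rightarrow> real) \<Rightarrow> real \<Rightarrow> (real \<Rightarrow> real) \<Rightarrow> (real \<Rightarrow> real) \<Rightarrow> bool" where
  "solves \<Lambda> b q w X \<longleftrightarrow> continuous_on {0..} X \<and>
     (\<forall>t\<ge>0. \<Lambda> (X t) = \<Lambda> q + integral {0..t} (\<lambda>s. b (X s)) + w t)"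

lemma coerciveD:
  assumes "coercive m \<Lambda>"
  shows "0 < m" "m * \<bar>x - y\<bar> \<le> \<bar>\<Lambda> x - \<Lambda> y\<bar>" "continuous_on UNIV \<Lambda>" "surj \<Lambda>"
  using assms by (auto simp: coercive_def)

lemma coercive_inj: "coercive m \<Lambda> \<Longrightarrow> inj \<Lambda>"
  using coerciveD(1,2)[of m \<Lambda>] by (auto intro!: injI) (metis abs_0 diff_self eq_iff_diff_eq_0 mult_le_0_iff abs_le_zero_iff linorder_not_less)

lemma coercive_inv:
  assumes "coercive m \<Lambda>"
  shows "\<Lambda> (inv \<Lambda> z) = z" "inv \<Lambda> (\<Lambda> x) = x" "\<bar>inv \<Lambda> z - inv \<Lambda> z'\<bar> \<le> \<bar>z - z'\<bar> / m"
    "continuous_on UNIV (inv \<Lambda>)"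
proof -
  show 1: "\<Lambda> (inv \<Lambda> z) = z" for z using coerciveD(4)[OF assms] by (rule surj_f_inv_f)
  show "inv \<Lambda> (\<Lambda> x) = x" using coercive_inj[OF assms] by (rule inv_f_f)
  show 3: "\<bar>inv \<Lambda> z - inv \<Lambda> z'\<bar> \<le> \<bar>z - z'\<bar> / m" for z z'
    using coerciveD(2)[OF assms, of "inv \<Lambda> z" "inv \<Lambda> z'"] coerciveD(1)[OF assms]
    by (simp add: 1 field_simps)
  show "continuous_on UNIV (inv \<Lambda>)"
    unfolding continuous_on_iff
  proof (intro ballI allI impI)
    fix x e :: real assume e: "e > 0"
    have "\<bar>inv \<Lambda> x' - inv \<Lambda> x\<bar> < e" if "\<bar>x' - x\<bar> < e * m" for x'
    proof -
      have "\<bar>x' - x\<bar> / m < e" using that coerciveD(1)[OF assms] by (simp add: field_simps)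
      then show ?thesis using 3[of x' x] by linarith
    qed
    then show "\<exists>d>0. \<forall>x'\<in>UNIV. dist x' x < d \<longrightarrow> dist (inv \<Lambda> x') (inv \<Lambda> x) < e"
      using coerciveD(1)[OF assms] e
      by (intro exI[of _ "e * m"]) (auto simp: dist_real_def)
  qed
qed

text \<open>The coordinates \<open>\<Lambda>\<close> and \<open>\<Lambda>'\<close> are compared only
  along the second solution and at the starting points. Coercivity of the first one converts the
  bound on \<open>\<Lambda> (X s) - \<Lambda> (X' s)\<close> into one on \<open>X s - X' s\<close>,
  and Gronwall's inequality closes the estimate. All three limits use it, with a perturbed noise or
  a perturbed coordinate.\<close>

lemma solves_stability:
  assumes co: "coercive m \<Lambda>" and b: "continuous_on UNIV b" "L-lipschitz_on UNIV b"
    and X: "solves \<Lambda> b q w X" and X': "solves \<Lambda>' b q' w' X'"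
    and e: "\<And>t. t \<in> {0..T} \<Longrightarrow> \<bar>w t - w' t\<bar> + \<bar>\<Lambda> (X' t) - \<Lambda>' (X' t)\<bar> + \<bar>\<Lambda> q - \<Lambda>' q'\<bar> \<le> e"
    and t: "t \<in> {0..T}"
  shows "\<bar>X t - X' t\<bar> \<le> e / m * exp (L / m * T)"
proof -
  have m: "m > 0" using coerciveD(1)[OF co] .
  have L: "L \<ge> 0" using b(2) by (rule lipschitz_on_nonneg)
  have cX: "continuous_on {0..s} X" "continuous_on {0..s} X'" for s
    using X X' by (auto simp: solves_def intro: continuous_on_subset)
  have cb: "continuous_on {0..s} (\<lambda>u. b (X u))" "continuous_on {0..s} (\<lambda>u. b (X' u))" for s
    using cX by (auto intro!: continuous_on_compose2[OF b(1)])
  have e0: "e \<ge> 0" using e[OF t] by (smt (verit) abs_ge_zero)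
  have "\<bar>X t - X' t\<bar> \<le> e / m * exp (L / m * t)"
  proof (rule gronwall[OF _ _ _ t])
    show "continuous_on {0..T} (\<lambda>t. \<bar>X t - X' t\<bar>)" by (intro continuous_intros cX)
    show "0 \<le> L / m" using L m by simp
    fix s assume s: "s \<in> {0..T}"
    have "integral {0..s} (\<lambda>u. b (X u)) - integral {0..s} (\<lambda>u. b (X' u)) = integral {0..s} (\<lambda>u. b (X u) - b (X' u))"
      by (rule Henstock_Kurzweil_Integration.integral_diff[symmetric]) (auto intro!: integrable_continuous_real cb)
    also have "\<bar>\<dots>\<bar> \<le> integral {0..s} (\<lambda>u. L * \<bar>X u - X' u\<bar>)"
    proof (rule abs_integral_le)
      show "(\<lambda>u. b (X u) - b (X' u)) integrable_on {0..s}"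
        by (intro integrable_continuous_real continuous_intros cb)
      show "(\<lambda>u. L * \<bar>X u - X' u\<bar>) integrable_on {0..s}"
        by (intro integrable_continuous_real continuous_intros cX)
      fix u show "\<bar>b (X u) - b (X' u)\<bar> \<le> L * \<bar>X u - X' u\<bar>"
        using lipschitz_onD[OF b(2), of "X u" "X' u"] by (simp add: dist_real_def)
    qed
    also have "\<dots> = L * integral {0..s} (\<lambda>u. \<bar>X u - X' u\<bar>)" by simp
    finally have I: "\<bar>integral {0..s} (\<lambda>u. b (X u)) - integral {0..s} (\<lambda>u. b (X' u))\<bar> \<le> L * integral {0..s} (\<lambda>u. \<bar>X u - X' u\<bar>)" .
    have "m * \<bar>X s - X' s\<bar> \<le> \<bar>\<Lambda> (X s) - \<Lambda> (X' s)\<bar>" by (rule coerciveD(2)[OF co])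
    also have "\<dots> \<le> e + L * integral {0..s} (\<lambda>u. \<bar>X u - X' u\<bar>)"
    proof -
      have "\<Lambda> (X s) = \<Lambda> q + integral {0..s} (\<lambda>u. b (X u)) + w s"
        "\<Lambda>' (X' s) = \<Lambda>' q' + integral {0..s} (\<lambda>u. b (X' u)) + w' s"
        using X X' s by (auto simp: solves_def)
      then show ?thesis using I e[OF s] by linarith
    qed
    finally show "\<bar>X s - X' s\<bar> \<le> e / m + L / m * integral {0..s} (\<lambda>u. \<bar>X u - X' u\<bar>)"
      using m by (simp add: field_simps)
  qed
  also have "\<dots> \<le> e / m * exp (L / m * T)"
    using t e0 m L by (intro mult_left_mono) (auto simp: divide_right_mono mult_left_mono)
  finally show ?thesis .
qed

lemma solves_unique:
  assumes co: "coercive m \<Lambda>" and b: "continuous_on UNIV b" "L-lipschitz_on UNIV b"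
    and X: "solves \<Lambda> b q w X" and X': "solves \<Lambda> b q w' X'"
    and w: "\<And>t. t \<in> {0..T} \<Longrightarrow> w t = w' t" and t: "t \<in> {0..T}"
  shows "X t = X' t"
  using solves_stability[OF co b X X', of T 0 t] w t by auto

lemma solves_start:
  assumes co: "coercive m \<Lambda>" and X: "solves \<Lambda> b q w X" and w: "w 0 = 0"
  shows "X 0 = q"
proof -
  have "\<Lambda> (X 0) = \<Lambda> q" using X w unfolding solves_def by (auto dest!: spec[of _ 0])
  then show ?thesis using coercive_inj[OF co] by (auto dest: injD)
qed

lemma lipschitz_inv:
  assumes co: "coercive m \<Lambda>" and b: "L-lipschitz_on UNIV b"
  shows "(L / m)-lipschitz_on UNIV (\<lambda>z. b (inv \<Lambda> z))"
proof (rule lipschitz_onI)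
  have m: "m > 0" using coerciveD(1)[OF co] .
  have L: "L \<ge> 0" using b(1) by (rule lipschitz_on_nonneg)
  show "0 \<le> L / m" using m L by simp
  fix x y :: real
  have "dist (b (inv \<Lambda> x)) (b (inv \<Lambda> y)) \<le> L * dist (inv \<Lambda> x) (inv \<Lambda> y)"
    using lipschitz_onD[OF b] by auto
  also have "\<dots> \<le> L * (dist x y / m)"
    using coercive_inv(3)[OF co, of x y] L by (intro mult_left_mono) (auto simp: dist_real_def)
  finally show "dist (b (inv \<Lambda> x)) (b (inv \<Lambda> y)) \<le> L / m * dist x y" by simp
qed

text \<open>The Picard operator for \<open>z + \<integral> g(Z) + w\<close> acts on the weighted difference
  \<open>exp (- K t) (Z t - w t)\<close>, where it contracts on all of \<open>[0,\<infinity>)\<close> at once for \<open>K = 2 L + 1\<close>.\<close>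

lemma integral_equation_exists:
  fixes g w :: "real \<Rightarrow> real"
  assumes g: "L-lipschitz_on UNIV g" "\<And>x. \<bar>g x\<bar> \<le> B" and w: "continuous_on {0..} w"
  shows "\<exists>Z. continuous_on {0..} Z \<and> (\<forall>t\<ge>0. Z t = z + integral {0..t} (\<lambda>s. g (Z s)) + w t)"
proof -
  define K where "K = 2 * L + 1"
  have L: "L \<ge> 0" using g(1) by (rule lipschitz_on_nonneg)
  then have K: "K > 0" "L / K \<le> 1 / 2" by (auto simp: K_def field_simps)
  have gc: "continuous_on UNIV g" using g(1) by (rule lipschitz_on_continuous_on)
  define w' where "w' t = w (max 0 t)" for t
  have w'c: "continuous_on UNIV w'"
    unfolding w'_def by (rule continuous_on_compose2[OF w]) (auto intro!: continuous_intros)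
  define h where "h y s = g (exp (K * s) * apply_bcontfun y s + w' s)" for y :: "real \<Rightarrow>\<^sub>C real" and s
  have hc: "continuous_on S (h y)" for y S
    unfolding h_def
    by (rule continuous_on_compose2[OF gc])
       (auto intro!: continuous_intros continuous_on_subset[OF w'c])
  have hi: "h y integrable_on {0..t}" for y t
    by (rule integrable_continuous_real[OF hc])
  have hB: "\<bar>integral {0..t} (h y)\<bar> \<le> B * t" if "t \<ge> 0" for y t
    using integral_bound[OF that hc[of "{0..t}" y], of B] g(2) by (auto simp: h_def)
  \<comment> \<open>The fixed point is sought among bounded continuous functions on the whole line,
    hence the constant continuation to negative times by \<open>max 0 t\<close>.\<close>
  define P where "P y t = exp (- K * max 0 t) * (z + integral {0..max 0 t} (h y))" for y t
  have Pc: "P y \<in> bcontfun" for y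
    unfolding bcontfun_def
  proof (intro CollectI conjI)
    have I: "continuous_on {0..} (\<lambda>t. integral {0..t} (h y))"
      unfolding continuous_on_eq_continuous_within
    proof
      fix t :: real assume t: "t \<in> {0..}"
      have "continuous_on {0..t+1} (\<lambda>t. integral {0..t} (h y))"
        by (rule indefinite_integral_continuous_1[OF hi])
      then have "continuous (at t within {0..t+1}) (\<lambda>t. integral {0..t} (h y))"
        using t by (auto simp: continuous_on_eq_continuous_within)
      moreover have "at t within {0..t+1} = at t within {0..}"
        by (rule at_within_nhd[where S = "{..<t+1}"]) auto
      ultimately show "continuous (at t within {0..}) (\<lambda>t. integral {0..t} (h y))"
        by (simp add: continuous_within)
    qed
    show "continuous_on UNIV (P y)"
      unfolding P_def
      by (intro continuous_intros continuous_on_compose2[OF I]) auto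
    \<comment> \<open>A bounded drift lets the integral grow at most linearly, which the exponential
      weight turns into a uniform bound.\<close>
    have "\<bar>P y t\<bar> \<le> \<bar>z\<bar> + \<bar>B\<bar> / K" for t
    proof -
      define u where "u = max 0 t"
      have u: "u \<ge> 0" by (simp add: u_def)
      have "\<bar>P y t\<bar> \<le> exp (- K * u) * (\<bar>z\<bar> + \<bar>B\<bar> * u)"
        unfolding P_def u_def[symmetric] abs_mult
        using hB[OF u, of y] u by (auto intro!: mult_left_mono simp: abs_mult intro: order_trans[OF abs_triangle_ineq])
          (smt (verit) abs_triangle_ineq mult_right_mono)
      also have "\<dots> = exp (- K * u) * \<bar>z\<bar> + \<bar>B\<bar> * (u * exp (- K * u))" by (simp add: algebra_simps)
      also have "\<dots> \<le> 1 * \<bar>z\<bar> + \<bar>B\<bar> * (1 / K)"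
      proof (intro add_mono mult_right_mono mult_left_mono)
        show "exp (- K * u) \<le> 1" using K u by simp
        have "K * u \<le> exp (K * u)" using exp_ge_add_one_self[of "K * u"] by linarith
        then show "u * exp (- K * u) \<le> 1 / K" using K by (simp add: exp_minus field_simps)
      qed auto
      finally show ?thesis by simp
    qed
    then show "bounded (range (P y))" by (auto simp: bounded_iff)
  qed
  define \<Phi> where "\<Phi> y = Bcontfun (P y)" for y
  have \<Phi>: "apply_bcontfun (\<Phi> y) t = P y t" for y t
    by (simp add: \<Phi>_def Bcontfun_inverse[OF Pc])
  have contr: "dist (\<Phi> y) (\<Phi> y') \<le> 1/2 * dist y y'" for y y'
  proof (rule dist_bound)
    fix t :: real
    define u where "u = max 0 t"
    define D where "D = dist y y'"
    have u: "u \<ge> 0" by (simp add: u_def)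
    have "\<bar>integral {0..u} (h y) - integral {0..u} (h y')\<bar> = \<bar>integral {0..u} (\<lambda>s. h y s - h y' s)\<bar>"
      by (subst Henstock_Kurzweil_Integration.integral_diff[OF hi hi]) simp
    also have "\<dots> \<le> integral {0..u} (\<lambda>s. L * D * exp (K * s))"
    proof (rule abs_integral_le)
      show "(\<lambda>s. h y s - h y' s) integrable_on {0..u}" by (intro integrable_diff hi)
      show "(\<lambda>s. L * D * exp (K * s)) integrable_on {0..u}"
        by (intro integrable_continuous_real continuous_intros)
      fix s
      have "\<bar>h y s - h y' s\<bar> \<le> L * \<bar>exp (K * s) * (apply_bcontfun y s - apply_bcontfun y' s)\<bar>"
        using lipschitz_onD[OF g(1), of "exp (K * s) * apply_bcontfun y s + w' s" "exp (K * s) * apply_bcontfun y' s + w' s"]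
        by (simp add: h_def dist_real_def algebra_simps)
      also have "\<dots> = L * (exp (K * s) * dist (apply_bcontfun y s) (apply_bcontfun y' s))"
        by (simp add: abs_mult dist_real_def)
      also have "\<dots> \<le> L * (exp (K * s) * D)"
        using dist_bounded[of y s y'] L by (intro mult_left_mono) (auto simp: D_def)
      finally show "\<bar>h y s - h y' s\<bar> \<le> L * D * exp (K * s)" by (simp add: ac_simps)
    qed
    also have "\<dots> = L * D * (exp (K * u) / K - 1 / K)"
    proof -
      have "((\<lambda>s. exp (K * s)) has_integral (exp (K * u) / K - exp (K * 0) / K)) {0..u}"
        by (rule fundamental_theorem_of_calculus[OF u])
           (use K in \<open>auto intro!: derivative_eq_intros simp: has_real_derivative_iff_has_vector_derivative[symmetric]\<close>)
      then have "integral {0..u} (\<lambda>s. exp (K * s)) = exp (K * u) / K - 1 / K"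
        by (simp add: integral_unique)
      then show ?thesis by simp
    qed
    also have "\<dots> \<le> L * D * (exp (K * u) / K)"
      using L K by (intro mult_left_mono) (auto simp: D_def)
    finally have "\<bar>integral {0..u} (h y) - integral {0..u} (h y')\<bar> \<le> L * D * (exp (K * u) / K)" .
    then have "exp (- K * u) * \<bar>integral {0..u} (h y) - integral {0..u} (h y')\<bar> \<le> exp (- K * u) * (L * D * (exp (K * u) / K))"
      by (rule mult_left_mono) simp
    also have "\<dots> = (L / K) * D" by (simp add: exp_minus)
    also have "\<dots> \<le> 1 / 2 * D" using K by (intro mult_right_mono) (auto simp: D_def)
    finally have "exp (- K * u) * \<bar>integral {0..u} (h y) - integral {0..u} (h y')\<bar> \<le> 1/2 * D" .
    moreover have "P y t - P y' t = exp (- K * u) * (integral {0..u} (h y) - integral {0..u} (h y'))"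
      by (simp add: P_def u_def algebra_simps)
    ultimately show "dist (apply_bcontfun (\<Phi> y) t) (apply_bcontfun (\<Phi> y') t) \<le> 1/2 * dist y y'"
      by (simp add: \<Phi> dist_real_def abs_mult D_def)
  qed
  have "\<exists>!y. \<Phi> y = y"
    by (rule banach_fix_type[where c = "1/2"]) (use contr in auto)
  then obtain y where y: "\<Phi> y = y" by blast
  define Z where "Z t = exp (K * t) * apply_bcontfun y t + w' t" for t
  have hZ: "h y = (\<lambda>s. g (Z s))" by (rule ext) (simp add: h_def Z_def)
  show ?thesis
  proof (intro exI[of _ Z] conjI allI impI)
    show "continuous_on {0..} Z"
      unfolding Z_def by (intro continuous_intros continuous_on_subset[OF w'c]) auto
    fix t :: real assume t: "t \<ge> 0"
    have "apply_bcontfun y t = exp (- K * t) * (z + integral {0..t} (h y))"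
      using \<Phi>[of y t] t by (simp add: y P_def)
    then have "exp (K * t) * apply_bcontfun y t = (exp (K * t) * exp (- K * t)) * (z + integral {0..t} (h y))"
      by simp
    also have "exp (K * t) * exp (- K * t) = 1" by (simp add: exp_minus)
    finally show "Z t = z + integral {0..t} (\<lambda>s. g (Z s)) + w t"
      using t by (simp add: Z_def[of t] w'_def hZ)
  qed
qed

lemma solves_exists:
  assumes co: "coercive m \<Lambda>" and b: "L-lipschitz_on UNIV b" "\<And>x. \<bar>b x\<bar> \<le> B"
    and w: "continuous_on {0..} w"
  shows "\<exists>X. solves \<Lambda> b q w X"
proof -
  obtain Z where Z: "continuous_on {0..} Z" "\<And>t. t \<ge> 0 \<Longrightarrow> Z t = \<Lambda> q + integral {0..t} (\<lambda>s. b (inv \<Lambda> (Z s))) + w t"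
    using integral_equation_exists[OF lipschitz_inv[OF co b(1)] _ w, of B "\<Lambda> q"] b(2) by auto
  have "solves \<Lambda> b q w (\<lambda>t. inv \<Lambda> (Z t))"
    unfolding solves_def using Z
    by (auto simp: coercive_inv[OF co] intro!: continuous_on_compose2[OF coercive_inv(4)[OF co]])
  then show ?thesis by blast
qed

definition flow :: "(real \<Rightarrow> real) \<Rightarrow> (real \<Rightarrow> real) \<Rightarrow> real \<Rightarrow> (real \<Rightarrow> real) \<Rightarrow> real \<Rightarrow> real" where
  "flow \<Lambda> b q w = (SOME X. solves \<Lambda> b q w X)"

lemma solves_shift:
  assumes X: "solves \<Lambda> b q w X" and s: "s \<ge> 0" and b: "continuous_on UNIV b"
  shows "solves \<Lambda> b (X s) (\<lambda>r. w (s + r) - w s) (\<lambda>r. X (s + r))"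
  unfolding solves_def
proof (intro conjI allI impI)
  have cX: "continuous_on {0..} X" using X by (simp add: solves_def)
  show "continuous_on {0..} (\<lambda>r. X (s + r))"
    by (rule continuous_on_compose2[OF cX]) (use s in \<open>auto intro!: continuous_intros\<close>)
  fix r :: real assume r: "r \<ge> 0"
  have cb: "continuous_on {0..u} (\<lambda>v. b (X v))" for u
    by (rule continuous_on_compose2[OF b]) (auto intro: continuous_on_subset[OF cX])
  have "integral {0..s} (\<lambda>v. b (X v)) + integral {s..s+r} (\<lambda>v. b (X v)) = integral {0..s+r} (\<lambda>v. b (X v))"
    by (rule Henstock_Kurzweil_Integration.integral_combine) (use s r cb in \<open>auto intro!: integrable_continuous_real\<close>)
  moreover have "integral {s..s+r} (\<lambda>v. b (X v)) = integral {0..r} (\<lambda>v. b (X (s + v)))"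
    using integral_shift_Icc_real[of 0 r "\<lambda>v. b (X v)" s] by (simp add: comp_def add.commute)
  ultimately show "\<Lambda> (X (s + r)) = \<Lambda> (X s) + integral {0..r} (\<lambda>v. b (X (s + v))) + (w (s + r) - w s)"
    using X s r by (auto simp: solves_def)
qed

text \<open>Coercivity of \<open>\<Lambda>\<close> makes the velocity bounded uniformly in \<open>\<mu>\<close>, so that
  \<open>\<mu> (p - v t)\<close> acts as a vanishing perturbation of the noise in the integrated equation.\<close>

lemma damped_velocity_bound:
  fixes v c l :: "real \<Rightarrow> real"
  assumes \<mu>: "\<mu> > 0" and m: "m > 0"
    and v: "\<And>t. t \<in> {0..T} \<Longrightarrow> (v has_real_derivative a t) (at t within {0..})"
    and eq: "\<And>t. t \<in> {0..T} \<Longrightarrow> \<mu> * a t = c t - l t * v t"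
    and l: "continuous_on {0..T} l" "\<And>t. t \<in> {0..T} \<Longrightarrow> m \<le> l t"
    and c: "\<And>t. t \<in> {0..T} \<Longrightarrow> c t \<le> m * V" and V: "v 0 \<le> V" "0 \<le> V" and t: "t \<in> {0..T}"
  shows "v t \<le> V"
proof -
  \<comment> \<open>Integrating factor of the damped equation: \<open>(V - v) * E\<close> has
    derivative \<open>(V * l - c) / \<mu> * E\<close>, which is nonnegative because
    \<open>c \<le> m * V \<le> l * V\<close>. The mass enters through the factor only, not through
    the bound.\<close>
  define E where "E s = exp (integral {0..s} l / \<mu>)" for s
  have Epos: "E s > 0" for s by (simp add: E_def)
  have dE: "(E has_real_derivative l s / \<mu> * E s) (at s within {0..t})" if s: "s \<in> {0..t}" for s
  proof -
    have "((\<lambda>u. integral {0..u} l) has_real_derivative l s) (at s within {0..t})"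
      using integral_has_real_derivative[of 0 T l s] l(1) s t by (auto intro: DERIV_subset)
    then show ?thesis
      unfolding E_def using \<mu> by (auto intro!: derivative_eq_intros)
  qed
  have d: "((\<lambda>s. (V - v s) * E s) has_real_derivative (V * l s - c s) / \<mu> * E s) (at s within {0..t})"
    if s: "s \<in> {0..t}" for s
  proof -
    have "(v has_real_derivative a s) (at s within {0..t})"
      using v[of s] s t by (auto intro: DERIV_subset)
    moreover have "a s = (c s - l s * v s) / \<mu>" using eq[of s] s t \<mu> by (simp add: field_simps)
    ultimately show ?thesis
      using \<mu> by (auto intro!: derivative_eq_intros dE[OF s] simp: field_simps)
  qed
  have "(V - v 0) * E 0 \<le> (V - v t) * E t"
  proof (rule DERIV_nonneg_imp_increasing_open[where f = "\<lambda>s. (V - v s) * E s" and a = 0 and b = t])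
    show "0 \<le> t" using t by simp
    show "continuous_on {0..t} (\<lambda>s. (V - v s) * E s)" using d by (rule DERIV_continuous_on)
    fix s assume s: "0 < s" "s < t"
    have "((\<lambda>s. (V - v s) * E s) has_real_derivative (V * l s - c s) / \<mu> * E s) (at s)"
      using d[of s] s by (simp add: at_within_interior[of s "{0..t}"])
    moreover have "m * V \<le> l s * V" using l(2)[of s] s t V by (intro mult_right_mono) auto
    then have "(V * l s - c s) / \<mu> * E s \<ge> 0"
      using c[of s] s t Epos[of s] \<mu> by (intro mult_nonneg_nonneg divide_nonneg_pos) (auto simp: mult.commute)
    ultimately show "\<exists>y. ((\<lambda>s. (V - v s) * E s) has_real_derivative y) (at s) \<and> 0 \<le> y" by blast
  qed
  then have "0 \<le> (V - v t) * E t" using V Epos[of 0] by (smt (verit) mult_nonneg_nonneg)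
  then show ?thesis using Epos[of t] by (simp add: zero_le_mult_iff)
qed

text \<open>One integration in time removes the derivative of the noise. With
  \<open>\<mu> * (p - v t)\<close> moved to the noise side the motion solves a first order equation
  exactly; the velocity stays visible because its bound is obtained from the differential
  form.\<close>

lemma motion_integrated:
  assumes sol: "solves_motion \<mu> b l \<xi> q p x" and \<mu>: "\<mu> > 0"
    and \<Lambda>: "\<And>x. (\<Lambda> has_real_derivative l x) (at x)"
    and b: "continuous_on UNIV b"
    and w: "\<And>t. t \<ge> 0 \<Longrightarrow> (w has_real_derivative \<xi> t) (at t within {0..})"
  obtains v where "v 0 = p" "\<And>t. t \<ge> 0 \<Longrightarrow> (x has_real_derivative v t) (at t within {0..})"
    "\<exists>a. \<forall>t\<ge>0. (v has_real_derivative a t) (at t within {0..}) \<and> \<mu> * a t = (b (x t) + \<xi> t) - l (x t) * v t"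
    "solves \<Lambda> b q (\<lambda>t. w t - w 0 + \<mu> * (p - v t)) x" "x 0 = q"
proof -
  obtain v a where va: "x 0 = q" "v 0 = p"
    "\<And>t. t \<ge> 0 \<Longrightarrow> (x has_real_derivative v t) (at t within {0..})"
    "\<And>t. t \<ge> 0 \<Longrightarrow> (v has_real_derivative a t) (at t within {0..})"
    "\<And>t. t \<ge> 0 \<Longrightarrow> \<mu> * a t = b (x t) - l (x t) * v t + \<xi> t"
    using sol unfolding solves_motion_def by blast
  have cx: "continuous_on {0..} x" using va(3) by (intro DERIV_continuous_on) auto
  have cb: "continuous_on {0..t} (\<lambda>s. b (x s))" for t
    by (rule continuous_on_compose2[OF b]) (auto intro: continuous_on_subset[OF cx])
  have "solves \<Lambda> b q (\<lambda>t. w t - w 0 + \<mu> * (p - v t)) x"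
    unfolding solves_def
  proof (intro conjI allI impI cx)
    fix t :: real assume t: "t \<ge> 0"
    have "((\<lambda>s. b (x s)) has_integral
       (\<mu> * v t + \<Lambda> (x t) - w t) - (\<mu> * v 0 + \<Lambda> (x 0) - w 0)) {0..t}"
    proof (rule fundamental_theorem_of_calculus[OF t])
      fix s assume s: "s \<in> {0..t}"
      have sub: "(f has_real_derivative D) (at s within {0..t})" if "(f has_real_derivative D) (at s within {0..})" for f D
        using that by (rule DERIV_subset) auto
      have "((\<lambda>s. \<mu> * v s + \<Lambda> (x s) - w s) has_real_derivative \<mu> * a s + l (x s) * v s - \<xi> s) (at s within {0..t})"
        using s by (intro DERIV_diff DERIV_add DERIV_cmult DERIV_chain2[OF \<Lambda>] sub va(3,4) w) auto
      then show "((\<lambda>s. \<mu> * v s + \<Lambda> (x s) - w s) has_vector_derivative b (x s)) (at s within {0..t})"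
        using va(5)[of s] s by (simp add: has_real_derivative_iff_has_vector_derivative)
    qed
    then have "integral {0..t} (\<lambda>s. b (x s)) = (\<mu> * v t + \<Lambda> (x t) - w t) - (\<mu> * p + \<Lambda> q - w 0)"
      using va(1,2) by (simp add: integral_unique)
    then show "\<Lambda> (x t) = \<Lambda> q + integral {0..t} (\<lambda>s. b (x s)) + (w t - w 0 + \<mu> * (p - v t))"
      by (simp add: algebra_simps)
  qed
  then show ?thesis using va by (intro that[of v]) (auto simp: algebra_simps intro!: exI[of _ a])
qed

lemma motion_close_to_first_order:
  assumes sol: "solves_motion \<mu> b l \<xi> q p x" and \<mu>: "\<mu> > 0"
    and \<Lambda>: "\<And>x. (\<Lambda> has_real_derivative l x) (at x)" and co: "coercive m \<Lambda>"
    and l: "continuous_on UNIV l" "\<And>x. m \<le> l x"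
    and b: "continuous_on UNIV b" "L-lipschitz_on UNIV b" "\<And>x. \<bar>b x\<bar> \<le> B"
    and w: "\<And>t. t \<ge> 0 \<Longrightarrow> (w has_real_derivative \<xi> t) (at t within {0..})"
    and \<xi>: "\<And>t. t \<in> {0..T} \<Longrightarrow> \<bar>\<xi> t\<bar> \<le> K"
    and X: "solves \<Lambda> b q (\<lambda>t. w t - w 0) X" and t: "t \<in> {0..T}"
  shows "\<bar>x t - X t\<bar> \<le> \<mu> * (2 * (\<bar>p\<bar> + (B + K) / m)) / m * exp (L / m * T)"
proof -
  have m: "m > 0" using coerciveD(1)[OF co] .
  obtain v a where v: "v 0 = p" "\<And>t. t \<ge> 0 \<Longrightarrow> (x has_real_derivative v t) (at t within {0..})"
    "\<And>t. t \<ge> 0 \<Longrightarrow> (v has_real_derivative a t) (at t within {0..})"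
    "\<And>t. t \<ge> 0 \<Longrightarrow> \<mu> * a t = (b (x t) + \<xi> t) - l (x t) * v t"
    "solves \<Lambda> b q (\<lambda>t. w t - w 0 + \<mu> * (p - v t)) x" "x 0 = q"
    by (rule motion_integrated[OF sol \<mu> \<Lambda> b(1) w]) blast+
  \<comment> \<open>Initial speed plus the largest terminal speed, that is the largest force
    \<open>B + K\<close> over the least friction \<open>m\<close>. It dominates
    \<open>\<bar>v\<bar>\<close> for every mass, so \<open>\<bar>p - v s\<bar>\<close> is at most
    \<open>2 * V\<close>.\<close>
  define V where "V = \<bar>p\<bar> + (B + K) / m"
  have BK: "0 \<le> B" "0 \<le> K" using b(3)[of 0] \<xi>[of 0] t by auto
  have V: "\<bar>p\<bar> \<le> V" "0 \<le> V" "B + K \<le> m * V" using BK m by (auto simp: V_def field_simps)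
  have cx: "continuous_on {0..T} x" using v(5) by (auto simp: solves_def intro: continuous_on_subset)
  have cl: "continuous_on {0..T} (\<lambda>t. l (x t))" by (rule continuous_on_compose2[OF l(1) cx]) auto
  have vb: "\<bar>v s\<bar> \<le> V" if s: "s \<in> {0..T}" for s
  proof -
    have c: "\<bar>b (x u) + \<xi> u\<bar> \<le> m * V" if "u \<in> {0..T}" for u
      using b(3)[of "x u"] \<xi>[OF that] V(3) by linarith
    have "v s \<le> V"
      by (rule damped_velocity_bound[OF \<mu> m, where T=T and a=a and l = "\<lambda>t. l (x t)" and c = "\<lambda>t. b (x t) + \<xi> t"])
         (use v c V s cl l in \<open>auto simp: abs_le_iff\<close>)
    moreover have "- v s \<le> V"
      by (rule damped_velocity_bound[OF \<mu> m, where T=T and v = "\<lambda>t. - v t" and a="\<lambda>t. - a t" and l = "\<lambda>t. l (x t)" and c = "\<lambda>t. - (b (x t) + \<xi> t)"])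
         (use v c V s cl l in \<open>auto simp: abs_le_iff intro!: derivative_eq_intros\<close>)
    ultimately show ?thesis by linarith
  qed
  have "\<bar>x t - X t\<bar> \<le> \<mu> * (2 * V) / m * exp (L / m * T)"
  proof (rule solves_stability[OF co b(1,2) v(5) X _ t])
    fix s assume s: "s \<in> {0..T}"
    have "\<bar>\<mu> * (p - v s)\<bar> \<le> \<mu> * (2 * V)"
      using \<mu> vb[OF s] V(1) by (auto simp: abs_mult intro!: mult_left_mono)
    then show "\<bar>w s - w 0 + \<mu> * (p - v s) - (w s - w 0)\<bar> + \<bar>\<Lambda> (X s) - \<Lambda> (X s)\<bar> + \<bar>\<Lambda> q - \<Lambda> q\<bar> \<le> \<mu> * (2 * V)"
      by simp
  qed
  then show ?thesis by (simp add: V_def)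
qed

text \<open>For fixed \<open>\<mu>\<close> the motion depends on the noise in a Lipschitz way; this yields its
  measurability without any appeal to existence theory.\<close>

lemma motion_lipschitz:
  assumes sol: "solves_motion \<mu> b l \<xi> q p x" "solves_motion \<mu> b l \<xi>' q p x'" and \<mu>: "\<mu> > 0"
    and \<Lambda>: "\<And>x. (\<Lambda> has_real_derivative l x) (at x)" and K: "K-lipschitz_on UNIV \<Lambda>"
    and b: "continuous_on UNIV b" "L-lipschitz_on UNIV b"
    and w: "\<And>t. t \<ge> 0 \<Longrightarrow> (w has_real_derivative \<xi> t) (at t within {0..})"
    and w': "\<And>t. t \<ge> 0 \<Longrightarrow> (w' has_real_derivative \<xi>' t) (at t within {0..})"
    and e: "\<And>t. t \<in> {0..T} \<Longrightarrow> \<bar>w t - w' t\<bar> \<le> e" and t: "t \<in> {0..T}"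
  shows "\<bar>x t - x' t\<bar> \<le> (2 * T / \<mu> * exp ((K + L * T) / \<mu> * T)) * e"
proof -
  obtain v where v: "v 0 = p" "\<And>t. t \<ge> 0 \<Longrightarrow> (x has_real_derivative v t) (at t within {0..})"
    "solves \<Lambda> b q (\<lambda>t. w t - w 0 + \<mu> * (p - v t)) x" "x 0 = q"
    by (rule motion_integrated[OF sol(1) \<mu> \<Lambda> b(1) w]) blast+
  obtain v' where v': "v' 0 = p" "\<And>t. t \<ge> 0 \<Longrightarrow> (x' has_real_derivative v' t) (at t within {0..})"
    "solves \<Lambda> b q (\<lambda>t. w' t - w' 0 + \<mu> * (p - v' t)) x'" "x' 0 = q"
    by (rule motion_integrated[OF sol(2) \<mu> \<Lambda> b(1) w']) blast+
  have L: "L \<ge> 0" "K \<ge> 0" using b(2) K by (auto dest: lipschitz_on_nonneg)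
  have e0: "e \<ge> 0" using e[OF t] by linarith
  define D where "D t = \<bar>x t - x' t\<bar>" for t
  have cx: "continuous_on {0..} x" "continuous_on {0..} x'" using v(3) v'(3) by (auto simp: solves_def)
  have cD: "continuous_on {0..s} D" for s
    unfolding D_def by (intro continuous_intros continuous_on_subset[OF cx(1)] continuous_on_subset[OF cx(2)]) auto
  have iD: "D integrable_on {0..s}" for s by (rule integrable_continuous_real[OF cD])
  have cb: "continuous_on {0..s} (\<lambda>u. b (x u))" "continuous_on {0..s} (\<lambda>u. b (x' u))" for s
    by (rule continuous_on_compose2[OF b(1)]; auto intro: continuous_on_subset[OF cx(1)] continuous_on_subset[OF cx(2)])+
  define J where "J s = integral {0..s} D" for s
  have Jmono: "J s \<le> J s'" if "0 \<le> s" "s \<le> s'" for s s'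
    unfolding J_def by (rule integral_subset_le) (use that iD in \<open>auto simp: D_def\<close>)
  have Ib: "\<bar>integral {0..s} (\<lambda>u. b (x u)) - integral {0..s} (\<lambda>u. b (x' u))\<bar> \<le> L * J s" for s
  proof -
    have "integral {0..s} (\<lambda>u. b (x u)) - integral {0..s} (\<lambda>u. b (x' u)) = integral {0..s} (\<lambda>u. b (x u) - b (x' u))"
      by (rule Henstock_Kurzweil_Integration.integral_diff[symmetric]) (auto intro!: integrable_continuous_real cb)
    also have "\<bar>\<dots>\<bar> \<le> integral {0..s} (\<lambda>u. L * D u)"
    proof (rule abs_integral_le)
      show "(\<lambda>u. b (x u) - b (x' u)) integrable_on {0..s}"
        by (intro integrable_continuous_real continuous_intros cb)
      show "(\<lambda>u. L * D u) integrable_on {0..s}"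
        by (intro integrable_continuous_real continuous_intros cD)
      fix u show "\<bar>b (x u) - b (x' u)\<bar> \<le> L * D u"
        using lipschitz_onD[OF b(2), of "x u" "x' u"] by (simp add: dist_real_def D_def)
    qed
    finally show ?thesis by (simp add: J_def)
  qed
  \<comment> \<open>The integrated equation expresses the difference of velocities by that of
    positions, its time integral and the noise. The term \<open>2 * e\<close> counts the noise
    difference at time \<open>s\<close> and at time 0.\<close>
  have vv: "\<bar>v s - v' s\<bar> \<le> (K * D s + L * J s + 2 * e) / \<mu>" if s: "s \<in> {0..T}" for s
  proof -
    have "\<Lambda> (x s) = \<Lambda> q + integral {0..s} (\<lambda>u. b (x u)) + (w s - w 0 + \<mu> * (p - v s))"
      "\<Lambda> (x' s) = \<Lambda> q + integral {0..s} (\<lambda>u. b (x' u)) + (w' s - w' 0 + \<mu> * (p - v' s))"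
      using v(3) v'(3) s by (auto simp: solves_def)
    then have "\<mu> * (v s - v' s) = - (\<Lambda> (x s) - \<Lambda> (x' s)) +
       (integral {0..s} (\<lambda>u. b (x u)) - integral {0..s} (\<lambda>u. b (x' u))) + (w s - w' s) - (w 0 - w' 0)"
      by (simp add: algebra_simps)
    moreover have "\<bar>\<Lambda> (x s) - \<Lambda> (x' s)\<bar> \<le> K * D s"
      using lipschitz_onD[OF K, of "x s" "x' s"] by (simp add: dist_real_def D_def)
    moreover have "\<bar>w s - w' s\<bar> \<le> e" "\<bar>w 0 - w' 0\<bar> \<le> e" using e[of s] e[of 0] s by auto
    ultimately have "\<bar>\<mu> * (v s - v' s)\<bar> \<le> K * D s + L * J s + 2 * e"
      using Ib[of s] by linarith
    then show ?thesis using \<mu> by (simp add: abs_mult pos_le_divide_eq mult.commute)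
  qed
  have "D t \<le> (2 * T / \<mu> * e) * exp ((K + L * T) / \<mu> * t)"
  proof (rule gronwall[OF cD _ _ t])
    show "0 \<le> (K + L * T) / \<mu>" using L \<mu> t by simp
    fix s assume s: "s \<in> {0..T}"
    have "((\<lambda>u. v u - v' u) has_integral (x s - x' s) - (x 0 - x' 0)) {0..s}"
    proof (rule fundamental_theorem_of_calculus)
      fix u assume u: "u \<in> {0..s}"
      have "((\<lambda>s. x s - x' s) has_real_derivative v u - v' u) (at u within {0..})"
        by (intro DERIV_diff v(2) v'(2)) (use u in auto)
      then show "((\<lambda>s. x s - x' s) has_vector_derivative v u - v' u) (at u within {0..s})"
        unfolding has_real_derivative_iff_has_vector_derivative[symmetric]
        by (rule DERIV_subset) auto
    qed (use s in auto)
    then have hi: "((\<lambda>u. v u - v' u) has_integral (x s - x' s)) {0..s}" using v(4) v'(4) by simp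
    have i2: "((\<lambda>u. K / \<mu> * D u + (L * J s + 2 * e) / \<mu>) has_integral K / \<mu> * J s + s * ((L * J s + 2 * e) / \<mu>)) {0..s}"
      unfolding J_def using s has_integral_const_real[of "(L * integral {0..s} D + 2 * e) / \<mu>" 0 s]
      by (intro has_integral_add has_integral_mult_right integrable_integral iD) simp
    have "D s = \<bar>integral {0..s} (\<lambda>u. v u - v' u)\<bar>" using hi by (simp add: integral_unique D_def)
    also have "\<dots> \<le> integral {0..s} (\<lambda>u. K / \<mu> * D u + (L * J s + 2 * e) / \<mu>)"
    proof (rule abs_integral_le)
      fix u assume u: "u \<in> {0..s}"
      have "\<bar>v u - v' u\<bar> \<le> (K * D u + L * J u + 2 * e) / \<mu>" using vv[of u] u s by auto
      also have "\<dots> \<le> (K * D u + L * J s + 2 * e) / \<mu>"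
        using Jmono[of u s] u L \<mu> by (intro divide_right_mono add_mono mult_left_mono) auto
      finally show "\<bar>v u - v' u\<bar> \<le> K / \<mu> * D u + (L * J s + 2 * e) / \<mu>" by (simp add: add_divide_distrib)
    qed (use hi i2 in \<open>auto simp: has_integral_iff\<close>)
    also have "\<dots> = K / \<mu> * J s + s * ((L * J s + 2 * e) / \<mu>)" using i2 by (simp add: integral_unique)
    also have "\<dots> \<le> K / \<mu> * J s + T * ((L * J s + 2 * e) / \<mu>)"
    proof -
      have "0 \<le> J s" unfolding J_def by (rule Henstock_Kurzweil_Integration.integral_nonneg[OF iD]) (simp add: D_def)
      then show ?thesis using s L e0 \<mu> by (intro add_left_mono mult_right_mono) auto
    qed
    also have "\<dots> = 2 * T / \<mu> * e + (K + L * T) / \<mu> * integral {0..s} D"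
      using \<mu> by (simp add: J_def field_simps)
    finally show "D s \<le> 2 * T / \<mu> * e + (K + L * T) / \<mu> * integral {0..s} D" .
  qed
  also have "\<dots> \<le> (2 * T / \<mu> * e) * exp ((K + L * T) / \<mu> * T)"
    using t e0 L \<mu> by (intro mult_left_mono) (auto intro!: mult_left_mono divide_right_mono)
  finally show ?thesis by (simp add: D_def mult_ac)
qed

section \<open>The solution operator of the first order equation\<close>

locale drift =
  fixes m L B :: real and \<Lambda> b :: "real \<Rightarrow> real"
  assumes coercive: "coercive m \<Lambda>" and lipschitz: "L-lipschitz_on UNIV b" and bounded_by: "\<And>x. \<bar>b x\<bar> \<le> B"
begin

lemma continuous_drift: "continuous_on UNIV b"
  using lipschitz by (rule lipschitz_on_continuous_on)

lemma solves_flow: "continuous_on {0..} w \<Longrightarrow> solves \<Lambda> b q w (flow \<Lambda> b q w)"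
  unfolding flow_def by (rule someI_ex[OF solves_exists[OF coercive lipschitz bounded_by]])

lemma continuous_flow: "continuous_on {0..} w \<Longrightarrow> continuous_on {0..} (flow \<Lambda> b q w)"
  using solves_flow by (auto simp: solves_def)

text \<open>Causality: up to time \<open>T\<close> only the noise on [0,T] matters, so the flow may
  be fed with a path frozen after \<open>T\<close>.\<close>

lemma flow_eqI:
  assumes "solves \<Lambda> b q w X" "continuous_on {0..} w'" "\<And>t. t \<in> {0..T} \<Longrightarrow> w t = w' t" "t \<in> {0..T}"
  shows "flow \<Lambda> b q w' t = X t"
  using solves_unique[OF coercive continuous_drift lipschitz assms(1) solves_flow[OF assms(2)] assms(3,4)] by simp

lemma flow_lipschitz:
  assumes "continuous_on {0..} w" "continuous_on {0..} w'"
    and "\<And>t. t \<in> {0..T} \<Longrightarrow> \<bar>w t - w' t\<bar> \<le> e" "t \<in> {0..T}"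
  shows "\<bar>flow \<Lambda> b q w t - flow \<Lambda> b q' w' t\<bar> \<le> (e + \<bar>\<Lambda> q - \<Lambda> q'\<bar>) / m * exp (L / m * T)"
  by (rule solves_stability[OF coercive continuous_drift lipschitz solves_flow[OF assms(1)] solves_flow[OF assms(2)]])
     (use assms in auto)

lemma flow_start: "continuous_on {0..} w \<Longrightarrow> w 0 = 0 \<Longrightarrow> flow \<Lambda> b q w 0 = q"
  by (rule solves_start[OF coercive solves_flow])

lemma continuous_shift:
  fixes w :: "real \<Rightarrow> real"
  assumes "continuous_on {0..} w" "s \<ge> 0"
  shows "continuous_on {0..} (\<lambda>r. w (s + r) - w s)"
  by (intro continuous_intros continuous_on_compose2[OF assms(1)]) (use assms(2) in auto)

text \<open>Cocycle property, the deterministic source of the Markov property: after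
  \<open>s\<close> the flow restarts from its current position with the increments of the
  noise.\<close>

lemma flow_shift:
  assumes w: "continuous_on {0..} w" and "s \<ge> 0" "r \<ge> 0"
  shows "flow \<Lambda> b q w (s + r) = flow \<Lambda> b (flow \<Lambda> b q w s) (\<lambda>r. w (s + r) - w s) r"
  by (rule flow_eqI[symmetric, OF solves_shift[OF solves_flow[OF w] assms(2) continuous_drift]])
     (use assms continuous_shift in auto)

end

section \<open>Smoothing a path\<close>

definition mollify :: "(real \<Rightarrow> real) \<Rightarrow> (real \<Rightarrow> real) \<Rightarrow> real \<Rightarrow> real \<Rightarrow> real" where
  "mollify \<rho> w \<delta> t = 1 / \<delta> * (LBINT s:{0..}. w s * \<rho> ((s - t) / \<delta>))"

lemma smoothed_eq_mollify: "smoothed \<rho> W \<delta> t \<omega> = mollify \<rho> (\<lambda>s. W s \<omega>) \<delta> t"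
  by (simp add: smoothed_def mollify_def)

lemma continuous_abs_bounded:
  fixes f :: "real \<Rightarrow> real"
  assumes "continuous_on {a..c} f"
  shows "\<exists>K. \<forall>x\<in>{a..c}. \<bar>f x\<bar> \<le> K"
proof -
  have "bounded (f ` {a..c})" by (intro compact_imp_bounded compact_continuous_image assms) auto
  then show ?thesis by (metis bounded_iff imageI real_norm_def)
qed

lemma mollifier_facts:
  assumes "mollifier \<rho>"
  shows "(\<rho> has_real_derivative deriv \<rho> x) (at x)" "continuous_on S \<rho>" "continuous_on S (deriv \<rho>)"
    "x \<notin> {0..1} \<Longrightarrow> \<rho> x = 0" "integral {0..1} \<rho> = 1" "\<exists>R. \<forall>x. \<bar>\<rho> x\<bar> \<le> R"
proof -
  have 0: "\<rho> field_differentiable (at x)" for x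
    using assms unfolding mollifier_def by (metis funpow_0)
  have 1: "deriv \<rho> field_differentiable (at x)" for x
    using assms[unfolded mollifier_def, THEN conjunct1, rule_format, of 1 x] by simp
  show "(\<rho> has_real_derivative deriv \<rho> x) (at x)" using 0 by (simp add: DERIV_deriv_iff_field_differentiable)
  show c: "continuous_on S \<rho>" for S
    using 0 by (meson continuous_at_imp_continuous_on field_differentiable_imp_continuous_at)
  show "continuous_on S (deriv \<rho>)"
    using 1 by (meson continuous_at_imp_continuous_on field_differentiable_imp_continuous_at)
  show z: "\<rho> x = 0" if "x \<notin> {0..1}" for x using assms that by (auto simp: mollifier_def)
  have "(LBINT x=ereal 0..ereal 1. \<rho> x) = integral {0..1} \<rho>"
    by (rule interval_integral_eq_integral) (auto intro!: borel_integrable_atLeastAtMost' c)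
  then show "integral {0..1} \<rho> = 1"
    using assms by (simp add: mollifier_def zero_ereal_def one_ereal_def)
  obtain R where R: "\<And>x. x \<in> {0..1} \<Longrightarrow> \<bar>\<rho> x\<bar> \<le> R"
    using continuous_abs_bounded[OF c] by blast
  have "\<bar>\<rho> x\<bar> \<le> \<bar>R\<bar>" for x using R[of x] z[of x] by (cases "x \<in> {0..1}") auto
  then show "\<exists>R. \<forall>x. \<bar>\<rho> x\<bar> \<le> R" by blast
qed

lemma mollify_eq_average:
  assumes \<rho>: "mollifier \<rho>" and w: "continuous_on {0..} w" and \<delta>: "\<delta> > 0" and t: "t \<ge> 0"
  shows "mollify \<rho> w \<delta> t = integral {0..1} (\<lambda>r. w (t + \<delta> * r) * \<rho> r)"
proof -
  note \<rho> = mollifier_facts[OF \<rho>]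
  have cont: "continuous_on {0..1} (\<lambda>r. w (t + \<delta> * r) * \<rho> r)"
    by (intro continuous_intros \<rho>(2) continuous_on_compose2[OF w]) (use \<delta> t in auto)
  have "mollify \<rho> w \<delta> t = 1 / \<delta> * (LBINT s. indicator {0..} s * (w s * \<rho> ((s - t) / \<delta>)))"
    by (simp add: mollify_def set_lebesgue_integral_def)
  also have "\<dots> = 1 / \<delta> * (\<bar>\<delta>\<bar> *\<^sub>R (LBINT r. indicator {0..} (t + \<delta> * r) * (w (t + \<delta> * r) * \<rho> ((t + \<delta> * r - t) / \<delta>))))"
    by (subst lborel_integral_real_affine[of \<delta> _ t]) (use \<delta> in auto)
  also have "\<dots> = (LBINT r. indicator {0..1} r * (w (t + \<delta> * r) * \<rho> r))"
  proof -
    have "indicator {0..} (t + \<delta> * r) * (w (t + \<delta> * r) * \<rho> ((t + \<delta> * r - t) / \<delta>)) =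
      indicator {0..1} r * (w (t + \<delta> * r) * \<rho> r)" for r
      using \<delta> t \<rho>(4)[of r] by (auto simp: indicator_def)
    then show ?thesis using \<delta> by (simp only:) simp
  qed
  also have "\<dots> = (LBINT r:{0..1}. w (t + \<delta> * r) * \<rho> r)"
    by (simp add: set_lebesgue_integral_def)
  also have "\<dots> = integral {0..1} (\<lambda>r. w (t + \<delta> * r) * \<rho> r)"
    by (intro set_borel_integral_eq_integral borel_integrable_atLeastAtMost' cont)
  finally show ?thesis .
qed

text \<open>Total mass 1 lets the constant \<open>c\<close> pass under the average. As
  \<open>\<rho>\<close> may change sign, its mass does not bound the error, and the supremum
  \<open>R\<close> takes that place.\<close>

lemma mollify_close:
  assumes \<rho>: "mollifier \<rho>" and R: "\<And>x. \<bar>\<rho> x\<bar> \<le> R" and w: "continuous_on {0..} w" and \<delta>: "\<delta> > 0" and t: "t \<ge> 0"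
    and e: "\<And>s. s \<in> {t..t+\<delta>} \<Longrightarrow> \<bar>w s - c\<bar> \<le> e"
  shows "\<bar>mollify \<rho> w \<delta> t - c\<bar> \<le> R * e"
proof -
  note facts = mollifier_facts[OF \<rho>]
  have cont: "continuous_on {0..1} (\<lambda>r. w (t + \<delta> * r))"
    by (intro continuous_intros continuous_on_compose2[OF w]) (use \<delta> t in auto)
  have "c = integral {0..1} (\<lambda>r. c * \<rho> r)" by (simp add: facts(5))
  then have "mollify \<rho> w \<delta> t - c = integral {0..1} (\<lambda>r. w (t + \<delta> * r) * \<rho> r) - integral {0..1} (\<lambda>r. c * \<rho> r)"
    by (simp add: mollify_eq_average[OF \<rho> w \<delta> t])
  also have "\<dots> = integral {0..1} (\<lambda>r. (w (t + \<delta> * r) - c) * \<rho> r)"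
    by (subst Henstock_Kurzweil_Integration.integral_diff[symmetric])
       (auto intro!: integrable_continuous_real continuous_on_mult continuous_on_diff continuous_on_const cont facts(2) simp: left_diff_distrib)
  also have "\<bar>\<dots>\<bar> \<le> integral {0..1::real} (\<lambda>r. R * e)"
  proof (rule abs_integral_le)
    fix r :: real assume r: "r \<in> {0..1}"
    have "\<delta> * r \<le> \<delta>" using r \<delta> by (simp add: mult_left_le)
    then have "\<bar>w (t + \<delta> * r) - c\<bar> \<le> e" using r \<delta> by (intro e) auto
    then have "\<bar>w (t + \<delta> * r) - c\<bar> * \<bar>\<rho> r\<bar> \<le> e * R" using R[of r] by (intro mult_mono) auto
    then show "\<bar>(w (t + \<delta> * r) - c) * \<rho> r\<bar> \<le> R * e" by (simp add: abs_mult mult.commute)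
  qed (auto intro!: integrable_continuous_real continuous_intros cont facts(2))
  finally show ?thesis by simp
qed

lemma mollify_lipschitz:
  assumes \<rho>: "mollifier \<rho>" and R: "\<And>x. \<bar>\<rho> x\<bar> \<le> R" and w: "continuous_on {0..} w" "continuous_on {0..} w'"
    and \<delta>: "\<delta> > 0" and t: "t \<ge> 0" and e: "\<And>s. s \<in> {t..t+\<delta>} \<Longrightarrow> \<bar>w s - w' s\<bar> \<le> e"
  shows "\<bar>mollify \<rho> w \<delta> t - mollify \<rho> w' \<delta> t\<bar> \<le> R * e"
proof -
  note facts = mollifier_facts[OF \<rho>]
  have cont: "continuous_on {0..1} (\<lambda>r. w (t + \<delta> * r))" "continuous_on {0..1} (\<lambda>r. w' (t + \<delta> * r))"
    by (intro continuous_intros continuous_on_compose2[OF w(1)] continuous_on_compose2[OF w(2)]; use \<delta> t in auto)+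
  have "mollify \<rho> w \<delta> t - mollify \<rho> w' \<delta> t = integral {0..1} (\<lambda>r. (w (t + \<delta> * r) - w' (t + \<delta> * r)) * \<rho> r)"
    by (simp add: mollify_eq_average[OF \<rho> w(1) \<delta> t] mollify_eq_average[OF \<rho> w(2) \<delta> t],
        subst Henstock_Kurzweil_Integration.integral_diff[symmetric])
       (auto intro!: integrable_continuous_real continuous_on_mult continuous_on_diff continuous_on_const cont facts(2) simp: left_diff_distrib)
  also have "\<bar>\<dots>\<bar> \<le> integral {0..1::real} (\<lambda>r. R * e)"
  proof (rule abs_integral_le)
    fix r :: real assume r: "r \<in> {0..1}"
    have "\<delta> * r \<le> \<delta>" using r \<delta> by (simp add: mult_left_le)
    then have "\<bar>w (t + \<delta> * r) - w' (t + \<delta> * r)\<bar> \<le> e" using r \<delta> by (intro e) auto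
    then have "\<bar>w (t + \<delta> * r) - w' (t + \<delta> * r)\<bar> * \<bar>\<rho> r\<bar> \<le> e * R" using R[of r] by (intro mult_mono) auto
    then show "\<bar>(w (t + \<delta> * r) - w' (t + \<delta> * r)) * \<rho> r\<bar> \<le> R * e" by (simp add: abs_mult mult.commute)
  qed (auto intro!: integrable_continuous_real continuous_intros cont facts(2))
  finally show ?thesis by simp
qed

text \<open>The time derivative falls on the kernel. For times in the open set \<open>U\<close> the
  support of the kernel stays below \<open>R = T + 1 + \<delta>\<close>, so the integral runs over a
  fixed interval and the Leibniz rule applies. \<open>U\<close> extends below 0 to give a two-sided
  derivative at time 0, as \<open>deriv\<close> demands.\<close>

lemma mollify_differentiable:
  assumes \<rho>: "mollifier \<rho>" and w: "continuous_on {0..} w" and \<delta>: "\<delta> > 0" and T: "T \<ge> 0"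
  shows "\<exists>K. \<forall>t\<in>{0..T}. (mollify \<rho> w \<delta> has_real_derivative deriv (mollify \<rho> w \<delta>) t) (at t) \<and>
     \<bar>deriv (mollify \<rho> w \<delta>) t\<bar> \<le> K"
proof -
  note facts = mollifier_facts[OF \<rho>]
  define R where "R = T + 1 + \<delta>"
  define U where "U = {-1<..<T + 1}"
  have cw: "continuous_on {0..R} w" by (rule continuous_on_subset[OF w]) auto
  have c\<rho>: "continuous_on S (\<lambda>s. \<rho> (f s))" "continuous_on S (\<lambda>s. deriv \<rho> (f s))"
    if "continuous_on S f" for S and f :: "'z::topological_space \<Rightarrow> real"
    using that by (auto intro: continuous_on_compose2[OF facts(2)[of UNIV]] continuous_on_compose2[OF facts(3)[of UNIV]])
  have eq: "mollify \<rho> w \<delta> t = 1 / \<delta> * integral {0..R} (\<lambda>s. w s * \<rho> ((s - t) / \<delta>))" if t: "t \<in> U" for t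
  proof -
    have ind: "indicator {0..} s * (w s * \<rho> ((s - t) / \<delta>)) = indicator {0..R} s * (w s * \<rho> ((s - t) / \<delta>))" for s
    proof (cases "s \<in> {0..R}")
      case False
      then show ?thesis
        using \<delta> t facts(4)[of "(s - t) / \<delta>"] by (auto simp: indicator_def U_def R_def field_simps)
    qed auto
    have "mollify \<rho> w \<delta> t = 1 / \<delta> * (LBINT s:{0..R}. w s * \<rho> ((s - t) / \<delta>))"
      unfolding mollify_def set_lebesgue_integral_def by (simp add: ind)
    also have "(LBINT s:{0..R}. w s * \<rho> ((s - t) / \<delta>)) = integral {0..R} (\<lambda>s. w s * \<rho> ((s - t) / \<delta>))"
      using \<delta> by (intro set_borel_integral_eq_integral borel_integrable_atLeastAtMost' continuous_intros cw c\<rho>) auto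
    finally show ?thesis .
  qed
  define D where "D t = 1 / \<delta> * integral {0..R} (\<lambda>s. w s * (deriv \<rho> ((s - t) / \<delta>) * (- 1 / \<delta>)))" for t
  have d: "(mollify \<rho> w \<delta> has_real_derivative D t) (at t)" if t: "t \<in> U" for t
  proof -
    have "((\<lambda>t. integral (cbox 0 R) (\<lambda>s. w s * \<rho> ((s - t) / \<delta>))) has_real_derivative
       integral (cbox 0 R) (\<lambda>s. w s * (deriv \<rho> ((s - t) / \<delta>) * (- 1 / \<delta>)))) (at t within U)"
    proof (rule leibniz_rule_field_derivative)
      show "((\<lambda>t. w s * \<rho> ((s - t) / \<delta>)) has_real_derivative w s * (deriv \<rho> ((s - t) / \<delta>) * (- 1 / \<delta>))) (at t within U)"
        for s t
        by (rule DERIV_cmult, rule DERIV_chain2[OF facts(1)])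
           (use \<delta> in \<open>auto intro!: derivative_eq_intros\<close>)
      show "(\<lambda>s. w s * \<rho> ((s - t) / \<delta>)) integrable_on cbox 0 R" for t
        unfolding cbox_interval using \<delta> by (intro integrable_continuous_real continuous_intros cw c\<rho>) auto
      show "continuous_on (U \<times> cbox 0 R) (\<lambda>(t, s). w s * (deriv \<rho> ((s - t) / \<delta>) * (- 1 / \<delta>)))"
        unfolding case_prod_beta using \<delta>
        by (intro continuous_intros c\<rho> continuous_on_compose2[OF cw]) auto
    qed (use t in \<open>auto simp: U_def\<close>)
    then have "((\<lambda>t. 1 / \<delta> * integral {0..R} (\<lambda>s. w s * \<rho> ((s - t) / \<delta>))) has_real_derivative D t) (at t within U)"
      unfolding D_def cbox_interval by (rule DERIV_cmult)
    from has_field_derivative_transform_within[OF this, of 1 "mollify \<rho> w \<delta>"]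
    have "(mollify \<rho> w \<delta> has_real_derivative D t) (at t within U)"
      using t eq by simp
    then show ?thesis using t at_within_open[of t U] by (simp add: U_def)
  qed
  obtain Bw where Bw: "\<And>s. s \<in> {0..R} \<Longrightarrow> \<bar>w s\<bar> \<le> Bw"
    using continuous_abs_bounded[OF cw] by blast
  obtain Br where Br: "\<And>s. s \<in> {- T / \<delta>..R / \<delta>} \<Longrightarrow> \<bar>deriv \<rho> s\<bar> \<le> Br"
    using continuous_abs_bounded[OF facts(3)] by blast
  have R0: "R \<ge> 0" using T \<delta> by (simp add: R_def)
  have Db: "\<bar>D t\<bar> \<le> 1 / \<delta> * integral {0..R} (\<lambda>s. Bw * (Br * (1 / \<delta>)))" if t: "t \<in> {0..T}" for t
  proof -
    have "\<bar>integral {0..R} (\<lambda>s. w s * (deriv \<rho> ((s - t) / \<delta>) * (- 1 / \<delta>)))\<bar> \<le> integral {0..R} (\<lambda>s. Bw * (Br * (1 / \<delta>)))"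
    proof (rule abs_integral_le)
      show "(\<lambda>s. w s * (deriv \<rho> ((s - t) / \<delta>) * (- 1 / \<delta>))) integrable_on {0..R}"
        using \<delta> by (intro integrable_continuous_real continuous_intros cw c\<rho>) auto
      fix s assume s: "s \<in> {0..R}"
      have "(s - t) / \<delta> \<in> {- T / \<delta>..R / \<delta>}" using s t \<delta> unfolding atLeastAtMost_iff by (intro conjI divide_right_mono) auto
      then have "\<bar>w s\<bar> * (\<bar>deriv \<rho> ((s - t) / \<delta>)\<bar> * (1 / \<delta>)) \<le> Bw * (Br * (1 / \<delta>))"
        using Bw[OF s] Br \<delta> by (intro mult_mono) (auto intro: order_trans[OF abs_ge_zero])
      then show "\<bar>w s * (deriv \<rho> ((s - t) / \<delta>) * (- 1 / \<delta>))\<bar> \<le> Bw * (Br * (1 / \<delta>))"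
        using \<delta> by (simp add: abs_mult)
    qed auto
    then have "\<bar>1 / \<delta>\<bar> * \<bar>integral {0..R} (\<lambda>s. w s * (deriv \<rho> ((s - t) / \<delta>) * (- 1 / \<delta>)))\<bar>
        \<le> \<bar>1 / \<delta>\<bar> * integral {0..R} (\<lambda>s. Bw * (Br * (1 / \<delta>)))"
      by (rule mult_left_mono) simp
    also have "\<bar>1 / \<delta>\<bar> = 1 / \<delta>" using \<delta> by simp
    finally show ?thesis unfolding D_def abs_mult using \<delta> by simp
  qed
  show ?thesis
  proof (intro exI ballI conjI)
    fix t assume t: "t \<in> {0..T}"
    then have "t \<in> U" by (simp add: U_def)
    from d[OF this] have dd: "deriv (mollify \<rho> w \<delta>) t = D t" by (rule DERIV_imp_deriv)
    show "(mollify \<rho> w \<delta> has_real_derivative deriv (mollify \<rho> w \<delta>) t) (at t)"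
      using d[OF \<open>t \<in> U\<close>] by (simp add: dd)
    show "\<bar>deriv (mollify \<rho> w \<delta>) t\<bar> \<le> 1 / \<delta> * integral {0..R} (\<lambda>s. Bw * (Br * (1 / \<delta>)))"
      unfolding dd by (rule Db[OF t])
  qed
qed

lemma mollify_uniform_limit:
  assumes \<rho>: "mollifier \<rho>" and w: "continuous_on {0..} w" and T: "T \<ge> 0" and e: "e > 0"
  shows "\<exists>d>0. \<forall>\<delta>. 0 < \<delta> \<and> \<delta> < d \<longrightarrow> (\<forall>t\<in>{0..T}. \<bar>mollify \<rho> w \<delta> t - w t\<bar> \<le> e)"
proof -
  obtain R where R: "\<And>x. \<bar>\<rho> x\<bar> \<le> R" using mollifier_facts(6)[OF \<rho>] by blast
  have R0: "R \<ge> 0" using R[of 0] by linarith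
  \<comment> \<open>The average at \<open>t\<close> looks ahead to \<open>t + \<delta>\<close> with
    \<open>\<delta> < 1\<close>, hence the longer interval.\<close>
  have "uniformly_continuous_on {0..T+1} w"
    by (rule compact_uniformly_continuous) (auto intro: continuous_on_subset[OF w])
  moreover have "e / (R + 1) > 0" using e R0 by simp
  ultimately obtain d where d: "d > 0" "\<And>s t. s \<in> {0..T+1} \<Longrightarrow> t \<in> {0..T+1} \<Longrightarrow> dist s t < d \<Longrightarrow> dist (w s) (w t) < e / (R + 1)"
    unfolding uniformly_continuous_on_def by metis
  show ?thesis
  proof (intro exI[of _ "min d 1"] conjI allI impI ballI)
    fix \<delta> t assume \<delta>: "0 < \<delta> \<and> \<delta> < min d 1" and t: "t \<in> {0..T}"
    have "\<bar>mollify \<rho> w \<delta> t - w t\<bar> \<le> R * (e / (R + 1))"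
    proof (rule mollify_close[OF \<rho> R w])
      fix s assume s: "s \<in> {t..t + \<delta>}"
      then show "\<bar>w s - w t\<bar> \<le> e / (R + 1)" using d(2)[of s t] \<delta> t by (auto simp: dist_real_def)
    qed (use \<delta> t in auto)
    also have "\<dots> \<le> e" using R0 e by (simp add: field_simps)
    finally show "\<bar>mollify \<rho> w \<delta> t - w t\<bar> \<le> e" .
  qed (use d in auto)
qed

section \<open>Increments of the Wiener process\<close>

locale wiener =
  fixes M :: "'a measure" and W :: "real \<Rightarrow> 'a \<Rightarrow> real"
  assumes wiener: "wiener_process M W"
begin

sublocale prob_space M using wiener by (simp add: wiener_process_def)

definition noise :: "real \<Rightarrow> 'a \<Rightarrow> real \<Rightarrow> real" where
  "noise a \<omega> r = W (a + r) \<omega> - W a \<omega>"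

lemma measurable_W [measurable]: "0 \<le> t \<Longrightarrow> W t \<in> borel_measurable M"
  using wiener by (simp add: wiener_process_def)

lemma continuous_W: "\<omega> \<in> space M \<Longrightarrow> continuous_on {0..} (\<lambda>t. W t \<omega>)"
  using wiener by (simp add: wiener_process_def)

lemma AE_W_0: "AE \<omega> in M. W 0 \<omega> = 0"
  using wiener by (simp add: wiener_process_def)

lemma increment_distributed:
  "0 \<le> s \<Longrightarrow> s < t \<Longrightarrow> distributed M lborel (\<lambda>\<omega>. W t \<omega> - W s \<omega>) (\<lambda>x. ennreal (normal_density 0 (sqrt (t - s)) x))"
  using wiener by (simp add: wiener_process_def)

lemma increments_indep:
  fixes \<tau> :: "nat \<Rightarrow> real"
  assumes "0 \<le> \<tau> 0" "\<And>i. i < n \<Longrightarrow> \<tau> i < \<tau> (Suc i)"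
  shows "indep_vars (\<lambda>_. borel) (\<lambda>i \<omega>. W (\<tau> (Suc i)) \<omega> - W (\<tau> i) \<omega>) {..<n}"
  using wiener assms unfolding wiener_process_def by blast

lemma noise_0 [simp]: "noise a \<omega> 0 = 0"
  by (simp add: noise_def)

lemma measurable_noise [measurable]: "0 \<le> a \<Longrightarrow> 0 \<le> r \<Longrightarrow> (\<lambda>\<omega>. noise a \<omega> r) \<in> borel_measurable M"
  unfolding noise_def by measurable

lemma continuous_noise: "0 \<le> a \<Longrightarrow> \<omega> \<in> space M \<Longrightarrow> continuous_on {0..} (noise a \<omega>)"
  unfolding noise_def by (intro continuous_intros continuous_on_compose2[OF continuous_W]) auto

lemma continuous_noise': "0 \<le> a \<Longrightarrow> \<omega> \<in> space M \<Longrightarrow> continuous_on {0..t} (noise a \<omega>)"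
  by (rule continuous_on_subset[OF continuous_noise]) auto

lemma measurable_noise_path [measurable]:
  "0 \<le> a \<Longrightarrow> 0 \<le> t \<Longrightarrow> (\<lambda>\<omega>. path t (noise a \<omega>)) \<in> M \<rightarrow>\<^sub>M borel"
  by (rule borel_measurable_path) (auto intro: continuous_noise')

lemma path_noise_0: "0 \<le> a \<Longrightarrow> \<omega> \<in> space M \<Longrightarrow> path 0 (noise a \<omega>) = 0"
  by (rule bcontfun_eqI) (simp add: path_apply)

lemma interp_noise_tendsto:
  "0 \<le> a \<Longrightarrow> 0 < t \<Longrightarrow> \<omega> \<in> space M \<Longrightarrow> (\<lambda>n. interp t (Suc n) (noise a \<omega>)) \<longlonglongrightarrow> path t (noise a \<omega>)"
  by (rule interp_tendsto_path) (auto intro: continuous_noise')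

lemma expectation_interp_tendsto:
  fixes f :: "(real \<Rightarrow>\<^sub>C real) \<Rightarrow> real"
  assumes "continuous_on UNIV f" "bounded (range f)" "0 \<le> a" "0 < t"
  shows "(\<lambda>n. expectation (\<lambda>\<omega>. f (interp t (Suc n) (noise a \<omega>)))) \<longlonglongrightarrow> expectation (\<lambda>\<omega>. f (path t (noise a \<omega>)))"
proof -
  obtain B where B: "\<And>x. \<bar>f x\<bar> \<le> B" using assms(2) by (auto simp: bounded_iff)
  have [measurable]: "f \<in> borel_measurable borel" using assms(1) by (rule borel_measurable_continuous_onI)
  have [measurable]: "(\<lambda>\<omega>. interp t (Suc n) (noise a \<omega>)) \<in> M \<rightarrow>\<^sub>M borel" for n
    by (rule borel_measurable_interp) (use assms in auto)
  have [measurable]: "(\<lambda>\<omega>. path t (noise a \<omega>)) \<in> M \<rightarrow>\<^sub>M borel" using assms by simp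
  show ?thesis
  proof (rule integral_dominated_convergence[where w = "\<lambda>_. B"])
    show "AE \<omega> in M. (\<lambda>n. f (interp t (Suc n) (noise a \<omega>))) \<longlonglongrightarrow> f (path t (noise a \<omega>))"
      by (rule AE_I2, rule continuous_on_tendsto_compose[OF assms(1)])
         (use assms in \<open>auto intro: interp_noise_tendsto\<close>)
  qed (use B in auto)
qed

text \<open>The interpolations of \<open>noise a\<close> are assembled from independent normal
  increments whose joint law \<open>N n\<close> does not contain \<open>a\<close>. Refining the grid
  transfers stationarity to expectations of continuous functions of the path.\<close>

lemma noise_path_law:
  assumes a: "0 \<le> a" and t: "0 \<le> t"
  shows "distr M borel (\<lambda>\<omega>. path t (noise a \<omega>)) = distr M borel (\<lambda>\<omega>. path t (noise 0 \<omega>))"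
proof (rule measure_eqI_continuous)
  show "finite_measure (distr M borel (\<lambda>\<omega>. path t (noise a \<omega>)))" "finite_measure (distr M borel (\<lambda>\<omega>. path t (noise 0 \<omega>)))"
    using a t by (auto intro!: finite_measure_distr)
  fix f :: "(real \<Rightarrow>\<^sub>C real) \<Rightarrow> real" assume f: "continuous_on UNIV f" "bounded (range f)"
  have [measurable]: "f \<in> borel_measurable borel" using f(1) by (rule borel_measurable_continuous_onI)
  have "expectation (\<lambda>\<omega>. f (path t (noise a \<omega>))) = expectation (\<lambda>\<omega>. f (path t (noise 0 \<omega>)))"
  proof (cases "t = 0")
    case True
    then show ?thesis using a by (auto intro!: Bochner_Integration.integral_cong simp: path_noise_0)
  next
    case False
    then have t0: "t > 0" using t by simp
    define N where "N n = Pi\<^sub>M {..<Suc n} (\<lambda>_. density lborel (\<lambda>x. ennreal (normal_density 0 (sqrt (t / Suc n)) x)))" for n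
    have E: "expectation (\<lambda>\<omega>. f (interp t (Suc n) (noise a \<omega>))) = (\<integral>c. f (ramp_sum t (Suc n) 0 c) \<partial>N n)" if a: "0 \<le> a" for a n
    proof -
      define m where "m = Suc n"
      define \<tau> where "\<tau> i = a + t * i / m" for i :: nat
      define \<xi> where "\<xi> i \<omega> = W (\<tau> (Suc i)) \<omega> - W (\<tau> i) \<omega>" for i \<omega>
      have \<tau>0: "0 \<le> \<tau> i" for i using a t by (simp add: \<tau>_def)
      have \<tau>S: "\<tau> (Suc i) - \<tau> i = t / m" for i by (simp add: \<tau>_def add_divide_distrib algebra_simps)
      have \<tau>lt: "\<tau> i < \<tau> (Suc i)" for i using \<tau>S[of i] divide_pos_pos[OF t0, of m] by (simp add: m_def)
      have ind: "indep_vars (\<lambda>_. borel) \<xi> {..<m}"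
        unfolding \<xi>_def using increments_indep[of \<tau> m] \<tau>0 \<tau>lt by auto
      have \<xi>m: "\<xi> i \<in> borel_measurable M" for i unfolding \<xi>_def using \<tau>0 by measurable
      have law: "distr M borel (\<xi> i) = density lborel (\<lambda>x. ennreal (normal_density 0 (sqrt (t / m)) x))" for i
        using increment_distributed[OF \<tau>0 \<tau>lt, of i] unfolding \<xi>_def distributed_def \<tau>S
        by (simp cong: distr_cong)
      have "distr M (Pi\<^sub>M {..<m} (\<lambda>_. borel)) (\<lambda>\<omega>. \<lambda>i\<in>{..<m}. \<xi> i \<omega>) = Pi\<^sub>M {..<m} (\<lambda>i. distr M borel (\<xi> i))"
        using ind \<xi>m by (subst (asm) indep_vars_iff_distr_eq_PiM) (auto simp: m_def)
      then have D: "distr M (Pi\<^sub>M {..<m} (\<lambda>_. borel)) (\<lambda>\<omega>. \<lambda>i\<in>{..<m}. \<xi> i \<omega>) = N n"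
        by (simp add: law N_def m_def)
      have mm: "(\<lambda>c. f (ramp_sum t m 0 c)) \<in> borel_measurable (Pi\<^sub>M {..<m} (\<lambda>_. borel))"
        by (rule measurable_compose[where g = f and N = borel], rule borel_measurable_ramp_sum) auto
      have "(\<integral>c. f (ramp_sum t m 0 c) \<partial>N n) = expectation (\<lambda>\<omega>. f (ramp_sum t m 0 (\<lambda>i\<in>{..<m}. \<xi> i \<omega>)))"
        unfolding D[symmetric]
        by (rule integral_distr[OF _ mm]) (use \<xi>m in \<open>auto intro!: measurable_restrict\<close>)
      also have "\<dots> = expectation (\<lambda>\<omega>. f (interp t m (noise a \<omega>)))"
        by (rule Bochner_Integration.integral_cong)
           (auto simp: interp_def ramp_sum_def noise_def \<xi>_def \<tau>_def intro!: arg_cong[where f = f])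
      finally show ?thesis by (simp add: m_def)
    qed
    have "(\<lambda>n. expectation (\<lambda>\<omega>. f (interp t (Suc n) (noise a \<omega>)))) = (\<lambda>n. expectation (\<lambda>\<omega>. f (interp t (Suc n) (noise 0 \<omega>))))"
      using E[OF a] E[of 0] by auto
    then show ?thesis
      using expectation_interp_tendsto[OF f a t0] expectation_interp_tendsto[OF f order_refl t0] LIMSEQ_unique by metis
  qed
  then show "(\<integral>x. f x \<partial>distr M borel (\<lambda>\<omega>. path t (noise a \<omega>))) = (\<integral>x. f x \<partial>distr M borel (\<lambda>\<omega>. path t (noise 0 \<omega>)))"
    using a t by (simp add: integral_distr)
qed auto

lemma noise_paths_indep:
  assumes a: "0 \<le> a" and t: "0 \<le> t"
  shows "indep_var borel (\<lambda>\<omega>. path a (noise 0 \<omega>)) borel (\<lambda>\<omega>. path t (noise a \<omega>))"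
proof (rule indep_varI_continuous)
  fix f g :: "(real \<Rightarrow>\<^sub>C real) \<Rightarrow> real"
  assume f: "continuous_on UNIV f" "bounded (range f)" and g: "continuous_on UNIV g" "bounded (range g)"
  have [measurable]: "f \<in> borel_measurable borel" "g \<in> borel_measurable borel"
    using f(1) g(1) by (auto intro: borel_measurable_continuous_onI)
  obtain Bf Bg where B: "\<And>x. \<bar>f x\<bar> \<le> Bf" "\<And>x. \<bar>g x\<bar> \<le> Bg" using f(2) g(2) by (auto simp: bounded_iff)
  consider "a = 0" | "t = 0" | "0 < a" "0 < t" using a t by linarith
  then show "expectation (\<lambda>\<omega>. f (path a (noise 0 \<omega>)) * g (path t (noise a \<omega>))) =
    expectation (\<lambda>\<omega>. f (path a (noise 0 \<omega>))) * expectation (\<lambda>\<omega>. g (path t (noise a \<omega>)))"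
  proof cases
    case 1
    have "expectation (\<lambda>\<omega>. f (path a (noise 0 \<omega>)) * g (path t (noise a \<omega>))) = expectation (\<lambda>\<omega>. f 0 * g (path t (noise a \<omega>)))"
      "expectation (\<lambda>\<omega>. f (path a (noise 0 \<omega>))) = expectation (\<lambda>\<omega>. f 0)"
      unfolding 1 by (rule Bochner_Integration.integral_cong[OF refl], simp add: path_noise_0)+
    then show ?thesis by (simp add: prob_space)
  next
    case 2
    have "expectation (\<lambda>\<omega>. f (path a (noise 0 \<omega>)) * g (path t (noise a \<omega>))) = expectation (\<lambda>\<omega>. f (path a (noise 0 \<omega>)) * g 0)"
      "expectation (\<lambda>\<omega>. g (path t (noise a \<omega>))) = expectation (\<lambda>\<omega>. g 0)"
      unfolding 2 by (rule Bochner_Integration.integral_cong[OF refl], simp add: a path_noise_0)+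
    then show ?thesis by (simp add: prob_space)
  next
    case 3
    have E: "expectation (\<lambda>\<omega>. f (interp a (Suc n) (noise 0 \<omega>)) * g (interp t (Suc n) (noise a \<omega>))) =
        expectation (\<lambda>\<omega>. f (interp a (Suc n) (noise 0 \<omega>))) * expectation (\<lambda>\<omega>. g (interp t (Suc n) (noise a \<omega>)))" for n
    proof -
      define m where "m = Suc n"
      \<comment> \<open>A single grid serves both stretches, with \<open>m\<close> steps on
        \<open>[0,a]\<close> followed by \<open>m\<close> steps on \<open>[a,a+t]\<close>; the two
        interpolations then depend on disjoint blocks of independent increments. Strict growth of
        the grid requires \<open>a\<close> and \<open>t\<close> to be positive, which is why the
        degenerate cases were split off.\<close>
      define \<tau> where "\<tau> i = (if i \<le> m then a * i / m else a + t * (i - m) / m)" for i :: nat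
      define \<xi> where "\<xi> i \<omega> = W (\<tau> (Suc i)) \<omega> - W (\<tau> i) \<omega>" for i \<omega>
      have m0: "m > 0" by (simp add: m_def)
      have \<tau>0: "0 \<le> \<tau> i" for i using a t by (simp add: \<tau>_def)
      have \<tau>m: "\<tau> (m + i) = a + t * i / m" for i using m0 by (cases i) (auto simp: \<tau>_def)
      have \<tau>lt: "\<tau> i < \<tau> (Suc i)" for i
      proof (cases "i < m")
        case True
        then show ?thesis using 3 m0 by (auto simp: \<tau>_def intro!: divide_strict_right_mono)
      next
        case False
        then obtain j where "i = m + j" by (metis le_add_diff_inverse not_less)
        then show ?thesis using \<tau>m[of j] \<tau>m[of "Suc j"] 3 m0 by (simp add: divide_strict_right_mono)
      qed
      have ind: "indep_vars (\<lambda>_. borel) \<xi> {..<2 * m}"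
        unfolding \<xi>_def using increments_indep[of \<tau> "2 * m"] \<tau>0 \<tau>lt by auto
      have \<xi>m: "\<xi> i \<in> borel_measurable M" for i unfolding \<xi>_def using \<tau>0 by measurable
      let ?F = "\<lambda>c. f (ramp_sum a m 0 c)"
      let ?G = "\<lambda>c. g (ramp_sum t m 0 (\<lambda>i. c (m + i)))"
      have F: "?F \<in> borel_measurable (Pi\<^sub>M {..<m} (\<lambda>_. borel))"
        by (rule measurable_compose[where g = f and N = borel], rule borel_measurable_ramp_sum) auto
      have G: "?G \<in> borel_measurable (Pi\<^sub>M {m..<2*m} (\<lambda>_. borel))"
        by (rule measurable_compose[where g = g and N = borel], rule borel_measurable_ramp_sum) auto
      have iv: "indep_var borel (?F \<circ> (\<lambda>\<omega>. \<lambda>i\<in>{..<m}. \<xi> i \<omega>)) borel (?G \<circ> (\<lambda>\<omega>. \<lambda>i\<in>{m..<2*m}. \<xi> i \<omega>))"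
        by (rule indep_var_compose[OF indep_var_restrict[OF ind] F G]) auto
      have eqF: "?F \<circ> (\<lambda>\<omega>. \<lambda>i\<in>{..<m}. \<xi> i \<omega>) = (\<lambda>\<omega>. f (interp a m (noise 0 \<omega>)))"
        by (auto simp: fun_eq_iff interp_def ramp_sum_def noise_def \<xi>_def \<tau>_def intro!: arg_cong[where f = f] sum.cong)
      have eqG: "?G \<circ> (\<lambda>\<omega>. \<lambda>i\<in>{m..<2*m}. \<xi> i \<omega>) = (\<lambda>\<omega>. g (interp t m (noise a \<omega>)))"
        by (auto simp: fun_eq_iff interp_def ramp_sum_def noise_def \<xi>_def \<tau>m add_Suc_right[symmetric] simp del: add_Suc_right
            intro!: arg_cong[where f = g] sum.cong)
      have mF: "?F \<circ> (\<lambda>\<omega>. \<lambda>i\<in>{..<m}. \<xi> i \<omega>) \<in> borel_measurable M"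
        by (rule measurable_comp[OF _ F]) (auto intro!: measurable_restrict \<xi>m)
      have mG: "?G \<circ> (\<lambda>\<omega>. \<lambda>i\<in>{m..<2*m}. \<xi> i \<omega>) \<in> borel_measurable M"
        by (rule measurable_comp[OF _ G]) (auto intro!: measurable_restrict \<xi>m)
      have "integrable M (?F \<circ> (\<lambda>\<omega>. \<lambda>i\<in>{..<m}. \<xi> i \<omega>))"
        by (rule integrable_const_bound[where B = Bf]) (use B mF in auto)
      moreover have "integrable M (?G \<circ> (\<lambda>\<omega>. \<lambda>i\<in>{m..<2*m}. \<xi> i \<omega>))"
        by (rule integrable_const_bound[where B = Bg]) (use B mG in auto)
      ultimately show ?thesis
        using indep_var_lebesgue_integral[OF iv] unfolding m_def[symmetric] eqF eqG by blast
    qed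
    have [measurable]: "(\<lambda>\<omega>. interp t (Suc n) (noise a \<omega>)) \<in> M \<rightarrow>\<^sub>M borel" for n
      by (rule borel_measurable_interp) (use a t in auto)
    have [measurable]: "(\<lambda>\<omega>. interp a (Suc n) (noise 0 \<omega>)) \<in> M \<rightarrow>\<^sub>M borel" for n
      by (rule borel_measurable_interp) (use a t in auto)
    have [measurable]: "(\<lambda>\<omega>. path t (noise a \<omega>)) \<in> M \<rightarrow>\<^sub>M borel" "(\<lambda>\<omega>. path a (noise 0 \<omega>)) \<in> M \<rightarrow>\<^sub>M borel"
      using a t by auto
    have "(\<lambda>n. expectation (\<lambda>\<omega>. f (interp a (Suc n) (noise 0 \<omega>)) * g (interp t (Suc n) (noise a \<omega>))))
       \<longlonglongrightarrow> expectation (\<lambda>\<omega>. f (path a (noise 0 \<omega>)) * g (path t (noise a \<omega>)))"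
    proof (rule integral_dominated_convergence[where w = "\<lambda>_. Bf * Bg"])
      show "AE \<omega> in M. (\<lambda>n. f (interp a (Suc n) (noise 0 \<omega>)) * g (interp t (Suc n) (noise a \<omega>)))
          \<longlonglongrightarrow> f (path a (noise 0 \<omega>)) * g (path t (noise a \<omega>))"
        by (rule AE_I2, intro tendsto_mult continuous_on_tendsto_compose[OF f(1)] continuous_on_tendsto_compose[OF g(1)])
           (use a 3 in \<open>auto intro: interp_noise_tendsto\<close>)
      show "AE \<omega> in M. norm (f (interp a (Suc n) (noise 0 \<omega>)) * g (interp t (Suc n) (noise a \<omega>))) \<le> Bf * Bg" for n
        using B by (auto simp: abs_mult intro!: mult_mono order_trans[OF abs_ge_zero B(1)])
    qed auto
    moreover have "(\<lambda>n. expectation (\<lambda>\<omega>. f (interp a (Suc n) (noise 0 \<omega>))) * expectation (\<lambda>\<omega>. g (interp t (Suc n) (noise a \<omega>))))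
       \<longlonglongrightarrow> expectation (\<lambda>\<omega>. f (path a (noise 0 \<omega>))) * expectation (\<lambda>\<omega>. g (path t (noise a \<omega>)))"
      using 3 a by (intro tendsto_mult expectation_interp_tendsto f g) auto
    ultimately show ?thesis
      using LIMSEQ_unique E by (simp add: E)
  qed
qed (use a t in auto)

lemma noise_moments:
  assumes t: "t > 0"
  shows "has_bochner_integral M (\<lambda>\<omega>. (noise 0 \<omega> t)\<^sup>2) t" "has_bochner_integral M (\<lambda>\<omega>. (noise 0 \<omega> t) ^ 4) (3 * t\<^sup>2)"
proof -
  have d: "distributed M lborel (\<lambda>\<omega>. noise 0 \<omega> t) (\<lambda>x. ennreal (normal_density 0 (sqrt t) x))"
    using increment_distributed[of 0 t] t by (simp add: noise_def)
  have *: "has_bochner_integral M (\<lambda>\<omega>. noise 0 \<omega> t ^ (2 * k)) (fact (2 * k) / ((2 / t) ^ k * fact k))" for k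
  proof -
    have "has_bochner_integral lborel (\<lambda>x. normal_density 0 (sqrt t) x * (x - 0) ^ (2 * k))
       (fact (2 * k) / ((2 / (sqrt t)\<^sup>2) ^ k * fact k))"
      by (rule normal_moment_even) (use t in simp)
    then have h: "has_bochner_integral lborel (\<lambda>x. normal_density 0 (sqrt t) x * x ^ (2 * k))
       (fact (2 * k) / ((2 / t) ^ k * fact k))" using t by simp
    have "integrable M (\<lambda>\<omega>. noise 0 \<omega> t ^ (2 * k))"
      using distributed_integrable[OF d, of "\<lambda>x. x ^ (2 * k)"] h by (auto simp: has_bochner_integral_iff)
    moreover have "expectation (\<lambda>\<omega>. noise 0 \<omega> t ^ (2 * k)) = fact (2 * k) / ((2 / t) ^ k * fact k)"
      using distributed_integral[OF d, of "\<lambda>x. x ^ (2 * k)"] h by (auto simp: has_bochner_integral_iff)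
    ultimately show ?thesis by (simp add: has_bochner_integral_iff)
  qed
  have "fact (2 * 1) / ((2 / t) ^ 1 * fact 1) = t" using t by (simp add: fact_numeral)
  then show "has_bochner_integral M (\<lambda>\<omega>. (noise 0 \<omega> t)\<^sup>2) t" using *[of 1] by simp
  have "fact (2 * 2) / ((2 / t) ^ 2 * fact 2) = 3 * t\<^sup>2" using t by (simp add: fact_numeral power2_eq_square field_simps)
  then show "has_bochner_integral M (\<lambda>\<omega>. (noise 0 \<omega> t) ^ 4) (3 * t\<^sup>2)" using *[of 2] by simp
qed

end

text \<open>The existence claim asks for a process on some measure on \<^typ>\<open>real \<Rightarrow> real\<close>, so the noise is moved
  from the abstract sample space to such a measure.\<close>

definition canonical_space :: "'a measure \<Rightarrow> (real \<Rightarrow> 'a \<Rightarrow> real) \<Rightarrow> (real \<Rightarrow> real) measure" where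
  "canonical_space M W = distr M (restrict_space (Pi\<^sub>M UNIV (\<lambda>_. borel)) ((\<lambda>\<omega> t. W (max 0 t) \<omega>) ` space M)) (\<lambda>\<omega> t. W (max 0 t) \<omega>)"

text \<open>The coordinate space is cut down to the actual sample paths because continuity is
  required at every point, while the continuous functions do not form a measurable set of the full
  product. \<open>max 0 t\<close> extends paths constantly to negative times, where measurability of
  \<open>W t\<close> is unknown.\<close>

lemma wiener_canonical:
  assumes "wiener_process M W"
  shows "wiener_process (canonical_space M W) (\<lambda>t f. f t)"
proof -
  interpret wiener M W by standard fact
  let ?p = "\<lambda>\<omega> t. W (max 0 t) \<omega>"
  let ?R = "restrict_space (Pi\<^sub>M UNIV (\<lambda>_. borel)) (?p ` space M) :: (real \<Rightarrow> real) measure"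
  let ?N = "canonical_space M W"
  have p: "?p \<in> M \<rightarrow>\<^sub>M ?R"
    by (rule measurable_restrict_space2) (auto intro!: measurable_PiM_single' measurable_W)
  interpret N: prob_space ?N unfolding canonical_space_def by (rule prob_space_distr[OF p])
  have spN: "space ?N = ?p ` space M"
    by (simp add: canonical_space_def space_restrict_space space_PiM)
  have coord: "(\<lambda>f. f t) \<in> borel_measurable ?R" for t
    by (rule measurable_restrict_space1) (rule measurable_component_singleton; simp)
  then have coordN: "(\<lambda>f. f t) \<in> borel_measurable ?N" for t
    by (simp add: canonical_space_def)
  \<comment> \<open>Any finite family of increments has the same joint law under both measures. The
    map \<open>g\<close> lets the law of one increment be read off from a family with a single
    index.\<close>
  have law: "distr ?N K (\<lambda>f. g (\<lambda>i\<in>I. f (s i) - f (r i))) = distr M K (\<lambda>\<omega>. g (\<lambda>i\<in>I. W (s i) \<omega> - W (r i) \<omega>))"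
    if "\<And>i. i \<in> I \<Longrightarrow> 0 \<le> s i" "\<And>i. i \<in> I \<Longrightarrow> 0 \<le> r i" "g \<in> Pi\<^sub>M I (\<lambda>_. borel) \<rightarrow>\<^sub>M K" for K :: "'b measure" and g and s r :: "nat \<Rightarrow> real" and I
  proof -
    have "(\<lambda>f. g (\<lambda>i\<in>I. f (s i) - f (r i))) \<in> ?R \<rightarrow>\<^sub>M K"
      by (rule measurable_compose[OF _ that(3)]) (intro measurable_restrict borel_measurable_diff coord)
    then have "distr ?N K (\<lambda>f. g (\<lambda>i\<in>I. f (s i) - f (r i))) = distr M K ((\<lambda>f. g (\<lambda>i\<in>I. f (s i) - f (r i))) \<circ> ?p)"
      unfolding canonical_space_def by (rule distr_distr[OF _ p])
    also have "((\<lambda>f. g (\<lambda>i\<in>I. f (s i) - f (r i))) \<circ> ?p) = (\<lambda>\<omega>. g (\<lambda>i\<in>I. W (s i) \<omega> - W (r i) \<omega>))"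
      using that(1,2) by (auto simp: fun_eq_iff restrict_def intro!: arg_cong[where f = g])
    finally show ?thesis .
  qed
  have law1: "distr ?N K (\<lambda>f. f s - f r) = distr M K (\<lambda>\<omega>. W s \<omega> - W r \<omega>)"
    if "0 \<le> s" "0 \<le> r" "sets K = sets borel" for K :: "real measure" and s r
  proof -
    have "(\<lambda>c. c (0::nat)) \<in> Pi\<^sub>M {0} (\<lambda>_. borel) \<rightarrow>\<^sub>M K"
      using measurable_component_singleton[of 0 "{0::nat}" "\<lambda>_. borel :: real measure"] measurable_cong_sets[OF refl that(3)] by blast
    from law[of "{0}" "\<lambda>_. s" "\<lambda>_. r", OF _ _ this] show ?thesis using that by simp
  qed
  show ?thesis
    unfolding wiener_process_def
  proof (intro conjI allI impI ballI)
    show "prob_space ?N" by (rule N.prob_space_axioms)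
    show "(\<lambda>f. f t) \<in> borel_measurable ?N" for t by (rule coordN)
    have "{f \<in> space ?R. f 0 = 0} \<in> sets ?R" using coord[of 0] by measurable
    then show "AE f in ?N. f 0 = 0"
      unfolding canonical_space_def using AE_W_0 by (subst AE_distr_iff[OF p]) auto
    show "continuous_on {0..} (\<lambda>t. f t)" if "f \<in> space ?N" for f
    proof -
      obtain \<omega> where "\<omega> \<in> space M" "f = ?p \<omega>" using \<open>f \<in> space ?N\<close> spN by auto
      then show ?thesis using continuous_W[of \<omega>] by (auto intro: continuous_on_eq)
    qed
    show "distributed ?N lborel (\<lambda>f. f t - f s) (\<lambda>x. ennreal (normal_density 0 (sqrt (t - s)) x))"
      if "0 \<le> s" "s < t" for s t
      using increment_distributed[OF that] that law1[of t s lborel] coordN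
      by (auto simp: distributed_def)
    fix \<tau> :: "nat \<Rightarrow> real" and n assume \<tau>: "0 \<le> \<tau> 0" "\<forall>i<n. \<tau> i < \<tau> (Suc i)"
    have \<tau>0: "0 \<le> \<tau> i" if "i \<le> n" for i
      using that by (induction i) (use \<tau> in \<open>auto simp: Suc_le_eq intro: order_trans less_imp_le\<close>)
    show "prob_space.indep_vars ?N (\<lambda>_. borel) (\<lambda>i f. f (\<tau> (Suc i)) - f (\<tau> i)) {..<n}"
    proof (cases "n = 0")
      case True
      then show ?thesis by (simp add: N.indep_vars_def N.indep_sets_def)
    next
      case False
      have A: "indep_vars (\<lambda>_. borel) (\<lambda>i \<omega>. W (\<tau> (Suc i)) \<omega> - W (\<tau> i) \<omega>) {..<n}"
        using \<tau> by (intro increments_indep) auto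
      have "distr ?N (Pi\<^sub>M {..<n} (\<lambda>_. borel)) (\<lambda>f. \<lambda>i\<in>{..<n}. f (\<tau> (Suc i)) - f (\<tau> i)) =
        distr M (Pi\<^sub>M {..<n} (\<lambda>_. borel)) (\<lambda>\<omega>. \<lambda>i\<in>{..<n}. W (\<tau> (Suc i)) \<omega> - W (\<tau> i) \<omega>)"
        using law[of "{..<n}" "\<lambda>i. \<tau> (Suc i)" \<tau> "\<lambda>c. c"] \<tau>0 by auto
      also have "\<dots> = Pi\<^sub>M {..<n} (\<lambda>i. distr M borel (\<lambda>\<omega>. W (\<tau> (Suc i)) \<omega> - W (\<tau> i) \<omega>))"
        using A False \<tau>0 by (subst (asm) indep_vars_iff_distr_eq_PiM') auto
      also have "\<dots> = Pi\<^sub>M {..<n} (\<lambda>i. distr ?N borel (\<lambda>f. f (\<tau> (Suc i)) - f (\<tau> i)))"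
        using \<tau>0 by (intro PiM_cong refl law1[symmetric]) auto
      finally show ?thesis
        using False coordN by (subst N.indep_vars_iff_distr_eq_PiM') auto
    qed
  qed
qed

section \<open>The generator in the natural scale of the limit\<close>

text \<open>Chosen as an antiderivative on the whole line instead of an integral from 0, so that no
  orientation has to be tracked at negative points.\<close>

definition antider :: "(real \<Rightarrow> real) \<Rightarrow> real \<Rightarrow> real" where
  "antider f = (SOME F. F 0 = 0 \<and> (\<forall>x. (F has_real_derivative f x) (at x)))"

lemma antider:
  assumes "continuous_on UNIV f"
  shows "antider f 0 = 0" "(antider f has_real_derivative f x) (at x)"
proof -
  have "\<exists>F. \<forall>x :: real. - \<infinity> < ereal x \<longrightarrow> ereal x < \<infinity> \<longrightarrow> (F has_vector_derivative f x) (at x)"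
    by (rule einterval_antiderivative) (use assms in \<open>auto simp: continuous_on_eq_continuous_at\<close>)
  then obtain F where F: "\<And>x. (F has_real_derivative f x) (at x)"
    by (auto simp: has_real_derivative_iff_has_vector_derivative)
  have "\<exists>F. F 0 = 0 \<and> (\<forall>x. (F has_real_derivative f x) (at x))"
    by (rule exI[of _ "\<lambda>x. F x - F 0"]) (auto intro!: derivative_eq_intros F)
  from someI_ex[OF this] show "antider f 0 = 0" "(antider f has_real_derivative f x) (at x)"
    by (auto simp: antider_def)
qed

lemma deriv_wrt_eq: "has_deriv_wrt u f d q \<Longrightarrow> deriv_wrt u f q = d"
  unfolding has_deriv_wrt_def deriv_wrt_def by (rule tendsto_Lim) auto

locale two_media =
  fixes b :: "real \<Rightarrow> real" and l1 l2 L B :: real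
  assumes l1: "l1 > 0" and l2: "l2 > 0" and lip_b: "L-lipschitz_on UNIV b" and bounded_b: "\<And>x. \<bar>b x\<bar> \<le> B"
begin

text \<open>The integral of \<open>lam_hat\<close> from 0 to \<open>q\<close>, evaluated; the
  interface survives only as a change of slope at 0.\<close>

definition scale :: "real \<Rightarrow> real" where
  "scale q = (if q \<le> 0 then l1 * q else l2 * q)"

definition unscale :: "real \<Rightarrow> real" where
  "unscale z = (if z \<le> 0 then z / l1 else z / l2)"

lemma scale_unscale [simp]: "scale (unscale z) = z"
  using l1 l2 by (auto simp: scale_def unscale_def divide_le_0_iff)

lemma unscale_scale [simp]: "unscale (scale q) = q"
  using l1 l2 by (auto simp: scale_def unscale_def mult_le_0_iff zero_less_mult_iff not_le)

lemma scale_0 [simp]: "scale 0 = 0"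
  by (simp add: scale_def)

lemma inj_scale: "scale x = scale y \<longleftrightarrow> x = y"
  by (metis unscale_scale)

lemma coercive_scale: "coercive (min l1 l2) scale"
  unfolding coercive_def
proof (intro conjI allI)
  show "0 < min l1 l2" using l1 l2 by simp
  have *: "min l1 l2 * (y - x) \<le> scale y - scale x" if "x \<le> y" for x y
  proof -
    consider "y \<le> 0" | "x \<le> 0" "0 < y" | "0 < x" using that by linarith
    then show ?thesis
    proof cases
      case 1
      have "min l1 l2 * (y - x) \<le> l1 * (y - x)" using that by (intro mult_right_mono) auto
      then show ?thesis using 1 that by (simp add: scale_def algebra_simps)
    next
      case 2
      have "min l1 l2 * y \<le> l2 * y" "min l1 l2 * (- x) \<le> l1 * (- x)" using 2 by (intro mult_right_mono; simp)+
      moreover have "scale y = l2 * y" "scale x = l1 * x" using 2 by (auto simp: scale_def)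
      moreover have "min l1 l2 * (y - x) = min l1 l2 * y + min l1 l2 * (- x)" by (simp add: algebra_simps)
      ultimately show ?thesis by linarith
    next
      case 3
      have "min l1 l2 * (y - x) \<le> l2 * (y - x)" using that by (intro mult_right_mono) auto
      then show ?thesis using 3 that by (simp add: scale_def algebra_simps)
    qed
  qed
  show "min l1 l2 * \<bar>x - y\<bar> \<le> \<bar>scale x - scale y\<bar>" for x y
    using *[of x y] *[of y x] by (cases "x \<le> y") auto
  show "continuous_on UNIV scale"
    unfolding scale_def by (rule continuous_on_cases_le) (auto intro!: continuous_intros)
  show "surj scale" by (metis surjI scale_unscale)
qed

sublocale drift "min l1 l2" L B scale b
  by standard (rule coercive_scale lip_b bounded_b)+

lemma continuous_scale: "continuous_on S scale"
  using coercive_scale by (auto simp: coercive_def intro: continuous_on_subset)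

lemma inv_scale: "inv scale = unscale"
  by (rule inv_equality) auto

lemma continuous_unscale: "continuous_on S unscale"
  using coercive_inv(4)[OF coercive_scale] by (auto simp: inv_scale intro: continuous_on_subset)

definition bz :: "real \<Rightarrow> real" where "bz z = b (unscale z)"

definition \<beta> :: "real \<Rightarrow> real" where "\<beta> = antider bz"

text \<open>Natural scale of \<open>F'' / 2 + bz F'\<close>, with speed function
  \<open>2 * V\<close>: dividing the derivative of \<open>F' * exp (2 * \<beta>)\<close> by
  \<open>2 * exp (2 * \<beta>)\<close> gives that operator back.\<close>

definition U :: "real \<Rightarrow> real" where "U = antider (\<lambda>z. exp (- 2 * \<beta> z))"

definition V :: "real \<Rightarrow> real" where "V = antider (\<lambda>z. exp (2 * \<beta> z))"

lemma continuous_bz: "continuous_on S bz"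
  unfolding bz_def by (rule continuous_on_compose2[OF continuous_drift]) (auto intro: continuous_unscale)

lemma bz_bound: "\<bar>bz z\<bar> \<le> B"
  by (simp add: bz_def bounded_b)

lemma deriv_\<beta>: "(\<beta> has_real_derivative bz z) (at z)" and \<beta>_0: "\<beta> 0 = 0"
  unfolding \<beta>_def by (auto intro!: antider continuous_bz)

lemma continuous_\<beta>: "continuous_on S \<beta>"
  by (rule DERIV_continuous_on) (rule DERIV_subset[OF deriv_\<beta> subset_UNIV])

lemma deriv_U: "(U has_real_derivative exp (- 2 * \<beta> z)) (at z)" and U_0: "U 0 = 0"
  unfolding U_def by (auto intro!: antider(2)[of "\<lambda>z. exp (- 2 * \<beta> z)", simplified] antider(1) continuous_intros continuous_\<beta>)

lemma deriv_V: "(V has_real_derivative exp (2 * \<beta> z)) (at z)" and V_0: "V 0 = 0"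
  unfolding V_def by (auto intro!: antider(2)[of "\<lambda>z. exp (2 * \<beta> z)", simplified] antider(1) continuous_intros continuous_\<beta>)

text \<open>Substitution \<open>z = scale x\<close>, for which \<open>lam_hat\<close> is the
  Jacobian. Each half-line is treated by itself, since \<open>scale\<close> is linear there and the
  fundamental theorem applies.\<close>

lemma integral_lam_hat:
  assumes F: "\<And>z. (F has_real_derivative g z) (at z)" and g: "continuous_on UNIV g"
  shows "(LBINT x=0..q. lam_hat l1 l2 x * g (scale x)) = F (scale q) - F 0"
proof -
  have *: "(LBINT x=ereal 0..ereal q. c * g (c * x)) = F (c * q) - F (c * 0)" for c
  proof (rule interval_integral_FTC_finite)
    show "continuous_on {min 0 q..max 0 q} (\<lambda>x. c * g (c * x))"
      by (intro continuous_intros continuous_on_compose2[OF g]) auto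
    fix x
    have "((\<lambda>x. F (c * x)) has_real_derivative g (c * x) * c) (at x)"
      by (rule DERIV_chain2[OF F]) (auto intro!: derivative_eq_intros)
    then have "((\<lambda>x. F (c * x)) has_real_derivative c * g (c * x)) (at x within {min 0 q..max 0 q})"
      by (auto intro: DERIV_subset simp: mult.commute)
    then show "((\<lambda>x. F (c * x)) has_vector_derivative c * g (c * x)) (at x within {min 0 q..max 0 q})"
      by (simp add: has_real_derivative_iff_has_vector_derivative)
  qed
  consider "q < 0" | "q = 0" | "q > 0" by linarith
  then show ?thesis
  proof cases
    case 1
    have "(LBINT x=ereal 0..ereal q. lam_hat l1 l2 x * g (scale x)) = (LBINT x=ereal 0..ereal q. l1 * g (l1 * x))"
      by (rule interval_integral_cong) (use 1 in \<open>auto simp: lam_hat_def scale_def einterval_def min_def max_def\<close>)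
    then show ?thesis using *[of l1] 1 by (simp add: scale_def zero_ereal_def)
  next
    case 2
    then show ?thesis by (simp add: zero_ereal_def)
  next
    case 3
    have "(LBINT x=ereal 0..ereal q. lam_hat l1 l2 x * g (scale x)) = (LBINT x=ereal 0..ereal q. l2 * g (l2 * x))"
      by (rule interval_integral_cong) (use 3 in \<open>auto simp: lam_hat_def scale_def einterval_def min_def max_def\<close>)
    then show ?thesis using *[of l2] 3 by (simp add: scale_def zero_ereal_def)
  qed
qed

lemma integral_drift: "(LBINT y=0..x. b y * lam_hat l1 l2 y) = \<beta> (scale x)"
  using integral_lam_hat[OF deriv_\<beta> continuous_bz, of x] by (simp add: bz_def \<beta>_0 mult.commute)

lemma u_hat_eq: "u_hat b l1 l2 = (\<lambda>q. U (scale q))"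
proof
  fix q
  have "u_hat b l1 l2 q = (LBINT x=0..q. lam_hat l1 l2 x * exp (- 2 * \<beta> (scale x)))"
    by (simp add: u_hat_def integral_drift)
  also have "\<dots> = U (scale q)"
    using integral_lam_hat[OF deriv_U, of q] by (simp add: U_0 continuous_intros continuous_\<beta>)
  finally show "u_hat b l1 l2 q = U (scale q)" .
qed

lemma v_hat_eq: "v_hat b l1 l2 = (\<lambda>q. 2 * V (scale q))"
proof
  fix q
  have "v_hat b l1 l2 q = 2 * (LBINT x=0..q. lam_hat l1 l2 x * exp (2 * \<beta> (scale x)))"
    by (simp add: v_hat_def integral_drift)
  also have "\<dots> = 2 * V (scale q)"
    using integral_lam_hat[OF deriv_V, of q] by (simp add: V_0 continuous_intros continuous_\<beta>)
  finally show "v_hat b l1 l2 q = 2 * V (scale q)" .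
qed

text \<open>A homeomorphism maps punctured neighbourhoods onto punctured neighbourhoods. Quotients
  of increments in \<open>q\<close> thereby become quotients of increments in \<open>z\<close>, also
  at the kink.\<close>

lemma filtermap_scale: "filtermap (\<lambda>h. scale (q + h) - scale q) (at 0) = at 0"
proof (rule filtermap_fun_inverse[where g = "\<lambda>k. unscale (scale q + k) - q"])
  have "continuous_on UNIV (\<lambda>h. scale (q + h) - scale q)"
    by (intro continuous_intros continuous_on_compose2[OF continuous_scale[of UNIV]]) auto
  then have "isCont (\<lambda>h. scale (q + h) - scale q) 0" by (simp add: continuous_on_eq_continuous_at)
  from isContD[OF this]
  show "filterlim (\<lambda>h. scale (q + h) - scale q) (at 0) (at 0)"
    by (auto simp: filterlim_at eventually_at_filter inj_scale)
  have "continuous_on UNIV (\<lambda>k. unscale (scale q + k) - q)"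
    by (intro continuous_intros continuous_on_compose2[OF continuous_unscale[of UNIV]]) auto
  then have "isCont (\<lambda>k. unscale (scale q + k) - q) 0" by (simp add: continuous_on_eq_continuous_at)
  note isContD[OF this]
  moreover have "unscale (scale q + k) - q \<noteq> 0" if "k \<noteq> 0" for k
  proof
    assume "unscale (scale q + k) - q = 0"
    then have "scale (unscale (scale q + k)) = scale q" by simp
    then show False using that by simp
  qed
  ultimately show "filterlim (\<lambda>k. unscale (scale q + k) - q) (at 0) (at 0)"
    by (auto simp: filterlim_at eventually_at_filter)
qed auto

text \<open>The kink of \<open>scale\<close> cancels between numerator and denominator. Hence this
  is an equivalence at every point: a derivative with respect to \<open>G (scale q)\<close> exists
  at 0 exactly when \<open>F\<close> has an ordinary derivative there.\<close>

lemma has_deriv_wrt_scale_iff: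
  assumes G: "(G has_real_derivative c) (at (scale q))" and c: "c \<noteq> 0"
  shows "has_deriv_wrt (\<lambda>q. G (scale q)) (\<lambda>q. F (scale q)) d q \<longleftrightarrow> (F has_real_derivative d * c) (at (scale q))"
proof -
  define z where "z = scale q"
  have Gl: "((\<lambda>k. (G (z + k) - G z) / k) \<longlongrightarrow> c) (at 0)"
    using G by (simp add: DERIV_def z_def)
  then have ne: "eventually (\<lambda>k. (G (z + k) - G z) / k \<noteq> 0) (at 0)"
    using c by (rule tendsto_imp_eventually_ne)
  have "has_deriv_wrt (\<lambda>q. G (scale q)) (\<lambda>q. F (scale q)) d q \<longleftrightarrow>
     ((\<lambda>h. (\<lambda>k. (F (z + k) - F z) / (G (z + k) - G z)) (scale (q + h) - scale q)) \<longlongrightarrow> d) (at 0)"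
    by (simp add: has_deriv_wrt_def z_def)
  also have "\<dots> \<longleftrightarrow> ((\<lambda>k. (F (z + k) - F z) / (G (z + k) - G z)) \<longlongrightarrow> d) (at 0)"
    using filterlim_filtermap[of "\<lambda>k. (F (z + k) - F z) / (G (z + k) - G z)" "nhds d" "\<lambda>h. scale (q + h) - scale q" "at 0"]
    by (simp add: filtermap_scale)
  also have "\<dots> \<longleftrightarrow> ((\<lambda>k. (F (z + k) - F z) / k) \<longlongrightarrow> d * c) (at 0)"
  proof
    assume "((\<lambda>k. (F (z + k) - F z) / (G (z + k) - G z)) \<longlongrightarrow> d) (at 0)"
    from tendsto_mult[OF this Gl]
    show "((\<lambda>k. (F (z + k) - F z) / k) \<longlongrightarrow> d * c) (at 0)"
      by (rule Lim_transform_eventually) (use ne in eventually_elim, auto)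
  next
    assume "((\<lambda>k. (F (z + k) - F z) / k) \<longlongrightarrow> d * c) (at 0)"
    from tendsto_divide[OF this Gl c]
    have "((\<lambda>k. (F (z + k) - F z) / (G (z + k) - G z)) \<longlongrightarrow> d * c / c) (at 0)"
      by (rule Lim_transform_eventually) (use ne in eventually_elim, auto)
    then show "((\<lambda>k. (F (z + k) - F z) / (G (z + k) - G z)) \<longlongrightarrow> d) (at 0)" using c by simp
  qed
  finally show ?thesis by (simp add: DERIV_def z_def)
qed

lemma has_deriv_u_iff:
  "has_deriv_wrt (u_hat b l1 l2) (\<lambda>q. F (scale q)) d q \<longleftrightarrow> (F has_real_derivative d * exp (- 2 * \<beta> (scale q))) (at (scale q))"
  unfolding u_hat_eq by (rule has_deriv_wrt_scale_iff[OF deriv_U]) simp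

lemma has_deriv_v_iff:
  "has_deriv_wrt (v_hat b l1 l2) (\<lambda>q. F (scale q)) d q \<longleftrightarrow> (F has_real_derivative d * (2 * exp (2 * \<beta> (scale q)))) (at (scale q))"
  unfolding v_hat_eq
  by (rule has_deriv_wrt_scale_iff[where G = "\<lambda>z. 2 * V z"]) (auto intro!: derivative_eq_intros deriv_V)

lemma deriv_scale:
  assumes "q \<noteq> 0" shows "(scale has_real_derivative lam_hat l1 l2 q) (at q)"
proof (cases "q < 0")
  case True
  show ?thesis
  proof (rule has_field_derivative_transform_within_open[where S = "{..<0}" and f = "\<lambda>q. l1 * q"])
    show "((*) l1 has_real_derivative lam_hat l1 l2 q) (at q)"
      using True by (auto intro!: derivative_eq_intros simp: lam_hat_def)
  qed (use True in \<open>auto simp: scale_def\<close>)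
next
  case False
  then have q: "q > 0" using assms by simp
  show ?thesis
  proof (rule has_field_derivative_transform_within_open[where S = "{0<..}" and f = "\<lambda>q. l2 * q"])
    show "((*) l2 has_real_derivative lam_hat l1 l2 q) (at q)"
      using q by (auto intro!: derivative_eq_intros simp: lam_hat_def)
  qed (use q in \<open>auto simp: scale_def\<close>)
qed

lemma deriv_lam_hat:
  assumes "q \<noteq> 0" shows "(lam_hat l1 l2 has_real_derivative 0) (at q)"
proof (cases "q < 0")
  case True
  show ?thesis
    by (rule has_field_derivative_transform_within_open[where S = "{..<0}" and f = "\<lambda>q. l1"])
       (use True in \<open>auto simp: lam_hat_def\<close>)
next
  case False
  then have q: "q > 0" using assms by simp
  show ?thesis
    by (rule has_field_derivative_transform_within_open[where S = "{0<..}" and f = "\<lambda>q. l2"])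
       (use q in \<open>auto simp: lam_hat_def\<close>)
qed

text \<open>With \<open>F\<close> differentiable across 0, the one-sided derivatives in
  \<open>q\<close> at 0 are \<open>F' 0 * l1\<close> and \<open>F' 0 * l2\<close>, which is the
  gluing condition. Away from 0 \<open>lam_hat\<close> is locally constant and contributes only its
  square to the second derivative.\<close>

lemma
  assumes F: "\<And>z. (F has_real_derivative F' z) (at z)" "\<And>z. (F' has_real_derivative F'' z) (at z)"
    and F'': "continuous_on UNIV F''" and bdd: "bounded (range F)"
  shows A_domI: "(\<lambda>q. F (scale q)) \<in> A_dom b l1 l2"
    and A_op_eq: "A_op b l1 l2 (\<lambda>q. F (scale q)) = (\<lambda>q. 1/2 * F'' (scale q) + b q * F' (scale q))"
proof -
  have cF: "continuous_on UNIV F" "continuous_on UNIV F'"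
    by (auto intro!: DERIV_continuous_on F)
  have u: "has_deriv_wrt (u_hat b l1 l2) (\<lambda>q. F (scale q)) (F' (scale q) * exp (2 * \<beta> (scale q))) q" for q
    unfolding has_deriv_u_iff using F(1)[of "scale q"] by (simp add: mult.assoc exp_add[symmetric])
  have du: "deriv_wrt (u_hat b l1 l2) (\<lambda>q. F (scale q)) = (\<lambda>q. (\<lambda>z. F' z * exp (2 * \<beta> z)) (scale q))"
    using u by (auto simp: fun_eq_iff deriv_wrt_eq)
  have v: "has_deriv_wrt (v_hat b l1 l2) (\<lambda>q. (\<lambda>z. F' z * exp (2 * \<beta> z)) (scale q))
      (1/2 * F'' (scale q) + b q * F' (scale q)) q" for q
    by (rule iffD2[OF has_deriv_v_iff])
       (auto intro!: derivative_eq_intros F deriv_\<beta> simp: bz_def algebra_simps)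
  show op: "A_op b l1 l2 (\<lambda>q. F (scale q)) = (\<lambda>q. 1/2 * F'' (scale q) + b q * F' (scale q))"
    unfolding A_op_def du using v by (auto simp: fun_eq_iff deriv_wrt_eq)
  show "(\<lambda>q. F (scale q)) \<in> A_dom b l1 l2"
    unfolding A_dom_def
  proof (intro CollectI conjI allI)
    show "continuous_on UNIV (\<lambda>q. F (scale q))"
      by (rule continuous_on_compose2[OF cF(1)]) (auto intro: continuous_scale)
    show "bounded (range (\<lambda>q. F (scale q)))" using bdd by (rule bounded_subset) auto
    show "continuous_on UNIV (A_op b l1 l2 (\<lambda>q. F (scale q)))"
      unfolding op
      by (intro continuous_intros continuous_drift continuous_on_compose2[OF F''] continuous_on_compose2[OF cF(2)]
          continuous_scale) auto
    show "\<exists>d. has_deriv_wrt (u_hat b l1 l2) (\<lambda>q. F (scale q)) d q" for q using u by blast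
    show "\<exists>d. has_deriv_wrt (v_hat b l1 l2) (deriv_wrt (u_hat b l1 l2) (\<lambda>q. F (scale q))) d q" for q
      unfolding du using v by blast
    show "\<exists>dl dr. ((\<lambda>q. F (scale q)) has_real_derivative dl) (at_left 0) \<and>
         ((\<lambda>q. F (scale q)) has_real_derivative dr) (at_right 0) \<and> 1 / l1 * dl = 1 / l2 * dr"
    proof (intro exI conjI)
      have d: "((\<lambda>q. F (c * q)) has_real_derivative F' 0 * c) (at 0)" for c
        by (rule DERIV_chain2[where f = F]) (use F(1)[of 0] in \<open>auto intro!: derivative_eq_intros\<close>)
      have "((\<lambda>q. F (scale q)) has_real_derivative F' 0 * l1) (at 0 within {..0})"
        using has_field_derivative_transform_within[OF DERIV_subset[OF d[of l1] subset_UNIV], of 1 "{..0}" "\<lambda>q. F (scale q)"]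
        by (auto simp: scale_def)
      then show "((\<lambda>q. F (scale q)) has_real_derivative F' 0 * l1) (at_left 0)" by (rule DERIV_subset) auto
      have "((\<lambda>q. F (scale q)) has_real_derivative F' 0 * l2) (at 0 within {0..})"
        using has_field_derivative_transform_within[OF DERIV_subset[OF d[of l2] subset_UNIV], of 1 "{0..}" "\<lambda>q. F (scale q)"]
        by (auto simp: scale_def order_class.antisym_conv)
      then show "((\<lambda>q. F (scale q)) has_real_derivative F' 0 * l2) (at_right 0)" by (rule DERIV_subset) auto
      show "1 / l1 * (F' 0 * l1) = 1 / l2 * (F' 0 * l2)" using l1 l2 by simp
    qed
    show "\<exists>f' f''. (\<forall>q\<in>-{0}. ((\<lambda>q. F (scale q)) has_real_derivative f' q) (at q) \<and> (f' has_real_derivative f'' q) (at q)) \<and>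
               continuous_on (-{0}) f''"
    proof (intro exI conjI ballI)
      fix q :: real assume "q \<in> -{0}"
      then have q: "q \<noteq> 0" by simp
      show "((\<lambda>q. F (scale q)) has_real_derivative F' (scale q) * lam_hat l1 l2 q) (at q)"
        by (rule DERIV_chain2[OF F(1) deriv_scale[OF q]])
      have "((\<lambda>q. F' (scale q)) has_real_derivative F'' (scale q) * lam_hat l1 l2 q) (at q)"
        by (rule DERIV_chain2[OF F(2) deriv_scale[OF q]])
      from DERIV_mult[OF this deriv_lam_hat[OF q]]
      show "((\<lambda>q. F' (scale q) * lam_hat l1 l2 q) has_real_derivative F'' (scale q) * lam_hat l1 l2 q * lam_hat l1 l2 q) (at q)"
        by simp
    next
      have "isCont (lam_hat l1 l2) q" if "q \<noteq> 0" for q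
        using deriv_lam_hat[OF that] by (rule DERIV_isCont)
      then have "continuous_on (-{0}) (lam_hat l1 l2)" by (simp add: continuous_at_imp_continuous_on)
      then show "continuous_on (-{0}) (\<lambda>q. F'' (scale q) * lam_hat l1 l2 q * lam_hat l1 l2 q)"
        by (intro continuous_intros continuous_on_compose2[OF F''] continuous_scale) auto
    qed
  qed
qed

text \<open>Let \<open>G\<close> and \<open>g\<close> be the \<open>u\<close>-derivative of
  \<open>f\<close> and \<open>A f\<close>, read in \<open>z\<close>. The two derivatives of the
  domain say \<open>F' = G * exp (- 2 * \<beta>)\<close> and
  \<open>G' = 2 * g * exp (2 * \<beta>)\<close>, at 0 as elsewhere. Hence
  \<open>F'' = 2 * g - 2 * bz * F'\<close>, continuous because \<open>A f\<close> is.\<close>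

lemma A_domE:
  assumes f: "f \<in> A_dom b l1 l2"
  obtains F F' F'' where "f = (\<lambda>q. F (scale q))" "\<And>z. (F has_real_derivative F' z) (at z)"
    "\<And>z. (F' has_real_derivative F'' z) (at z)" "continuous_on UNIV F''" "bounded (range F)"
proof -
  define F where "F z = f (unscale z)" for z
  have fF: "f = (\<lambda>q. F (scale q))" by (simp add: F_def)
  define G where "G z = deriv_wrt (u_hat b l1 l2) f (unscale z)" for z
  have duG: "deriv_wrt (u_hat b l1 l2) f = (\<lambda>q. G (scale q))" by (simp add: G_def)
  define g where "g z = A_op b l1 l2 f (unscale z)" for z
  have gop: "A_op b l1 l2 f = (\<lambda>q. g (scale q))" by (simp add: g_def)
  have dF: "(F has_real_derivative G z * exp (- 2 * \<beta> z)) (at z)" for z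
  proof -
    obtain d where d: "has_deriv_wrt (u_hat b l1 l2) f d (unscale z)" using f unfolding A_dom_def by blast
    then have "d = G z" by (simp add: G_def deriv_wrt_eq)
    then show ?thesis using d has_deriv_u_iff[of F d "unscale z"] by (simp add: fF[symmetric])
  qed
  have dG: "(G has_real_derivative g z * (2 * exp (2 * \<beta> z))) (at z)" for z
  proof -
    obtain d where "has_deriv_wrt (v_hat b l1 l2) (deriv_wrt (u_hat b l1 l2) f) d (unscale z)"
      using f unfolding A_dom_def by blast
    then have d: "has_deriv_wrt (v_hat b l1 l2) (\<lambda>q. G (scale q)) d (unscale z)" by (subst duG[symmetric])
    then have "d = g z" by (simp add: g_def A_op_def duG deriv_wrt_eq)
    then show ?thesis using d has_deriv_v_iff[of G d "unscale z"] by simp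
  qed
  have cg: "continuous_on UNIV g"
    unfolding g_def by (rule continuous_on_compose2[OF _ continuous_unscale[of UNIV]]) (use f in \<open>auto simp: A_dom_def\<close>)
  have cG: "continuous_on UNIV G" by (rule DERIV_continuous_on) (rule dG)
  show ?thesis
  proof (rule that[OF fF dF])
    show "((\<lambda>z. G z * exp (- 2 * \<beta> z)) has_real_derivative 2 * g z - 2 * bz z * (G z * exp (- 2 * \<beta> z))) (at z)" for z
    proof -
      have "exp (2 * \<beta> z) * exp (- (2 * \<beta> z)) = 1" by (simp add: exp_minus)
      then have "g z * (2 * exp (2 * \<beta> z)) * exp (- 2 * \<beta> z) = 2 * g z" by (simp add: mult.assoc)
      then show ?thesis
        by (auto intro!: derivative_eq_intros dG deriv_\<beta> simp: algebra_simps)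
    qed
    show "continuous_on UNIV (\<lambda>z. 2 * g z - 2 * bz z * (G z * exp (- 2 * \<beta> z)))"
      by (intro continuous_intros cg cG continuous_bz continuous_\<beta>)
    have "bounded (range f)" using f by (simp add: A_dom_def)
    then show "bounded (range F)" by (rule bounded_subset) (auto simp: F_def)
  qed
qed

end

section \<open>The past of a process\<close>

lemma space_past: "space (past N X s) = space N"
  unfolding past_def by (simp add: space_measure_of_conv)

lemma subalgebra_past:
  assumes "\<And>t. 0 \<le> t \<Longrightarrow> X t \<in> borel_measurable N"
  shows "subalgebra N (past N X s)"
proof -
  have "{X r -` D \<inter> space N | r D. 0 \<le> r \<and> r \<le> s \<and> D \<in> sets borel} \<subseteq> sets N"
    using assms by (auto intro: measurable_sets)
  then have "sets (past N X s) \<subseteq> sets N"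
    unfolding past_def using sets.sigma_sets_subset[of _ N] by (subst sets_measure_of) auto
  then show ?thesis by (simp add: subalgebra_def space_past)
qed

lemma measurable_past:
  assumes "0 \<le> r" "r \<le> s"
  shows "X r \<in> borel_measurable (past N X s)"
proof (rule measurableI)
  fix D :: "real set" assume D: "D \<in> sets borel"
  have "X r -` D \<inter> space N \<in> {X r -` B \<inter> space N | r B. 0 \<le> r \<and> r \<le> s \<and> B \<in> sets borel}"
    using assms D by blast
  then show "X r -` D \<inter> space (past N X s) \<in> sets (past N X s)"
    unfolding space_past unfolding past_def by (subst sets_measure_of) auto
qed simp

section \<open>The limit process\<close>

locale media_noise = two_media b l1 l2 L B + wiener M W
  for b :: "real \<Rightarrow> real" and l1 l2 L B :: real and M :: "'a measure" and W :: "real \<Rightarrow> 'a \<Rightarrow> real"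
begin

definition process :: "real \<Rightarrow> real \<Rightarrow> 'a \<Rightarrow> real" where
  "process q t \<omega> = flow scale b q (noise 0 \<omega>) t"

text \<open>The solution at time \<open>t\<close> as a function on \<open>C[0,t]\<close>.\<close>

definition solution :: "real \<Rightarrow> real \<Rightarrow> (real \<Rightarrow>\<^sub>C real) \<Rightarrow> real" where
  "solution t q v = flow scale b q (apply_bcontfun v) t"

definition transition :: "real \<Rightarrow> real \<Rightarrow> real measure" where
  "transition t q = distr M borel (process q t)"

lemma continuous_apply_bcontfun: "continuous_on S (apply_bcontfun (v :: real \<Rightarrow>\<^sub>C real))"
  using apply_bcontfun[of v] by (auto simp: bcontfun_def intro: continuous_on_subset)

lemma solution_lipschitz:
  assumes "0 \<le> t"
  shows "\<bar>solution t q v - solution t q' v'\<bar> \<le> (dist v v' + \<bar>scale q - scale q'\<bar>) / min l1 l2 * exp (L / min l1 l2 * t)"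
  unfolding solution_def
  by (rule flow_lipschitz) (use assms dist_bounded[of v _ v'] in \<open>auto simp: dist_real_def continuous_apply_bcontfun\<close>)

lemma continuous_solution:
  assumes t: "0 \<le> t"
  shows "continuous_on UNIV (\<lambda>p. solution t (fst p) (snd p))"
  unfolding continuous_on_def
proof (intro ballI)
  fix p :: "real \<times> (real \<Rightarrow>\<^sub>C real)"
  let ?g = "\<lambda>p'. (dist (snd p') (snd p) + \<bar>scale (fst p') - scale (fst p)\<bar>) / min l1 l2 * exp (L / min l1 l2 * t)"
  have "(?g \<longlongrightarrow> ?g p) (at p)"
    using l1 l2 continuous_scale[of UNIV]
    by (intro tendsto_intros isCont_tendsto_compose[of _ scale]) (auto simp: continuous_on_eq_continuous_at)
  then have lim: "(?g \<longlongrightarrow> 0) (at p)" by simp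
  have "((\<lambda>p'. solution t (fst p') (snd p') - solution t (fst p) (snd p)) \<longlongrightarrow> 0) (at p)"
    by (rule Lim_null_comparison[OF _ lim], rule always_eventually)
       (use solution_lipschitz[OF t] in auto)
  then show "((\<lambda>p'. solution t (fst p') (snd p')) \<longlongrightarrow> solution t (fst p) (snd p)) (at p within UNIV)"
    by (rule iffD2[OF Lim_null])
qed

lemma continuous_solution1: "0 \<le> t \<Longrightarrow> continuous_on UNIV (\<lambda>q. solution t q v)"
  by (rule continuous_on_compose2[OF continuous_solution, of t UNIV "\<lambda>q. (q, v)", simplified]) (auto intro!: continuous_intros)

lemma continuous_solution2: "0 \<le> t \<Longrightarrow> continuous_on UNIV (solution t q)"
  by (rule continuous_on_compose2[OF continuous_solution, of t UNIV "\<lambda>v. (q, v)", simplified]) (auto intro!: continuous_intros)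

lemma measurable_solution: "0 \<le> t \<Longrightarrow> (\<lambda>(q, v). solution t q v) \<in> borel_measurable (borel \<Otimes>\<^sub>M borel)"
  by (rule measurable_caratheodory)
     (auto intro: borel_measurable_continuous_onI continuous_solution1 continuous_solution2)

lemma process_eq_solution:
  assumes "0 \<le> t" "t \<le> T" "\<omega> \<in> space M"
  shows "process q t \<omega> = solution t q (path T (noise 0 \<omega>))"
  unfolding process_def solution_def
  by (rule flow_eqI[where T = t, OF solves_flow[OF continuous_apply_bcontfun]])
     (use assms in \<open>auto simp: path_apply continuous_noise' continuous_noise\<close>)

text \<open>Pathwise form of the Markov property: the later position is a fixed function of the
  present one and of the noise after \<open>s\<close>.\<close>

lemma process_shift_eq_solution:
  assumes "0 \<le> s" "0 \<le> t" "\<omega> \<in> space M"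
  shows "process q (s + t) \<omega> = solution t (process q s \<omega>) (path t (noise s \<omega>))"
proof -
  have "process q (s + t) \<omega> = flow scale b (process q s \<omega>) (\<lambda>r. noise 0 \<omega> (s + r) - noise 0 \<omega> s) t"
    unfolding process_def by (rule flow_shift) (use assms in \<open>auto intro: continuous_noise\<close>)
  also have "(\<lambda>r. noise 0 \<omega> (s + r) - noise 0 \<omega> s) = noise s \<omega>"
    by (auto simp: noise_def)
  also have "flow scale b (process q s \<omega>) (noise s \<omega>) t = solution t (process q s \<omega>) (path t (noise s \<omega>))"
    unfolding solution_def
    by (rule flow_eqI[where T = t, OF solves_flow[OF continuous_apply_bcontfun]])
       (use assms in \<open>auto simp: path_apply continuous_noise' continuous_noise\<close>)
  finally show ?thesis .
qed

lemma measurable_process2: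
  assumes t: "0 \<le> t"
  shows "(\<lambda>(q, \<omega>). process q t \<omega>) \<in> borel_measurable (borel \<Otimes>\<^sub>M M)"
proof -
  have p: "(\<lambda>(q, \<omega>). (q, path t (noise 0 \<omega>))) \<in> borel \<Otimes>\<^sub>M M \<rightarrow>\<^sub>M borel \<Otimes>\<^sub>M borel"
    using t measurable_noise_path[of 0 t] by measurable
  have "(\<lambda>(q, \<omega>). solution t q (path t (noise 0 \<omega>))) \<in> borel_measurable (borel \<Otimes>\<^sub>M M)"
    using measurable_compose[OF p measurable_solution[OF t]] by (simp add: case_prod_beta)
  then show ?thesis
    by (rule iffD1[OF measurable_cong, rotated]) (use t in \<open>auto simp: space_pair_measure process_eq_solution[OF t order_refl]\<close>)
qed

lemma measurable_process [measurable]: "0 \<le> t \<Longrightarrow> process q t \<in> borel_measurable M"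
  using measurable_compose[OF measurable_Pair1' measurable_process2, of q] by simp

lemma process_0: "\<omega> \<in> space M \<Longrightarrow> process q 0 \<omega> = q"
  unfolding process_def by (rule flow_start) (auto intro: continuous_noise)

lemma continuous_process: "\<omega> \<in> space M \<Longrightarrow> continuous_on {0..} (\<lambda>t. process q t \<omega>)"
  unfolding process_def[abs_def] by (rule continuous_flow) (auto intro: continuous_noise)

lemma continuous_process_start: "0 \<le> t \<Longrightarrow> \<omega> \<in> space M \<Longrightarrow> continuous_on UNIV (\<lambda>q. process q t \<omega>)"
  using continuous_solution1[of t "path t (noise 0 \<omega>)"] by (simp add: process_eq_solution[of t t])

lemma sets_transition [simp]: "sets (transition t q) = sets borel"
  by (simp add: transition_def)

lemma prob_transition: "0 \<le> t \<Longrightarrow> prob_space (transition t q)"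
  unfolding transition_def by (rule prob_space_distr) simp

lemma integral_transition:
  fixes f :: "real \<Rightarrow> real"
  shows "0 \<le> t \<Longrightarrow> f \<in> borel_measurable borel \<Longrightarrow> (\<integral>y. f y \<partial>transition t q) = expectation (\<lambda>\<omega>. f (process q t \<omega>))"
  unfolding transition_def by (rule integral_distr) auto

lemma measurable_transition:
  assumes t: "0 \<le> t" shows "transition t \<in> borel \<rightarrow>\<^sub>M prob_algebra borel"
proof (rule measurable_prob_algebraI)
  show "prob_space (transition t q)" for q using t by (rule prob_transition)
  have "M \<in> space (subprob_algebra M)"
    by (simp add: space_subprob_algebra subprob_space_axioms)
  then show "transition t \<in> borel \<rightarrow>\<^sub>M subprob_algebra borel"
    unfolding transition_def[abs_def]
    by (intro measurable_distr2[OF measurable_process2[OF t]]) simp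
qed

lemma measurable_transition_measure:
  assumes t: "0 \<le> t" and D: "D \<in> sets borel"
  shows "(\<lambda>x. measure (transition t x) D) \<in> borel_measurable borel"
  using measurable_compose[OF measurable_prob_algebraD[OF measurable_transition[OF t]] measurable_measure_subprob_algebra[OF D]] .

lemma transition_solution:
  assumes t: "0 \<le> t" and D: "D \<in> sets borel"
  shows "(\<integral>v. indicator D (solution t x v) \<partial>distr M borel (\<lambda>\<omega>. path t (noise 0 \<omega>))) = measure (transition t x) D"
proof -
  have [measurable]: "(\<lambda>\<omega>. path t (noise 0 \<omega>)) \<in> M \<rightarrow>\<^sub>M borel" using t by simp
  have [measurable]: "solution t x \<in> borel_measurable borel"
    by (rule borel_measurable_continuous_onI[OF continuous_solution2[OF t]])
  note [measurable] = D
  have "(\<integral>v. indicator D (solution t x v) \<partial>distr M borel (\<lambda>\<omega>. path t (noise 0 \<omega>)))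
    = expectation (\<lambda>\<omega>. indicator D (solution t x (path t (noise 0 \<omega>))) :: real)"
    by (rule integral_distr) auto
  also have "\<dots> = expectation (\<lambda>\<omega>. indicator D (process x t \<omega>))"
    by (rule Bochner_Integration.integral_cong) (use t in \<open>auto simp: process_eq_solution[of t t]\<close>)
  also have "\<dots> = (\<integral>y. indicator D y \<partial>transition t x)"
    using t by (subst integral_transition) auto
  also have "\<dots> = measure (transition t x) D" using D by simp
  finally show ?thesis .
qed

text \<open>The position at \<open>s\<close> is a function of the noise before \<open>s\<close>, and
  the rest of the motion is driven by the independent path after \<open>s\<close>. Integrating over
  the latter first leaves the transition measure, as the law of that path does not depend on
  \<open>s\<close>.\<close>

lemma markov_expectation:
  assumes s: "0 \<le> s" and t: "0 \<le> t" and C: "C \<in> sets borel" and D: "D \<in> sets borel"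
  shows "expectation (\<lambda>\<omega>. indicator C (path s (noise 0 \<omega>)) * indicator D (process q (s + t) \<omega>)) =
    expectation (\<lambda>\<omega>. indicator C (path s (noise 0 \<omega>)) * measure (transition t (process q s \<omega>)) D)"
proof -
  let ?U = "\<lambda>\<omega>. path s (noise 0 \<omega>)"
  let ?V = "\<lambda>\<omega>. path t (noise s \<omega>)"
  let ?DU = "distr M borel ?U"
  let ?DV = "distr M borel ?V"
  have U[measurable]: "?U \<in> M \<rightarrow>\<^sub>M borel" and V[measurable]: "?V \<in> M \<rightarrow>\<^sub>M borel" using s t by auto
  have prod: "?DU \<Otimes>\<^sub>M ?DV = distr M (borel \<Otimes>\<^sub>M borel) (\<lambda>\<omega>. (?U \<omega>, ?V \<omega>))"
    using noise_paths_indep[OF s t] by (simp add: indep_var_distribution_eq)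
  interpret DU: prob_space ?DU by (rule prob_space_distr) simp
  interpret DV: prob_space ?DV by (rule prob_space_distr) simp
  interpret P: pair_prob_space ?DU ?DV ..
  define h :: "(real \<Rightarrow>\<^sub>C real) \<times> (real \<Rightarrow>\<^sub>C real) \<Rightarrow> real"
    where "h p = indicator C (fst p) * indicator D (solution t (solution s q (fst p)) (snd p))" for p
  have [measurable]: "solution s q \<in> borel_measurable borel"
    by (rule borel_measurable_continuous_onI[OF continuous_solution2[OF s]])
  have "(\<lambda>p. (solution s q (fst p), snd p)) \<in> borel \<Otimes>\<^sub>M borel \<rightarrow>\<^sub>M borel \<Otimes>\<^sub>M borel" by measurable
  from measurable_compose[OF this measurable_solution[OF t]]
  have m: "(\<lambda>p. solution t (solution s q (fst p)) (snd p)) \<in> borel_measurable (borel \<Otimes>\<^sub>M borel)" by simp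
  have h[measurable]: "h \<in> borel_measurable (borel \<Otimes>\<^sub>M borel)"
    unfolding h_def
    by (intro borel_measurable_times measurable_compose[OF measurable_fst borel_measurable_indicator[OF C]]
        measurable_compose[OF m borel_measurable_indicator[OF D]])
  have "h \<in> borel_measurable (?DU \<Otimes>\<^sub>M ?DV)"
    unfolding prod by simp
  then have hint: "integrable (?DU \<Otimes>\<^sub>M ?DV) h"
    by (intro P.integrable_const_bound[where B = 1]) (auto simp: h_def indicator_def)
  have "expectation (\<lambda>\<omega>. indicator C (?U \<omega>) * indicator D (process q (s + t) \<omega>)) = expectation (\<lambda>\<omega>. h (?U \<omega>, ?V \<omega>))"
    by (rule Bochner_Integration.integral_cong)
       (use s t in \<open>auto simp: h_def process_shift_eq_solution process_eq_solution[of s s]\<close>)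
  also have "\<dots> = integral\<^sup>L (?DU \<Otimes>\<^sub>M ?DV) h"
    unfolding prod by (rule integral_distr[symmetric]) auto
  also have "\<dots> = (\<integral>u. (\<integral>v. h (u, v) \<partial>?DV) \<partial>?DU)"
    by (rule P.integral_fst'[symmetric, OF hint])
  also have "\<dots> = (\<integral>u. indicator C u * measure (transition t (solution s q u)) D \<partial>?DU)"
  proof (rule Bochner_Integration.integral_cong[OF refl])
    fix u
    have "(\<integral>v. h (u, v) \<partial>?DV) = indicator C u * (\<integral>v. indicator D (solution t (solution s q u) v) \<partial>?DV)"
      by (simp add: h_def)
    then show "(\<integral>v. h (u, v) \<partial>?DV) = indicator C u * measure (transition t (solution s q u)) D"
      by (simp add: noise_path_law[OF s t] transition_solution[OF t D])
  qed
  also have "\<dots> = expectation (\<lambda>\<omega>. indicator C (?U \<omega>) * measure (transition t (solution s q (?U \<omega>))) D)"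
    by (rule integral_distr[OF U])
       (intro borel_measurable_times borel_measurable_indicator[OF C]
         measurable_compose[OF _ measurable_transition_measure[OF t D]], measurable)
  also have "\<dots> = expectation (\<lambda>\<omega>. indicator C (?U \<omega>) * measure (transition t (process q s \<omega>)) D)"
    by (rule Bochner_Integration.integral_cong) (use s in \<open>auto simp: process_eq_solution[of s s]\<close>)
  finally show ?thesis .
qed

text \<open>Chapman-Kolmogorov is \<open>markov_expectation\<close> with the trivial event of the
  past. Continuity in the starting point holds for each sample point and passes to expectations by
  dominated convergence.\<close>

lemma feller_transition: "feller_transition transition"
  unfolding feller_transition_def
proof (intro conjI allI impI)
  show "transition t \<in> borel \<rightarrow>\<^sub>M prob_algebra borel" if "0 \<le> t" for t using that by (rule measurable_transition)
  show "transition 0 x = return borel x" for x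
  proof -
    have "transition 0 x = distr M borel (\<lambda>\<omega>. x)"
      unfolding transition_def by (rule distr_cong) (auto simp: process_0)
    then show ?thesis by simp
  qed
  show "transition (s + t) x = transition s x \<bind> transition t" if st: "0 \<le> s" "0 \<le> t" for s t x
  proof (rule measure_eqI)
    interpret S: prob_space "transition s x" by (rule prob_transition) fact
    interpret ST: prob_space "transition (s + t) x" by (rule prob_transition) (use st in simp)
    have K: "transition t \<in> transition s x \<rightarrow>\<^sub>M subprob_algebra borel"
      using measurable_prob_algebraD[OF measurable_transition[OF st(2)]] by (simp cong: measurable_cong_sets)
    have sets_bind': "sets (transition s x \<bind> transition t) = sets borel"
      by (rule sets_bind[OF _ S.not_empty]) simp
    then show "sets (transition (s + t) x) = sets (transition s x \<bind> transition t)" by simp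
    fix D assume "D \<in> sets (transition (s + t) x)"
    then have D: "D \<in> sets borel" by simp
    interpret Bd: prob_space "transition s x \<bind> transition t"
      by (rule S.prob_space_bind[OF _ K]) (use st in \<open>auto intro: prob_transition\<close>)
    have "measure (transition (s + t) x) D = (\<integral>y. indicator D y \<partial>transition (s + t) x)"
      using D by simp
    also have "\<dots> = expectation (\<lambda>\<omega>. indicator UNIV (path s (noise 0 \<omega>)) * indicator D (process x (s + t) \<omega>))"
      using st D by (subst integral_transition) auto
    also have "\<dots> = expectation (\<lambda>\<omega>. measure (transition t (process x s \<omega>)) D)"
      using markov_expectation[OF st _ D, of UNIV x] by simp
    also have "\<dots> = (\<integral>y. measure (transition t y) D \<partial>transition s x)"
      using st D by (subst integral_transition) (auto intro: measurable_transition_measure)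
    also have "\<dots> = measure (transition s x \<bind> transition t) D"
      by (rule S.measure_bind[symmetric, OF K D])
    finally show "emeasure (transition (s + t) x) D = emeasure (transition s x \<bind> transition t) D"
      by (simp add: ST.emeasure_eq_measure Bd.emeasure_eq_measure)
  qed
  fix t :: real and f :: "real \<Rightarrow> real"
  assume t: "0 \<le> t" and f: "continuous_on UNIV f" "bounded (range f)"
  have [measurable]: "f \<in> borel_measurable borel" using f(1) by (rule borel_measurable_continuous_onI)
  obtain Bf where Bf: "\<And>x. \<bar>f x\<bar> \<le> Bf" using f(2) by (auto simp: bounded_iff)
  show "continuous_on UNIV (\<lambda>x. \<integral>y. f y \<partial>transition t x)"
    unfolding continuous_on_sequentially comp_def
  proof (intro allI ballI impI)
    fix x :: "nat \<Rightarrow> real" and a assume x: "(\<forall>n. x n \<in> UNIV) \<and> x \<longlonglongrightarrow> a"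
    have "(\<lambda>n. expectation (\<lambda>\<omega>. f (process (x n) t \<omega>))) \<longlonglongrightarrow> expectation (\<lambda>\<omega>. f (process a t \<omega>))"
    proof (rule integral_dominated_convergence[where w = "\<lambda>_. Bf"])
      show "AE \<omega> in M. (\<lambda>n. f (process (x n) t \<omega>)) \<longlonglongrightarrow> f (process a t \<omega>)"
      proof (rule AE_I2)
        fix \<omega> assume "\<omega> \<in> space M"
        from continuous_process_start[OF t this]
        have "(\<lambda>n. process (x n) t \<omega>) \<longlonglongrightarrow> process a t \<omega>"
          by (rule continuous_on_tendsto_compose) (use x in auto)
        then show "(\<lambda>n. f (process (x n) t \<omega>)) \<longlonglongrightarrow> f (process a t \<omega>)"
          by (rule continuous_on_tendsto_compose[OF f(1)]) auto
      qed
    qed (use t Bf in auto)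
    then show "(\<lambda>n. \<integral>y. f y \<partial>transition t (x n)) \<longlonglongrightarrow> (\<integral>y. f y \<partial>transition t a)"
      using t by (simp add: integral_transition)
  qed
qed

text \<open>The past of the process lies in the sigma-algebra of the noise path up to
  \<open>s\<close>. Events of the past thus take the form for which
  \<open>markov_expectation\<close> was proved.\<close>

lemma sets_past_process:
  assumes s: "0 \<le> s" and A: "A \<in> sets (past M (process q) s)"
  shows "\<exists>C\<in>sets borel. A = (\<lambda>\<omega>. path s (noise 0 \<omega>)) -` C \<inter> space M"
proof -
  let ?V = "vimage_algebra (space M) (\<lambda>\<omega>. path s (noise 0 \<omega>)) borel"
  have "{process q r -` D \<inter> space M | r D. 0 \<le> r \<and> r \<le> s \<and> D \<in> sets borel} \<subseteq> sets ?V"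
  proof clarify
    fix r and D :: "real set" assume r: "0 \<le> r" "r \<le> s" and D: "D \<in> sets borel"
    have "solution r q \<in> borel_measurable borel"
      by (rule borel_measurable_continuous_onI[OF continuous_solution2[OF r(1)]])
    then have "solution r q -` D \<in> sets borel" using D by (auto dest: measurable_sets)
    moreover have "process q r -` D \<inter> space M = (\<lambda>\<omega>. path s (noise 0 \<omega>)) -` (solution r q -` D) \<inter> space M"
      using r by (auto simp: process_eq_solution)
    ultimately show "process q r -` D \<inter> space M \<in> sets ?V"
      by (auto simp: sets_vimage_algebra2)
  qed
  moreover have "{process q r -` D \<inter> space M | r D. 0 \<le> r \<and> r \<le> s \<and> D \<in> sets borel} \<subseteq> Pow (space M)" by auto
  ultimately have "sets (past M (process q) s) \<subseteq> sets ?V"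
    unfolding past_def using sets.sigma_sets_subset[of _ ?V] by (simp add: sets_measure_of)
  then show ?thesis using A by (auto simp: sets_vimage_algebra2)
qed

lemma markov_process: "markov_process M (process q) transition"
  unfolding markov_process_def
proof (intro conjI allI impI ballI)
  show "prob_space M" by (rule prob_space_axioms)
  show "process q t \<in> borel_measurable M" if "0 \<le> t" for t using that by simp
  fix s t :: real and D :: "real set" assume st: "0 \<le> s" "0 \<le> t" and D: "D \<in> sets borel"
  have sub: "subalgebra M (past M (process q) s)" by (rule subalgebra_past) simp
  have "finite_measure_subalgebra M (past M (process q) s)"
    using sub by (simp add: finite_measure_subalgebra_def finite_measure_subalgebra_axioms_def finite_measure_axioms)
  then interpret S: sigma_finite_subalgebra M "past M (process q) s"
    by (rule finite_measure_subalgebra_is_sigma_finite)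
  have m1: "(\<lambda>\<omega>. measure (transition t (process q s \<omega>)) D) \<in> borel_measurable (past M (process q) s)"
    by (rule measurable_compose[OF measurable_past measurable_transition_measure[OF st(2) D]]) (use st in auto)
  have m2: "(\<lambda>\<omega>. measure (transition t (process q s \<omega>)) D) \<in> borel_measurable M"
    by (rule measurable_from_subalg[OF sub m1])
  have le1: "measure (transition t x) D \<le> 1" for x
    using prob_space.prob_le_1[OF prob_transition[OF st(2)]] by simp
  show "AE \<omega> in M. real_cond_exp M (past M (process q) s) (\<lambda>\<omega>. indicator D (process q (s + t) \<omega>)) \<omega> =
      measure (transition t (process q s \<omega>)) D"
  proof (rule S.real_cond_exp_charact)
    show "integrable M (\<lambda>\<omega>. indicator D (process q (s + t) \<omega>) :: real)"
      by (rule integrable_const_bound[where B = 1]) (use st D in auto)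
    show "integrable M (\<lambda>\<omega>. measure (transition t (process q s \<omega>)) D)"
      by (rule integrable_const_bound[where B = 1]) (use m2 le1 in auto)
    fix A assume "A \<in> sets (past M (process q) s)"
    then obtain C where C: "C \<in> sets borel" "A = (\<lambda>\<omega>. path s (noise 0 \<omega>)) -` C \<inter> space M"
      using sets_past_process[OF st(1)] by blast
    have ind: "indicator A \<omega> = (indicator C (path s (noise 0 \<omega>)) :: real)" if "\<omega> \<in> space M" for \<omega>
      using that C by (auto simp: indicator_def)
    have "set_lebesgue_integral M A f = expectation (\<lambda>\<omega>. indicator C (path s (noise 0 \<omega>)) * f \<omega>)" for f :: "'a \<Rightarrow> real"
      unfolding set_lebesgue_integral_def by (rule Bochner_Integration.integral_cong) (auto simp: ind)
    then show "set_lebesgue_integral M A (\<lambda>\<omega>. indicator D (process q (s + t) \<omega>)) =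
        set_lebesgue_integral M A (\<lambda>\<omega>. measure (transition t (process q s \<omega>)) D)"
      using markov_expectation[OF st C(1) D, of q] by simp
  qed (rule m1)
qed

end

section \<open>The generator of the limit process\<close>

text \<open>Near 0 differentiability of \<open>F'\<close> at the single point \<open>z\<close> gives
  the error \<open>\<kappa> * h^2\<close>; away from 0 every term is dominated by a multiple of
  \<open>h^4\<close>, as \<open>F\<close> is bounded. The estimate covers all \<open>h\<close>
  because the displacement is unbounded, and it asks nothing of the derivatives far from
  \<open>z\<close>.\<close>

lemma second_order_taylor:
  fixes F :: "real \<Rightarrow> real"
  assumes bdd: "\<And>x. \<bar>F x\<bar> \<le> K" and d: "d > 0"
    and F: "\<And>x. \<bar>x - z\<bar> < d \<Longrightarrow> (F has_real_derivative F' x) (at x)"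
    and F': "(F' has_real_derivative c) (at z)" and \<kappa>: "\<kappa> > 0"
  shows "\<exists>C. \<forall>h. \<bar>F (z + h) - F z - F' z * h - c / 2 * h\<^sup>2\<bar> \<le> \<kappa> * h\<^sup>2 + C * h ^ 4"
proof -
  have "((\<lambda>h. (F' (z + h) - F' z) / h) \<longlongrightarrow> c) (at 0)" using F' by (simp add: DERIV_def)
  from tendstoD[OF this \<kappa>] obtain e where e: "e > 0"
    "\<And>h. h \<noteq> 0 \<Longrightarrow> \<bar>h\<bar> < e \<Longrightarrow> \<bar>(F' (z + h) - F' z) / h - c\<bar> < \<kappa>"
    by (auto simp: eventually_at dist_real_def)
  define \<eta> where "\<eta> = min d e / 2"
  have \<eta>: "\<eta> > 0" "\<eta> < d" "\<eta> < e" using d e by (auto simp: \<eta>_def)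
  define g where "g h = F (z + h) - F z - F' z * h - c / 2 * h\<^sup>2" for h
  have dg: "(g has_real_derivative F' (z + h) - F' z - c * h) (at h)" if "\<bar>h\<bar> < d" for h
  proof -
    have "((\<lambda>h. F (z + h)) has_real_derivative F' (z + h) * 1) (at h)"
      by (rule DERIV_chain2[of F]) (use that F[of "z + h"] in \<open>auto intro!: derivative_eq_intros\<close>)
    then show ?thesis unfolding g_def by (auto intro!: derivative_eq_intros)
  qed
  have dgb: "\<bar>F' (z + h) - F' z - c * h\<bar> \<le> \<kappa> * \<bar>h\<bar>" if "\<bar>h\<bar> < e" for h
  proof (cases "h = 0")
    case False
    have "\<bar>F' (z + h) - F' z - c * h\<bar> = \<bar>(F' (z + h) - F' z) / h - c\<bar> * \<bar>h\<bar>"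
      using False by (simp add: abs_mult[symmetric] field_simps)
    also have "\<dots> \<le> \<kappa> * \<bar>h\<bar>" using e(2)[OF False that] by (intro mult_right_mono) auto
    finally show ?thesis .
  qed simp
  have near: "\<bar>g h\<bar> \<le> \<kappa> * h\<^sup>2" if h: "\<bar>h\<bar> \<le> \<eta>" for h
  proof -
    have "norm (g h - g 0) \<le> (\<kappa> * \<bar>h\<bar>) * norm (h - 0)"
    proof (rule field_differentiable_bound[where S = "{-\<bar>h\<bar>..\<bar>h\<bar>}"])
      fix x assume x: "x \<in> {-\<bar>h\<bar>..\<bar>h\<bar>}"
      then have xh: "\<bar>x\<bar> \<le> \<bar>h\<bar>" by auto
      then show "(g has_field_derivative F' (z + x) - F' z - c * x) (at x within {-\<bar>h\<bar>..\<bar>h\<bar>})"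
        using dg[of x] h \<eta> by (auto intro: has_field_derivative_at_within)
      have "\<bar>F' (z + x) - F' z - c * x\<bar> \<le> \<kappa> * \<bar>x\<bar>" using dgb[of x] xh h \<eta> by auto
      also have "\<dots> \<le> \<kappa> * \<bar>h\<bar>" using xh \<kappa> by (intro mult_left_mono) auto
      finally show "norm (F' (z + x) - F' z - c * x) \<le> \<kappa> * \<bar>h\<bar>" by simp
    qed auto
    then show ?thesis by (simp add: g_def power2_eq_square abs_mult)
  qed
  have K0: "K \<ge> 0" using bdd[of 0] by linarith
  \<comment> \<open>For \<open>\<bar>h\<bar> > \<eta>\<close> the terms of order 0, 1 and 2 are
    raised to order 4 at the price of the fourth, third and second power of
    \<open>1 / \<eta>\<close>.\<close>
  define C where "C = 2 * K / \<eta> ^ 4 + \<bar>F' z\<bar> / \<eta> ^ 3 + \<bar>c / 2\<bar> / \<eta> ^ 2"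
  have C0: "C \<ge> 0" using K0 \<eta> by (simp add: C_def)
  have far: "\<bar>g h\<bar> \<le> C * h ^ 4" if h: "\<bar>h\<bar> > \<eta>" for h
  proof -
    have p: "\<eta> ^ k \<le> \<bar>h\<bar> ^ k" for k using h \<eta> by (intro power_mono) auto
    have q: "\<bar>h\<bar> ^ j \<le> \<bar>h\<bar> ^ 4 / \<eta> ^ k" if "j + k = 4" for j k
    proof -
      have "\<eta> ^ k * \<bar>h\<bar> ^ j \<le> \<bar>h\<bar> ^ k * \<bar>h\<bar> ^ j" by (rule mult_right_mono[OF p]) simp
      also have "\<dots> = \<bar>h\<bar> ^ 4" using that by (simp add: power_add[symmetric] add.commute)
      finally show ?thesis using \<eta> by (simp add: pos_le_divide_eq mult.commute)
    qed
    have "\<bar>g h\<bar> \<le> 2 * K + \<bar>F' z * h\<bar> + \<bar>c / 2 * h\<^sup>2\<bar>"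
      using bdd[of "z + h"] bdd[of z] unfolding g_def by linarith
    also have "\<dots> = 2 * K * \<bar>h\<bar> ^ 0 + \<bar>F' z\<bar> * \<bar>h\<bar> ^ 1 + \<bar>c / 2\<bar> * \<bar>h\<bar> ^ 2"
      by (simp add: abs_mult)
    also have "\<dots> \<le> 2 * K * (\<bar>h\<bar> ^ 4 / \<eta> ^ 4) + \<bar>F' z\<bar> * (\<bar>h\<bar> ^ 4 / \<eta> ^ 3) + \<bar>c / 2\<bar> * (\<bar>h\<bar> ^ 4 / \<eta> ^ 2)"
      using K0 by (intro add_mono mult_left_mono q) auto
    also have "\<dots> = C * h ^ 4" by (simp add: C_def algebra_simps)
    finally show ?thesis .
  qed
  have "\<bar>g h\<bar> \<le> \<kappa> * h\<^sup>2 + C * h ^ 4" for h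
  proof (cases "\<bar>h\<bar> \<le> \<eta>")
    case True
    have "0 \<le> C * h ^ 4" using C0 by simp
    then show ?thesis using near[OF True] by linarith
  next
    case False
    have "0 \<le> \<kappa> * h\<^sup>2" using \<kappa> by simp
    then show ?thesis using far[of h] False by linarith
  qed
  then show ?thesis unfolding g_def by blast
qed

lemma tendsto_at_rightI:
  assumes "\<And>X :: nat \<Rightarrow> real. (\<And>i. 0 < X i) \<Longrightarrow> (\<And>i. X i \<le> 1) \<Longrightarrow> X \<longlonglongrightarrow> 0 \<Longrightarrow>
    filterlim X (at_right 0) sequentially \<Longrightarrow> (\<lambda>i. f (X i)) \<longlonglongrightarrow> l"
  shows "(f \<longlongrightarrow> l) (at_right (0::real))"
  unfolding at_within_Icc_at_right[OF zero_less_one, symmetric] tendsto_at_iff_sequentially comp_def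
proof (intro allI impI)
  fix X :: "nat \<Rightarrow> real" assume X: "\<forall>i. X i \<in> {0..1} - {0}" "X \<longlonglongrightarrow> 0"
  have pos: "0 < X i" "X i \<le> 1" "X i \<noteq> 0" for i using spec[OF X(1), of i] by auto
  then have "filterlim X (at_right 0) sequentially" using X(2) by (auto simp: filterlim_at)
  with pos show "(\<lambda>i. f (X i)) \<longlonglongrightarrow> l" using X(2) by (intro assms) auto
qed

section \<open>Short time moments of the displacement and the generator on smooth functions\<close>

context media_noise
begin

definition displacement :: "real \<Rightarrow> real \<Rightarrow> 'a \<Rightarrow> real" where
  "displacement q t \<omega> = scale (process q t \<omega>) - scale q"

text \<open>The time integral of the drift. Defining it by subtraction makes it measurable at
  once.\<close>

definition travel :: "real \<Rightarrow> real \<Rightarrow> 'a \<Rightarrow> real" where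
  "travel q t \<omega> = displacement q t \<omega> - noise 0 \<omega> t"

lemma B_nonneg: "0 \<le> B"
  using bounded_by[of 0] by linarith

lemma measurable_scale [measurable]: "scale \<in> borel_measurable borel"
  by (rule borel_measurable_continuous_onI) (rule continuous_scale)

lemma measurable_displacement [measurable]: "0 \<le> t \<Longrightarrow> displacement q t \<in> borel_measurable M"
  unfolding displacement_def[abs_def]
  by (intro borel_measurable_diff measurable_compose[OF _ measurable_scale]) auto

lemma measurable_travel [measurable]: "0 \<le> t \<Longrightarrow> travel q t \<in> borel_measurable M"
  unfolding travel_def[abs_def] by simp

lemma travel_eq:
  assumes "\<omega> \<in> space M" "0 \<le> t"
  shows "travel q t \<omega> = integral {0..t} (\<lambda>s. b (process q s \<omega>))"
  using solves_flow[OF continuous_noise[of 0 \<omega>], of q] assms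
  by (simp add: solves_def travel_def displacement_def process_def)

lemma continuous_drift_process: "\<omega> \<in> space M \<Longrightarrow> continuous_on {0..t} (\<lambda>s. b (process q s \<omega>))"
  by (rule continuous_on_compose2[OF continuous_drift continuous_on_subset[OF continuous_process]]) auto

lemma travel_bound: "\<omega> \<in> space M \<Longrightarrow> 0 \<le> t \<Longrightarrow> \<bar>travel q t \<omega>\<bar> \<le> B * t"
  using integral_bound[of 0 t "\<lambda>s. b (process q s \<omega>)" B] bounded_by
  by (simp add: travel_eq continuous_drift_process)

lemma travel_rate:
  assumes w: "\<omega> \<in> space M"
  shows "((\<lambda>t. travel q t \<omega> / t) \<longlongrightarrow> b q) (at_right 0)"
proof -
  have "((\<lambda>t. integral {0..t} (\<lambda>s. b (process q s \<omega>))) has_real_derivative b (process q 0 \<omega>)) (at 0 within {0..1})"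
    by (rule integral_has_real_derivative) (use w in \<open>auto intro: continuous_drift_process\<close>)
  then have "((\<lambda>t. integral {0..t} (\<lambda>s. b (process q s \<omega>)) / t) \<longlongrightarrow> b q) (at_right 0)"
    using w by (simp add: has_field_derivative_iff at_within_Icc_at_right process_0)
  moreover have "eventually (\<lambda>t. integral {0..t} (\<lambda>s. b (process q s \<omega>)) / t = travel q t \<omega> / t) (at_right 0)"
    using eventually_at_right_less by eventually_elim (simp add: travel_eq w)
  ultimately show ?thesis by (rule Lim_transform_eventually)
qed

lemma travel_mean_rate: "((\<lambda>t. expectation (travel q t) / t) \<longlongrightarrow> b q) (at_right 0)"
proof (rule tendsto_at_rightI)
  fix X :: "nat \<Rightarrow> real" assume X: "\<And>i. 0 < X i" "\<And>i. X i \<le> 1" "X \<longlonglongrightarrow> 0"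
      and XX: "filterlim X (at_right 0) sequentially"
  have "(\<lambda>i. expectation (\<lambda>\<omega>. travel q (X i) \<omega> / X i)) \<longlonglongrightarrow> expectation (\<lambda>\<omega>. b q)"
  proof (rule integral_dominated_convergence[where w = "\<lambda>_. B"])
    show "AE \<omega> in M. (\<lambda>i. travel q (X i) \<omega> / X i) \<longlonglongrightarrow> b q"
      by (rule AE_I2, rule filterlim_compose[OF travel_rate XX])
    show "AE \<omega> in M. norm (travel q (X i) \<omega> / X i) \<le> B" for i
    proof (rule AE_I2)
      fix \<omega> assume "\<omega> \<in> space M"
      from travel_bound[OF this, of "X i" q] X(1)[of i]
      show "norm (travel q (X i) \<omega> / X i) \<le> B" by (simp add: pos_divide_le_eq)
    qed
  qed (use X(1)[THEN less_imp_le] in auto)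
  then show "(\<lambda>i. expectation (travel q (X i)) / X i) \<longlonglongrightarrow> b q"
    by (simp add: prob_space)
qed

lemma noise_integrable_power:
  assumes t: "0 < t"
  shows "integrable M (\<lambda>\<omega>. noise 0 \<omega> t)" "expectation (\<lambda>\<omega>. noise 0 \<omega> t) = 0"
    "integrable M (\<lambda>\<omega>. (noise 0 \<omega> t)\<^sup>2)" "expectation (\<lambda>\<omega>. (noise 0 \<omega> t)\<^sup>2) = t"
    "integrable M (\<lambda>\<omega>. (noise 0 \<omega> t) ^ 4)" "expectation (\<lambda>\<omega>. (noise 0 \<omega> t) ^ 4) = 3 * t\<^sup>2"
proof -
  show "integrable M (\<lambda>\<omega>. (noise 0 \<omega> t)\<^sup>2)" "expectation (\<lambda>\<omega>. (noise 0 \<omega> t)\<^sup>2) = t"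
    "integrable M (\<lambda>\<omega>. (noise 0 \<omega> t) ^ 4)" "expectation (\<lambda>\<omega>. (noise 0 \<omega> t) ^ 4) = 3 * t\<^sup>2"
    using noise_moments[OF t] by (auto simp: has_bochner_integral_iff)
  have d: "distributed M lborel (\<lambda>\<omega>. noise 0 \<omega> t) (\<lambda>x. ennreal (normal_density 0 (sqrt t) x))"
    using increment_distributed[of 0 t] t by (simp add: noise_def)
  have h: "has_bochner_integral lborel (\<lambda>x. normal_density 0 (sqrt t) x * x) 0"
    by (rule normal_moment_nz_1) (use t in simp)
  show "integrable M (\<lambda>\<omega>. noise 0 \<omega> t)"
    using distributed_integrable[OF d, of "\<lambda>x. x"] h by (auto simp: has_bochner_integral_iff)
  show "expectation (\<lambda>\<omega>. noise 0 \<omega> t) = 0"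
    using distributed_integral[OF d, of "\<lambda>x. x"] h by (auto simp: has_bochner_integral_iff)
qed

lemma travel_integrable:
  assumes t: "0 < t"
  shows "integrable M (travel q t)"
  by (rule integrable_const_bound[where B = "B * t"]) (use t travel_bound in \<open>auto\<close>)

lemma displacement_eq: "displacement q t \<omega> = noise 0 \<omega> t + travel q t \<omega>"
  by (simp add: travel_def)

text \<open>The mixed term is split with weight \<open>sqrt t\<close>, as
  \<open>2 * \<bar>n * i\<bar> \<le> sqrt t * n^2 + i^2 / sqrt t\<close>. Since
  \<open>\<bar>i\<bar> \<le> B * t\<close> and \<open>n^2\<close> has mean \<open>t\<close>, all
  errors have mean of order \<open>t * sqrt t\<close> or smaller, negligible against
  \<open>t\<close>.\<close>

lemma displacement_sq_close:
  assumes w: "\<omega> \<in> space M" and t: "0 < t"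
  shows "\<bar>(displacement q t \<omega>)\<^sup>2 - (noise 0 \<omega> t)\<^sup>2\<bar> \<le> sqrt t * (noise 0 \<omega> t)\<^sup>2 + (B\<^sup>2 * t * sqrt t + B\<^sup>2 * t\<^sup>2)"
proof -
  define n where "n = noise 0 \<omega> t"
  define i where "i = travel q t \<omega>"
  define s where "s = sqrt t"
  have s: "s > 0" "s\<^sup>2 = t" using t by (auto simp: s_def)
  have "\<bar>i\<bar> \<le> B * t" unfolding i_def using travel_bound[OF w, of t q] t by simp
  then have i2: "i\<^sup>2 \<le> B\<^sup>2 * t\<^sup>2" using abs_le_square_iff[of i "B * t"] B_nonneg t by (simp add: power_mult_distrib)
  have "0 \<le> (s * \<bar>n\<bar> - \<bar>i\<bar>)\<^sup>2" by simp
  then have "2 * (\<bar>n\<bar> * \<bar>i\<bar>) * s \<le> s\<^sup>2 * n\<^sup>2 + i\<^sup>2" by (simp add: power2_diff power_mult_distrib algebra_simps)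
  also have "\<dots> \<le> s\<^sup>2 * n\<^sup>2 + B\<^sup>2 * t\<^sup>2" using i2 by simp
  also have "\<dots> = (s * n\<^sup>2 + B\<^sup>2 * t * s) * s"
    by (simp add: s(2)[symmetric] power2_eq_square algebra_simps)
  finally have "2 * (\<bar>n\<bar> * \<bar>i\<bar>) \<le> s * n\<^sup>2 + B\<^sup>2 * t * s" using s(1) by (simp only: mult_le_cancel_right_pos)
  moreover have "\<bar>(n + i)\<^sup>2 - n\<^sup>2\<bar> \<le> 2 * (\<bar>n\<bar> * \<bar>i\<bar>) + i\<^sup>2"
  proof -
    have "(n + i)\<^sup>2 - n\<^sup>2 = 2 * (n * i) + i\<^sup>2" by (simp add: power2_sum)
    moreover have "\<bar>2 * (n * i) + i\<^sup>2\<bar> \<le> 2 * \<bar>n * i\<bar> + i\<^sup>2"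
      using zero_le_power2[of i] by linarith
    ultimately show ?thesis by (simp add: abs_mult)
  qed
  ultimately show ?thesis
    using i2 unfolding displacement_eq n_def[symmetric] i_def[symmetric] s_def[symmetric] by linarith
qed

text \<open>Applying \<open>(x + y)^2 \<le> 2 * x^2 + 2 * y^2\<close> twice yields the factor
  8.\<close>

lemma displacement_pow4_le:
  assumes w: "\<omega> \<in> space M" and t: "0 < t"
  shows "(displacement q t \<omega>) ^ 4 \<le> 8 * (noise 0 \<omega> t) ^ 4 + 8 * (B * t) ^ 4"
proof -
  define n where "n = noise 0 \<omega> t"
  define i where "i = travel q t \<omega>"
  have "\<bar>i\<bar> \<le> B * t" unfolding i_def using travel_bound[OF w, of t q] t by simp
  then have i4: "i ^ 4 \<le> (B * t) ^ 4" using power_mono[of "\<bar>i\<bar>" "B * t" 4] by simp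
  have sq: "(x + y)\<^sup>2 \<le> 2 * x\<^sup>2 + 2 * y\<^sup>2" for x y :: real
    using sum_squares_bound[of x y] by (simp add: power2_sum)
  have "(n + i) ^ 4 = ((n + i)\<^sup>2)\<^sup>2" by simp
  also have "\<dots> \<le> (2 * n\<^sup>2 + 2 * i\<^sup>2)\<^sup>2" by (rule power_mono[OF sq]) simp
  also have "\<dots> \<le> 2 * (2 * n\<^sup>2)\<^sup>2 + 2 * (2 * i\<^sup>2)\<^sup>2" by (rule sq)
  also have "\<dots> = 8 * n ^ 4 + 8 * i ^ 4" by (simp add: power_mult_distrib)
  finally show ?thesis using i4 unfolding displacement_eq n_def i_def by linarith
qed

lemma displacement_integrable:
  assumes t: "0 < t"
  shows "integrable M (displacement q t)" "integrable M (\<lambda>\<omega>. (displacement q t \<omega>)\<^sup>2)" "integrable M (\<lambda>\<omega>. (displacement q t \<omega>) ^ 4)"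
proof -
  note n = noise_integrable_power[OF t]
  have m: "displacement q t \<in> borel_measurable M" using t by simp
  show "integrable M (displacement q t)"
    unfolding displacement_eq[abs_def] by (intro Bochner_Integration.integrable_add n travel_integrable[OF t])
  have "integrable M (\<lambda>\<omega>. (noise 0 \<omega> t)\<^sup>2 + (sqrt t * (noise 0 \<omega> t)\<^sup>2 + (B\<^sup>2 * t * sqrt t + B\<^sup>2 * t\<^sup>2)))"
    using n by (intro Bochner_Integration.integrable_add integrable_mult_right) auto
  then show "integrable M (\<lambda>\<omega>. (displacement q t \<omega>)\<^sup>2)"
  proof (rule Bochner_Integration.integrable_bound)
    show "AE \<omega> in M. norm ((displacement q t \<omega>)\<^sup>2) \<le> norm ((noise 0 \<omega> t)\<^sup>2 + (sqrt t * (noise 0 \<omega> t)\<^sup>2 + (B\<^sup>2 * t * sqrt t + B\<^sup>2 * t\<^sup>2)))"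
      by (rule AE_I2) (use displacement_sq_close[OF _ t, of _ q] t in \<open>fastforce simp: abs_le_iff\<close>)
  qed (use m in measurable)
  have "integrable M (\<lambda>\<omega>. 8 * (noise 0 \<omega> t) ^ 4 + 8 * (B * t) ^ 4)"
    using n by (intro Bochner_Integration.integrable_add integrable_mult_right) auto
  then show "integrable M (\<lambda>\<omega>. (displacement q t \<omega>) ^ 4)"
  proof (rule Bochner_Integration.integrable_bound)
    show "AE \<omega> in M. norm ((displacement q t \<omega>) ^ 4) \<le> norm (8 * (noise 0 \<omega> t) ^ 4 + 8 * (B * t) ^ 4)"
      by (rule AE_I2) (use displacement_pow4_le[OF _ t, of _ q] in \<open>fastforce\<close>)
  qed (use m in measurable)
qed

lemma displacement_rate1: "((\<lambda>t. expectation (displacement q t) / t) \<longlongrightarrow> b q) (at_right 0)"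
proof (rule Lim_transform_eventually[OF travel_mean_rate])
  show "eventually (\<lambda>t. expectation (travel q t) / t = expectation (displacement q t) / t) (at_right 0)"
    using eventually_at_right_less
  proof eventually_elim
    case (elim t)
    then show ?case
      using noise_integrable_power[OF elim] travel_integrable[OF elim, of q]
      by (simp add: displacement_eq[abs_def])
  qed
qed

lemma displacement_rate2: "((\<lambda>t. expectation (\<lambda>\<omega>. (displacement q t \<omega>)\<^sup>2) / t) \<longlongrightarrow> 1) (at_right 0)"
proof -
  let ?g = "\<lambda>t. sqrt t + B\<^sup>2 * sqrt t + B\<^sup>2 * t"
  have "(?g \<longlongrightarrow> ?g 0) (at_right 0)" by (intro tendsto_intros)
  then have lim: "(?g \<longlongrightarrow> 0) (at_right 0)" by simp
  have ev: "eventually (\<lambda>t. norm (expectation (\<lambda>\<omega>. (displacement q t \<omega>)\<^sup>2) / t - 1) \<le> ?g t) (at_right 0)"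
    using eventually_at_right_less
  proof eventually_elim
    case (elim t)
    note n = noise_integrable_power[OF elim]
    note d = displacement_integrable[OF elim, of q]
    have "\<bar>expectation (\<lambda>\<omega>. (displacement q t \<omega>)\<^sup>2) - t\<bar> = \<bar>expectation (\<lambda>\<omega>. (displacement q t \<omega>)\<^sup>2 - (noise 0 \<omega> t)\<^sup>2)\<bar>"
      using n d by simp
    also have "\<dots> \<le> expectation (\<lambda>\<omega>. \<bar>(displacement q t \<omega>)\<^sup>2 - (noise 0 \<omega> t)\<^sup>2\<bar>)"
      by (rule integral_abs_bound)
    also have "\<dots> \<le> expectation (\<lambda>\<omega>. sqrt t * (noise 0 \<omega> t)\<^sup>2 + (B\<^sup>2 * t * sqrt t + B\<^sup>2 * t\<^sup>2))"
      by (intro integral_mono integrable_abs Bochner_Integration.integrable_diff Bochner_Integration.integrable_add integrable_mult_right displacement_sq_close elim)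
         (use n d in auto)
    also have "\<dots> = sqrt t * t + (B\<^sup>2 * t * sqrt t + B\<^sup>2 * t\<^sup>2)"
      using n by (simp add: prob_space)
    finally have "\<bar>expectation (\<lambda>\<omega>. (displacement q t \<omega>)\<^sup>2) - t\<bar> \<le> ?g t * t"
      by (simp add: algebra_simps power2_eq_square)
    moreover have "expectation (\<lambda>\<omega>. (displacement q t \<omega>)\<^sup>2) / t - 1 = (expectation (\<lambda>\<omega>. (displacement q t \<omega>)\<^sup>2) - t) / t"
      using elim by (simp add: field_simps)
    ultimately show ?case using elim by (simp add: pos_divide_le_eq)
  qed
  have "((\<lambda>t. expectation (\<lambda>\<omega>. (displacement q t \<omega>)\<^sup>2) / t - 1) \<longlongrightarrow> 0) (at_right 0)"
    by (rule Lim_null_comparison[OF ev lim])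
  then show ?thesis by (rule iffD2[OF Lim_null])
qed

lemma displacement_rate4: "((\<lambda>t. expectation (\<lambda>\<omega>. (displacement q t \<omega>) ^ 4) / t) \<longlongrightarrow> 0) (at_right 0)"
proof -
  let ?g = "\<lambda>t. 24 * t + 8 * B ^ 4 * t ^ 3"
  have "(?g \<longlongrightarrow> ?g 0) (at_right 0)" by (intro tendsto_intros)
  then have lim: "(?g \<longlongrightarrow> 0) (at_right 0)" by simp
  have ev: "eventually (\<lambda>t. norm (expectation (\<lambda>\<omega>. (displacement q t \<omega>) ^ 4) / t) \<le> ?g t) (at_right 0)"
    using eventually_at_right_less
  proof eventually_elim
    case (elim t)
    note n = noise_integrable_power[OF elim]
    note d = displacement_integrable[OF elim, of q]
    have "expectation (\<lambda>\<omega>. (displacement q t \<omega>) ^ 4) \<le> expectation (\<lambda>\<omega>. 8 * (noise 0 \<omega> t) ^ 4 + 8 * (B * t) ^ 4)"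
      by (intro integral_mono Bochner_Integration.integrable_add integrable_mult_right displacement_pow4_le elim)
         (use n d in auto)
    also have "\<dots> = 8 * (3 * t\<^sup>2) + 8 * (B * t) ^ 4" using n by (simp add: prob_space)
    also have "\<dots> = ?g t * t" by (simp add: algebra_simps power2_eq_square power3_eq_cube power_numeral_reduce)
    finally have "expectation (\<lambda>\<omega>. (displacement q t \<omega>) ^ 4) / t \<le> ?g t" using elim by (simp add: pos_divide_le_eq)
    moreover have "0 \<le> expectation (\<lambda>\<omega>. (displacement q t \<omega>) ^ 4)" by (rule Bochner_Integration.integral_nonneg) simp
    ultimately show ?case using elim by simp
  qed
  show ?thesis by (rule Lim_null_comparison[OF ev lim])
qed

text \<open>The difference quotient of the semigroup, with the test function \<open>\<phi>\<close>
  read in the coordinate \<open>z\<close> and the starting point \<open>q\<close> in the original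
  one.\<close>

definition rate :: "(real \<Rightarrow> real) \<Rightarrow> real \<Rightarrow> real \<Rightarrow> real" where
  "rate \<phi> q t = expectation (\<lambda>\<omega>. \<phi> (scale q + displacement q t \<omega>) - \<phi> (scale q)) / t"

lemma bounded_increment_integrable:
  fixes \<phi> :: "real \<Rightarrow> real"
  assumes "\<phi> \<in> borel_measurable borel" "\<And>x. \<bar>\<phi> x\<bar> \<le> K" "0 < t"
  shows "integrable M (\<lambda>\<omega>. \<phi> (scale q + displacement q t \<omega>) - \<phi> (scale q))"
proof (rule integrable_const_bound[where B = "2 * K"])
  show "AE \<omega> in M. norm (\<phi> (scale q + displacement q t \<omega>) - \<phi> (scale q)) \<le> 2 * K"
  proof (rule AE_I2)
    fix \<omega> show "norm (\<phi> (scale q + displacement q t \<omega>) - \<phi> (scale q)) \<le> 2 * K"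
      using assms(2)[of "scale q"] assms(2)[of "scale q + displacement q t \<omega>"] unfolding real_norm_def by linarith
  qed
  have [measurable]: "\<phi> \<in> borel_measurable borel" "displacement q t \<in> borel_measurable M" using assms by auto
  show "(\<lambda>\<omega>. \<phi> (scale q + displacement q t \<omega>) - \<phi> (scale q)) \<in> borel_measurable M" by measurable
qed

text \<open>After division by \<open>t\<close> the first and second moments tend to
  \<open>b q\<close> and 1. The quadratic error contributes at most \<open>\<kappa>\<close> in the
  limit and the quartic one nothing, for any size of \<open>C\<close>; as \<open>\<kappa>\<close> is
  arbitrary, the remainder vanishes.\<close>

lemma rate_tendsto:
  assumes m: "\<phi> \<in> borel_measurable borel" and K: "\<And>x. \<bar>\<phi> x\<bar> \<le> K"
    and taylor: "\<And>\<kappa>. \<kappa> > 0 \<Longrightarrow> \<exists>C. \<forall>h. \<bar>\<phi> (scale q + h) - \<phi> (scale q) - a * h - c / 2 * h\<^sup>2\<bar> \<le> \<kappa> * h\<^sup>2 + C * h ^ 4"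
  shows "(rate \<phi> q \<longlongrightarrow> 1 / 2 * c + b q * a) (at_right 0)"
proof -
  let ?D1 = "\<lambda>t. expectation (displacement q t) / t"
  let ?D2 = "\<lambda>t. expectation (\<lambda>\<omega>. (displacement q t \<omega>)\<^sup>2) / t"
  let ?D4 = "\<lambda>t. expectation (\<lambda>\<omega>. (displacement q t \<omega>) ^ 4) / t"
  have rest: "((\<lambda>t. rate \<phi> q t - (a * ?D1 t + c / 2 * ?D2 t)) \<longlongrightarrow> 0) (at_right 0)"
  proof (rule tendstoI)
    fix e :: real assume e: "e > 0"
    define \<kappa> where "\<kappa> = e / 4"
    have \<kappa>: "\<kappa> > 0" using e by (simp add: \<kappa>_def)
    obtain C where C: "\<And>h. \<bar>\<phi> (scale q + h) - \<phi> (scale q) - a * h - c / 2 * h\<^sup>2\<bar> \<le> \<kappa> * h\<^sup>2 + C * h ^ 4"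
      using taylor[OF \<kappa>] by blast
    have "((\<lambda>t. \<kappa> * ?D2 t + C * ?D4 t) \<longlongrightarrow> \<kappa> * 1 + C * 0) (at_right 0)"
      by (intro tendsto_intros displacement_rate2 displacement_rate4)
    then have "eventually (\<lambda>t. \<kappa> * ?D2 t + C * ?D4 t < e) (at_right 0)"
      by (rule order_tendstoD) (use e in \<open>simp add: \<kappa>_def\<close>)
    then show "eventually (\<lambda>t. dist (rate \<phi> q t - (a * ?D1 t + c / 2 * ?D2 t)) 0 < e) (at_right 0)"
      using eventually_at_right_less
    proof eventually_elim
      case (elim t)
      note d = displacement_integrable[OF elim(2), of q]
      note i = bounded_increment_integrable[OF m K elim(2), of q]
      let ?R = "\<lambda>\<omega>. \<phi> (scale q + displacement q t \<omega>) - \<phi> (scale q) - a * displacement q t \<omega> - c / 2 * (displacement q t \<omega>)\<^sup>2"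
      have iR: "integrable M ?R"
        by (intro Bochner_Integration.integrable_diff[OF Bochner_Integration.integrable_diff[OF i]] integrable_mult_right d)
      have "rate \<phi> q t - (a * ?D1 t + c / 2 * ?D2 t) = expectation ?R / t"
        using d i by (simp add: rate_def diff_divide_distrib add_divide_distrib)
      moreover have "\<bar>expectation ?R / t\<bar> \<le> \<kappa> * ?D2 t + C * ?D4 t"
      proof -
        have "\<bar>expectation ?R\<bar> \<le> expectation (\<lambda>\<omega>. \<bar>?R \<omega>\<bar>)" by (rule integral_abs_bound)
        also have "\<dots> \<le> expectation (\<lambda>\<omega>. \<kappa> * (displacement q t \<omega>)\<^sup>2 + C * (displacement q t \<omega>) ^ 4)"
          by (intro integral_mono integrable_abs iR Bochner_Integration.integrable_add integrable_mult_right d C)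
        also have "\<dots> = (\<kappa> * ?D2 t + C * ?D4 t) * t"
          using d elim(2) by (simp add: field_simps)
        finally show ?thesis using elim(2) by (simp add: pos_divide_le_eq)
      qed
      ultimately have "\<bar>rate \<phi> q t - (a * ?D1 t + c / 2 * ?D2 t)\<bar> \<le> \<kappa> * ?D2 t + C * ?D4 t"
        by simp
      then show ?case using elim(1) by simp
    qed
  qed
  have "((\<lambda>t. (rate \<phi> q t - (a * ?D1 t + c / 2 * ?D2 t)) + (a * ?D1 t + c / 2 * ?D2 t)) \<longlongrightarrow> 0 + (a * b q + c / 2 * 1)) (at_right 0)"
    by (intro tendsto_add[OF rest] tendsto_intros displacement_rate1 displacement_rate2)
  then show ?thesis by (simp add: mult.commute add.commute)
qed

lemma rate_tendsto_deriv:
  assumes m: "F \<in> borel_measurable borel" and K: "\<And>x. \<bar>F x\<bar> \<le> K" and d: "d > 0"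
    and F: "\<And>x. \<bar>x - scale q\<bar> < d \<Longrightarrow> (F has_real_derivative F' x) (at x)"
    and F': "(F' has_real_derivative c) (at (scale q))"
  shows "(rate F q \<longlongrightarrow> 1 / 2 * c + b q * F' (scale q)) (at_right 0)"
  by (rule rate_tendsto[OF m K second_order_taylor[OF K d F F']])

text \<open>Growth of fourth order is invisible to the rate. For bounded \<open>\<phi>\<close> a
  local maximum at \<open>scale q\<close> is therefore as good as a global one.\<close>

lemma rate_le:
  assumes m: "\<phi> \<in> borel_measurable borel" and K: "\<And>x. \<bar>\<phi> x\<bar> \<le> K"
    and le: "\<And>h. \<phi> (scale q + h) - \<phi> (scale q) \<le> C * h ^ 4"
    and lim: "(rate \<phi> q \<longlongrightarrow> r) (at_right 0)"
  shows "r \<le> 0"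
proof (rule tendsto_le[OF _ _ lim])
  have "((\<lambda>t. C * (expectation (\<lambda>\<omega>. (displacement q t \<omega>) ^ 4) / t)) \<longlongrightarrow> C * 0) (at_right 0)"
    by (intro tendsto_intros displacement_rate4)
  then show "((\<lambda>t. C * (expectation (\<lambda>\<omega>. (displacement q t \<omega>) ^ 4) / t)) \<longlongrightarrow> 0) (at_right 0)" by simp
  show "eventually (\<lambda>t. rate \<phi> q t \<le> C * (expectation (\<lambda>\<omega>. (displacement q t \<omega>) ^ 4) / t)) (at_right 0)"
    using eventually_at_right_less
  proof eventually_elim
    case (elim t)
    have "expectation (\<lambda>\<omega>. \<phi> (scale q + displacement q t \<omega>) - \<phi> (scale q)) \<le> expectation (\<lambda>\<omega>. C * (displacement q t \<omega>) ^ 4)"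
      by (intro integral_mono bounded_increment_integrable[OF m K elim] integrable_mult_right displacement_integrable elim le)
    then show ?case using elim displacement_integrable(3)[OF elim, of q] by (simp add: rate_def divide_right_mono)
  qed
qed simp

lemma rate_eq_transition:
  assumes "f \<in> borel_measurable borel" "\<And>x. \<bar>f x\<bar> \<le> K" "0 < t"
  shows "((\<integral>y. f y \<partial>transition t q) - f q) / t = rate (\<lambda>z. f (unscale z)) q t"
proof -
  have "integrable M (\<lambda>\<omega>. f (process q t \<omega>))"
    by (rule integrable_const_bound[where B = K])
       (use assms in \<open>auto intro: measurable_compose[OF measurable_process]\<close>)
  then show ?thesis
    using assms by (simp add: rate_def displacement_def integral_transition prob_space)
qed

text \<open>\<open>\<psi>\<close> may be unbounded, so outside [a,c] it is replaced by its end
  values. The clamped function has the same derivatives at the interior maximum, hence a rate given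
  by the differential operator, and the difference \<open>F - cl\<close> has a local maximum
  there.\<close>

lemma rate_maximum_principle:
  assumes F: "continuous_on UNIV F" "\<And>x. \<bar>F x\<bar> \<le> K" and lim: "(rate F q \<longlongrightarrow> r) (at_right 0)"
    and \<psi>: "\<And>x. (\<psi> has_real_derivative \<psi>' x) (at x)" "\<And>x. (\<psi>' has_real_derivative \<psi>'' x) (at x)"
    and q: "a < scale q" "scale q < c"
    and mx: "\<And>x. x \<in> {a..c} \<Longrightarrow> F x - \<psi> x \<le> F (scale q) - \<psi> (scale q)"
  shows "r \<le> 1 / 2 * \<psi>'' (scale q) + b q * \<psi>' (scale q)"
proof -
  define z where "z = scale q"
  define cl where "cl x = \<psi> (max a (min x c))" for x
  have c\<psi>: "continuous_on S \<psi>" for S by (rule DERIV_continuous_on) (rule DERIV_subset[OF \<psi>(1) subset_UNIV])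
  have ccl: "continuous_on UNIV cl"
    unfolding cl_def by (rule continuous_on_compose2[OF c\<psi>[of UNIV]]) (auto intro!: continuous_intros)
  obtain K' where K': "\<forall>x\<in>{a..c}. \<bar>\<psi> x\<bar> \<le> K'"
    using continuous_abs_bounded[OF c\<psi>] by (rule exE)
  have Kcl: "\<bar>cl x\<bar> \<le> K'" for x unfolding cl_def using K' q by auto
  define d where "d = min (z - a) (c - z)"
  have d: "d > 0" using q by (simp add: d_def z_def)
  have in_ac: "a < x \<and> x < c" if "\<bar>x - z\<bar> < d" for x
    using that unfolding d_def min_less_iff_conj by linarith
  have clpsi: "cl x = \<psi> x" if "\<bar>x - z\<bar> < d" for x using in_ac[OF that] by (simp add: cl_def)
  have dcl: "(cl has_real_derivative \<psi>' x) (at x)" if "\<bar>x - scale q\<bar> < d" for x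
  proof (rule has_field_derivative_transform_within_open[OF \<psi>(1), where S = "{a<..<c}"])
    show "x \<in> {a<..<c}" using in_ac[of x] that by (simp add: z_def)
  qed (auto simp: cl_def)
  have mF: "F \<in> borel_measurable borel" and mcl: "cl \<in> borel_measurable borel"
    using F(1) ccl by (auto intro: borel_measurable_continuous_onI)
  have limcl: "(rate cl q \<longlongrightarrow> 1 / 2 * \<psi>'' (scale q) + b q * \<psi>' (scale q)) (at_right 0)"
    by (rule rate_tendsto_deriv[OF mcl Kcl d dcl \<psi>(2)])
  have rd: "eventually (\<lambda>t. rate F q t - rate cl q t = rate (\<lambda>x. F x - cl x) q t) (at_right 0)"
    using eventually_at_right_less
  proof eventually_elim
    case (elim t)
    show ?case
      unfolding rate_def diff_divide_distrib[symmetric]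
      by (subst Bochner_Integration.integral_diff[symmetric, OF bounded_increment_integrable[OF mF F(2) elim] bounded_increment_integrable[OF mcl Kcl elim]])
         (simp add: algebra_simps)
  qed
  have limd: "(rate (\<lambda>x. F x - cl x) q \<longlongrightarrow> r - (1 / 2 * \<psi>'' (scale q) + b q * \<psi>' (scale q))) (at_right 0)"
    by (rule Lim_transform_eventually[OF tendsto_diff[OF lim limcl] rd])
  have KK: "0 \<le> K" "0 \<le> K'" using F(2)[of 0] Kcl[of 0] by linarith+
  have "r - (1 / 2 * \<psi>'' (scale q) + b q * \<psi>' (scale q)) \<le> 0"
  proof (rule rate_le[OF _ _ _ limd])
    show "(\<lambda>x. F x - cl x) \<in> borel_measurable borel" using mF mcl by simp
    show "\<bar>F x - cl x\<bar> \<le> K + K'" for x using F(2)[of x] Kcl[of x] by linarith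
    fix h
    \<comment> \<open>Outside the distance \<open>d\<close> the quotient \<open>h^4 / d^4\<close> is
      at least 1, so this constant covers the largest possible increment \<open>2 * (K + K')\<close>
      of \<open>F - cl\<close>.\<close>
    define C where "C = 2 * (K + K') / d ^ 4"
    have C: "0 \<le> C" using KK d by (simp add: C_def)
    show "F (scale q + h) - cl (scale q + h) - (F (scale q) - cl (scale q)) \<le> C * h ^ 4"
    proof (cases "\<bar>h\<bar> < d")
      case True
      have "F (z + h) - \<psi> (z + h) \<le> F z - \<psi> z"
        unfolding z_def by (rule mx) (use in_ac[of "z + h"] True in \<open>auto simp: z_def\<close>)
      moreover have "0 \<le> C * h ^ 4" using C by simp
      ultimately show ?thesis using clpsi[of "z + h"] clpsi[of z] True d by (simp add: z_def)
    next
      case False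
      have "d ^ 4 \<le> \<bar>h\<bar> ^ 4" using False d by (intro power_mono) auto
      then have "1 \<le> h ^ 4 / d ^ 4" using d by simp
      then have "2 * (K + K') * 1 \<le> 2 * (K + K') * (h ^ 4 / d ^ 4)" using KK by (intro mult_left_mono) auto
      then have "2 * (K + K') \<le> C * h ^ 4" by (simp add: C_def)
      moreover have "F (scale q + h) - cl (scale q + h) - (F (scale q) - cl (scale q)) \<le> 2 * (K + K')"
        using F(2)[of "scale q + h"] F(2)[of "scale q"] Kcl[of "scale q + h"] Kcl[of "scale q"] by (simp add: abs_le_iff)
      ultimately show ?thesis by simp
    qed
  qed
  then show ?thesis by simp
qed

end

section \<open>Comparison functions from an ordinary differential equation\<close>

context two_media
begin

lemma U_strict_mono: "x < y \<Longrightarrow> U x < U y"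
  by (rule DERIV_pos_imp_increasing[where f = U]) (auto intro!: exI deriv_U)

text \<open>Variation of constants: the equation \<open>H'' / 2 + bz H' = G\<close> is linear of
  first order for \<open>H'\<close>, with integrating factor
  \<open>exp (2 * \<beta>)\<close>.\<close>

lemma inhomogeneous_solution:
  assumes G: "continuous_on UNIV G"
  shows "\<exists>H H'. (\<forall>z. (H has_real_derivative H' z) (at z)) \<and> (\<forall>z. (H' has_real_derivative 2 * G z - 2 * bz z * H' z) (at z))"
proof -
  define K where "K = antider (\<lambda>z. 2 * G z * exp (2 * \<beta> z))"
  have dK: "(K has_real_derivative 2 * G z * exp (2 * \<beta> z)) (at z)" for z
    unfolding K_def by (rule antider(2)) (intro continuous_intros G continuous_\<beta>)
  define H' where "H' z = exp (- 2 * \<beta> z) * K z" for z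
  have dH': "(H' has_real_derivative 2 * G z - 2 * bz z * H' z) (at z)" for z
  proof -
    have "exp (- 2 * \<beta> z) * (2 * G z * exp (2 * \<beta> z)) = 2 * G z"
      by (simp add: exp_minus)
    then show ?thesis
      unfolding H'_def by (auto intro!: derivative_eq_intros dK deriv_\<beta> simp: algebra_simps)
  qed
  have "continuous_on UNIV H'" by (rule DERIV_continuous_on) (rule dH')
  then have "(antider H' has_real_derivative H' z) (at z)" for z by (rule antider(2))
  then show ?thesis using dH' by blast
qed

end

section \<open>Regularity of functions whose rates converge to a continuous function\<close>

context media_noise
begin

text \<open>Schwarz' perturbation. With \<open>m\<close> solving the equation for right-hand side 1,
  the operator takes \<open>\<psi> = H - e * m\<close> to \<open>G - e\<close>. If \<open>F\<close>
  exceeded \<open>H\<close> somewhere, \<open>F - \<psi>\<close> would have an interior maximum,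
  where the maximum principle gives \<open>G \<le> G - e\<close>.\<close>

lemma rate_comparison:
  assumes F: "continuous_on UNIV F" "\<And>x. \<bar>F x\<bar> \<le> K" and lim: "\<And>q. (rate F q \<longlongrightarrow> G (scale q)) (at_right 0)"
    and H: "\<And>z. (H has_real_derivative H' z) (at z)" "\<And>z. (H' has_real_derivative 2 * G z - 2 * bz z * H' z) (at z)"
    and ends: "F a \<le> H a" "F c \<le> H c" and x: "x \<in> {a..c}"
  shows "F x \<le> H x"
proof (rule ccontr)
  assume "\<not> F x \<le> H x"
  then have J: "F x - H x > 0" by simp
  obtain m m' where m: "\<And>z. (m has_real_derivative m' z) (at z)" "\<And>z. (m' has_real_derivative 2 * 1 - 2 * bz z * m' z) (at z)"
    using inhomogeneous_solution[of "\<lambda>_. 1"] by auto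
  have cH: "continuous_on S H" and cm: "continuous_on S m" for S
    by (rule DERIV_continuous_on, rule DERIV_subset[OF H(1) subset_UNIV],
        rule DERIV_continuous_on, rule DERIV_subset[OF m(1) subset_UNIV])
  obtain S where S: "\<forall>x\<in>{a..c}. \<bar>m x\<bar> \<le> S"
    using continuous_abs_bounded[OF cm] by (rule exE)
  have S0: "S \<ge> 0" using S x by (smt (verit))
  \<comment> \<open>Small enough for \<open>2 * (e * S) < F x - H x\<close>, where \<open>S\<close>
    bounds \<open>m\<close>: the perturbation then cannot move the maximum to the ends. The added 1
    keeps the denominator positive when \<open>S = 0\<close>.\<close>
  define e where "e = (F x - H x) / (2 * S + 1)"
  have e: "e > 0" using J S0 by (simp add: e_def)
  have eS: "2 * (e * S) < F x - H x"
  proof -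
    have "(F x - H x) = e * (2 * S + 1)" using S0 by (simp add: e_def)
    then show ?thesis using e by (simp add: algebra_simps)
  qed
  have em: "\<bar>e * m y\<bar> \<le> e * S" if "y \<in> {a..c}" for y
    using S that e by (simp add: abs_mult)
  define \<psi> where "\<psi> z = H z - e * m z" for z
  define \<psi>' where "\<psi>' z = H' z - e * m' z" for z
  have d\<psi>: "(\<psi> has_real_derivative \<psi>' z) (at z)" for z
    unfolding \<psi>_def \<psi>'_def by (auto intro!: derivative_eq_intros H m)
  have d\<psi>': "(\<psi>' has_real_derivative 2 * (G z - e) - 2 * bz z * \<psi>' z) (at z)" for z
    unfolding \<psi>'_def by (auto intro!: derivative_eq_intros H m simp: algebra_simps)
  have "\<exists>y\<in>{a..c}. \<forall>u\<in>{a..c}. F u - \<psi> u \<le> F y - \<psi> y"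
    by (rule continuous_attains_sup)
       (use x in \<open>auto simp: \<psi>_def intro!: continuous_intros cH cm continuous_on_subset[OF F(1)]\<close>)
  then obtain y where y: "y \<in> {a..c}" "\<And>u. u \<in> {a..c} \<Longrightarrow> F u - \<psi> u \<le> F y - \<psi> y" by blast
  have "e * S < F y - \<psi> y" using y(2)[OF x] em[OF x] eS by (simp add: \<psi>_def abs_le_iff)
  moreover have "F a - \<psi> a \<le> e * S" using em[of a] x ends by (simp add: \<psi>_def abs_le_iff)
  moreover have "F c - \<psi> c \<le> e * S" using em[of c] x ends by (simp add: \<psi>_def abs_le_iff)
  ultimately have ac: "a < y" "y < c" using y(1) by (auto simp: order.order_iff_strict)
  have "G (scale (unscale y)) \<le> 1 / 2 * (2 * (G (scale (unscale y)) - e) - 2 * bz (scale (unscale y)) * \<psi>' (scale (unscale y)))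
      + b (unscale y) * \<psi>' (scale (unscale y))"
    by (rule rate_maximum_principle[OF F lim d\<psi> d\<psi>', of a _ c]) (use ac y(2) in simp_all)
  then show False using e by (simp add: bz_def diff_divide_distrib)
qed

lemma rate_uminus: "rate (\<lambda>x. - F x) q t = - rate F q t"
proof -
  have "expectation (\<lambda>\<omega>. - F (scale q + displacement q t \<omega>) - - F (scale q)) =
    expectation (\<lambda>\<omega>. - (F (scale q + displacement q t \<omega>) - F (scale q)))"
    by (rule Bochner_Integration.integral_cong) auto
  also have "\<dots> = - expectation (\<lambda>\<omega>. F (scale q + displacement q t \<omega>) - F (scale q))"
    by (rule integral_minus)
  finally show ?thesis unfolding rate_def by simp
qed

text \<open>The functions \<open>H + \<alpha> + \<gamma> * U\<close> are solutions with two free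
  constants, enough to match \<open>F\<close> at the ends of any interval. Comparison for
  \<open>F\<close> and for \<open>- F\<close> forces equality inside, so \<open>F\<close> inherits
  the regularity of a solution. The values at 0 and 1 determine both constants, since
  \<open>U\<close> is strictly increasing, and hence one choice fits the whole line.\<close>

lemma rate_limit_regular:
  assumes F: "continuous_on UNIV F" "\<And>x. \<bar>F x\<bar> \<le> K" and G: "continuous_on UNIV G"
    and lim: "\<And>q. (rate F q \<longlongrightarrow> G (scale q)) (at_right 0)"
  shows "\<exists>F'. (\<forall>z. (F has_real_derivative F' z) (at z)) \<and> (\<forall>z. (F' has_real_derivative 2 * G z - 2 * bz z * F' z) (at z))"
proof -
  obtain H H' where H: "\<And>z. (H has_real_derivative H' z) (at z)" "\<And>z. (H' has_real_derivative 2 * G z - 2 * bz z * H' z) (at z)"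
    using inhomogeneous_solution[OF G] by auto
  define P where "P \<alpha> \<gamma> z = H z + \<alpha> + \<gamma> * U z" for \<alpha> \<gamma> z
  define P' where "P' \<gamma> z = H' z + \<gamma> * exp (- 2 * \<beta> z)" for \<gamma> z
  have dP: "(P \<alpha> \<gamma> has_real_derivative P' \<gamma> z) (at z)" for \<alpha> \<gamma> z
    unfolding P_def P'_def by (auto intro!: derivative_eq_intros H deriv_U)
  have dP': "(P' \<gamma> has_real_derivative 2 * G z - 2 * bz z * P' \<gamma> z) (at z)" for \<gamma> z
    unfolding P'_def by (auto intro!: derivative_eq_intros H deriv_\<beta> simp: algebra_simps)
  have interval: "\<exists>\<alpha> \<gamma>. \<forall>x\<in>{a..c}. F x = P \<alpha> \<gamma> x" if "a < c" for a c
  proof -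
    define \<gamma> where "\<gamma> = ((F c - H c) - (F a - H a)) / (U c - U a)"
    define \<alpha> where "\<alpha> = F a - H a - \<gamma> * U a"
    have "U c - U a \<noteq> 0" using U_strict_mono[OF that] by simp
    then have g: "\<gamma> * (U c - U a) = (F c - H c) - (F a - H a)" by (simp add: \<gamma>_def)
    have ends: "F a = P \<alpha> \<gamma> a" "F c = P \<alpha> \<gamma> c"
      using g by (simp_all add: P_def \<alpha>_def algebra_simps)
    have "F x = P \<alpha> \<gamma> x" if x: "x \<in> {a..c}" for x
    proof (rule antisym)
      show "F x \<le> P \<alpha> \<gamma> x"
        by (rule rate_comparison[OF F lim dP dP' _ _ x]) (use ends in simp_all)
      have "- F x \<le> - P \<alpha> \<gamma> x"
      proof (rule rate_comparison[of "\<lambda>x. - F x" K "\<lambda>z. - G z" _ "\<lambda>z. - P' \<gamma> z", OF _ _ _ _ _ _ _ x])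
        show "((\<lambda>z. - P' \<gamma> z) has_real_derivative 2 * - G z - 2 * bz z * - P' \<gamma> z) (at z)" for z
          by (auto intro!: derivative_eq_intros dP')
        show "(rate (\<lambda>x. - F x) q \<longlongrightarrow> - G (scale q)) (at_right 0)" for q
          using tendsto_minus[OF lim[of q]] by (simp add: rate_uminus[abs_def])
      qed (use ends F in \<open>auto intro!: continuous_intros derivative_eq_intros dP\<close>)
      then show "P \<alpha> \<gamma> x \<le> F x" by simp
    qed
    then show ?thesis by blast
  qed
  obtain \<alpha> \<gamma> where ag: "\<forall>x\<in>{0..1}. F x = P \<alpha> \<gamma> x" using interval[of 0 1] by auto
  have "F z = P \<alpha> \<gamma> z" for z
  proof -
    obtain \<alpha>' \<gamma>' where ag': "\<forall>x\<in>{min 0 z..max 1 z}. F x = P \<alpha>' \<gamma>' x" using interval[of "min 0 z" "max 1 z"] by (auto simp: min_less_iff_disj less_max_iff_disj)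
    have "P \<alpha> \<gamma> 0 = P \<alpha>' \<gamma>' 0" "P \<alpha> \<gamma> 1 = P \<alpha>' \<gamma>' 1" using ag ag' by (auto simp: min_def max_def)
    then have "\<alpha> + \<gamma> * U 0 = \<alpha>' + \<gamma>' * U 0" "\<alpha> + \<gamma> * U 1 = \<alpha>' + \<gamma>' * U 1" by (simp_all add: P_def)
    then have "(\<gamma> - \<gamma>') * (U 1 - U 0) = 0" by (simp add: algebra_simps)
    then have "\<gamma> = \<gamma>'" using U_strict_mono[of 0 1] by simp
    then have "\<alpha> = \<alpha>'" using \<open>\<alpha> + \<gamma> * U 0 = \<alpha>' + \<gamma>' * U 0\<close> by simp
    then show ?thesis using ag' \<open>\<gamma> = \<gamma>'\<close> by auto
  qed
  then have "F = P \<alpha> \<gamma>" by blast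
  then show ?thesis using dP dP' by blast
qed

lemma generator_is_transition: "generator_is transition (A_op b l1 l2) (A_dom b l1 l2)"
proof -
  have lim: "((\<lambda>t. ((\<integral>y. f y \<partial>transition t x) - f x) / t) \<longlongrightarrow> A_op b l1 l2 f x) (at_right 0)"
    if f: "f \<in> A_dom b l1 l2" for f x
  proof -
    obtain F F' F'' where F: "f = (\<lambda>q. F (scale q))" "\<And>z. (F has_real_derivative F' z) (at z)"
      "\<And>z. (F' has_real_derivative F'' z) (at z)" "continuous_on UNIV F''" "bounded (range F)"
      using A_domE[OF f] by blast
    obtain K where K: "\<And>x. \<bar>F x\<bar> \<le> K" using F(5) by (auto simp: bounded_iff)
    have cF: "continuous_on UNIV F" by (rule DERIV_continuous_on) (rule F(2))
    have mF: "F \<in> borel_measurable borel" using cF by (rule borel_measurable_continuous_onI)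
    have "(rate F x \<longlongrightarrow> 1 / 2 * F'' (scale x) + b x * F' (scale x)) (at_right 0)"
      by (rule rate_tendsto_deriv[OF mF K zero_less_one F(2) F(3)])
    moreover have "eventually (\<lambda>t. rate F x t = ((\<integral>y. f y \<partial>transition t x) - f x) / t) (at_right 0)"
      using eventually_at_right_less
    proof eventually_elim
      case (elim t)
      have "((\<integral>y. f y \<partial>transition t x) - f x) / t = rate (\<lambda>z. f (unscale z)) x t"
        by (rule rate_eq_transition[where K = K]) (use mF K elim in \<open>auto simp: F(1) intro!: measurable_compose[OF measurable_scale]\<close>)
      then show ?case by (simp add: F(1))
    qed
    ultimately show ?thesis
      unfolding F(1) A_op_eq[OF F(2-5)] by (rule Lim_transform_eventually)
  qed
  have "f \<in> A_dom b l1 l2 \<longleftrightarrow> continuous_on UNIV f \<and> bounded (range f) \<and>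
     (\<exists>g. continuous_on UNIV g \<and> (\<forall>x. ((\<lambda>t. ((\<integral>y. f y \<partial>transition t x) - f x) / t) \<longlongrightarrow> g x) (at_right 0)))" for f
  proof
    assume f: "f \<in> A_dom b l1 l2"
    then show "continuous_on UNIV f \<and> bounded (range f) \<and>
     (\<exists>g. continuous_on UNIV g \<and> (\<forall>x. ((\<lambda>t. ((\<integral>y. f y \<partial>transition t x) - f x) / t) \<longlongrightarrow> g x) (at_right 0)))"
      using lim[OF f] by (auto simp: A_dom_def intro!: exI[of _ "A_op b l1 l2 f"])
  next
    assume "continuous_on UNIV f \<and> bounded (range f) \<and>
     (\<exists>g. continuous_on UNIV g \<and> (\<forall>x. ((\<lambda>t. ((\<integral>y. f y \<partial>transition t x) - f x) / t) \<longlongrightarrow> g x) (at_right 0)))"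
    then obtain g where f: "continuous_on UNIV f" "bounded (range f)" and g: "continuous_on UNIV g"
      "\<And>x. ((\<lambda>t. ((\<integral>y. f y \<partial>transition t x) - f x) / t) \<longlongrightarrow> g x) (at_right 0)" by blast
    define F where "F z = f (unscale z)" for z
    define G where "G z = g (unscale z)" for z
    obtain K where K: "\<And>x. \<bar>f x\<bar> \<le> K" using f(2) by (auto simp: bounded_iff)
    have KF: "\<bar>F x\<bar> \<le> K" for x by (simp add: F_def K)
    have mf: "f \<in> borel_measurable borel" using f(1) by (rule borel_measurable_continuous_onI)
    have cF: "continuous_on UNIV F" "continuous_on UNIV G"
      unfolding F_def G_def by (rule continuous_on_compose2[OF f(1) continuous_unscale], simp,
        rule continuous_on_compose2[OF g(1) continuous_unscale], simp)
    have "(rate F q \<longlongrightarrow> G (scale q)) (at_right 0)" for q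
    proof (rule Lim_transform_eventually)
      show "((\<lambda>t. ((\<integral>y. f y \<partial>transition t q) - f q) / t) \<longlongrightarrow> G (scale q)) (at_right 0)"
        using g(2) by (simp add: G_def)
      show "eventually (\<lambda>t. ((\<integral>y. f y \<partial>transition t q) - f q) / t = rate F q t) (at_right 0)"
        using eventually_at_right_less
        by eventually_elim (simp add: rate_eq_transition[OF mf K] F_def[abs_def])
    qed
    from rate_limit_regular[OF cF(1) KF cF(2) this]
    obtain F' where F': "\<And>z. (F has_real_derivative F' z) (at z)" "\<And>z. (F' has_real_derivative 2 * G z - 2 * bz z * F' z) (at z)"
      by blast
    have "(\<lambda>q. F (scale q)) \<in> A_dom b l1 l2"
    proof (rule A_domI[OF F'])
      have "continuous_on UNIV F'" by (rule DERIV_continuous_on) (rule F'(2))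
      then show "continuous_on UNIV (\<lambda>z. 2 * G z - 2 * bz z * F' z)"
        by (intro continuous_intros cF continuous_bz)
      show "bounded (range F)" using KF by (auto simp: bounded_iff)
    qed
    then show "f \<in> A_dom b l1 l2" by (simp add: F_def)
  qed
  then show ?thesis
    unfolding generator_is_def using lim by blast
qed

lemma process_governed: "diffusion_governed_by (A_op b l1 l2) (A_dom b l1 l2) q M (process q)"
  unfolding diffusion_governed_by_def
  using feller_transition generator_is_transition markov_process continuous_process process_0 by blast

end

section \<open>Uniqueness of the transition function\<close>

lemma integrable_exponential_density:
  assumes "0 < l" shows "integrable lborel (exponential_density l)"
proof (rule integrableI_nonneg)
  interpret prob_space "density lborel (\<lambda>x. ennreal (exponential_density l x))"
    using assms by (rule prob_space_exponential_density)
  have "(\<integral>\<^sup>+x. ennreal (exponential_density l x) \<partial>lborel) = 1"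
    using emeasure_space_1 by (simp add: emeasure_density)
  then show "(\<integral>\<^sup>+x. ennreal (exponential_density l x) \<partial>lborel) < \<infinity>" by simp
qed (use assms in \<open>auto simp: exponential_density_nonneg\<close>)

text \<open>The functions \<open>exp (- n t)\<close> span a dense set by Weierstrass, and a right continuous function is
  determined by its integrals against small bumps.\<close>

lemma laplace_unique:
  fixes v :: "real \<Rightarrow> real"
  assumes m: "v \<in> borel_measurable borel" and K: "\<And>t. \<bar>v t\<bar> \<le> K"
    and rc: "\<And>t. 0 \<le> t \<Longrightarrow> (v \<longlongrightarrow> v t) (at_right t)"
    and zero: "\<And>n. (LBINT t. exponential_density (real (Suc n)) t * v t) = 0"
    and t: "0 \<le> t"
  shows "v t \<le> 0"
proof (rule ccontr)
  assume "\<not> v t \<le> 0"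
  then have vt: "v t > 0" by simp
  have K0: "0 \<le> K" using K[of 0] by linarith
  let ?w = "exponential_density 1"
  have w0: "0 \<le> ?w s" for s by (simp add: exponential_density_nonneg)
  note [measurable] = m
  have wi: "integrable lborel ?w" by (rule integrable_exponential_density) simp
  have int: "integrable lborel (\<lambda>s. ?w s * (f (exp (- s)) * v s))"
    if f: "continuous_on {0..1} f" for f
  proof -
    obtain C where C: "\<forall>x\<in>{0..1}. \<bar>f x\<bar> \<le> C"
    using continuous_abs_bounded[OF f] by (rule exE)
    have fm: "(\<lambda>s. ?w s * (f (exp (- s)) * v s)) \<in> borel_measurable borel"
    proof -
      have c: "continuous_on UNIV (\<lambda>s. f (min 1 (exp (- s))))"
        by (rule continuous_on_compose2[OF f]) (auto intro!: continuous_intros)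
      have [measurable]: "(\<lambda>s. f (min 1 (exp (- s)))) \<in> borel_measurable borel"
        by (rule borel_measurable_continuous_onI[OF c])
      have "(\<lambda>s. ?w s * (f (exp (- s)) * v s)) = (\<lambda>s. ?w s * (f (min 1 (exp (- s))) * v s))"
        by (auto simp: fun_eq_iff exponential_density_def min_def)
      then show ?thesis by simp
    qed
    show ?thesis
    proof (rule Bochner_Integration.integrable_bound[OF integrable_mult_right[OF wi, of "C * K"]])
      show "AE s in lborel. norm (?w s * (f (exp (- s)) * v s)) \<le> norm (C * K * ?w s)"
      proof (rule AE_I2)
        fix s :: real
        show "norm (?w s * (f (exp (- s)) * v s)) \<le> norm (C * K * ?w s)"
        proof (cases "s < 0")
          case False
          then have "\<bar>f (exp (- s))\<bar> \<le> C" using C by auto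
          then have "\<bar>f (exp (- s))\<bar> * \<bar>v s\<bar> \<le> C * K" using K[of s] by (intro mult_mono) auto
          then have "\<bar>?w s\<bar> * (\<bar>f (exp (- s))\<bar> * \<bar>v s\<bar>) \<le> \<bar>?w s\<bar> * \<bar>C * K\<bar>" by (intro mult_left_mono) auto
          then show ?thesis by (simp add: abs_mult mult_ac)
        qed (simp add: exponential_density_def)
      qed
    qed (use fm in simp)
  qed
  \<comment> \<open>The exponential density of rate \<open>i + 1\<close> is
    \<open>(i + 1) * exp (- s) ^ i\<close> times that of rate 1. A polynomial in
    \<open>exp (- s)\<close> thus leads to a finite combination of the integrals assumed to
    vanish.\<close>
  have poly: "(LBINT s. ?w s * (g (exp (- s)) * v s)) = 0" if gp: "real_polynomial_function g" for g
  proof -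
    obtain a :: "nat \<Rightarrow> real" and n where g: "g = (\<lambda>x. \<Sum>i\<le>n. a i * x ^ i)" using gp unfolding real_polynomial_function_iff_sum by blast
    have "?w s * (g (exp (- s)) * v s) = (\<Sum>i\<le>n. (a i / real (Suc i)) * (exponential_density (real (Suc i)) s * v s))" for s
    proof -
      have "exponential_density (real (Suc i)) s = real (Suc i) * (?w s * exp (- s) ^ i)" for i
        by (simp add: exponential_density_def exp_of_nat_mult[symmetric] exp_add[symmetric] algebra_simps)
      then show ?thesis by (simp add: g sum_distrib_left sum_distrib_right mult_ac del: of_nat_Suc)
    qed
    then have "(LBINT s. ?w s * (g (exp (- s)) * v s)) =
      (LBINT s. \<Sum>i\<le>n. (a i / real (Suc i)) * (exponential_density (real (Suc i)) s * v s))" by simp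
    also have "\<dots> = (\<Sum>i\<le>n. LBINT s. (a i / real (Suc i)) * (exponential_density (real (Suc i)) s * v s))"
    proof (rule Bochner_Integration.integral_sum)
      fix i
      have "integrable lborel (\<lambda>s. K * exponential_density (real (Suc i)) s)"
        by (intro integrable_mult_right integrable_exponential_density) simp
      then have "integrable lborel (\<lambda>s. exponential_density (real (Suc i)) s * v s)"
      proof (rule Bochner_Integration.integrable_bound)
        show "AE s in lborel. norm (exponential_density (real (Suc i)) s * v s) \<le> norm (K * exponential_density (real (Suc i)) s)"
          by (rule AE_I2) (use K K0 in \<open>auto simp: abs_mult mult.commute intro!: mult_right_mono\<close>)
      qed simp
      then show "integrable lborel (\<lambda>s. (a i / real (Suc i)) * (exponential_density (real (Suc i)) s * v s))"
        by (rule integrable_mult_right)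
    qed
    also have "\<dots> = 0" using zero by (simp del: of_nat_Suc)
    finally show ?thesis .
  qed
  have all: "(LBINT s. ?w s * (f (exp (- s)) * v s)) = 0" if f: "continuous_on {0..1} f" for f
  proof (rule ccontr)
    assume ne: "(LBINT s. ?w s * (f (exp (- s)) * v s)) \<noteq> 0"
    define e where "e = \<bar>LBINT s. ?w s * (f (exp (- s)) * v s)\<bar> / (K + 1)"
    have e: "e > 0" using ne K0 by (simp add: e_def)
    obtain g where g: "real_polynomial_function g" "\<And>x. x \<in> {0..1} \<Longrightarrow> \<bar>f x - g x\<bar> < e"
      using Stone_Weierstrass_real_polynomial_function[OF _ f e] by blast
    have cg: "continuous_on {0..1} g" using g(1) by (intro continuous_at_imp_continuous_on ballI continuous_real_polymonial_function)
    have "\<bar>LBINT s. ?w s * (f (exp (- s)) * v s)\<bar> = \<bar>LBINT s. ?w s * (f (exp (- s)) * v s) - ?w s * (g (exp (- s)) * v s)\<bar>"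
      using poly[OF g(1)] int[OF f] int[OF cg] by simp
    also have "\<dots> \<le> (LBINT s. \<bar>?w s * (f (exp (- s)) * v s) - ?w s * (g (exp (- s)) * v s)\<bar>)"
      by (rule integral_abs_bound)
    also have "\<dots> \<le> (LBINT s. (e * K) * ?w s)"
    proof (rule integral_mono)
      show "integrable lborel (\<lambda>s. \<bar>?w s * (f (exp (- s)) * v s) - ?w s * (g (exp (- s)) * v s)\<bar>)"
        by (intro integrable_abs Bochner_Integration.integrable_diff int f cg)
      show "integrable lborel (\<lambda>s. (e * K) * ?w s)" by (intro integrable_mult_right wi)
      fix s :: real
      show "\<bar>?w s * (f (exp (- s)) * v s) - ?w s * (g (exp (- s)) * v s)\<bar> \<le> e * K * ?w s"
      proof (cases "s < 0")
        case False
        then have "\<bar>f (exp (- s)) - g (exp (- s))\<bar> * \<bar>v s\<bar> \<le> e * K"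
          using K[of s] g(2)[of "exp (- s)"] e by (intro mult_mono) auto
        then have "?w s * (\<bar>f (exp (- s)) - g (exp (- s))\<bar> * \<bar>v s\<bar>) \<le> ?w s * (e * K)" using w0 by (intro mult_left_mono) auto
        moreover have "?w s * (f (exp (- s)) * v s) - ?w s * (g (exp (- s)) * v s) = ?w s * ((f (exp (- s)) - g (exp (- s))) * v s)"
          by (simp add: algebra_simps)
        ultimately show ?thesis using w0[of s] by (simp add: abs_mult mult_ac)
      qed (simp add: exponential_density_def)
    qed
    also have "\<dots> = e * K"
    proof -
      interpret prob_space "density lborel (\<lambda>x. ennreal (?w x))" by (rule prob_space_exponential_density) simp
      have "(LBINT s. ?w s * 1) = (\<integral>s. 1 \<partial>density lborel (\<lambda>x. ennreal (?w x)))"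
        by (rule integral_real_density[symmetric]) (use w0 in auto)
      also have "\<dots> = 1" using prob_space by simp
      finally show ?thesis by simp
    qed
    also have "\<dots> < e * (K + 1)" using e by simp
    also have "\<dots> = \<bar>LBINT s. ?w s * (f (exp (- s)) * v s)\<bar>" using K0 by (simp add: e_def)
    finally show False by simp
  qed
  have "eventually (\<lambda>s. v s > 0) (at_right t)" using rc[OF t] vt by (rule order_tendstoD)
  then obtain u where u: "u > t" "\<And>s. t < s \<Longrightarrow> s < u \<Longrightarrow> v s > 0"
    unfolding eventually_at_right_field by blast
  \<comment> \<open>In the variable \<open>x = exp (- s)\<close> both factors are positive exactly
    for \<open>t < s < u\<close>, so \<open>f\<close> is a continuous bump carried by the interval
    on which \<open>v\<close> is positive.\<close>
  define f where "f x = max 0 ((exp (- t) - x) * (x - exp (- u)))" for x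
  have cf: "continuous_on {0..1} f" unfolding f_def by (intro continuous_intros)
  have fpos: "f (exp (- s)) > 0" if "t < s" "s < u" for s
    using that by (simp add: f_def)
  have fzero: "f (exp (- s)) = 0" if "\<not> (t < s \<and> s < u)" for s
  proof -
    have "(exp (- t) - exp (- s)) * (exp (- s) - exp (- u)) \<le> 0"
    proof (cases "s \<le> t")
      case True
      then show ?thesis using u(1) by (intro mult_nonpos_nonneg) auto
    next
      case False
      then show ?thesis using that by (intro mult_nonneg_nonpos) auto
    qed
    then show ?thesis by (simp add: f_def)
  qed
  have nn: "0 \<le> ?w s * (f (exp (- s)) * v s)" for s
  proof (cases "t < s \<and> s < u")
    case True
    then show ?thesis using fpos[of s] u(2)[of s] w0[of s] by simp
  qed (simp add: fzero)
  have "AE s in lborel. ?w s * (f (exp (- s)) * v s) = 0"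
    using all[OF cf] integral_nonneg_eq_0_iff_AE[OF int[OF cf]] nn by simp
  moreover have "?w s * (f (exp (- s)) * v s) \<noteq> 0" if "s \<in> {t<..<u}" for s
    using that t fpos[of s] u(2)[of s] by (auto simp: exponential_density_def)
  ultimately have "AE s in lborel. s \<notin> {t<..<u}" by (auto elim!: eventually_mono)
  then have "emeasure lborel {t<..<u} = 0" by (subst (asm) AE_iff_measurable[of "{t<..<u}"]) auto
  then show False using u(1) by simp
qed

section \<open>Uniqueness of bounded solutions of the resolvent equation\<close>

context two_media
begin

text \<open>Subtracting \<open>e * (x^2 + k)\<close> forces a maximum to be attained. At a maximum
  \<open>y\<close> with \<open>M y > 0\<close> the operator applied to \<open>M\<close> is at most
  0, while the eigenvalue equation and the choice of \<open>k\<close> make it at least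
  \<open>l * M y > 0\<close>.\<close>

lemma bounded_eigenfunction_nonpos:
  assumes D: "\<And>z. (D has_real_derivative D' z) (at z)" "\<And>z. (D' has_real_derivative D'' z) (at z)"
    and eq: "\<And>z. 1 / 2 * D'' z + bz z * D' z = l * D z" and l: "l > 0" and K: "\<And>z. \<bar>D z\<bar> \<le> K"
  shows "D z \<le> 0"
proof (rule ccontr)
  assume "\<not> D z \<le> 0"
  then have Dz: "D z > 0" by simp
  have K0: "K \<ge> 0" using K[of 0] by linarith
  \<comment> \<open>The operator takes \<open>y^2 + k\<close> to \<open>1 + 2 * y * bz y\<close>.
    Young's inequality \<open>2 * \<bar>y\<bar> * B \<le> l * y^2 + B^2 / l\<close> and
    \<open>l * k = 1 + B^2 / l\<close> bound this by \<open>l * (y^2 + k)\<close>.\<close>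
  define k where "k = (1 + B\<^sup>2 / l) / l"
  have k: "k > 0" using l by (simp add: k_def add_pos_nonneg)
  \<comment> \<open>This makes \<open>M z\<close> equal to \<open>D z / 2\<close>, still
    positive.\<close>
  define e where "e = D z / (2 * (z\<^sup>2 + k))"
  have zk: "z\<^sup>2 + k > 0" using k by (simp add: add_nonneg_pos)
  have e: "e > 0" using Dz zk by (simp add: e_def)
  define M where "M x = D x - e * (x\<^sup>2 + k)" for x
  define M' where "M' x = D' x - e * (2 * x)" for x
  have dM: "(M has_real_derivative M' x) (at x)" for x
    unfolding M_def M'_def by (auto intro!: derivative_eq_intros D)
  have dM': "(M' has_real_derivative D'' x - e * 2) (at x)" for x
    unfolding M'_def by (auto intro!: derivative_eq_intros D)
  have Mz: "M z > 0"
  proof -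
    have "e * (z\<^sup>2 + k) = D z / 2" using zk by (simp add: e_def field_simps)
    then show ?thesis using Dz by (simp add: M_def)
  qed
  \<comment> \<open>Beyond \<open>R\<close> the quadratic outweighs the bound on \<open>D\<close>:
    \<open>R \<ge> 1\<close> gives \<open>x^2 \<ge> R > K / e\<close>. The first entry keeps
    \<open>z\<close> inside the interval.\<close>
  define R where "R = max (\<bar>z\<bar> + 1) (K / e + 1)"
  have R: "\<bar>z\<bar> < R" "R \<ge> 1" "K / e < R" by (auto simp: R_def less_max_iff_disj le_max_iff_disj)
  have out: "M x < 0" if "\<bar>x\<bar> \<ge> R" for x
  proof -
    have "R * 1 \<le> \<bar>x\<bar> * \<bar>x\<bar>" using that R by (intro mult_mono) auto
    then have "K / e < x\<^sup>2" using R by (simp add: power2_eq_square abs_mult[symmetric])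
    then have "K < e * x\<^sup>2" using e by (simp add: pos_divide_less_eq mult.commute)
    then show ?thesis using K[of x] e k by (simp add: M_def algebra_simps) (smt (verit) mult_pos_pos)
  qed
  have "\<exists>y\<in>{-R..R}. \<forall>u\<in>{-R..R}. M u \<le> M y"
    by (rule continuous_attains_sup)
       (use R in \<open>auto intro!: DERIV_continuous_on intro: DERIV_subset[OF dM]\<close>)
  then obtain y where y: "y \<in> {-R..R}" "\<And>u. u \<in> {-R..R} \<Longrightarrow> M u \<le> M y" by blast
  have "M z \<le> M y" using y(2)[of z] R by (simp add: abs_less_iff)
  then have My: "M y > 0" using Mz by simp
  have yR: "\<bar>y\<bar> < R" using out[of y] My by linarith
  have glob: "M u \<le> M y" for u
    using out[of u] My y(2)[of u] by (cases "\<bar>u\<bar> \<ge> R") (auto simp: not_le abs_less_iff)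
  have M'y: "M' y = 0"
    by (rule DERIV_local_max[OF dM, of 1]) (use glob in auto)
  have M''y: "D'' y - e * 2 \<le> 0"
  proof (rule ccontr)
    assume "\<not> D'' y - e * 2 \<le> 0"
    then obtain d where d: "d > 0" "\<And>h. 0 < h \<Longrightarrow> h < d \<Longrightarrow> M' y < M' (y + h)"
      using DERIV_pos_inc_right[OF dM'[of y]] by auto
    have "M y < M (y + d / 2)"
    proof (rule DERIV_pos_imp_increasing_open[where f = M])
      show "y < y + d / 2" using d by simp
      show "\<exists>r. (M has_real_derivative r) (at x) \<and> 0 < r" if "y < x" "x < y + d / 2" for x
        using d(2)[of "x - y"] that M'y d(1) dM by (intro exI[of _ "M' x"]) auto
      show "continuous_on {y..y + d / 2} M"
        by (rule DERIV_continuous_on) (rule DERIV_subset[OF dM subset_UNIV])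
    qed
    then show False using glob[of "y + d / 2"] by simp
  qed
  have "1 / 2 * (D'' y - e * 2) + bz y * M' y = l * D y - e * (1 + 2 * (y * bz y))"
    using eq[of y] by (simp add: M'_def algebra_simps)
  then have "l * D y - e * (1 + 2 * (y * bz y)) \<le> 0" using M'y M''y by simp
  moreover have "1 + 2 * (y * bz y) \<le> l * (y\<^sup>2 + k)"
  proof -
    have "y * bz y \<le> \<bar>y\<bar> * B" using bz_bound[of y] by (metis abs_ge_self abs_ge_zero abs_mult mult_left_mono order_trans)
    moreover have "2 * (\<bar>y\<bar> * B) \<le> l * y\<^sup>2 + B\<^sup>2 / l"
    proof -
      have "0 \<le> (l * \<bar>y\<bar> - B)\<^sup>2" by simp
      then have "2 * (\<bar>y\<bar> * B) * l \<le> (l * y\<^sup>2 + B\<^sup>2 / l) * l"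
        using l by (simp add: power2_diff power_mult_distrib power2_eq_square algebra_simps)
      then show ?thesis using l by (simp only: mult_le_cancel_right_pos)
    qed
    moreover have "l * k = 1 + B\<^sup>2 / l" using l by (simp add: k_def)
    ultimately show ?thesis unfolding distrib_left by linarith
  qed
  then have "e * (1 + 2 * (y * bz y)) \<le> e * (l * (y\<^sup>2 + k))" using e by (intro mult_left_mono) auto
  ultimately have "l * D y \<le> e * (l * (y\<^sup>2 + k))" by linarith
  moreover have "l * M y = l * D y - e * (l * (y\<^sup>2 + k))" by (simp add: M_def algebra_simps)
  ultimately have "l * M y \<le> 0" by simp
  then show False using l My by (simp add: mult_le_0_iff)
qed

end

section \<open>An arbitrary Feller semigroup with the given generator\<close>

locale media_semigroup = two_media b l1 l2 L B
  for b :: "real \<Rightarrow> real" and l1 l2 L B :: real +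
  fixes P :: "real \<Rightarrow> real \<Rightarrow> real measure"
  assumes feller: "feller_transition P" and gen: "generator_is P (A_op b l1 l2) (A_dom b l1 l2)"
begin

definition T :: "real \<Rightarrow> (real \<Rightarrow> real) \<Rightarrow> real \<Rightarrow> real" where
  "T t h x = (\<integral>y. h y \<partial>P t x)"

lemma measurable_P: "0 \<le> t \<Longrightarrow> P t \<in> borel \<rightarrow>\<^sub>M prob_algebra borel"
  using feller by (simp add: feller_transition_def)

lemma P_prob: assumes "0 \<le> t" shows "prob_space (P t x)" "sets (P t x) = sets borel" "space (P t x) = UNIV"
proof -
  have "P t x \<in> space (prob_algebra borel)" using measurable_P[OF assms] by (auto dest: measurable_space)
  then show "prob_space (P t x)" "sets (P t x) = sets borel" by (auto simp: space_prob_algebra)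
  then show "space (P t x) = UNIV" by (auto dest: sets_eq_imp_space_eq)
qed

lemma P_integrable:
  assumes "0 \<le> t" "h \<in> borel_measurable borel" "\<And>x. \<bar>h x\<bar> \<le> (K::real)"
  shows "integrable (P t x) h"
proof -
  interpret prob_space "P t x" using assms(1) by (rule P_prob)
  show ?thesis
    by (rule integrable_const_bound[where B = K]) (use assms P_prob(2)[OF assms(1)] in \<open>auto cong: measurable_cong_sets\<close>)
qed

lemma T_bound:
  assumes "0 \<le> t" "h \<in> borel_measurable borel" "\<And>x. \<bar>h x\<bar> \<le> K"
  shows "\<bar>T t h x\<bar> \<le> K"
proof -
  interpret prob_space "P t x" using assms(1) by (rule P_prob)
  have "\<bar>T t h x\<bar> \<le> (\<integral>y. \<bar>h y\<bar> \<partial>P t x)" unfolding T_def by (rule integral_abs_bound)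
  also have "\<dots> \<le> (\<integral>y. K \<partial>P t x)"
    by (intro integral_mono integrable_abs P_integrable[OF assms]) (use assms in auto)
  finally show ?thesis by (simp add: prob_space)
qed

lemma T_0: "h \<in> borel_measurable borel \<Longrightarrow> T 0 h x = h x"
  using feller by (simp add: T_def feller_transition_def integral_return)

lemma continuous_T: "0 \<le> t \<Longrightarrow> continuous_on UNIV h \<Longrightarrow> bounded (range h) \<Longrightarrow> continuous_on UNIV (T t h)"
  using feller unfolding feller_transition_def T_def[abs_def] by blast

lemma T_add:
  assumes "0 \<le> s" "0 \<le> t" and h: "h \<in> borel_measurable borel" "\<And>x. \<bar>h x\<bar> \<le> K"
  shows "T (s + t) h x = T s (T t h) x"
proof -
  interpret prob_space "P s x" using assms(1) by (rule P_prob)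
  have "T (s + t) h x = (\<integral>y. h y \<partial>(P s x \<bind> P t))"
    using feller assms(1,2) by (simp add: T_def feller_transition_def)
  also have "\<dots> = (\<integral>z. (\<integral>y. h y \<partial>P t z) \<partial>P s x)"
  proof (rule integral_bind[where K = borel and B = K and B' = 1])
    show "P t \<in> P s x \<rightarrow>\<^sub>M subprob_algebra borel"
      using measurable_prob_algebraD[OF measurable_P[OF assms(2)]] P_prob(2)[OF assms(1)] by (simp cong: measurable_cong_sets)
    show "AE z in P s x. emeasure (P t z) (space (P t z)) \<le> ennreal 1"
      using prob_space.emeasure_space_1[OF P_prob(1)[OF assms(2)]] by simp
  qed (use h finite_measure_axioms in auto)
  finally show ?thesis by (simp add: T_def[abs_def])
qed

text \<open>Stochastic continuity comes from one bounded function of the domain vanishing only at the start.\<close>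

lemma A_dom_well:
  "\<exists>\<psi>\<in>A_dom b l1 l2. \<psi> x = 0 \<and> (\<forall>y. 0 \<le> \<psi> y) \<and> (\<forall>d>0. \<exists>c>0. \<forall>y. d \<le> \<bar>scale y - scale x\<bar> \<longrightarrow> c \<le> \<psi> y)"
proof -
  define z where "z = scale x"
  have pos: "1 + (u - z)\<^sup>2 > 0" for u :: real by (simp add: add_pos_nonneg)
  define I where "I u = inverse (1 + (u - z)\<^sup>2)" for u
  define \<Psi> where "\<Psi> u = 1 - I u" for u
  define \<Psi>' where "\<Psi>' u = 2 * (u - z) * (I u)\<^sup>2" for u
  define \<Psi>'' where "\<Psi>'' u = 2 * (I u)\<^sup>2 - 8 * (u - z)\<^sup>2 * (I u) ^ 3" for u
  have d0: "(I has_real_derivative - (2 * (u - z) * (I u)\<^sup>2)) (at u)" for u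
  proof -
    have ne: "1 + (u - z)\<^sup>2 \<noteq> 0" using pos[of u] by linarith
    have "(I has_real_derivative - (I u * (2 * (u - z)) * I u)) (at u)"
      unfolding I_def by (rule DERIV_inverse') (use ne in \<open>auto intro!: derivative_eq_intros\<close>)
    then show ?thesis by (simp add: power2_eq_square[of "I u"] mult_ac)
  qed
  have d1: "(\<Psi> has_real_derivative \<Psi>' u) (at u)" for u
    unfolding \<Psi>_def \<Psi>'_def by (auto intro!: derivative_eq_intros d0)
  have d2: "(\<Psi>' has_real_derivative \<Psi>'' u) (at u)" for u
    unfolding \<Psi>'_def \<Psi>''_def by (auto intro!: derivative_eq_intros d0 simp: power2_eq_square power3_eq_cube algebra_simps)
  have cI: "continuous_on UNIV I" by (rule DERIV_continuous_on) (rule d0)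
  have c: "continuous_on UNIV \<Psi>''"
    unfolding \<Psi>''_def by (intro continuous_intros cI)
  have r: "0 \<le> \<Psi> u" "\<Psi> u \<le> 1" for u
    using pos[of u] by (auto simp: \<Psi>_def I_def field_simps)
  have "bounded (range \<Psi>)" using r by (auto simp: bounded_iff intro!: exI[of _ 1])
  then have dom: "(\<lambda>q. \<Psi> (scale q)) \<in> A_dom b l1 l2" by (rule A_domI[OF d1 d2 c])
  have zero: "\<Psi> (scale x) = 0" by (simp add: \<Psi>_def I_def z_def)
  have away: "\<exists>c>0. \<forall>y. d \<le> \<bar>scale y - scale x\<bar> \<longrightarrow> c \<le> \<Psi> (scale y)" if d: "d > 0" for d
  proof (intro exI[of _ "1 - inverse (1 + d\<^sup>2)"] conjI allI impI)
    have "inverse (1 + d\<^sup>2) < inverse 1" using d by (intro less_imp_inverse_less) auto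
    then show "0 < 1 - inverse (1 + d\<^sup>2)" by simp
    fix y assume "d \<le> \<bar>scale y - scale x\<bar>"
    then have "d\<^sup>2 \<le> (scale y - z)\<^sup>2" using d abs_le_square_iff[of d "scale y - z"] by (simp add: z_def)
    then have "inverse (1 + (scale y - z)\<^sup>2) \<le> inverse (1 + d\<^sup>2)" by (intro le_imp_inverse_le) (auto simp: add_pos_nonneg)
    then show "1 - inverse (1 + d\<^sup>2) \<le> \<Psi> (scale y)" by (simp add: \<Psi>_def I_def)
  qed
  show ?thesis
    by (rule bexI[OF _ dom]) (intro conjI allI impI zero r away)
qed

text \<open>The difference quotient of \<open>\<psi>\<close> at \<open>x\<close> converges, so
  \<open>T t \<psi> x\<close> tends to \<open>\<psi> x = 0\<close>. Since \<open>\<psi>\<close> is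
  bounded below away from \<open>x\<close>, this controls the mass there:
  \<open>\<bar>h y - h x\<bar>\<close> is at most \<open>e / 2\<close> plus a multiple of
  \<open>\<psi> y\<close>. Distances are measured through \<open>scale\<close>, in which
  \<open>\<psi>\<close> is given.\<close>

lemma T_tendsto:
  assumes h: "continuous_on UNIV h" "\<And>x. \<bar>h x\<bar> \<le> K"
  shows "((\<lambda>t. T t h x) \<longlongrightarrow> h x) (at_right 0)"
proof (rule tendstoI)
  fix e :: real assume e: "e > 0"
  have mh: "h \<in> borel_measurable borel" using h(1) by (rule borel_measurable_continuous_onI)
  have K0: "0 \<le> K" using h(2)[of 0] by linarith
  obtain \<psi> where \<psi>: "\<psi> \<in> A_dom b l1 l2" "\<psi> x = 0" "\<And>y. 0 \<le> \<psi> y"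
    "\<And>d. d > 0 \<Longrightarrow> \<exists>c>0. \<forall>y. d \<le> \<bar>scale y - scale x\<bar> \<longrightarrow> c \<le> \<psi> y"
    using A_dom_well[of x] by blast
  have c\<psi>: "continuous_on UNIV \<psi>" "bounded (range \<psi>)" using \<psi>(1) by (auto simp: A_dom_def)
  have m\<psi>: "\<psi> \<in> borel_measurable borel" using c\<psi>(1) by (rule borel_measurable_continuous_onI)
  obtain K' where K': "\<And>x. \<bar>\<psi> x\<bar> \<le> K'" using c\<psi>(2) by (auto simp: bounded_iff)
  have "((\<lambda>t. (T t \<psi> x - \<psi> x) / t) \<longlongrightarrow> A_op b l1 l2 \<psi> x) (at_right 0)"
    using gen \<psi>(1) unfolding generator_is_def T_def by blast
  then have "((\<lambda>t. (T t \<psi> x - \<psi> x) / t * t) \<longlongrightarrow> A_op b l1 l2 \<psi> x * 0) (at_right 0)"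
    by (intro tendsto_mult tendsto_ident_at)
  then have lim: "((\<lambda>t. (T t \<psi> x - \<psi> x) / t * t) \<longlongrightarrow> 0) (at_right 0)" by simp
  have T\<psi>: "((\<lambda>t. T t \<psi> x) \<longlongrightarrow> 0) (at_right 0)"
    by (rule Lim_transform_eventually[OF lim], rule eventually_mono[OF eventually_at_right_less[of 0]]) (use \<psi>(2) in auto)
  have "continuous_on UNIV (\<lambda>z. h (unscale z))"
    by (rule continuous_on_compose2[OF h(1) continuous_unscale]) auto
  then obtain d where d: "d > 0" "\<And>z. dist z (scale x) < d \<Longrightarrow> dist (h (unscale z)) (h (unscale (scale x))) < e / 2"
    unfolding continuous_on_iff using e by (metis UNIV_I half_gt_zero)
  have near: "\<bar>h y - h x\<bar> < e / 2" if "\<bar>scale y - scale x\<bar> < d" for y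
    using d(2)[of "scale y"] that by (simp add: dist_real_def)
  obtain c where c: "c > 0" "\<And>y. d \<le> \<bar>scale y - scale x\<bar> \<Longrightarrow> c \<le> \<psi> y" using \<psi>(4)[OF d(1)] by blast
  have bnd: "\<bar>h y - h x\<bar> \<le> e / 2 + 2 * K / c * \<psi> y" for y
  proof (cases "\<bar>scale y - scale x\<bar> < d")
    case True
    have "0 \<le> 2 * K / c * \<psi> y" using K0 c \<psi>(3) by simp
    then show ?thesis using near[OF True] by linarith
  next
    case False
    then have "2 * K / c * c \<le> 2 * K / c * \<psi> y" using c K0 by (intro mult_left_mono) auto
    then have "2 * K \<le> 2 * K / c * \<psi> y" using c by simp
    moreover have "\<bar>h y - h x\<bar> \<le> 2 * K" using h(2)[of y] h(2)[of x] by linarith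
    ultimately show ?thesis using e by linarith
  qed
  have "((\<lambda>t. 2 * K / c * T t \<psi> x) \<longlongrightarrow> 2 * K / c * 0) (at_right 0)" by (intro tendsto_intros T\<psi>)
  then have "eventually (\<lambda>t. 2 * K / c * T t \<psi> x < e / 2) (at_right 0)"
    by (rule order_tendstoD) (use e in simp)
  then show "eventually (\<lambda>t. dist (T t h x) (h x) < e) (at_right 0)"
    using eventually_at_right_less
  proof eventually_elim
    case (elim t)
    then have t: "0 \<le> t" by simp
    interpret prob_space "P t x" using t by (rule P_prob)
    note ih = P_integrable[OF t mh h(2), of x] and i\<psi> = P_integrable[OF t m\<psi> K', of x]
    have "T t h x - h x = (\<integral>y. h y - h x \<partial>P t x)"
      using ih by (simp add: T_def prob_space)
    also have "\<bar>\<dots>\<bar> \<le> (\<integral>y. \<bar>h y - h x\<bar> \<partial>P t x)" by (rule integral_abs_bound)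
    also have "\<dots> \<le> (\<integral>y. e / 2 + 2 * K / c * \<psi> y \<partial>P t x)"
      by (intro integral_mono integrable_abs Bochner_Integration.integrable_diff Bochner_Integration.integrable_add integrable_mult_right ih i\<psi> bnd) auto
    also have "\<dots> = e / 2 + 2 * K / c * T t \<psi> x" using i\<psi> by (simp add: T_def prob_space)
    finally show ?case using elim by (simp add: dist_real_def)
  qed
qed

text \<open>Writing \<open>T (s + t) h\<close> as \<open>T s (T t h)\<close> puts the small time
  inside, where dominated convergence under \<open>P s x\<close> applies. This route yields limits
  from the right.\<close>

lemma T_right_continuous:
  assumes h: "continuous_on UNIV h" "\<And>x. \<bar>h x\<bar> \<le> K" and s: "0 \<le> s"
  shows "((\<lambda>t. T t h x) \<longlongrightarrow> T s h x) (at_right s)"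
proof -
  have mh: "h \<in> borel_measurable borel" using h(1) by (rule borel_measurable_continuous_onI)
  have bh: "bounded (range h)" using h(2) by (auto simp: bounded_iff)
  interpret prob_space "P s x" using s by (rule P_prob)
  have "((\<lambda>t. T (s + t) h x) \<longlongrightarrow> T s h x) (at_right 0)"
  proof (rule tendsto_at_rightI)
    fix X :: "nat \<Rightarrow> real" assume X: "\<And>i. 0 < X i" "\<And>i. X i \<le> 1" "X \<longlonglongrightarrow> 0"
      and XX: "filterlim X (at_right 0) sequentially"
    have X0: "0 \<le> X i" for i using X(1)[of i] by simp
    have "(\<lambda>i. \<integral>y. T (X i) h y \<partial>P s x) \<longlonglongrightarrow> (\<integral>y. h y \<partial>P s x)"
    proof (rule integral_dominated_convergence[where w = "\<lambda>_. K"])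
      show "AE y in P s x. (\<lambda>i. T (X i) h y) \<longlonglongrightarrow> h y"
        by (rule AE_I2, rule filterlim_compose[OF T_tendsto[OF h] XX])
      show "AE y in P s x. norm (T (X i) h y) \<le> K" for i
        by (rule AE_I2) (use T_bound[OF X0 mh h(2)] in simp)
      show "T (X i) h \<in> borel_measurable (P s x)" for i
        using borel_measurable_continuous_onI[OF continuous_T[OF X0 h(1) bh]] P_prob(2)[OF s] by (simp cong: measurable_cong_sets)
      show "h \<in> borel_measurable (P s x)" using mh P_prob(2)[OF s] by (simp cong: measurable_cong_sets)
    qed simp
    then show "(\<lambda>i. T (s + X i) h x) \<longlonglongrightarrow> T s h x"
      using T_add[OF s X0 mh h(2)] by (simp add: T_def)
  qed
  then show ?thesis
    by (simp add: filterlim_at_right_to_0[of _ _ s] add.commute)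
qed

text \<open>Time is rounded up to a countable grid, to match continuity from the right. Adding 1 to
  the floor makes the grid point strictly larger than the time, as convergence along
  \<open>at_right\<close> requires.\<close>

lemma measurable_T2:
  assumes h: "continuous_on UNIV h" "\<And>x. \<bar>h x\<bar> \<le> K"
  shows "(\<lambda>(t, x). T (max 0 t) h x) \<in> borel_measurable (borel \<Otimes>\<^sub>M borel)"
proof (rule borel_measurable_LIMSEQ_metric)
  have bh: "bounded (range h)" using h(2) by (auto simp: bounded_iff)
  define d where "d n t = real_of_int (\<lfloor>real (Suc n) * max 0 t\<rfloor> + 1) / real (Suc n)" for n t
  have d: "max 0 t < d n t" "d n t \<le> max 0 t + 1 / real (Suc n)" for n t
  proof -
    have "real (Suc n) * max 0 t < real_of_int (\<lfloor>real (Suc n) * max 0 t\<rfloor> + 1)" by linarith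
    then have "max 0 t * real (Suc n) < real_of_int (\<lfloor>real (Suc n) * max 0 t\<rfloor> + 1)" by (subst mult.commute)
    then show "max 0 t < d n t" unfolding d_def by (intro iffD2[OF pos_less_divide_eq]) simp
    have "real_of_int (\<lfloor>real (Suc n) * max 0 t\<rfloor> + 1) \<le> real (Suc n) * max 0 t + 1" by linarith
    then have "d n t \<le> (real (Suc n) * max 0 t + 1) / real (Suc n)" unfolding d_def by (rule divide_right_mono) simp
    then show "d n t \<le> max 0 t + 1 / real (Suc n)" by (simp add: add_divide_distrib del: of_nat_Suc)
  qed
  show "(\<lambda>(t, x). T (d n t) h x) \<in> borel_measurable (borel \<Otimes>\<^sub>M borel)" for n
  proof -
    have eq: "(\<lambda>(t, x). T (d n t) h x) = (\<lambda>p. (\<lambda>i p. T (max 0 (real_of_int (i + 1) / real (Suc n))) h (snd p)) \<lfloor>real (Suc n) * max 0 (fst p)\<rfloor> p)"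
    proof -
      have "max 0 (d n t) = d n t" for t using d(1)[of t n] by simp
      then show ?thesis by (auto simp: fun_eq_iff d_def)
    qed
    show ?thesis
      unfolding eq
    proof (rule measurable_compose_countable[where f = "\<lambda>i p. T (max 0 (real_of_int (i + 1) / real (Suc n))) h (snd p)"
          and g = "\<lambda>p. \<lfloor>real (Suc n) * max 0 (fst p)\<rfloor>"])
      show "(\<lambda>p. T (max 0 (real_of_int (i + 1) / real (Suc n))) h (snd p)) \<in> borel_measurable (borel \<Otimes>\<^sub>M borel)" for i
        using measurable_compose[OF measurable_snd borel_measurable_continuous_onI[OF continuous_T[OF max.cobounded1 h(1) bh]]] .
      have "(\<lambda>p. real (Suc n) * max 0 (fst p)) \<in> borel_measurable (borel \<Otimes>\<^sub>M borel)" by measurable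
      from measurable_compose[OF this measurable_real_floor]
      show "(\<lambda>p. \<lfloor>real (Suc n) * max 0 (fst p)\<rfloor>) \<in> borel \<Otimes>\<^sub>M borel \<rightarrow>\<^sub>M count_space UNIV" .
    qed
  qed
  fix p :: "real \<times> real"
  let ?t = "max 0 (fst p)"
  have "(\<lambda>n. d n (fst p)) \<longlonglongrightarrow> ?t"
  proof (rule tendsto_sandwich[where f = "\<lambda>_. ?t" and h = "\<lambda>n. ?t + 1 / real (Suc n)"])
    show "(\<lambda>n. ?t + 1 / real (Suc n)) \<longlonglongrightarrow> ?t"
      using tendsto_add[OF tendsto_const LIMSEQ_inverse_real_of_nat, of ?t] by (simp add: inverse_eq_divide del: of_nat_Suc)
  qed (use d in \<open>auto intro!: always_eventually less_imp_le\<close>)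
  moreover have "d n (fst p) \<noteq> ?t" for n using d(1)[of "fst p" n] by (rule less_imp_neq[THEN not_sym])
  ultimately have "filterlim (\<lambda>n. d n (fst p)) (at_right ?t) sequentially"
    using d(1) by (auto simp: filterlim_at)
  from filterlim_compose[OF T_right_continuous[OF h, of ?t] this]
  show "(\<lambda>n. case p of (t, x) \<Rightarrow> T (d n t) h x) \<longlonglongrightarrow> (case p of (t, x) \<Rightarrow> T (max 0 t) h x)"
    by (simp add: case_prod_beta)
qed

lemma measurable_T1:
  assumes h: "continuous_on UNIV h" "\<And>x. \<bar>h x\<bar> \<le> K"
  shows "(\<lambda>t. T (max 0 t) h x) \<in> borel_measurable borel"
proof -
  have "(\<lambda>t. (t, x)) \<in> borel \<rightarrow>\<^sub>M borel \<Otimes>\<^sub>M (borel :: real measure)" by measurable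
  from measurable_compose[OF this measurable_T2[OF h]] show ?thesis by simp
qed

text \<open>This is \<open>l\<close> times the resolvent at \<open>l\<close>: the semigroup run for an exponential time.\<close>

definition S :: "real \<Rightarrow> (real \<Rightarrow> real) \<Rightarrow> real \<Rightarrow> real" where
  "S l h x = (LBINT t. exponential_density l t * T (max 0 t) h x)"

lemma S_eq:
  assumes l: "0 < l" and h: "continuous_on UNIV h" "\<And>x. \<bar>h x\<bar> \<le> K"
  shows "S l h x = (\<integral>t. T (max 0 t) h x \<partial>density lborel (\<lambda>t. ennreal (exponential_density l t)))"
  unfolding S_def
  by (rule integral_real_density[symmetric]) (use l measurable_T1[OF h] in \<open>auto simp: exponential_density_nonneg\<close>)

lemma exponential_integrable:
  assumes l: "0 < l" and f: "f \<in> borel_measurable borel" "\<And>t. \<bar>f t\<bar> \<le> K"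
  shows "integrable lborel (\<lambda>t. exponential_density l t * f t)"
proof (rule Bochner_Integration.integrable_bound[OF integrable_mult_right[OF integrable_exponential_density[OF l], of K]])
  have K: "0 \<le> K" using f(2)[of 0] by linarith
  show "AE s in lborel. norm (exponential_density l s * f s) \<le> norm (K * exponential_density l s)"
    by (rule AE_I2) (use f(2) K in \<open>auto simp: abs_mult mult.commute intro!: mult_right_mono\<close>)
qed (use f in auto)

lemma S_bound:
  assumes l: "0 < l" and h: "continuous_on UNIV h" "\<And>x. \<bar>h x\<bar> \<le> K"
  shows "\<bar>S l h x\<bar> \<le> K"
proof -
  interpret E: prob_space "density lborel (\<lambda>t. ennreal (exponential_density l t))"
    using l by (rule prob_space_exponential_density)
  have mh: "h \<in> borel_measurable borel" using h(1) by (rule borel_measurable_continuous_onI)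
  have Tb: "\<bar>T (max 0 t) h x\<bar> \<le> K" for t by (rule T_bound[OF _ mh h(2)]) simp
  have i: "integrable (density lborel (\<lambda>t. ennreal (exponential_density l t))) (\<lambda>t. T (max 0 t) h x)"
    by (rule E.integrable_const_bound[where B = K]) (use Tb measurable_T1[OF h] in auto)
  have "\<bar>S l h x\<bar> \<le> (\<integral>t. \<bar>T (max 0 t) h x\<bar> \<partial>density lborel (\<lambda>t. ennreal (exponential_density l t)))"
    unfolding S_eq[OF l h] by (rule integral_abs_bound)
  also have "\<dots> \<le> (\<integral>t. K \<partial>density lborel (\<lambda>t. ennreal (exponential_density l t)))"
    by (intro integral_mono integrable_abs i Tb) auto
  finally show ?thesis by (simp add: E.prob_space del: space_density)
qed

lemma continuous_S:
  assumes l: "0 < l" and h: "continuous_on UNIV h" "\<And>x. \<bar>h x\<bar> \<le> K"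
  shows "continuous_on UNIV (S l h)"
  unfolding continuous_on_sequentially comp_def
proof (intro allI ballI impI)
  fix x :: "nat \<Rightarrow> real" and a assume x: "(\<forall>n. x n \<in> UNIV) \<and> x \<longlonglongrightarrow> a"
  have mh: "h \<in> borel_measurable borel" using h(1) by (rule borel_measurable_continuous_onI)
  have bh: "bounded (range h)" using h(2) by (auto simp: bounded_iff)
  have Tb: "\<bar>T (max 0 t) h y\<bar> \<le> K" for t y by (rule T_bound[OF _ mh h(2)]) simp
  show "(\<lambda>n. S l h (x n)) \<longlonglongrightarrow> S l h a"
    unfolding S_def
  proof (rule integral_dominated_convergence[where w = "\<lambda>t. K * exponential_density l t"])
    show "AE t in lborel. (\<lambda>n. exponential_density l t * T (max 0 t) h (x n)) \<longlonglongrightarrow> exponential_density l t * T (max 0 t) h a"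
    proof (rule AE_I2, rule tendsto_mult[OF tendsto_const])
      fix t :: real
      show "(\<lambda>n. T (max 0 t) h (x n)) \<longlonglongrightarrow> T (max 0 t) h a"
        by (rule continuous_on_tendsto_compose[OF continuous_T[OF _ h(1) bh]]) (use x in auto)
    qed
    show "AE t in lborel. norm (exponential_density l t * T (max 0 t) h (x n)) \<le> K * exponential_density l t" for n
    proof (rule AE_I2)
      fix t
      have "0 \<le> exponential_density l t" using l by (simp add: exponential_density_nonneg)
      then show "norm (exponential_density l t * T (max 0 t) h (x n)) \<le> K * exponential_density l t"
        using mult_left_mono[OF Tb[of t "x n"], of "exponential_density l t"] by (simp add: abs_mult mult.commute)
    qed
    show "integrable lborel (\<lambda>t. K * exponential_density l t)" using integrable_exponential_density[OF l] by simp
  qed (use measurable_T1[OF h] in auto)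
qed

text \<open>Lack of memory of the exponential time: delaying by \<open>s\<close> multiplies the
  density by \<open>exp (l * s)\<close> and removes the times in [0,s). The removed integral is
  rescaled to [0,1), so that its domain stays fixed as \<open>s\<close> tends to 0.\<close>

lemma T_S:
  assumes l: "0 < l" and h: "continuous_on UNIV h" "\<And>x. \<bar>h x\<bar> \<le> K" and s: "0 < s"
  shows "T s (S l h) x = exp (l * s) * (S l h x - s * (LBINT r. indicator {0..<1} r * (exponential_density l (s * r) * T (max 0 (s * r)) h x)))"
proof -
  define u where "u t = T (max 0 t) h x" for t
  have mh: "h \<in> borel_measurable borel" using h(1) by (rule borel_measurable_continuous_onI)
  have Tb: "\<bar>T (max 0 t) h y\<bar> \<le> K" for t y by (rule T_bound[OF _ mh h(2)]) simp
  have um[measurable]: "u \<in> borel_measurable borel" unfolding u_def by (rule measurable_T1[OF h])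
  let ?E = "density lborel (\<lambda>t. ennreal (exponential_density l t))"
  interpret E: prob_space ?E using l by (rule prob_space_exponential_density)
  interpret P: prob_space "P s x" using s by (intro P_prob) simp
  interpret EP: pair_prob_space ?E "P s x" ..
  have "(\<lambda>(t, y). T (max 0 t) h y) \<in> borel_measurable (?E \<Otimes>\<^sub>M P s x)"
    using measurable_T2[OF h] by (subst measurable_cong_sets[OF sets_pair_measure_cong[OF _ P_prob(2)] refl]) (use s in auto)
  then have i: "integrable (?E \<Otimes>\<^sub>M P s x) (\<lambda>(t, y). T (max 0 t) h y)"
    by (intro EP.integrable_const_bound[where B = K]) (use Tb in auto)
  have "T s (S l h) x = (\<integral>y. (\<integral>t. T (max 0 t) h y \<partial>?E) \<partial>P s x)"
    unfolding T_def[of s] by (rule Bochner_Integration.integral_cong[OF refl S_eq[OF l h]])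
  also have "\<dots> = (\<integral>t. (\<integral>y. T (max 0 t) h y \<partial>P s x) \<partial>?E)"
    by (rule EP.Fubini_integral[OF i])
  also have "\<dots> = (\<integral>t. u (s + max 0 t) \<partial>?E)"
    using s by (intro Bochner_Integration.integral_cong[OF refl])
      (simp add: u_def T_add[OF _ _ mh h(2), of s] T_def[of s, symmetric] max_def)
  also have "\<dots> = (LBINT t. exponential_density l t * u (s + max 0 t))"
    by (rule integral_real_density) (use l in \<open>auto simp: exponential_density_nonneg\<close>)
  also have "\<dots> = (LBINT t. exponential_density l (s + 1 * t - s) * u (s + 1 * t))"
    by (rule Bochner_Integration.integral_cong[OF refl]) (auto simp: exponential_density_def max_def)
  also have "\<dots> = (LBINT r. exponential_density l (r - s) * u r)"
    using lborel_integral_real_affine[of 1 "\<lambda>r. exponential_density l (r - s) * u r" s] by simp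
  also have "\<dots> = (LBINT r. exp (l * s) * (exponential_density l r * u r - indicator {0..<s} r * (exponential_density l r * u r)))"
  proof (rule Bochner_Integration.integral_cong[OF refl])
    fix r
    show "exponential_density l (r - s) * u r = exp (l * s) * (exponential_density l r * u r - indicator {0..<s} r * (exponential_density l r * u r))"
      using s by (cases "r < s"; cases "r < 0") (auto simp: exponential_density_def exp_add[symmetric] algebra_simps indicator_def)
  qed
  also have "\<dots> = exp (l * s) * ((LBINT r. exponential_density l r * u r) - (LBINT r. indicator {0..<s} r * (exponential_density l r * u r)))"
  proof -
    have iu: "integrable lborel (\<lambda>r. exponential_density l r * u r)"
      by (rule exponential_integrable[OF l um, of K]) (simp add: u_def Tb)
    have "integrable lborel (\<lambda>r. indicator {0..<s} r * (exponential_density l r * u r))"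
      using integrable_real_mult_indicator[OF _ iu, of "{0..<s}"] by (simp add: mult.commute)
    then show ?thesis using iu by simp
  qed
  also have "(LBINT r. indicator {0..<s} r * (exponential_density l r * u r)) =
      \<bar>s\<bar> *\<^sub>R (LBINT r. indicator {0..<s} (0 + s * r) * (exponential_density l (0 + s * r) * u (0 + s * r)))"
    by (rule lborel_integral_real_affine) (use s in simp)
  also have "\<dots> = s * (LBINT r. indicator {0..<1} r * (exponential_density l (s * r) * u (s * r)))"
  proof -
    have "indicator {0..<s} (0 + s * r) = (indicator {0..<1} r :: real)" for r
      using s by (auto simp: indicator_def zero_le_mult_iff)
    then show ?thesis using s by simp
  qed
  finally show ?thesis unfolding S_def[of l h x] u_def .
qed

text \<open>The resolvent equation. In \<open>T_S\<close> the factor \<open>exp (l * s)\<close>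
  contributes \<open>l * S l h x\<close>, and the removed integral, divided by \<open>s\<close>,
  tends to \<open>l * h x\<close> by continuity of the semigroup at time 0.\<close>

lemma S_rate:
  assumes l: "0 < l" and h: "continuous_on UNIV h" "\<And>x. \<bar>h x\<bar> \<le> K"
  shows "((\<lambda>s. (T s (S l h) x - S l h x) / s) \<longlongrightarrow> l * (S l h x - h x)) (at_right 0)"
proof -
  have mh: "h \<in> borel_measurable borel" using h(1) by (rule borel_measurable_continuous_onI)
  have Tb: "\<bar>T (max 0 t) h y\<bar> \<le> K" for t y by (rule T_bound[OF _ mh h(2)]) simp
  have K0: "0 \<le> K" using h(2)[of 0] by linarith
  let ?J = "\<lambda>s. LBINT r. indicator {0..<1} r * (exponential_density l (s * r) * T (max 0 (s * r)) h x)"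
  have J: "(?J \<longlongrightarrow> l * h x) (at_right 0)"
  proof (rule tendsto_at_rightI)
    fix X :: "nat \<Rightarrow> real" assume X: "\<And>i. 0 < X i" "\<And>i. X i \<le> 1" "X \<longlonglongrightarrow> 0"
      and XX: "filterlim X (at_right 0) sequentially"
    have "(\<lambda>i. ?J (X i)) \<longlonglongrightarrow> (LBINT r::real. indicator {0..<1} r * (l * h x))"
    proof (rule integral_dominated_convergence[where w = "\<lambda>r::real. indicator {0..<1} r * (l * K)"])
      show "AE r in lborel. (\<lambda>i. indicator {0..<1} r * (exponential_density l (X i * r) * T (max 0 (X i * r)) h x)) \<longlonglongrightarrow> indicator {0..<1} r * (l * h x)"
      proof (rule AE_I2)
        fix r :: real
        show "(\<lambda>i. indicator {0..<1} r * (exponential_density l (X i * r) * T (max 0 (X i * r)) h x)) \<longlonglongrightarrow> indicator {0..<1} r * (l * h x)"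
        proof (cases "r \<in> {0..<1}")
          case True
          have pos: "0 \<le> X i * r" for i using True X(1)[of i] by simp
          have lim: "(\<lambda>i. X i * r) \<longlonglongrightarrow> 0" using tendsto_mult[OF X(3) tendsto_const, of r] by simp
          have "(\<lambda>i. l * exp (- (X i * r) * l)) \<longlonglongrightarrow> l * exp (- 0 * l)" by (intro tendsto_intros lim)
          then have 1: "(\<lambda>i. exponential_density l (X i * r)) \<longlonglongrightarrow> l"
            using pos by (simp add: exponential_density_def not_less[symmetric])
          have 2: "(\<lambda>i. T (max 0 (X i * r)) h x) \<longlonglongrightarrow> h x"
          proof (cases "r = 0")
            case False
            then have p: "0 < X i * r" for i using True X(1)[of i] by simp
            have "X i * r \<noteq> 0" for i using p[of i] by (rule less_imp_neq[THEN not_sym])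
            then have "filterlim (\<lambda>i. X i * r) (at_right 0) sequentially" using lim p by (auto simp: filterlim_at)
            from filterlim_compose[OF T_tendsto[OF h] this] show ?thesis using pos by (simp add: max_def)
          qed (simp add: T_0[OF mh])
          show ?thesis using tendsto_mult[OF 1 2] True by simp
        qed simp
      qed
      show "AE r in lborel. norm (indicator {0..<1} r * (exponential_density l (X i * r) * T (max 0 (X i * r)) h x)) \<le> indicator {0..<1} r * (l * K)" for i
      proof (rule AE_I2)
        fix r :: real
        have "\<bar>exponential_density l (X i * r)\<bar> \<le> l" using l by (auto simp: exponential_density_def)
        then have "\<bar>exponential_density l (X i * r)\<bar> * \<bar>T (max 0 (X i * r)) h x\<bar> \<le> l * K" using Tb l by (intro mult_mono) auto
        then show "norm (indicator {0..<1} r * (exponential_density l (X i * r) * T (max 0 (X i * r)) h x)) \<le> indicator {0..<1} r * (l * K)"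
          by (auto simp: abs_mult indicator_def)
      qed
      have mm: "(\<lambda>r. T (max 0 (X i * r)) h x) \<in> borel_measurable borel" for i
        by (rule measurable_compose[OF _ measurable_T1[OF h]]) simp
      show "(\<lambda>r. indicator {0..<1} r * (exponential_density l (X i * r) * T (max 0 (X i * r)) h x)) \<in> borel_measurable lborel" for i
        using mm[of i] by simp
      show "integrable lborel (\<lambda>r::real. indicator {0..<1} r * (l * K))" by (intro integrable_mult_left integrable_real_indicator) auto
    qed simp
    also have "(LBINT r::real. indicator {0..<1} r * (l * h x)) = l * h x" by simp
    finally show "(\<lambda>i. ?J (X i)) \<longlonglongrightarrow> l * h x" .
  qed
  have "((\<lambda>s. exp (l * s)) has_real_derivative l) (at 0)"
    by (auto intro!: derivative_eq_intros)
  then have "((\<lambda>s. (exp (l * s) - 1) / s) \<longlongrightarrow> l) (at 0)"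
    by (simp add: DERIV_def)
  then have 1: "((\<lambda>s. (exp (l * s) - 1) / s) \<longlongrightarrow> l) (at_right 0)"
    by (rule tendsto_within_subset) simp
  have "((\<lambda>s. exp (l * s)) \<longlongrightarrow> exp (l * 0)) (at_right 0)" by (intro tendsto_intros)
  then have 2: "((\<lambda>s. exp (l * s)) \<longlongrightarrow> 1) (at_right 0)" by simp
  have lim: "((\<lambda>s. (exp (l * s) - 1) / s * S l h x - exp (l * s) * ?J s) \<longlongrightarrow> l * S l h x - 1 * (l * h x)) (at_right 0)"
    by (intro tendsto_diff tendsto_mult tendsto_const 1 2 J)
  have "((\<lambda>s. (T s (S l h) x - S l h x) / s) \<longlongrightarrow> l * S l h x - 1 * (l * h x)) (at_right 0)"
    by (rule Lim_transform_eventually[OF lim])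
       (use eventually_at_right_less in eventually_elim, simp add: T_S[OF l h] field_simps)
  then show ?thesis by (simp add: algebra_simps)
qed

text \<open>\<open>generator_is\<close> fixes the domain exactly, so a bounded continuous function
  whose quotients converge pointwise to a continuous limit lies in \<open>A_dom\<close>. This ties
  an abstract semigroup to a differential equation.\<close>

lemma S_in_domain:
  assumes l: "0 < l" and h: "continuous_on UNIV h" "\<And>x. \<bar>h x\<bar> \<le> K"
  shows "S l h \<in> A_dom b l1 l2" "A_op b l1 l2 (S l h) x = l * (S l h x - h x)"
proof -
  have c: "continuous_on UNIV (\<lambda>x. l * (S l h x - h x))" by (intro continuous_intros continuous_S[OF l h] h)
  have bd: "bounded (range (S l h))" using S_bound[OF l h] by (auto simp: bounded_iff)
  have lim: "\<forall>x. ((\<lambda>t. ((\<integral>y. S l h y \<partial>P t x) - S l h x) / t) \<longlongrightarrow> l * (S l h x - h x)) (at_right 0)"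
    using S_rate[OF l h] by (simp add: T_def)
  show dom: "S l h \<in> A_dom b l1 l2"
    using gen c bd lim continuous_S[OF l h] unfolding generator_is_def by blast
  have "((\<lambda>t. ((\<integral>y. S l h y \<partial>P t x) - S l h x) / t) \<longlongrightarrow> A_op b l1 l2 (S l h) x) (at_right 0)"
    using gen dom unfolding generator_is_def by blast
  then show "A_op b l1 l2 (S l h) x = l * (S l h x - h x)"
    using lim tendsto_unique[OF trivial_limit_at_right_real] by blast
qed

end

section \<open>Identification of semigroups with the same generator\<close>

context two_media
begin

text \<open>In the coordinate \<open>z\<close> the right-hand side \<open>h\<close> cancels and the
  difference of two solutions is a bounded eigenfunction for \<open>l\<close>. Exchanging
  \<open>f\<close> and \<open>f'\<close> gives equality.\<close>

lemma resolvent_equation_le: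
  assumes f: "f \<in> A_dom b l1 l2" "f' \<in> A_dom b l1 l2" and l: "l > 0"
    and eq: "\<And>x. A_op b l1 l2 f x = l * (f x - h x)" "\<And>x. A_op b l1 l2 f' x = l * (f' x - h x)"
  shows "f x \<le> f' x"
proof -
  obtain F F1 F2 where F: "f = (\<lambda>q. F (scale q))" "\<And>z. (F has_real_derivative F1 z) (at z)"
    "\<And>z. (F1 has_real_derivative F2 z) (at z)" "continuous_on UNIV F2" "bounded (range F)"
    using A_domE[OF f(1)] by blast
  obtain G G1 G2 where G: "f' = (\<lambda>q. G (scale q))" "\<And>z. (G has_real_derivative G1 z) (at z)"
    "\<And>z. (G1 has_real_derivative G2 z) (at z)" "continuous_on UNIV G2" "bounded (range G)"
    using A_domE[OF f(2)] by blast
  obtain K K' where K: "\<And>z. \<bar>F z\<bar> \<le> K" "\<And>z. \<bar>G z\<bar> \<le> K'" using F(5) G(5) by (auto simp: bounded_iff)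
  have "F (scale x) - G (scale x) \<le> 0"
  proof (rule bounded_eigenfunction_nonpos[where D = "\<lambda>z. F z - G z" and D' = "\<lambda>z. F1 z - G1 z" and D'' = "\<lambda>z. F2 z - G2 z", OF _ _ _ l])
    show "((\<lambda>z. F z - G z) has_real_derivative F1 z - G1 z) (at z)" for z by (intro DERIV_diff F G)
    show "((\<lambda>z. F1 z - G1 z) has_real_derivative F2 z - G2 z) (at z)" for z by (intro DERIV_diff F G)
    show "\<bar>F z - G z\<bar> \<le> K + K'" for z using K(1)[of z] K(2)[of z] by linarith
    fix z
    have 1: "1 / 2 * F2 z + bz z * F1 z = l * (F z - h (unscale z))"
      using eq(1)[of "unscale z"] by (simp add: F(1) A_op_eq[OF F(2-5)] bz_def)
    have 2: "1 / 2 * G2 z + bz z * G1 z = l * (G z - h (unscale z))"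
      using eq(2)[of "unscale z"] by (simp add: G(1) A_op_eq[OF G(2-5)] bz_def)
    have "1 / 2 * (F2 z - G2 z) + bz z * (F1 z - G1 z) = (1 / 2 * F2 z + bz z * F1 z) - (1 / 2 * G2 z + bz z * G1 z)"
      by (simp add: field_simps)
    also have "\<dots> = l * (F z - G z)" unfolding 1 2 by (simp add: algebra_simps)
    finally show "1 / 2 * (F2 z - G2 z) + bz z * (F1 z - G1 z) = l * (F z - G z)" .
  qed
  then show ?thesis by (simp add: F(1) G(1))
qed

lemma transition_unique:
  assumes P: "feller_transition P" "generator_is P (A_op b l1 l2) (A_dom b l1 l2)"
    and P': "feller_transition P'" "generator_is P' (A_op b l1 l2) (A_dom b l1 l2)" and t: "0 \<le> t"
  shows "P t x = P' t x"
proof -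
  interpret S1: media_semigroup b l1 l2 L B P by standard fact+
  interpret S2: media_semigroup b l1 l2 L B P' by standard fact+
  have "(\<integral>y. h y \<partial>P t x) = (\<integral>y. h y \<partial>P' t x)" if h: "continuous_on UNIV h" "bounded (range h)" for h :: "real \<Rightarrow> real"
  proof -
    obtain K where K: "\<And>x. \<bar>h x\<bar> \<le> K" using h(2) by (auto simp: bounded_iff)
    note hK = h(1) K
    have mh: "h \<in> borel_measurable borel" using h(1) by (rule borel_measurable_continuous_onI)
    have S: "S1.S l h x = S2.S l h x" if l: "l > 0" for l
      by (rule antisym; rule resolvent_equation_le[where h = h, OF _ _ l])
         (use S1.S_in_domain[OF l hK] S2.S_in_domain[OF l hK] in auto)
    define v where "v t = S1.T (max 0 t) h x - S2.T (max 0 t) h x" for t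
    have vm: "v \<in> borel_measurable borel"
      unfolding v_def by (intro borel_measurable_diff S1.measurable_T1[OF hK] S2.measurable_T1[OF hK])
    have T1b: "\<bar>S1.T (max 0 t) h x\<bar> \<le> K" and T2b: "\<bar>S2.T (max 0 t) h x\<bar> \<le> K" for t
      by (rule S1.T_bound[OF _ mh K], simp, rule S2.T_bound[OF _ mh K], simp)
    have vb: "\<bar>v t\<bar> \<le> 2 * K" for t using T1b[of t] T2b[of t] unfolding v_def by linarith
    have rc: "(v \<longlongrightarrow> v s) (at_right s)" if s: "0 \<le> s" for s
    proof (rule Lim_transform_eventually)
      show "((\<lambda>t. S1.T t h x - S2.T t h x) \<longlongrightarrow> v s) (at_right s)"
        unfolding v_def using tendsto_diff[OF S1.T_right_continuous[OF hK s, of x] S2.T_right_continuous[OF hK s, of x]] s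
        by (simp add: max_def)
      show "eventually (\<lambda>t. S1.T t h x - S2.T t h x = v t) (at_right s)"
        using eventually_at_right_less by eventually_elim (use s in \<open>simp add: v_def max_def\<close>)
    qed
    have int: "(LBINT t. exponential_density (real (Suc n)) t * v t) = 0" for n
    proof -
      have l: "0 < real (Suc n)" by simp
      note i1 = S1.exponential_integrable[OF l S1.measurable_T1[OF hK, of x] T1b]
      note i2 = S1.exponential_integrable[OF l S2.measurable_T1[OF hK, of x] T2b]
      have "(LBINT t. exponential_density (real (Suc n)) t * v t) = S1.S (real (Suc n)) h x - S2.S (real (Suc n)) h x"
        unfolding S1.S_def S2.S_def v_def right_diff_distrib
        using Bochner_Integration.integral_diff[OF i1 i2] .
      then show ?thesis using S[OF l] by simp
    qed
    have "v t \<le> 0" by (rule laplace_unique[OF vm vb rc int t])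
    moreover have "- v t \<le> 0"
      by (rule laplace_unique[of "\<lambda>t. - v t", OF _ _ _ _ t]) (use vm vb rc int in \<open>auto intro: tendsto_minus\<close>)
    ultimately have "v t = 0" by simp
    then show ?thesis using t by (simp add: v_def S1.T_def S2.T_def max_def)
  qed
  then show ?thesis
    using S1.P_prob[OF t, of x] S2.P_prob[OF t, of x]
    by (intro measure_eqI_continuous) (auto simp: prob_space.finite_measure)
qed

end

section \<open>Laws of Markov processes\<close>

lemma markov_processD:
  assumes "markov_process N X P"
  shows "prob_space N" "0 \<le> t \<Longrightarrow> X t \<in> borel_measurable N"
  using assms by (auto simp: markov_process_def)

lemma markov_process_integral:
  assumes mp: "markov_process N X P" and s: "0 \<le> s" and t: "0 \<le> t"
    and A: "A \<in> sets (past N X s)" and D: "D \<in> sets borel"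
    and P: "(\<lambda>x. measure (P t x) D) \<in> borel_measurable borel"
  shows "measure N (A \<inter> {\<omega> \<in> space N. X (s + t) \<omega> \<in> D}) = (\<integral>\<omega>. indicator A \<omega> * measure (P t (X s \<omega>)) D \<partial>N)"
proof -
  interpret prob_space N using markov_processD(1)[OF mp] .
  note X = markov_processD(2)[OF mp]
  have sub: "subalgebra N (past N X s)" by (rule subalgebra_past) (rule X)
  have "finite_measure_subalgebra N (past N X s)"
    using sub by (simp add: finite_measure_subalgebra_def finite_measure_subalgebra_axioms_def finite_measure_axioms)
  then interpret S: sigma_finite_subalgebra N "past N X s"
    by (rule finite_measure_subalgebra_is_sigma_finite)
  have AN: "A \<in> sets N" using A sub by (auto simp: subalgebra_def)
  have XD: "{\<omega> \<in> space N. X (s + t) \<omega> \<in> D} \<in> sets N"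
    using measurable_sets[OF X D, of "s + t"] s t by (simp add: vimage_def Int_def conj_commute)
  have i: "integrable N (\<lambda>\<omega>. indicator D (X (s + t) \<omega>) :: real)"
  proof (rule integrable_const_bound[where B = 1])
    show "(\<lambda>\<omega>. indicator D (X (s + t) \<omega>) :: real) \<in> borel_measurable N"
      by (rule measurable_compose[OF X borel_measurable_indicator[OF D]]) (use s t in simp)
  qed auto
  have "measure N (A \<inter> {\<omega> \<in> space N. X (s + t) \<omega> \<in> D}) = (\<integral>\<omega>. indicator (A \<inter> {\<omega> \<in> space N. X (s + t) \<omega> \<in> D}) \<omega> \<partial>N)"
    using AN XD by simp
  also have "\<dots> = set_lebesgue_integral N A (\<lambda>\<omega>. indicator D (X (s + t) \<omega>))"
    unfolding set_lebesgue_integral_def by (rule Bochner_Integration.integral_cong) (auto simp: indicator_def)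
  also have "\<dots> = set_lebesgue_integral N A (real_cond_exp N (past N X s) (\<lambda>\<omega>. indicator D (X (s + t) \<omega>)))"
    by (rule S.real_cond_exp_intA[OF i A])
  also have "\<dots> = set_lebesgue_integral N A (\<lambda>\<omega>. measure (P t (X s \<omega>)) D)"
    unfolding set_lebesgue_integral_def
  proof (rule integral_cong_AE)
    have "AE \<omega> in N. real_cond_exp N (past N X s) (\<lambda>\<omega>. indicator D (X (s + t) \<omega>)) \<omega> = measure (P t (X s \<omega>)) D"
      using mp s t D unfolding markov_process_def by blast
    then show "AE \<omega> in N. indicat_real A \<omega> *\<^sub>R real_cond_exp N (past N X s) (\<lambda>\<omega>. indicator D (X (s + t) \<omega>)) \<omega> =
        indicat_real A \<omega> *\<^sub>R measure (P t (X s \<omega>)) D" by eventually_elim simp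
    have [measurable]: "(\<lambda>\<omega>. measure (P t (X s \<omega>)) D) \<in> borel_measurable N"
      by (rule measurable_compose[OF X[OF s] P])
    show "(\<lambda>\<omega>. indicat_real A \<omega> *\<^sub>R measure (P t (X s \<omega>)) D) \<in> borel_measurable N" using AN by measurable
    show "(\<lambda>\<omega>. indicat_real A \<omega> *\<^sub>R real_cond_exp N (past N X s) (\<lambda>\<omega>. indicator D (X (s + t) \<omega>)) \<omega>) \<in> borel_measurable N"
      using AN by measurable
  qed
  finally show ?thesis by (simp add: set_lebesgue_integral_def)
qed

text \<open>The values on the grid up to index \<open>k\<close> are stored as an infinite sequence
  frozen after \<open>k\<close> by \<open>min i k\<close>, so all laws live on one space and
  induction on \<open>k\<close> can compare them.\<close>

lemma markov_grid_law:
  assumes mp: "markov_process N X P" "markov_process N' X' P" and q: "AE \<omega> in N. X 0 \<omega> = q" "AE \<omega> in N'. X' 0 \<omega> = q"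
    and h: "0 \<le> h" and P: "\<And>D. D \<in> sets borel \<Longrightarrow> (\<lambda>x. measure (P h x) D) \<in> borel_measurable borel"
  shows "distr N (Pi\<^sub>M UNIV (\<lambda>_. borel)) (\<lambda>\<omega> i. X (h * real (min i k)) \<omega>) =
    distr N' (Pi\<^sub>M UNIV (\<lambda>_. borel)) (\<lambda>\<omega> i. X' (h * real (min i k)) \<omega>)"
proof (induction k)
  have meas: "(\<lambda>\<omega> i. Y (h * real (min i k)) \<omega>) \<in> K \<rightarrow>\<^sub>M Pi\<^sub>M UNIV (\<lambda>_. borel)"
    if "\<And>t. 0 \<le> t \<Longrightarrow> Y t \<in> borel_measurable K" for K :: "'k measure" and Y :: "real \<Rightarrow> 'k \<Rightarrow> real" and k
    by (rule measurable_PiM_single') (use that h in auto)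
  {
    case 0
    have "distr K (Pi\<^sub>M UNIV (\<lambda>_. borel)) (\<lambda>\<omega> i. Y (h * real (min i 0)) \<omega>) = return (Pi\<^sub>M UNIV (\<lambda>_. borel)) (\<lambda>_::nat. q)"
      if "markov_process K Y P" "AE \<omega> in K. Y 0 \<omega> = q" for K :: "'k measure" and Y :: "real \<Rightarrow> 'k \<Rightarrow> real"
    proof -
      interpret prob_space K using markov_processD(1)[OF that(1)] .
      have "distr K (Pi\<^sub>M UNIV (\<lambda>_. borel)) (\<lambda>\<omega> i. Y (h * real (min i 0)) \<omega>) = distr K (Pi\<^sub>M UNIV (\<lambda>_. borel)) (\<lambda>\<omega> i::nat. q)"
        by (rule distr_cong_AE) (use that meas[of Y K 0] markov_processD(2)[OF that(1)] in \<open>auto simp: space_PiM\<close>)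
      also have "\<dots> = return (Pi\<^sub>M UNIV (\<lambda>_. borel)) (\<lambda>_::nat. q)"
        by (rule distr_const) (simp add: space_PiM)
      finally show ?thesis .
    qed
    from this[OF mp(1) q(1)] this[OF mp(2) q(2)] show ?case by simp
  next
    case (Suc k)
    let ?\<Pi> = "Pi\<^sub>M UNIV (\<lambda>_. borel) :: (nat \<Rightarrow> real) measure"
    \<comment> \<open>Rectangles suffice for the law of old values and next value together. Their
      mass involves only the law on the shorter grid and \<open>P h\<close>, so the induction
      hypothesis applies. The sample type is left general to serve both processes.\<close>
    have rect: "emeasure (distr K (?\<Pi> \<Otimes>\<^sub>M borel) (\<lambda>\<omega>. (\<lambda>i. Y (h * real (min i k)) \<omega>, Y (h * real (Suc k)) \<omega>))) (C \<times> D) =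
        ennreal (\<integral>x. indicator C x * measure (P h (x k)) D \<partial>distr K ?\<Pi> (\<lambda>\<omega> i. Y (h * real (min i k)) \<omega>))"
      if mpK: "markov_process K Y P" and C: "C \<in> sets ?\<Pi>" and D: "D \<in> sets borel"
      for K :: "'k measure" and Y :: "real \<Rightarrow> 'k \<Rightarrow> real" and C D
    proof -
      interpret prob_space K using markov_processD(1)[OF mpK] .
      note Y = markov_processD(2)[OF mpK]
      define s where "s = h * real k"
      have s: "0 \<le> s" "h * real (Suc k) = s + h" using h by (auto simp: s_def algebra_simps)
      let ?\<Xi> = "\<lambda>\<omega> i. Y (h * real (min i k)) \<omega>"
      have \<Xi>: "?\<Xi> \<in> K \<rightarrow>\<^sub>M ?\<Pi>" by (rule meas) (rule Y)
      have \<Xi>p: "?\<Xi> \<in> past K Y s \<rightarrow>\<^sub>M ?\<Pi>"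
        by (rule measurable_PiM_single') (use h in \<open>auto intro!: measurable_past simp: s_def mult_left_mono space_PiM\<close>)
      define A where "A = ?\<Xi> -` C \<inter> space K"
      have A: "A \<in> sets (past K Y s)" using measurable_sets[OF \<Xi>p C] by (simp add: A_def space_past)
      have pr: "(\<lambda>\<omega>. (?\<Xi> \<omega>, Y (h * real (Suc k)) \<omega>)) \<in> K \<rightarrow>\<^sub>M ?\<Pi> \<Otimes>\<^sub>M borel"
        using \<Xi> Y[of "h * real (Suc k)"] h by (intro measurable_Pair) auto
      have "emeasure (distr K (?\<Pi> \<Otimes>\<^sub>M borel) (\<lambda>\<omega>. (?\<Xi> \<omega>, Y (h * real (Suc k)) \<omega>))) (C \<times> D) =
        emeasure K (A \<inter> {\<omega> \<in> space K. Y (s + h) \<omega> \<in> D})"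
        by (subst emeasure_distr[OF pr]) (use C D in \<open>auto simp: A_def s(2)[symmetric] intro!: arg_cong[where f = "emeasure K"]\<close>)
      also have "\<dots> = ennreal (\<integral>\<omega>. indicator A \<omega> * measure (P h (Y s \<omega>)) D \<partial>K)"
        using markov_process_integral[OF mpK s(1) h A D P[OF D]] by (simp add: emeasure_eq_measure)
      also have "(\<integral>\<omega>. indicator A \<omega> * measure (P h (Y s \<omega>)) D \<partial>K) = (\<integral>\<omega>. indicator C (?\<Xi> \<omega>) * measure (P h (?\<Xi> \<omega> k)) D \<partial>K)"
        by (rule Bochner_Integration.integral_cong) (auto simp: A_def s_def indicator_def)
      also have "\<dots> = (\<integral>x. indicator C x * measure (P h (x k)) D \<partial>distr K ?\<Pi> ?\<Xi>)"
      proof (rule integral_distr[symmetric, OF \<Xi>])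
        have "(\<lambda>x. measure (P h (x k)) D) \<in> borel_measurable ?\<Pi>"
        proof -
          have "(\<lambda>x. x k) \<in> borel_measurable ?\<Pi>" by (rule measurable_component_singleton) simp
          from measurable_compose[OF this P[OF D]] show ?thesis .
        qed
        then show "(\<lambda>x. indicator C x * measure (P h (x k)) D) \<in> borel_measurable ?\<Pi>" using C by measurable
      qed
      finally show ?thesis .
    qed
    let ?pair = "\<lambda>K Y. distr K (?\<Pi> \<Otimes>\<^sub>M borel) (\<lambda>\<omega>. (\<lambda>i. Y (h * real (min i k)) \<omega>, Y (h * real (Suc k)) \<omega>))"
    have pm: "(\<lambda>\<omega>. (\<lambda>i. Y (h * real (min i k)) \<omega>, Y (h * real (Suc k)) \<omega>)) \<in> K \<rightarrow>\<^sub>M ?\<Pi> \<Otimes>\<^sub>M borel"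
      if "markov_process K Y P" for K :: "'k measure" and Y :: "real \<Rightarrow> 'k \<Rightarrow> real"
      by (intro measurable_Pair meas) (use markov_processD(2)[OF that] h in auto)
    have eq: "distr N (?\<Pi> \<Otimes>\<^sub>M borel) (\<lambda>\<omega>. (\<lambda>i. X (h * real (min i k)) \<omega>, X (h * real (Suc k)) \<omega>)) =
        distr N' (?\<Pi> \<Otimes>\<^sub>M borel) (\<lambda>\<omega>. (\<lambda>i. X' (h * real (min i k)) \<omega>, X' (h * real (Suc k)) \<omega>))"
    proof (rule pair_measure_eqI_rectangles)
      show "finite_measure (distr N (?\<Pi> \<Otimes>\<^sub>M borel) (\<lambda>\<omega>. (\<lambda>i. X (h * real (min i k)) \<omega>, X (h * real (Suc k)) \<omega>)))"
        using prob_space.prob_space_distr[OF markov_processD(1)[OF mp(1)] pm[OF mp(1)]] by (rule prob_space.finite_measure)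
      fix C D assume "C \<in> sets ?\<Pi>" "D \<in> sets (borel :: real measure)"
      then show "emeasure (distr N (?\<Pi> \<Otimes>\<^sub>M borel) (\<lambda>\<omega>. (\<lambda>i. X (h * real (min i k)) \<omega>, X (h * real (Suc k)) \<omega>))) (C \<times> D) =
        emeasure (distr N' (?\<Pi> \<Otimes>\<^sub>M borel) (\<lambda>\<omega>. (\<lambda>i. X' (h * real (min i k)) \<omega>, X' (h * real (Suc k)) \<omega>))) (C \<times> D)"
        using rect[OF mp(1)] rect[OF mp(2)] Suc.IH by simp
    qed auto
    \<comment> \<open>Appends the new value and repeats it for all later indices, matching the
      freezing by \<open>min i (Suc k)\<close>.\<close>
    let ?G = "\<lambda>p i. if i \<le> k then fst p i else (snd p :: real)"
    have G: "?G \<in> ?\<Pi> \<Otimes>\<^sub>M borel \<rightarrow>\<^sub>M ?\<Pi>"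
    proof (rule measurable_PiM_single')
      fix i
      show "(\<lambda>p. if i \<le> k then fst p i else snd p) \<in> borel_measurable (?\<Pi> \<Otimes>\<^sub>M borel)"
        by (cases "i \<le> k") (auto intro: measurable_compose[OF measurable_fst measurable_component_singleton])
    qed (simp add: space_PiM)
    have step: "distr K ?\<Pi> (\<lambda>\<omega> i. Y (h * real (min i (Suc k))) \<omega>) =
        distr (distr K (?\<Pi> \<Otimes>\<^sub>M borel) (\<lambda>\<omega>. (\<lambda>i. Y (h * real (min i k)) \<omega>, Y (h * real (Suc k)) \<omega>))) ?\<Pi> ?G"
      if "markov_process K Y P" for K :: "'k measure" and Y :: "real \<Rightarrow> 'k \<Rightarrow> real"
      by (subst distr_distr[OF G pm[OF that]])
         (auto intro!: arg_cong[where f = "distr K ?\<Pi>"] simp: fun_eq_iff min_def le_Suc_eq)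
    show ?case unfolding step[OF mp(1)] step[OF mp(2)] eq ..
  }
qed

lemma path_law_eq: "path_law N T X = distr N borel (\<lambda>\<omega>. path T (\<lambda>t. X t \<omega>))"
  by (simp add: path_law_def path_def)

text \<open>The nodes of the interpolations form a grid, so both processes give the interpolations
  the same law. Refinement carries this to expectations of bounded continuous functions of the
  path.\<close>

lemma markov_path_law_unique:
  assumes mp: "markov_process N X P" "markov_process N' X' P" and q: "AE \<omega> in N. X 0 \<omega> = q" "AE \<omega> in N'. X' 0 \<omega> = q"
    and P: "\<And>h D. 0 \<le> h \<Longrightarrow> D \<in> sets borel \<Longrightarrow> (\<lambda>x. measure (P h x) D) \<in> borel_measurable borel"
    and cont: "\<And>\<omega>. \<omega> \<in> space N \<Longrightarrow> continuous_on {0..} (\<lambda>t. X t \<omega>)" "\<And>\<omega>. \<omega> \<in> space N' \<Longrightarrow> continuous_on {0..} (\<lambda>t. X' t \<omega>)"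
    and T: "0 < T"
  shows "path_law N T X = path_law N' T X'"
  unfolding path_law_eq
proof (rule measure_eqI_continuous)
  let ?\<Pi> = "Pi\<^sub>M UNIV (\<lambda>_. borel) :: (nat \<Rightarrow> real) measure"
  have pm: "(\<lambda>\<omega>. path T (\<lambda>t. Y t \<omega>)) \<in> K \<rightarrow>\<^sub>M borel"
    if "markov_process K Y P" "\<And>\<omega>. \<omega> \<in> space K \<Longrightarrow> continuous_on {0..} (\<lambda>t. Y t \<omega>)" for K :: "'k measure" and Y
    by (rule borel_measurable_path) (use T markov_processD(2)[OF that(1)] continuous_on_subset[OF that(2)] in auto)
  show "finite_measure (distr N borel (\<lambda>\<omega>. path T (\<lambda>t. X t \<omega>)))"
    using prob_space.prob_space_distr[OF markov_processD(1)[OF mp(1)] pm[OF mp(1) cont(1)]] by (rule prob_space.finite_measure)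
  show "finite_measure (distr N' borel (\<lambda>\<omega>. path T (\<lambda>t. X' t \<omega>)))"
    using prob_space.prob_space_distr[OF markov_processD(1)[OF mp(2)] pm[OF mp(2) cont(2)]] by (rule prob_space.finite_measure)
  fix f :: "(real \<Rightarrow>\<^sub>C real) \<Rightarrow> real" assume f: "continuous_on UNIV f" "bounded (range f)"
  have fm[measurable]: "f \<in> borel_measurable borel" using f(1) by (rule borel_measurable_continuous_onI)
  obtain K where K: "\<And>x. \<bar>f x\<bar> \<le> K" using f(2) by (auto simp: bounded_iff)
  define R where "R n c = f (ramp_sum T (Suc n) (c 0) (\<lambda>i. c (Suc i) - c i))" for n and c :: "nat \<Rightarrow> real"
  have Rm: "R n \<in> borel_measurable ?\<Pi>" for n
    unfolding R_def by (rule measurable_compose[OF _ fm], rule borel_measurable_ramp_sum)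
      (auto intro!: borel_measurable_diff measurable_component_singleton)
  have lim: "(\<lambda>n. \<integral>c. R n c \<partial>distr K' ?\<Pi> (\<lambda>\<omega> i. Y (T / real (Suc n) * real (min i (Suc n))) \<omega>)) \<longlonglongrightarrow> (\<integral>\<omega>. f (path T (\<lambda>t. Y t \<omega>)) \<partial>K')"
    if mpK: "markov_process K' Y P" and c: "\<And>\<omega>. \<omega> \<in> space K' \<Longrightarrow> continuous_on {0..} (\<lambda>t. Y t \<omega>)" for K' :: "'k measure" and Y
  proof -
    interpret prob_space K' using markov_processD(1)[OF mpK] .
    have [measurable]: "(\<lambda>\<omega>. path T (\<lambda>t. Y t \<omega>)) \<in> K' \<rightarrow>\<^sub>M borel" by (rule pm[OF mpK c])
    have [measurable]: "(\<lambda>\<omega>. interp T (Suc n) (\<lambda>t. Y t \<omega>)) \<in> K' \<rightarrow>\<^sub>M borel" for n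
      by (rule borel_measurable_interp) (use T markov_processD(2)[OF mpK] in auto)
    have "(\<integral>c. R n c \<partial>distr K' ?\<Pi> (\<lambda>\<omega> i. Y (T / real (Suc n) * real (min i (Suc n))) \<omega>)) = (\<integral>\<omega>. f (interp T (Suc n) (\<lambda>t. Y t \<omega>)) \<partial>K')" for n
    proof -
      have "(\<lambda>\<omega> i. Y (T / real (Suc n) * real (min i (Suc n))) \<omega>) \<in> K' \<rightarrow>\<^sub>M ?\<Pi>"
        by (rule measurable_PiM_single') (use T markov_processD(2)[OF mpK] in auto)
      then have "(\<integral>c. R n c \<partial>distr K' ?\<Pi> (\<lambda>\<omega> i. Y (T / real (Suc n) * real (min i (Suc n))) \<omega>)) =
        (\<integral>\<omega>. R n (\<lambda>i. Y (T / real (Suc n) * real (min i (Suc n))) \<omega>) \<partial>K')"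
        by (rule integral_distr[OF _ Rm])
      also have "\<dots> = (\<integral>\<omega>. f (interp T (Suc n) (\<lambda>t. Y t \<omega>)) \<partial>K')"
        by (rule Bochner_Integration.integral_cong[OF refl])
           (auto simp: R_def interp_def ramp_sum_def simp del: of_nat_Suc intro!: arg_cong[where f = f] sum.cong)
      finally show ?thesis .
    qed
    moreover have "(\<lambda>n. \<integral>\<omega>. f (interp T (Suc n) (\<lambda>t. Y t \<omega>)) \<partial>K') \<longlonglongrightarrow> (\<integral>\<omega>. f (path T (\<lambda>t. Y t \<omega>)) \<partial>K')"
    proof (rule integral_dominated_convergence[where w = "\<lambda>_. K"])
      show "AE \<omega> in K'. (\<lambda>n. f (interp T (Suc n) (\<lambda>t. Y t \<omega>))) \<longlonglongrightarrow> f (path T (\<lambda>t. Y t \<omega>))"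
        by (rule AE_I2, rule continuous_on_tendsto_compose[OF f(1) interp_tendsto_path[OF T]])
           (use continuous_on_subset[OF c] in auto)
    qed (use K in auto)
    ultimately show ?thesis by simp
  qed
  have "distr N ?\<Pi> (\<lambda>\<omega> i. X (T / real (Suc n) * real (min i (Suc n))) \<omega>) = distr N' ?\<Pi> (\<lambda>\<omega> i. X' (T / real (Suc n) * real (min i (Suc n))) \<omega>)" for n
    by (rule markov_grid_law[OF mp q]) (use T P in auto)
  then have "(\<integral>\<omega>. f (path T (\<lambda>t. X t \<omega>)) \<partial>N) = (\<integral>\<omega>. f (path T (\<lambda>t. X' t \<omega>)) \<partial>N')"
    using LIMSEQ_unique[OF lim[OF mp(1) cont(1)]] lim[OF mp(2) cont(2)] by simp
  then show "(\<integral>x. f x \<partial>distr N borel (\<lambda>\<omega>. path T (\<lambda>t. X t \<omega>))) = (\<integral>x. f x \<partial>distr N' borel (\<lambda>\<omega>. path T (\<lambda>t. X' t \<omega>)))"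
    using pm[OF mp(1) cont(1)] pm[OF mp(2) cont(2)] by (simp add: integral_distr)
qed auto

text \<open>The processes may come with different semigroups; since the generator determines the
  semigroup, both are Markov for the same transition function.\<close>

lemma (in two_media) governed_path_law_unique:
  assumes X: "diffusion_governed_by (A_op b l1 l2) (A_dom b l1 l2) q N X"
    and X': "diffusion_governed_by (A_op b l1 l2) (A_dom b l1 l2) q N' X'" and T: "0 < T"
  shows "path_law N T X = path_law N' T X'"
proof -
  obtain P where P: "feller_transition P" "generator_is P (A_op b l1 l2) (A_dom b l1 l2)" "markov_process N X P"
    using X unfolding diffusion_governed_by_def by blast
  obtain P' where P': "feller_transition P'" "generator_is P' (A_op b l1 l2) (A_dom b l1 l2)" "markov_process N' X' P'"
    using X' unfolding diffusion_governed_by_def by blast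
  have "P' t x = P t x" if "0 \<le> t" for t x by (rule transition_unique[OF P'(1,2) P(1,2) that])
  then have mp': "markov_process N' X' P"
    using P'(3) by (simp add: markov_process_def)
  show ?thesis
  proof (rule markov_path_law_unique[OF P(3) mp' _ _ _ _ _ T])
    fix h :: real and D :: "real set" assume "0 \<le> h" and D: "D \<in> sets borel"
    then have "P h \<in> borel \<rightarrow>\<^sub>M prob_algebra borel" using P(1) by (simp add: feller_transition_def)
    from measurable_compose[OF measurable_prob_algebraD[OF this] measurable_measure_subprob_algebra[OF D]]
    show "(\<lambda>x. measure (P h x) D) \<in> borel_measurable borel" .
  qed (use X X' in \<open>auto simp: diffusion_governed_by_def\<close>)
qed

section \<open>The three limits\<close>

lemma C1_bounded_deriv_lipschitz:
  assumes "C1_bounded_deriv f"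
  shows "\<exists>L. L-lipschitz_on UNIV f"
proof -
  obtain f' where f': "\<And>x. (f has_real_derivative f' x) (at x)" "bounded (range f')"
    using assms by (auto simp: C1_bounded_deriv_def)
  obtain K where K: "\<And>x. \<bar>f' x\<bar> \<le> K" using f'(2) by (auto simp: bounded_iff)
  have "norm (f x - f y) \<le> K * norm (x - y)" for x y
    by (rule field_differentiable_bound[where S = UNIV]) (use f'(1) K in auto)
  moreover have "0 \<le> K" using K[of 0] by linarith
  ultimately have "K-lipschitz_on UNIV f" by (intro lipschitz_onI) (auto simp: dist_norm)
  then show ?thesis by blast
qed

lemma C1_bounded_deriv_continuous: "C1_bounded_deriv f \<Longrightarrow> continuous_on S f"
  using C1_bounded_deriv_lipschitz[of f] lipschitz_on_continuous_on continuous_on_subset by blast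

lemma antider_coercive:
  assumes l: "continuous_on UNIV l" "\<And>x. m \<le> l x" "0 < m"
  shows "coercive m (antider l)"
proof -
  have mono: "m * (y - x) \<le> antider l y - antider l x" if "x \<le> y" for x y
  proof -
    have "(\<lambda>x. antider l x - m * x) x \<le> (\<lambda>x. antider l x - m * x) y"
    proof (rule DERIV_nonneg_imp_nondecreasing[OF that])
      fix u
      have "((\<lambda>x. antider l x - m * x) has_real_derivative l u - m) (at u)"
        by (auto intro!: derivative_eq_intros antider[OF l(1)])
      then show "\<exists>d. ((\<lambda>x. antider l x - m * x) has_real_derivative d) (at u) \<and> 0 \<le> d" using l(2)[of u] by auto
    qed
    then show ?thesis by (simp add: algebra_simps)
  qed
  have c: "continuous_on S (antider l)" for S
    by (rule DERIV_continuous_on) (rule DERIV_subset[OF antider(2)[OF l(1)] subset_UNIV])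
  have "\<exists>x. antider l x = z" for z
  proof -
    define r where "r = \<bar>z\<bar> / m"
    have r: "0 \<le> r" "m * r = \<bar>z\<bar>" using l(3) by (auto simp: r_def)
    have "antider l (-r) \<le> z" "z \<le> antider l r"
      using mono[of "-r" 0] mono[of 0 r] r antider(1)[OF l(1)] by auto
    then show ?thesis using IVT'[of "antider l" "-r" z r] c r(1) by auto
  qed
  then have "surj (antider l)" by (metis surjI someI_ex)
  moreover have "m * \<bar>x - y\<bar> \<le> \<bar>antider l x - antider l y\<bar>" for x y
    using mono[of x y] mono[of y x] by (cases "x \<le> y") auto
  ultimately show ?thesis using l(3) c unfolding coercive_def by blast
qed

lemma antider_lipschitz:
  assumes l: "continuous_on UNIV l" "\<And>x. \<bar>l x\<bar> \<le> K"
  shows "K-lipschitz_on UNIV (antider l)"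
proof (rule lipschitz_onI)
  show "0 \<le> K" using l(2)[of 0] by linarith
  fix x y
  have "norm (antider l x - antider l y) \<le> K * norm (x - y)"
    by (rule field_differentiable_bound[where S = UNIV]) (use antider(2)[OF l(1)] l(2) in auto)
  then show "dist (antider l x) (antider l y) \<le> K * dist x y" by (simp add: dist_norm)
qed

lemma abs_integral_le_set_integral:
  fixes g :: "real \<Rightarrow> real"
  assumes g: "continuous_on UNIV g" and "a \<le> c" "c \<le> d" "d \<le> e"
  shows "\<bar>integral {c..d} g\<bar> \<le> (LBINT s:{a..e}. \<bar>g s\<bar>)"
proof -
  have c: "continuous_on S (\<lambda>s. \<bar>g s\<bar>)" for S by (intro continuous_intros continuous_on_subset[OF g]) auto
  have "\<bar>integral {c..d} g\<bar> \<le> integral {c..d} (\<lambda>s. \<bar>g s\<bar>)"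
    by (rule abs_integral_le) (auto intro!: integrable_continuous_real c continuous_on_subset[OF g])
  also have "\<dots> \<le> integral {a..e} (\<lambda>s. \<bar>g s\<bar>)"
    by (rule integral_subset_le) (use assms in \<open>auto intro!: integrable_continuous_real c\<close>)
  also have "\<dots> = (LBINT s:{a..e}. \<bar>g s\<bar>)"
    by (intro set_borel_integral_eq_integral(2)[symmetric] borel_integrable_atLeastAtMost' c)
  finally show ?thesis .
qed

text \<open>Nothing is known about convergence at the interface 0 itself, but a single point is null
  for the integral. The uniform bounds on the friction provide the dominating function.\<close>

lemma friction_integral_tendsto:
  fixes lam :: "real \<Rightarrow> real \<Rightarrow> real"
  assumes c: "\<And>\<epsilon>. \<epsilon> \<in> {0<..1} \<Longrightarrow> continuous_on UNIV (lam \<epsilon>)"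
    and K: "\<And>\<epsilon> x. \<epsilon> \<in> {0<..1} \<Longrightarrow> \<bar>lam \<epsilon> x\<bar> \<le> K"
    and lim: "\<And>x. x \<in> {a..e} \<Longrightarrow> x \<noteq> 0 \<Longrightarrow> ((\<lambda>\<epsilon>. lam \<epsilon> x) \<longlongrightarrow> l) (at_right 0)"
  shows "((\<lambda>\<epsilon>. LBINT s:{a..e}. \<bar>lam \<epsilon> s - l\<bar>) \<longlongrightarrow> 0) (at_right 0)"
proof (rule tendsto_at_rightI)
  fix X :: "nat \<Rightarrow> real" assume X: "\<And>i. 0 < X i" "\<And>i. X i \<le> 1" "X \<longlonglongrightarrow> 0"
      and XX: "filterlim X (at_right 0) sequentially"
  have Xi: "X i \<in> {0<..1}" for i using X(1,2)[of i] by simp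
  have "(\<lambda>i. LBINT s. indicator {a..e} s * \<bar>lam (X i) s - l\<bar>) \<longlonglongrightarrow> (LBINT s::real. 0)"
  proof (rule integral_dominated_convergence[where w = "\<lambda>s. indicator {a..e} s * (K + \<bar>l\<bar>)"])
    have "AE s in lborel. s \<noteq> (0::real)" by (rule AE_lborel_singleton)
    then show "AE s in lborel. (\<lambda>i. indicator {a..e} s * \<bar>lam (X i) s - l\<bar>) \<longlonglongrightarrow> 0"
    proof eventually_elim
      case (elim s)
      show ?case
      proof (cases "s \<in> {a..e}")
        case True
        have "(\<lambda>i. lam (X i) s) \<longlonglongrightarrow> l" by (rule filterlim_compose[OF lim[OF True elim] XX])
        then have "(\<lambda>i. \<bar>lam (X i) s - l\<bar>) \<longlonglongrightarrow> \<bar>l - l\<bar>" by (intro tendsto_intros)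
        then show ?thesis using True by simp
      qed simp
    qed
    show "AE s in lborel. norm (indicator {a..e} s * \<bar>lam (X i) s - l\<bar>) \<le> indicator {a..e} s * (K + \<bar>l\<bar>)" for i
    proof (rule AE_I2)
      fix s
      have "\<bar>lam (X i) s - l\<bar> \<le> K + \<bar>l\<bar>" using K[OF Xi, of i s] by linarith
      then show "norm (indicator {a..e} s * \<bar>lam (X i) s - l\<bar>) \<le> indicator {a..e} s * (K + \<bar>l\<bar>)" by (auto simp: indicator_def)
    qed
    have [measurable]: "lam (X i) \<in> borel_measurable borel" for i by (rule borel_measurable_continuous_onI[OF c[OF Xi]])
    show "(\<lambda>s. indicator {a..e} s * \<bar>lam (X i) s - l\<bar>) \<in> borel_measurable lborel" for i by measurable
    show "integrable lborel (\<lambda>s. indicator {a..e} s * (K + \<bar>l\<bar>))"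
      by (intro integrable_mult_left integrable_real_indicator) (auto simp: emeasure_lborel_Icc_eq)
  qed simp
  then show "(\<lambda>i. LBINT s:{a..e}. \<bar>lam (X i) s - l\<bar>) \<longlonglongrightarrow> 0"
    by (simp add: set_lebesgue_integral_def)
qed

context two_media
begin

text \<open>The difference of the coordinates is the friction error integrated from 0 to
  \<open>x\<close>. Bounding it by the total error on either side of the interface gives an estimate
  uniform on \<open>[-R,R]\<close>, although the friction converges only pointwise.\<close>

lemma antider_close_to_scale:
  assumes l: "continuous_on UNIV l" and x: "\<bar>x\<bar> \<le> R"
  shows "\<bar>antider l x - scale x\<bar> \<le> (LBINT s:{-R..0}. \<bar>l s - l1\<bar>) + (LBINT s:{0..R}. \<bar>l s - l2\<bar>)"
proof -
  have c: "continuous_on UNIV (\<lambda>s. l s - c)" for c by (intro continuous_intros l)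
  have ftc: "((\<lambda>s. l s - c) has_integral (antider l v - c * v) - (antider l u - c * u)) {u..v}" if "u \<le> v" for u v c
  proof (rule fundamental_theorem_of_calculus[OF that])
    fix s
    have "((\<lambda>s. antider l s - c * s) has_real_derivative l s - c) (at s)"
      by (auto intro!: derivative_eq_intros antider[OF l])
    then show "((\<lambda>s. antider l s - c * s) has_vector_derivative l s - c) (at s within {u..v})"
      unfolding has_real_derivative_iff_has_vector_derivative by (rule has_vector_derivative_at_within)
  qed
  have nn: "0 \<le> (LBINT s:A. \<bar>l s - c\<bar>)" for A c
    unfolding set_lebesgue_integral_def by (rule Bochner_Integration.integral_nonneg) simp
  show ?thesis
  proof (cases "x \<le> 0")
    case True
    have "integral {x..0} (\<lambda>s. l s - l1) = - (antider l x - l1 * x)"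
      using ftc[OF True, of l1] antider(1)[OF l] by (simp add: integral_unique)
    then have "\<bar>antider l x - scale x\<bar> = \<bar>integral {x..0} (\<lambda>s. l s - l1)\<bar>" using True by (simp add: scale_def)
    also have "\<dots> \<le> (LBINT s:{-R..0}. \<bar>l s - l1\<bar>)"
      by (rule abs_integral_le_set_integral[OF c]) (use True x in auto)
    finally show ?thesis using nn[of "{0..R}" l2] by linarith
  next
    case False
    have "integral {0..x} (\<lambda>s. l s - l2) = antider l x - l2 * x"
      using ftc[of 0 x l2] False antider(1)[OF l] by (simp add: integral_unique)
    then have "\<bar>antider l x - scale x\<bar> = \<bar>integral {0..x} (\<lambda>s. l s - l2)\<bar>" using False by (simp add: scale_def)
    also have "\<dots> \<le> (LBINT s:{0..R}. \<bar>l s - l2\<bar>)"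
      by (rule abs_integral_le_set_integral[OF c]) (use False x in auto)
    finally show ?thesis using nn[of "{-R..0}" l1] by linarith
  qed
qed

end

lemma tendsto_path:
  fixes Y :: "real \<Rightarrow> real \<Rightarrow> real"
  assumes T: "0 \<le> T" and c: "\<And>h. 0 < h \<Longrightarrow> h \<le> 1 \<Longrightarrow> continuous_on {0..T} (Y h)" "continuous_on {0..T} Y0"
    and lim: "\<And>e. e > 0 \<Longrightarrow> eventually (\<lambda>h. \<forall>t\<in>{0..T}. \<bar>Y h t - Y0 t\<bar> \<le> e) (at_right 0)"
  shows "((\<lambda>h. path T (Y h)) \<longlongrightarrow> path T Y0) (at_right 0)"
proof (rule tendstoI)
  fix e :: real assume e: "e > 0"
  have "eventually (\<lambda>h. h \<in> {0<..1}) (at_right (0::real))"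
    using eventually_at_right[of 0 "1::real"] by (intro eventually_at_rightI[of 0 1]) auto
  moreover have "eventually (\<lambda>h. \<forall>t\<in>{0..T}. \<bar>Y h t - Y0 t\<bar> \<le> e / 2) (at_right 0)" using e by (intro lim) simp
  ultimately show "eventually (\<lambda>h. dist (path T (Y h)) (path T Y0) < e) (at_right 0)"
  proof eventually_elim
    case (elim h)
    have "dist (path T (Y h)) (path T Y0) \<le> e / 2" by (rule dist_path_le) (use elim c T in auto)
    then show ?case using e by linarith
  qed
qed

section \<open>The small mass and white noise limits for a fixed friction\<close>

locale smoothed_motion = wiener M W + drift m L B "antider l" b
  for M :: "'a measure" and W :: "real \<Rightarrow> 'a \<Rightarrow> real" and m L B :: real and l b :: "real \<Rightarrow> real" +
  fixes \<rho> :: "real \<Rightarrow> real" and K :: real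
  assumes mollifier: "mollifier \<rho>" and continuous_l: "continuous_on UNIV l"
    and l_lower: "\<And>x. m \<le> l x" and l_upper: "\<And>x. \<bar>l x\<bar> \<le> K"
begin

definition mollified :: "real \<Rightarrow> 'a \<Rightarrow> real \<Rightarrow> real" where
  "mollified \<delta> \<omega> = mollify \<rho> (\<lambda>s. W s \<omega>) \<delta>"

definition mollified_noise :: "real \<Rightarrow> 'a \<Rightarrow> real \<Rightarrow> real" where
  "mollified_noise \<delta> \<omega> t = mollified \<delta> \<omega> t - mollified \<delta> \<omega> 0"

lemma mollified_derivative:
  assumes "\<omega> \<in> space M" "0 < \<delta>" "0 \<le> t"
  shows "(mollified \<delta> \<omega> has_real_derivative deriv (mollified \<delta> \<omega>) t) (at t)"
proof -
  obtain C where C: "\<forall>u\<in>{0..t}. (mollified \<delta> \<omega> has_real_derivative deriv (mollified \<delta> \<omega>) u) (at u) \<and> \<bar>deriv (mollified \<delta> \<omega>) u\<bar> \<le> C"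
    unfolding mollified_def
    by (rule exE[OF mollify_differentiable[OF mollifier continuous_W[OF assms(1)] assms(2,3)]])
  have "t \<in> {0..t}" using assms(3) by simp
  from bspec[OF C this] show ?thesis by (rule conjunct1)
qed

lemma continuous_mollified: "\<omega> \<in> space M \<Longrightarrow> 0 < \<delta> \<Longrightarrow> continuous_on {0..} (mollified \<delta> \<omega>)"
  by (rule DERIV_continuous_on, rule has_field_derivative_at_within, rule mollified_derivative) auto

lemma continuous_mollified_noise: "\<omega> \<in> space M \<Longrightarrow> 0 < \<delta> \<Longrightarrow> continuous_on {0..} (mollified_noise \<delta> \<omega>)"
  unfolding mollified_noise_def by (intro continuous_intros continuous_mollified)

lemma measurable_W_path: "0 \<le> T \<Longrightarrow> (\<lambda>\<omega>. path T (\<lambda>t. W t \<omega>)) \<in> M \<rightarrow>\<^sub>M borel"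
  by (rule borel_measurable_path) (auto intro: continuous_on_subset[OF continuous_W])

text \<open>The kernel looks ahead by \<open>\<delta>\<close>, so times up to \<open>T\<close>
  involve the Wiener path up to \<open>T + \<delta>\<close>. The constant is the supremum of the
  kernel, the same for all \<open>\<delta>\<close>.\<close>

lemma mollified_lipschitz:
  "\<exists>R\<ge>0. \<forall>\<delta>>0. \<forall>T\<ge>0. \<forall>\<omega>\<in>space M. \<forall>\<omega>'\<in>space M. \<forall>t\<in>{0..T}.
     \<bar>mollified \<delta> \<omega> t - mollified \<delta> \<omega>' t\<bar> \<le> R * dist (path (T + \<delta>) (\<lambda>t. W t \<omega>)) (path (T + \<delta>) (\<lambda>t. W t \<omega>'))"
proof -
  obtain R where R: "\<And>x. \<bar>\<rho> x\<bar> \<le> R" using mollifier_facts(6)[OF mollifier] by blast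
  show ?thesis
  proof (intro exI[of _ R] conjI allI impI ballI)
    show "0 \<le> R" using R[of 0] by linarith
    fix \<delta> T t :: real and \<omega> \<omega>'
    assume a: "0 < \<delta>" "0 \<le> T" "\<omega> \<in> space M" "\<omega>' \<in> space M" "t \<in> {0..T}"
    show "\<bar>mollified \<delta> \<omega> t - mollified \<delta> \<omega>' t\<bar> \<le> R * dist (path (T + \<delta>) (\<lambda>t. W t \<omega>)) (path (T + \<delta>) (\<lambda>t. W t \<omega>'))"
      unfolding mollified_def
      by (rule mollify_lipschitz[OF mollifier R continuous_W continuous_W])
         (use a in \<open>auto intro!: path_dist_ge continuous_on_subset[OF continuous_W]\<close>)
  qed
qed

lemma measurable_mollified_flow:
  assumes \<delta>: "0 < \<delta>" and T: "0 \<le> T"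
  shows "(\<lambda>\<omega>. path T (\<lambda>t. flow (antider l) b q (mollified_noise \<delta> \<omega>) t)) \<in> M \<rightarrow>\<^sub>M borel"
proof -
  obtain R where R: "R \<ge> 0" "\<And>\<omega> \<omega>' t. \<omega> \<in> space M \<Longrightarrow> \<omega>' \<in> space M \<Longrightarrow> t \<in> {0..T} \<Longrightarrow>
     \<bar>mollified \<delta> \<omega> t - mollified \<delta> \<omega>' t\<bar> \<le> R * dist (path (T + \<delta>) (\<lambda>t. W t \<omega>)) (path (T + \<delta>) (\<lambda>t. W t \<omega>'))"
    using mollified_lipschitz \<delta> T by meson
  show ?thesis
  proof (rule measurable_lipschitz_factor[OF measurable_W_path[of "T + \<delta>"]])
    show "0 \<le> T + \<delta>" using \<delta> T by simp
    fix \<omega> \<omega>' assume w: "\<omega> \<in> space M" "\<omega>' \<in> space M"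
    define D where "D = dist (path (T + \<delta>) (\<lambda>t. W t \<omega>)) (path (T + \<delta>) (\<lambda>t. W t \<omega>'))"
    show "dist (path T (\<lambda>t. flow (antider l) b q (mollified_noise \<delta> \<omega>) t)) (path T (\<lambda>t. flow (antider l) b q (mollified_noise \<delta> \<omega>') t))
       \<le> (2 * R / m * exp (L / m * T)) * dist (path (T + \<delta>) (\<lambda>t. W t \<omega>)) (path (T + \<delta>) (\<lambda>t. W t \<omega>'))"
      unfolding D_def[symmetric]
    proof (rule dist_path_le)
      fix t assume t: "t \<in> {0..T}"
      have "\<bar>flow (antider l) b q (mollified_noise \<delta> \<omega>) t - flow (antider l) b q (mollified_noise \<delta> \<omega>') t\<bar>
         \<le> (2 * (R * D) + \<bar>antider l q - antider l q\<bar>) / m * exp (L / m * T)"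
      proof (rule flow_lipschitz)
        fix s assume s: "s \<in> {0..T}"
        show "\<bar>mollified_noise \<delta> \<omega> s - mollified_noise \<delta> \<omega>' s\<bar> \<le> 2 * (R * D)"
          using R(2)[OF w s] R(2)[OF w, of 0] T unfolding mollified_noise_def D_def by (simp add: abs_le_iff)
      qed (use w \<delta> t continuous_mollified_noise in auto)
      then show "\<bar>flow (antider l) b q (mollified_noise \<delta> \<omega>) t - flow (antider l) b q (mollified_noise \<delta> \<omega>') t\<bar>
         \<le> 2 * R / m * exp (L / m * T) * D" by (simp add: mult_ac)
    qed (use w \<delta> T in \<open>auto intro!: continuous_on_subset[OF continuous_flow] continuous_mollified_noise\<close>)
  qed
qed

lemma motion_continuous:
  assumes "solves_motion \<mu> b' l' \<xi> q p x"
  shows "continuous_on {0..T} x"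
proof -
  obtain v where "\<And>t. t \<ge> 0 \<Longrightarrow> (x has_real_derivative v t) (at t within {0..})"
    using assms unfolding solves_motion_def by blast
  then have "continuous_on {0..} x" by (rule DERIV_continuous_on) simp
  then show ?thesis by (rule continuous_on_subset) auto
qed

lemma small_mass_limit:
  assumes \<delta>: "0 < \<delta>" and T: "0 < T"
    and Q: "\<And>\<mu> \<omega>. 0 < \<mu> \<Longrightarrow> \<omega> \<in> space M \<Longrightarrow> solves_motion \<mu> b l (deriv (mollified \<delta> \<omega>)) q p (\<lambda>t. Q \<mu> t \<omega>)"
  shows "converges_weakly (\<lambda>\<mu>. path_law M T (Q \<mu>)) (path_law M T (\<lambda>t \<omega>. flow (antider l) b q (mollified_noise \<delta> \<omega>) t)) (at_right 0)"
  unfolding path_law_eq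
proof (rule converges_weakly_pathwise[OF prob_space_axioms _ zero_less_one])
  note d = antider(2)[OF continuous_l]
  have w: "(mollified \<delta> \<omega> has_real_derivative deriv (mollified \<delta> \<omega>) t) (at t within {0..})" if "\<omega> \<in> space M" "0 \<le> t" for \<omega> t
    by (rule has_field_derivative_at_within[OF mollified_derivative]) (use that \<delta> in auto)
  show "(\<lambda>\<omega>. path T (\<lambda>t. flow (antider l) b q (mollified_noise \<delta> \<omega>) t)) \<in> M \<rightarrow>\<^sub>M borel"
    by (rule measurable_mollified_flow) (use \<delta> T in auto)
  \<comment> \<open>The motions are given only as solutions for each sample point. Their
    measurability follows because, for fixed mass, they depend in a Lipschitz way on the smoothed
    path and this in turn on the Wiener path.\<close>
  show "(\<lambda>\<omega>. path T (\<lambda>t. Q \<mu> t \<omega>)) \<in> M \<rightarrow>\<^sub>M borel" if \<mu>: "0 < \<mu>" for \<mu>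
  proof -
    obtain R where R: "R \<ge> 0" "\<And>\<omega> \<omega>' t. \<omega> \<in> space M \<Longrightarrow> \<omega>' \<in> space M \<Longrightarrow> t \<in> {0..T} \<Longrightarrow>
       \<bar>mollified \<delta> \<omega> t - mollified \<delta> \<omega>' t\<bar> \<le> R * dist (path (T + \<delta>) (\<lambda>t. W t \<omega>)) (path (T + \<delta>) (\<lambda>t. W t \<omega>'))"
      using mollified_lipschitz \<delta> T by (meson less_imp_le)
    show ?thesis
    proof (rule measurable_lipschitz_factor[OF measurable_W_path[of "T + \<delta>"]])
      show "0 \<le> T + \<delta>" using \<delta> T by simp
      fix \<omega> \<omega>' assume w': "\<omega> \<in> space M" "\<omega>' \<in> space M"
      define D where "D = dist (path (T + \<delta>) (\<lambda>t. W t \<omega>)) (path (T + \<delta>) (\<lambda>t. W t \<omega>'))"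
      show "dist (path T (\<lambda>t. Q \<mu> t \<omega>)) (path T (\<lambda>t. Q \<mu> t \<omega>'))
         \<le> (2 * T / \<mu> * exp ((K + L * T) / \<mu> * T) * R) * dist (path (T + \<delta>) (\<lambda>t. W t \<omega>)) (path (T + \<delta>) (\<lambda>t. W t \<omega>'))"
        unfolding D_def[symmetric]
      proof (rule dist_path_le)
        fix t assume t: "t \<in> {0..T}"
        have "\<bar>Q \<mu> t \<omega> - Q \<mu> t \<omega>'\<bar> \<le> (2 * T / \<mu> * exp ((K + L * T) / \<mu> * T)) * (R * D)"
          by (rule motion_lipschitz[OF Q[OF \<mu> w'(1)] Q[OF \<mu> w'(2)] \<mu> d antider_lipschitz[OF continuous_l l_upper]
                continuous_drift lipschitz w[OF w'(1)] w[OF w'(2)] _ t])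
             (use R(2)[OF w'] in \<open>auto simp: D_def\<close>)
        then show "\<bar>Q \<mu> t \<omega> - Q \<mu> t \<omega>'\<bar> \<le> 2 * T / \<mu> * exp ((K + L * T) / \<mu> * T) * R * D" by (simp add: mult.assoc)
      qed (use T motion_continuous[OF Q[OF \<mu>]] w' in auto)
    qed
  qed
  fix \<omega> assume w': "\<omega> \<in> space M"
  obtain C where C: "\<And>t. t \<in> {0..T} \<Longrightarrow> \<bar>deriv (mollified \<delta> \<omega>) t\<bar> \<le> C"
    using mollify_differentiable[OF mollifier continuous_W[OF w'] \<delta>, of T] T unfolding mollified_def by (meson less_imp_le)
  \<comment> \<open>\<open>C\<close> bounds the derivative of the smoothed noise and depends on
    \<open>\<delta>\<close> and the sample point. This is harmless because the mass tends to 0 with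
    both of them fixed.\<close>
  define A where "A = (2 * (\<bar>p\<bar> + (B + C) / m)) / m * exp (L / m * T)"
  have close: "\<bar>Q \<mu> t \<omega> - flow (antider l) b q (mollified_noise \<delta> \<omega>) t\<bar> \<le> \<mu> * A" if \<mu>: "0 < \<mu>" and t: "t \<in> {0..T}" for \<mu> t
  proof -
    have "\<bar>Q \<mu> t \<omega> - flow (antider l) b q (mollified_noise \<delta> \<omega>) t\<bar> \<le> \<mu> * (2 * (\<bar>p\<bar> + (B + C) / m)) / m * exp (L / m * T)"
    proof (rule motion_close_to_first_order[OF Q[OF \<mu> w'] \<mu> d coercive continuous_l l_lower continuous_drift lipschitz bounded_by w[OF w'] C _ t])
      show "solves (antider l) b q (\<lambda>t. mollified \<delta> \<omega> t - mollified \<delta> \<omega> 0) (flow (antider l) b q (mollified_noise \<delta> \<omega>))"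
        using solves_flow[OF continuous_mollified_noise[OF w' \<delta>]] by (simp add: mollified_noise_def[abs_def])
    qed
    then show ?thesis by (simp add: A_def)
  qed
  show "((\<lambda>\<mu>. path T (\<lambda>t. Q \<mu> t \<omega>)) \<longlongrightarrow> path T (\<lambda>t. flow (antider l) b q (mollified_noise \<delta> \<omega>) t)) (at_right 0)"
  proof (rule tendsto_path)
    fix e :: real assume e: "e > 0"
    have "((\<lambda>\<mu>. \<mu> * A) \<longlongrightarrow> 0 * A) (at_right 0)" by (intro tendsto_intros)
    then have "eventually (\<lambda>\<mu>. \<mu> * A < e) (at_right 0)" by (rule order_tendstoD) (use e in simp)
    then show "eventually (\<lambda>\<mu>. \<forall>t\<in>{0..T}. \<bar>Q \<mu> t \<omega> - flow (antider l) b q (mollified_noise \<delta> \<omega>) t\<bar> \<le> e) (at_right 0)"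
      using eventually_at_right_less by eventually_elim (use close in force)
  qed (use T w' \<delta> motion_continuous[OF Q] in \<open>auto intro!: continuous_on_subset[OF continuous_flow] continuous_mollified_noise\<close>)
qed

lemma measurable_noise_flow:
  assumes T: "0 \<le> T"
  shows "(\<lambda>\<omega>. path T (\<lambda>t. flow (antider l) b q (noise 0 \<omega>) t)) \<in> M \<rightarrow>\<^sub>M borel"
proof (rule measurable_lipschitz_factor[OF measurable_noise_path[of 0 T]])
  fix \<omega> \<omega>' assume w: "\<omega> \<in> space M" "\<omega>' \<in> space M"
  define D where "D = dist (path T (noise 0 \<omega>)) (path T (noise 0 \<omega>'))"
  show "dist (path T (\<lambda>t. flow (antider l) b q (noise 0 \<omega>) t)) (path T (\<lambda>t. flow (antider l) b q (noise 0 \<omega>') t))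
     \<le> (1 / m * exp (L / m * T)) * dist (path T (noise 0 \<omega>)) (path T (noise 0 \<omega>'))"
    unfolding D_def[symmetric]
  proof (rule dist_path_le)
    fix t assume t: "t \<in> {0..T}"
    have "\<bar>flow (antider l) b q (noise 0 \<omega>) t - flow (antider l) b q (noise 0 \<omega>') t\<bar>
       \<le> (D + \<bar>antider l q - antider l q\<bar>) / m * exp (L / m * T)"
      by (rule flow_lipschitz)
         (use w t in \<open>auto simp: D_def intro!: continuous_noise continuous_noise' path_dist_ge\<close>)
    then show "\<bar>flow (antider l) b q (noise 0 \<omega>) t - flow (antider l) b q (noise 0 \<omega>') t\<bar>
       \<le> 1 / m * exp (L / m * T) * D" by (simp add: mult_ac)
  qed (use w T in \<open>auto intro!: continuous_on_subset[OF continuous_flow] continuous_noise\<close>)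
qed (use T in auto)

lemma white_noise_limit:
  assumes T: "0 < T"
  shows "converges_weakly (\<lambda>\<delta>. path_law M T (\<lambda>t \<omega>. flow (antider l) b q (mollified_noise \<delta> \<omega>) t))
    (path_law M T (\<lambda>t \<omega>. flow (antider l) b q (noise 0 \<omega>) t)) (at_right 0)"
  unfolding path_law_eq
proof (rule converges_weakly_pathwise[OF prob_space_axioms _ zero_less_one])
  have m: "m > 0" using coerciveD(1)[OF coercive] .
  show "(\<lambda>\<omega>. path T (\<lambda>t. flow (antider l) b q (noise 0 \<omega>) t)) \<in> M \<rightarrow>\<^sub>M borel"
    by (rule measurable_noise_flow) (use T in simp)
  show "(\<lambda>\<omega>. path T (\<lambda>t. flow (antider l) b q (mollified_noise \<delta> \<omega>) t)) \<in> M \<rightarrow>\<^sub>M borel" if "0 < \<delta>" for \<delta>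
    by (rule measurable_mollified_flow) (use that T in auto)
  fix \<omega> assume w: "\<omega> \<in> space M"
  show "((\<lambda>\<delta>. path T (\<lambda>t. flow (antider l) b q (mollified_noise \<delta> \<omega>) t)) \<longlongrightarrow> path T (\<lambda>t. flow (antider l) b q (noise 0 \<omega>) t)) (at_right 0)"
  proof (rule tendsto_path)
    fix e :: real assume e: "e > 0"
    define E where "E = exp (L / m * T)"
    have E: "E > 0" by (simp add: E_def)
    \<comment> \<open>The error of the noise is \<open>2 * r\<close>, one \<open>r\<close> at the
      current time and one at time 0; the amplification \<open>E / m\<close> of the flow turns it
      into exactly \<open>e\<close>.\<close>
    define r where "r = e * m / (2 * E)"
    have r: "r > 0" "2 * r / m * E = e" using e m E by (auto simp: r_def)
    obtain d where d: "d > 0" "\<And>\<delta> t. 0 < \<delta> \<Longrightarrow> \<delta> < d \<Longrightarrow> t \<in> {0..T} \<Longrightarrow> \<bar>mollified \<delta> \<omega> t - W t \<omega>\<bar> \<le> r"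
      using mollify_uniform_limit[OF mollifier continuous_W[OF w] _ r(1), of T] T unfolding mollified_def by (auto simp: less_imp_le)
    have "\<forall>t\<in>{0..T}. \<bar>flow (antider l) b q (mollified_noise \<delta> \<omega>) t - flow (antider l) b q (noise 0 \<omega>) t\<bar> \<le> e"
      if \<delta>: "0 < \<delta>" "\<delta> < d" for \<delta>
    proof
      fix t assume t: "t \<in> {0..T}"
      have "\<bar>flow (antider l) b q (mollified_noise \<delta> \<omega>) t - flow (antider l) b q (noise 0 \<omega>) t\<bar>
         \<le> (2 * r + \<bar>antider l q - antider l q\<bar>) / m * exp (L / m * T)"
      proof (rule flow_lipschitz)
        fix s assume s: "s \<in> {0..T}"
        show "\<bar>mollified_noise \<delta> \<omega> s - noise 0 \<omega> s\<bar> \<le> 2 * r"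
          using d(2)[OF \<delta> s] d(2)[OF \<delta>, of 0] T unfolding mollified_noise_def noise_def by (simp add: abs_le_iff)
      qed (use w \<delta> t continuous_mollified_noise continuous_noise in auto)
      then show "\<bar>flow (antider l) b q (mollified_noise \<delta> \<omega>) t - flow (antider l) b q (noise 0 \<omega>) t\<bar> \<le> e"
        using r(2) by (simp add: E_def)
    qed
    then show "eventually (\<lambda>\<delta>. \<forall>t\<in>{0..T}. \<bar>flow (antider l) b q (mollified_noise \<delta> \<omega>) t - flow (antider l) b q (noise 0 \<omega>) t\<bar> \<le> e) (at_right 0)"
      using d(1) by (intro eventually_at_rightI[of 0 d]) auto
  qed (use T w in \<open>auto intro!: continuous_on_subset[OF continuous_flow] continuous_mollified_noise continuous_noise\<close>)
qed

end

section \<open>Passage to discontinuous friction\<close>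

context media_noise
begin

text \<open>Stability compares the coordinates along the limit path and at \<open>q\<close> only.
  The range \<open>R\<close> is thus fixed by one continuous path before the interface parameter
  moves, and closeness of the coordinates on \<open>[-R,R]\<close> is enough.\<close>

lemma sharp_interface_limit:
  fixes lam :: "real \<Rightarrow> real \<Rightarrow> real"
  assumes T: "0 < T"
    and motion: "\<And>\<epsilon>. \<epsilon> \<in> {0<..1} \<Longrightarrow> smoothed_motion M W m L B (lam \<epsilon>) b \<rho> K"
    and lim: "\<And>x. x < 0 \<Longrightarrow> ((\<lambda>\<epsilon>. lam \<epsilon> x) \<longlongrightarrow> l1) (at_right 0)" "\<And>x. 0 < x \<Longrightarrow> ((\<lambda>\<epsilon>. lam \<epsilon> x) \<longlongrightarrow> l2) (at_right 0)"
  shows "converges_weakly (\<lambda>\<epsilon>. path_law M T (\<lambda>t \<omega>. flow (antider (lam \<epsilon>)) b q (noise 0 \<omega>) t)) (path_law M T (process q)) (at_right 0)"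
  unfolding path_law_eq
proof (rule converges_weakly_pathwise[OF prob_space_axioms _ zero_less_one])
  show "(\<lambda>\<omega>. path T (\<lambda>t. process q t \<omega>)) \<in> M \<rightarrow>\<^sub>M borel"
    by (rule borel_measurable_path) (use T in \<open>auto intro: continuous_on_subset[OF continuous_process]\<close>)
  show "(\<lambda>\<omega>. path T (\<lambda>t. flow (antider (lam \<epsilon>)) b q (noise 0 \<omega>) t)) \<in> M \<rightarrow>\<^sub>M borel" if "0 < \<epsilon>" "\<epsilon> \<le> 1" for \<epsilon>
    using smoothed_motion.measurable_noise_flow[OF motion, of \<epsilon> T q] that T by simp
  fix \<omega> assume w: "\<omega> \<in> space M"
  have cN: "continuous_on {0..} (noise 0 \<omega>)" by (rule continuous_noise) (use w in auto)
  have cP: "continuous_on {0..T} (\<lambda>t. process q t \<omega>)" by (rule continuous_on_subset[OF continuous_process[OF w]]) auto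
  have cl: "continuous_on UNIV (lam \<epsilon>)" and Kl: "\<bar>lam \<epsilon> x\<bar> \<le> K" and dr: "drift m L B (antider (lam \<epsilon>)) b"
    if "\<epsilon> \<in> {0<..1}" for \<epsilon> x
    using motion[OF that] by (auto simp: smoothed_motion_def smoothed_motion_axioms_def)
  have m: "0 < m" using coerciveD(1)[OF drift.coercive[OF dr[of 1]]] by simp
  obtain R0 where R0: "\<forall>t\<in>{0..T}. \<bar>process q t \<omega>\<bar> \<le> R0"
    using continuous_abs_bounded[OF cP] by (rule exE)
  define R where "R = max R0 \<bar>q\<bar>"
  define I where "I \<epsilon> = (LBINT s:{-R..0}. \<bar>lam \<epsilon> s - l1\<bar>) + (LBINT s:{0..R}. \<bar>lam \<epsilon> s - l2\<bar>)" for \<epsilon>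
  have I: "(I \<longlongrightarrow> 0 + 0) (at_right 0)"
    unfolding I_def
    by (intro tendsto_add friction_integral_tendsto[OF cl Kl]) (use lim in auto)
  show "((\<lambda>\<epsilon>. path T (\<lambda>t. flow (antider (lam \<epsilon>)) b q (noise 0 \<omega>) t)) \<longlongrightarrow> path T (\<lambda>t. process q t \<omega>)) (at_right 0)"
  proof (rule tendsto_path)
    show "continuous_on {0..T} (\<lambda>t. flow (antider (lam \<epsilon>)) b q (noise 0 \<omega>) t)" if "0 < \<epsilon>" "\<epsilon> \<le> 1" for \<epsilon>
      by (rule continuous_on_subset[OF drift.continuous_flow[OF dr cN]]) (use that in auto)
    fix e :: real assume e: "e > 0"
    have "((\<lambda>\<epsilon>. 2 * I \<epsilon> / m * exp (L / m * T)) \<longlongrightarrow> 2 * (0 + 0) / m * exp (L / m * T)) (at_right 0)"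
      using m by (intro tendsto_intros I) auto
    then have "eventually (\<lambda>\<epsilon>. 2 * I \<epsilon> / m * exp (L / m * T) < e) (at_right 0)"
      by (rule order_tendstoD) (use e in simp)
    moreover have "eventually (\<lambda>\<epsilon>. \<epsilon> \<in> {0<..1}) (at_right (0::real))"
      by (intro eventually_at_rightI[of 0 1]) auto
    ultimately show "eventually (\<lambda>\<epsilon>. \<forall>t\<in>{0..T}. \<bar>flow (antider (lam \<epsilon>)) b q (noise 0 \<omega>) t - process q t \<omega>\<bar> \<le> e) (at_right 0)"
    proof eventually_elim
      case (elim \<epsilon>)
      interpret D: drift m L B "antider (lam \<epsilon>)" b by (rule dr[OF elim(2)])
      show ?case
      proof
        fix t assume t: "t \<in> {0..T}"
        have "\<bar>flow (antider (lam \<epsilon>)) b q (noise 0 \<omega>) t - flow scale b q (noise 0 \<omega>) t\<bar> \<le> 2 * I \<epsilon> / m * exp (L / m * T)"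
        proof (rule solves_stability[OF D.coercive continuous_drift lipschitz D.solves_flow[OF cN] solves_flow[OF cN] _ t])
          fix s assume s: "s \<in> {0..T}"
          have "\<bar>antider (lam \<epsilon>) (flow scale b q (noise 0 \<omega>) s) - scale (flow scale b q (noise 0 \<omega>) s)\<bar> \<le> I \<epsilon>"
            unfolding I_def
            by (rule antider_close_to_scale[OF cl[OF elim(2)]])
               (use R0 s in \<open>auto simp: R_def process_def le_max_iff_disj\<close>)
          moreover have "\<bar>antider (lam \<epsilon>) q - scale q\<bar> \<le> I \<epsilon>"
            unfolding I_def by (rule antider_close_to_scale[OF cl[OF elim(2)]]) (simp add: R_def)
          ultimately show "\<bar>noise 0 \<omega> s - noise 0 \<omega> s\<bar> + \<bar>antider (lam \<epsilon>) (flow scale b q (noise 0 \<omega>) s) - scale (flow scale b q (noise 0 \<omega>) s)\<bar>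
              + \<bar>antider (lam \<epsilon>) q - scale q\<bar> \<le> 2 * I \<epsilon>" by simp
        qed
        then show "\<bar>flow (antider (lam \<epsilon>)) b q (noise 0 \<omega>) t - process q t \<omega>\<bar> \<le> e" using elim(1) by (simp add: process_def)
      qed
    qed
  qed (use T cP in auto)
qed

end

theorem theorem4p3:
  fixes b :: "real \<Rightarrow> real"
    and \<rho> :: "real \<Rightarrow> real"
    and M :: "'a measure"
    and W :: "real \<Rightarrow> 'a \<Rightarrow> real"
    and lam :: "real \<Rightarrow> real \<Rightarrow> real"
    and l1 l2 q p :: real
    and Q :: "real \<Rightarrow> real \<Rightarrow> real \<Rightarrow> real \<Rightarrow> 'a \<Rightarrow> real"
  assumes b: "C1_bounded_deriv b" "bounded (range b)"
    and W: "wiener_process M W"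
    and rho: "mollifier \<rho>"
    and lam_C1: "\<And>\<epsilon>. \<epsilon> \<in> {0<..1} \<Longrightarrow> C1_bounded_deriv (lam \<epsilon>)"
    and lam_bounds: "\<exists>m>0. \<exists>K. \<forall>\<epsilon>\<in>{0<..1}. \<forall>x. m \<le> lam \<epsilon> x \<and> lam \<epsilon> x \<le> K"
    and lam_neg: "\<And>x. x < 0 \<Longrightarrow> ((\<lambda>\<epsilon>. lam \<epsilon> x) \<longlongrightarrow> l1) (at_right 0)"
    and lam_pos: "\<And>x. x > 0 \<Longrightarrow> ((\<lambda>\<epsilon>. lam \<epsilon> x) \<longlongrightarrow> l2) (at_right 0)"
    and Q: "\<And>\<mu> \<delta> \<epsilon> \<omega>. \<mu> > 0 \<Longrightarrow> \<delta> > 0 \<Longrightarrow> \<epsilon> \<in> {0<..1} \<Longrightarrow> \<omega> \<in> space M \<Longrightarrow>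
        solves_motion \<mu> b (lam \<epsilon>) (deriv (\<lambda>t. smoothed \<rho> W \<delta> t \<omega>)) q p (\<lambda>t. Q \<mu> \<delta> \<epsilon> t \<omega>)"
  shows "(\<exists>(N :: (real \<Rightarrow> real) measure) X.
            diffusion_governed_by (A_op b l1 l2) (A_dom b l1 l2) q N X) \<and>
         (\<forall>(N :: 'c measure) X.
            diffusion_governed_by (A_op b l1 l2) (A_dom b l1 l2) q N X \<longrightarrow>
            (\<forall>T>0. iterated_weak_limit (\<lambda>\<mu> \<delta> \<epsilon>. path_law M T (Q \<mu> \<delta> \<epsilon>)) (path_law N T X)))"
proof -
  obtain L where L: "L-lipschitz_on UNIV b" using C1_bounded_deriv_lipschitz[OF b(1)] by blast
  obtain B where B: "\<And>x. \<bar>b x\<bar> \<le> B" using b(2) by (auto simp: bounded_iff)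
  obtain m K where m: "m > 0" "\<And>\<epsilon> x. \<epsilon> \<in> {0<..1} \<Longrightarrow> m \<le> lam \<epsilon> x" "\<And>\<epsilon> x. \<epsilon> \<in> {0<..1} \<Longrightarrow> lam \<epsilon> x \<le> K"
    using lam_bounds by blast
  \<comment> \<open>The uniform lower bound on the friction passes to the limits, tested at one
    point on each side of the interface, and makes \<open>l1\<close> and \<open>l2\<close>
    positive.\<close>
  have ev: "eventually (\<lambda>\<epsilon>. m \<le> lam \<epsilon> x) (at_right 0)" for x
    by (intro eventually_at_rightI[of 0 1]) (use m(2) in auto)
  have l1: "m \<le> l1" using tendsto_lowerbound[OF lam_neg[of "-1"] ev] by simp
  have l2: "m \<le> l2" using tendsto_lowerbound[OF lam_pos[of 1] ev] by simp
  have media: "two_media b l1 l2 L B" by standard (use l1 l2 m(1) L B in auto)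
  interpret media_noise b l1 l2 L B M W
    by (intro media_noise.intro media) (simp add: wiener_def W)
  \<comment> \<open>A second copy of the construction, driven by the coordinate process, supplies a
    diffusion on the type that the existence claim prescribes.\<close>
  interpret canonical: media_noise b l1 l2 L B "canonical_space M W" "\<lambda>t f. f t"
    by (intro media_noise.intro media) (simp add: wiener_def wiener_canonical[OF W])
  have cl: "continuous_on UNIV (lam \<epsilon>)" if "\<epsilon> \<in> {0<..1}" for \<epsilon>
    by (rule C1_bounded_deriv_continuous[OF lam_C1[OF that]])
  have motion: "smoothed_motion M W m L B (lam \<epsilon>) b \<rho> K" if \<epsilon>: "\<epsilon> \<in> {0<..1}" for \<epsilon>
  proof
    show "coercive m (antider (lam \<epsilon>))" by (rule antider_coercive[OF cl[OF \<epsilon>] m(2)[OF \<epsilon>] m(1)])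
    show "\<bar>lam \<epsilon> x\<bar> \<le> K" for x using m(1) m(2)[OF \<epsilon>, of x] m(3)[OF \<epsilon>, of x] by linarith
  qed (use L B rho cl m \<epsilon> in auto)
  show ?thesis
  proof (intro conjI allI impI)
    show "\<exists>(N :: (real \<Rightarrow> real) measure) X. diffusion_governed_by (A_op b l1 l2) (A_dom b l1 l2) q N X"
      using canonical.process_governed by blast
    fix N :: "'c measure" and X and T :: real
    assume X: "diffusion_governed_by (A_op b l1 l2) (A_dom b l1 l2) q N X" and T: "0 < T"
    \<comment> \<open>Any governed diffusion has the law of the process built from the given noise,
      so the three limits can all be taken on the one sample space \<open>M\<close>.\<close>
    have law: "path_law N T X = path_law M T (process q)"
      by (rule governed_path_law_unique[OF X process_governed T])
    let ?L1 = "\<lambda>\<delta> \<epsilon>. path_law M T (\<lambda>t \<omega>. flow (antider (lam \<epsilon>)) b q (smoothed_motion.mollified_noise W \<rho> \<delta> \<omega>) t)"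
    let ?L2 = "\<lambda>\<epsilon>. path_law M T (\<lambda>t \<omega>. flow (antider (lam \<epsilon>)) b q (noise 0 \<omega>) t)"
    show "iterated_weak_limit (\<lambda>\<mu> \<delta> \<epsilon>. path_law M T (Q \<mu> \<delta> \<epsilon>)) (path_law N T X)"
      unfolding iterated_weak_limit_def law
    proof (intro exI[of _ ?L1] exI[of _ ?L2] conjI ballI allI impI)
      fix \<epsilon> :: real assume \<epsilon>: "\<epsilon> \<in> {0<..1}"
      interpret S: smoothed_motion M W m L B "lam \<epsilon>" b \<rho> K by (rule motion[OF \<epsilon>])
      show "converges_weakly (\<lambda>\<delta>. ?L1 \<delta> \<epsilon>) (?L2 \<epsilon>) (at_right 0)" by (rule S.white_noise_limit[OF T])
      fix \<delta> :: real assume \<delta>: "0 < \<delta>"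
      show "converges_weakly (\<lambda>\<mu>. path_law M T (Q \<mu> \<delta> \<epsilon>)) (?L1 \<delta> \<epsilon>) (at_right 0)"
        by (rule S.small_mass_limit[OF \<delta> T, where p = p])
           (use Q[OF _ \<delta> \<epsilon>] in \<open>simp add: S.mollified_def smoothed_eq_mollify\<close>)
    next
      show "converges_weakly ?L2 (path_law M T (process q)) (at_right 0)"
        by (rule sharp_interface_limit[OF T motion lam_neg lam_pos])
    qed
  qed
qed

end
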